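(* Fix $r\ge2$, let $p=p(n)$ satisfy $n^{-2/r}(\log n)^{1/\binom r2}\ll p\ll n^{-2/(r+1)}$, let $H\sim G(n,p)$ with complement $\overline H\sim G(n,1-p)$, and put $\chi:=\chi(\overline H)$, $X_{r+1}:=X_{r+1}(H)$ and $\mu_{r+1}:=\mu_{r+1}(n,p)$. Then $$\left\|(\chi-\mathbb E\chi)+\frac{X_{r+1}-\mu_{r+1}}{r}\right\|_2=o\bigl(\sqrt{\mu_{r+1}}\bigr).$$ In particular, $$\operatorname{Corr}(\chi,X_{r+1})\longrightarrow-1.$$
   Context: All asymptotics are as $n\to\infty$; $f\ll g$ means $f/g\to0$. $G(n,p)$ is the binomial random graph on $[n]$; $\chi(\cdot)$ is the chromatic number. $X_{r+1}(H)$ is the number of copies of $K_{r+1}$ in $H$, equivalently the number of independent sets of size $r+1$ in $\overline H$; so $\chi$ and $X_{r+1}$ are defined on the same probability space. $\mu_{r+1}(n,p):=\binom n{r+1}p^{\binom{r+1}2}$. $\|Z\|_2:=(\mathbb EZ^2)^{1/2}$, and $\operatorname{Corr}$ is the correlation coefficient. *)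

theory Defs
  imports
    "HOL-Probability.Probability"
    "HOL-Library.Ramsey"
    "HOL-Library.Landau_Symbols"
begin

text \<open>
  A simple graph on a vertex set \<open>V\<close> is given by its edge set \<open>E \<subseteq> [V]\<^bsup>2\<^esup>\<close>,
  where \<^term>\<open>nsets V 2\<close> is the set of two-element subsets of \<open>V\<close>.
\<close>

definition graph_complement :: "'a set \<Rightarrow> 'a set set \<Rightarrow> 'a set set" where
  "graph_complement V E = nsets V 2 - E"

definition proper_coloring :: "'a set \<Rightarrow> 'a set set \<Rightarrow> nat \<Rightarrow> ('a \<Rightarrow> nat) \<Rightarrow> bool" where
  "proper_coloring V E k c \<longleftrightarrow>
     c ` V \<subseteq> {..<k} \<and> (\<forall>u\<in>V. \<forall>v\<in>V. {u, v} \<in> E \<longrightarrow> c u \<noteq> c v)"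

definition chromatic_number :: "'a set \<Rightarrow> 'a set set \<Rightarrow> nat" where
  "chromatic_number V E = (LEAST k. \<exists>c. proper_coloring V E k c)"

text \<open>A copy of \<open>K\<^sub>k\<close> is determined by its vertex set, which spans a clique.\<close>

definition clique_count :: "nat \<Rightarrow> 'a set \<Rightarrow> 'a set set \<Rightarrow> nat" where
  "clique_count k V E = card {S \<in> nsets V k. clique S E}"

text \<open>
  \<open>G(n,p)\<close>: the edge indicators are independent Bernoulli variables with parameter \<open>p\<close>,
  and the outcome is the random edge set on the vertices \<open>1, \<dots>, n\<close>.  Note that
  \<^const>\<open>bernoulli_pmf\<close> clamps parameters outside \<open>[0,1]\<close>.
\<close>

definition gnp :: "nat \<Rightarrow> real \<Rightarrow> nat set set pmf" where
  "gnp n p = map_pmf (\<lambda>f. {e \<in> nsets {1..n} 2. f e})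
               (Pi_pmf (nsets {1..n} 2) False (\<lambda>_. bernoulli_pmf p))"

definition l2_norm_pmf :: "'a pmf \<Rightarrow> ('a \<Rightarrow> real) \<Rightarrow> real" where
  "l2_norm_pmf M Z = sqrt (measure_pmf.expectation M (\<lambda>\<omega>. (Z \<omega>)\<^sup>2))"

definition covariance_pmf :: "'a pmf \<Rightarrow> ('a \<Rightarrow> real) \<Rightarrow> ('a \<Rightarrow> real) \<Rightarrow> real" where
  "covariance_pmf M X Y =
     measure_pmf.expectation M (\<lambda>\<omega>. (X \<omega> - measure_pmf.expectation M X) *
                                     (Y \<omega> - measure_pmf.expectation M Y))"

text \<open>By the convention \<open>x / 0 = 0\<close>, this is \<open>0\<close> if \<open>X\<close> or \<open>Y\<close> has variance \<open>0\<close>.\<close>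

definition correlation_pmf :: "'a pmf \<Rightarrow> ('a \<Rightarrow> real) \<Rightarrow> ('a \<Rightarrow> real) \<Rightarrow> real" where
  "correlation_pmf M X Y =
     covariance_pmf M X Y / (sqrt (measure_pmf.variance M X) * sqrt (measure_pmf.variance M Y))"

definition expected_cliques :: "nat \<Rightarrow> nat \<Rightarrow> real \<Rightarrow> real" where
  "expected_cliques k n p = real (n choose k) * p ^ (k choose 2)"

definition chi_compl :: "nat \<Rightarrow> nat set set \<Rightarrow> real" where
  "chi_compl n H = real (chromatic_number {1..n} (graph_complement {1..n} H))"

definition num_cliques :: "nat \<Rightarrow> nat \<Rightarrow> nat set set \<Rightarrow> real" where
  "num_cliques k n H = real (clique_count k {1..n} H)"

end

theory Submission
  imports Defs "HOL-Combinatorics.Permutations" "HOL-Real_Asymp.Real_Asymp"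
begin

text \<open>
  A proper colouring of the complement of \<open>H\<close> is a partition of the vertices into cliques of \<open>H\<close>.
  In the given window the cliques with \<open>r + 2\<close> vertices have bounded mean, those with \<open>r + 1\<close>
  vertices are rare (their mean \<open>\<mu>\<close> is \<open>o(n)\<close>, yet tends to infinity), and those with \<open>r\<close> vertices
  are so plentiful (\<open>n\<^bsup>r-1\<^esup> p\<^bsup>r(r-1)/2\<^esup>\<close> outgrows \<open>log n\<close>) that they tile almost everything.
  So the best colouring uses a maximum packing of \<open>M\<close> disjoint copies of \<open>K\<^bsub>r+1\<^esub>\<close>, and copies of
  \<open>K\<^sub>r\<close> on nearly all the rest; this gives \<open>r \<chi> \<approx> n - M\<close>.  With \<open>D = r \<chi> + M - n\<close> and \<open>X = X\<^bsub>r+1\<^esub>\<close>,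
  \<open>r \<chi> + X = n + (X - M) + D\<close>,
  and the theorem says that the right-hand side has standard deviation \<open>o(\<surd>\<mu>)\<close>.

  The term \<open>X - M\<close>: adding or deleting an edge changes it only through copies of \<open>K\<^bsub>r+1\<^esub>\<close> on that
  edge that meet another copy.  The Efron--Stein inequality (\<open>efron_stein\<close>) bounds the variance by
  the expected number of intersecting pairs of copies, which is \<open>o(\<mu>)\<close> (\<open>Var_packing_deficit\<close>).

  The term \<open>D\<close>: counting vertices colour by colour gives \<open>D \<ge> -X\<^bsub>r+2\<^esub>\<close> for every graph
  (\<open>card_le_packing_plus_cliques\<close>), and \<open>X\<^bsub>r+2\<^esub>\<close> has bounded second moment.  Always \<open>D \<le> r n\<close>, so it
  remains to show that \<open>D\<close> is at most some \<open>l\<close> with \<open>l\<^sup>2 = o(\<mu>)\<close>, except with probability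
  \<open>O(n\<^bsup>-4\<^esup>)\<close> (\<open>chromatic_upper_likely\<close>).

  For this upper bound, condition on the set of all copies of \<open>K\<^bsub>r+1\<^esub>\<close>.  Their edges are present, and
  the condition on the other pairs is the decreasing event that no other \<open>(r + 1)\<close>-set is complete.
  Remove a maximum packing and distribute the remaining vertices over \<open>q\<close> groups, each split into \<open>r\<close>
  parts of equal size.  Vertices on some copy of \<open>K\<^bsub>r+1\<^esub>\<close> go into the first parts, and two
  of them on a common copy go into different groups.  Then the conditioned edges together with
  edges inside groups never force a new \<open>(r + 1)\<close>-clique (\<open>no_forced_clique\<close>).  Hence the negative
  information costs only a constant factor each time one asks whether a transversal \<open>r\<close>-set is
  complete, and the complete transversals dominate a binomial random family of index sets
  (\<open>sequential_domination\<close>, \<open>transversals_given_cliques\<close>).  To keep the transversals that were already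
  found incomplete harmless as well, every transversal carries an additional independent bit of small
  probability, and counts as found only when this bit is set too.

  A perfect matching of a group by transversals is a tuple of permutations, and a uniformly random
  such tuple is spread.  A short form of the fragmentation argument
  (\<open>spread_family_contained\<close>) therefore finds perfect matchings in the binomial random family, and
  all but fewer than \<open>q r\<close> vertices are covered.

  The number \<open>q\<close> of groups is a constant near the lower end of the window, where \<open>\<mu>\<close> may be only
  a power of \<open>log n\<close>, and a small power of \<open>n\<close> otherwise (\<open>chromatic_excess_small\<close>).
  Finally \<open>X\<close> has variance of order at least \<open>\<mu>\<close>, so the correlation statement follows from the
  estimate in \<open>L\<^sup>2\<close> by the Cauchy--Schwarz inequality (\<open>correlation_plus_one_le\<close>).
\<close>

section \<open>Random subsets of a finite set\<close>

definition is_prob :: "('a \<Rightarrow> real) \<Rightarrow> bool" where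
  "is_prob pr \<longleftrightarrow> (\<forall>x. 0 \<le> pr x \<and> pr x \<le> 1)"

definition weight :: "'a set \<Rightarrow> ('a \<Rightarrow> real) \<Rightarrow> 'a set \<Rightarrow> real" where
  "weight E pr A = (\<Prod>e\<in>A. pr e) * (\<Prod>e\<in>E - A. 1 - pr e)"

text \<open>
  Only finitely many pairs are random, so expectations are finite sums over subsets.  The recursion in
  \<open>expect_insert\<close> below then allows proofs by induction over the ground set.
\<close>

definition expect :: "'a set \<Rightarrow> ('a \<Rightarrow> real) \<Rightarrow> ('a set \<Rightarrow> real) \<Rightarrow> real" where
  "expect E pr f = (\<Sum>A\<in>Pow E. weight E pr A * f A)"

definition Pr :: "'a set \<Rightarrow> ('a \<Rightarrow> real) \<Rightarrow> ('a set \<Rightarrow> bool) \<Rightarrow> real" where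
  "Pr E pr P = expect E pr (\<lambda>A. of_bool (P A))"

lemma is_probD: "is_prob pr \<Longrightarrow> 0 \<le> pr x" "is_prob pr \<Longrightarrow> pr x \<le> 1"
  by (auto simp: is_prob_def)

lemma weight_nonneg: "is_prob pr \<Longrightarrow> 0 \<le> weight E pr A"
  unfolding weight_def by (intro mult_nonneg_nonneg prod_nonneg) (auto simp: is_prob_def)

lemma expect_empty [simp]: "expect {} pr f = f {}"
  by (simp add: expect_def weight_def)

lemma expect_insert:
  assumes "finite E" "e \<notin> E"
  shows "expect (insert e E) pr f = pr e * expect E pr (\<lambda>A. f (insert e A)) + (1 - pr e) * expect E pr f"
proof -
  have w1: "weight (insert e E) pr (insert e A) = pr e * weight E pr A" if "A \<in> Pow E" for A
  proof -
    have "finite A" "e \<notin> A" using that assms finite_subset by auto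
    moreover have "insert e E - insert e A = E - A" using assms by auto
    ultimately show ?thesis by (simp add: weight_def)
  qed
  have w2: "weight (insert e E) pr A = (1 - pr e) * weight E pr A" if "A \<in> Pow E" for A
  proof -
    have "e \<notin> A" using that assms by auto
    then have "insert e E - A = insert e (E - A)" by auto
    then show ?thesis using assms by (simp add: weight_def)
  qed
  have "expect (insert e E) pr f = (\<Sum>A\<in>Pow E. weight (insert e E) pr A * f A) +
      (\<Sum>A\<in>insert e ` Pow E. weight (insert e E) pr A * f A)"
    unfolding expect_def Pow_insert using assms by (intro sum.union_disjoint) auto
  also have "(\<Sum>A\<in>insert e ` Pow E. weight (insert e E) pr A * f A)
      = (\<Sum>A\<in>Pow E. weight (insert e E) pr (insert e A) * f (insert e A))"
    using assms by (subst sum.reindex) (auto intro!: inj_onI)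
  also have "\<dots> = pr e * expect E pr (\<lambda>A. f (insert e A))"
    unfolding expect_def sum_distrib_left by (intro sum.cong) (auto simp: w1)
  also have "(\<Sum>A\<in>Pow E. weight (insert e E) pr A * f A) = (1 - pr e) * expect E pr f"
    unfolding expect_def sum_distrib_left by (intro sum.cong) (auto simp: w2)
  finally show ?thesis by simp
qed

lemma expect_cong: "(\<And>A. A \<subseteq> E \<Longrightarrow> f A = g A) \<Longrightarrow> expect E pr f = expect E pr g"
  unfolding expect_def by (intro sum.cong) auto

lemma expect_const: "finite E \<Longrightarrow> expect E pr (\<lambda>_. c) = c"
  by (induction E rule: finite_induct) (auto simp: expect_insert algebra_simps)

lemma expect_add: "expect E pr (\<lambda>A. f A + g A) = expect E pr f + expect E pr g"
  by (simp add: expect_def algebra_simps sum.distrib)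

lemma expect_diff: "expect E pr (\<lambda>A. f A - g A) = expect E pr f - expect E pr g"
  by (simp add: expect_def algebra_simps sum_subtractf)

lemma expect_cmult: "expect E pr (\<lambda>A. c * f A) = c * expect E pr f"
  by (simp add: expect_def sum_distrib_left mult_ac)

lemma expect_sum: "expect E pr (\<lambda>A. \<Sum>x\<in>S. f x A) = (\<Sum>x\<in>S. expect E pr (f x))"
  unfolding expect_def sum_distrib_left by (rule sum.swap)

lemma expect_mono:
  assumes "is_prob pr" "\<And>A. A \<subseteq> E \<Longrightarrow> f A \<le> g A"
  shows "expect E pr f \<le> expect E pr g"
  unfolding expect_def using assms by (intro sum_mono mult_left_mono weight_nonneg) auto

lemma expect_nonneg:
  assumes "is_prob pr" "\<And>A. A \<subseteq> E \<Longrightarrow> 0 \<le> f A"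
  shows "0 \<le> expect E pr f"
  unfolding expect_def using assms by (intro sum_nonneg mult_nonneg_nonneg weight_nonneg) auto

lemma Pr_nonneg: "is_prob pr \<Longrightarrow> 0 \<le> Pr E pr P"
  unfolding Pr_def by (rule expect_nonneg) auto

lemma Pr_le_1: "finite E \<Longrightarrow> is_prob pr \<Longrightarrow> Pr E pr P \<le> 1"
  unfolding Pr_def using expect_mono[of pr E "\<lambda>A. of_bool (P A)" "\<lambda>_. 1"] by (auto simp: expect_const)

lemma Pr_mono:
  assumes "is_prob pr" "\<And>A. A \<subseteq> E \<Longrightarrow> P A \<Longrightarrow> Q A"
  shows "Pr E pr P \<le> Pr E pr Q"
  unfolding Pr_def using assms by (intro expect_mono) auto

lemma Pr_cong: "(\<And>A. A \<subseteq> E \<Longrightarrow> P A = Q A) \<Longrightarrow> Pr E pr P = Pr E pr Q"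
  unfolding Pr_def by (intro expect_cong) auto

lemma Pr_compl: "finite E \<Longrightarrow> Pr E pr (\<lambda>A. \<not> P A) = 1 - Pr E pr P"
proof -
  assume "finite E"
  have "Pr E pr (\<lambda>A. \<not> P A) = expect E pr (\<lambda>A. 1 - of_bool (P A))"
    unfolding Pr_def by (intro expect_cong) auto
  also have "\<dots> = 1 - Pr E pr P"
    by (simp add: expect_diff expect_const \<open>finite E\<close> Pr_def)
  finally show ?thesis .
qed

lemma Pr_disj_le:
  assumes "is_prob pr"
  shows "Pr E pr (\<lambda>A. P A \<or> Q A) \<le> Pr E pr P + Pr E pr Q"
  unfolding Pr_def expect_add[symmetric] using assms by (intro expect_mono) auto

lemma Pr_Bex_le:
  assumes "is_prob pr" "finite S"
  shows "Pr E pr (\<lambda>A. \<exists>x\<in>S. P x A) \<le> (\<Sum>x\<in>S. Pr E pr (P x))"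
proof -
  have "of_bool (\<exists>x\<in>S. P x A) \<le> (\<Sum>x\<in>S. of_bool (P x A) :: real)" for A
  proof (cases "\<exists>x\<in>S. P x A")
    case True
    then obtain x where "x \<in> S" "P x A" by blast
    then have "(1::real) \<le> (\<Sum>x\<in>{x}. of_bool (P x A))" by simp
    also have "\<dots> \<le> (\<Sum>x\<in>S. of_bool (P x A))"
      using assms \<open>x \<in> S\<close> by (intro sum_mono2) auto
    finally show ?thesis using True by simp
  qed (auto intro: sum_nonneg)
  then show ?thesis unfolding Pr_def expect_sum[symmetric] using assms by (intro expect_mono) auto
qed

lemma Pr_markov:
  assumes "is_prob pr" "a > 0" "\<And>A. A \<subseteq> E \<Longrightarrow> 0 \<le> f A"
  shows "Pr E pr (\<lambda>A. a \<le> f A) \<le> expect E pr f / a"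
proof -
  have "Pr E pr (\<lambda>A. a \<le> f A) \<le> expect E pr (\<lambda>A. (1 / a) * f A)"
    unfolding Pr_def using assms by (intro expect_mono) (auto simp: field_simps)
  then show ?thesis unfolding expect_cmult by simp
qed

lemma expect_union:
  assumes "finite E" "finite F" "E \<inter> F = {}"
  shows "expect (E \<union> F) pr f = expect E pr (\<lambda>A. expect F pr (\<lambda>B. f (A \<union> B)))"
  using assms
proof (induction E arbitrary: f rule: finite_induct)
  case (insert e E)
  have "expect (insert e E \<union> F) pr f = pr e * expect (E \<union> F) pr (\<lambda>A. f (insert e A)) + (1 - pr e) * expect (E \<union> F) pr f"
    using insert by (simp add: expect_insert)
  also have "\<dots> = expect (insert e E) pr (\<lambda>A. expect F pr (\<lambda>B. f (A \<union> B)))"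
    using insert by (simp add: expect_insert)
  finally show ?case .
qed simp

lemma expect_marginal:
  assumes "finite E" "E' \<subseteq> E"
  shows "expect E pr (\<lambda>A. f (A \<inter> E')) = expect E' pr f"
proof -
  have "expect E pr (\<lambda>A. f (A \<inter> E')) = expect (E' \<union> (E - E')) pr (\<lambda>A. f (A \<inter> E'))"
    using assms by (simp add: Un_absorb1)
  also have "\<dots> = expect E' pr (\<lambda>A. expect (E - E') pr (\<lambda>B. f ((A \<union> B) \<inter> E')))"
    using assms finite_subset by (intro expect_union) auto
  also have "\<dots> = expect E' pr (\<lambda>A. expect (E - E') pr (\<lambda>B. f A))"
    by (intro expect_cong arg_cong[where f = f]) auto
  also have "\<dots> = expect E' pr f" using assms by (simp add: expect_const)
  finally show ?thesis .
qed

lemma expect_filter: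
  assumes "finite E" "F \<subseteq> E"
  shows "expect E pr (\<lambda>A. of_bool (F \<subseteq> A) * f A) = (\<Prod>e\<in>F. pr e) * expect E pr (\<lambda>A. f (A \<union> F))"
proof -
  have "finite F" using assms finite_subset by auto
  then show ?thesis using assms(2)
  proof (induction F arbitrary: f rule: finite_induct)
    case empty
    then show ?case by simp
  next
    case (insert e F)
    define E' where "E' = E - {e}"
    have E: "E = insert e E'" "e \<notin> E'" "finite E'" using insert assms by (auto simp: E'_def)
    have step: "expect E pr (\<lambda>A. of_bool (e \<in> A) * h A) = pr e * expect E pr (\<lambda>A. h (insert e A))" for h
    proof -
      have "expect E pr (\<lambda>A. of_bool (e \<in> A) * h A) = pr e * expect E' pr (\<lambda>A. h (insert e A))
         + (1 - pr e) * expect E' pr (\<lambda>A. of_bool (e \<in> A) * h A)"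
        using E by (simp add: expect_insert)
      also have "expect E' pr (\<lambda>A. of_bool (e \<in> A) * h A) = expect E' pr (\<lambda>A. 0)"
        using E by (intro expect_cong) auto
      also have "expect E' pr (\<lambda>A. h (insert e A)) = expect E pr (\<lambda>A. h (insert e A))"
        using E by (simp add: expect_insert algebra_simps)
      finally show ?thesis using E by (simp add: expect_const)
    qed
    have "expect E pr (\<lambda>A. of_bool (insert e F \<subseteq> A) * f A)
        = expect E pr (\<lambda>A. of_bool (F \<subseteq> A) * (of_bool (e \<in> A) * f A))"
      by (intro expect_cong) auto
    also have "\<dots> = (\<Prod>e\<in>F. pr e) * expect E pr (\<lambda>A. of_bool (e \<in> A \<union> F) * f (A \<union> F))"
      using insert by (subst insert.IH) auto
    also have "expect E pr (\<lambda>A. of_bool (e \<in> A \<union> F) * f (A \<union> F)) = expect E pr (\<lambda>A. of_bool (e \<in> A) * f (A \<union> F))"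
      using insert by (intro expect_cong) auto
    also have "\<dots> = pr e * expect E pr (\<lambda>A. f (insert e A \<union> F))" by (rule step)
    finally show ?case using insert by (simp add: mult_ac)
  qed
qed

lemma Pr_filter:
  assumes "finite E" "F \<subseteq> E"
  shows "Pr E pr (\<lambda>A. F \<subseteq> A \<and> P A) = (\<Prod>e\<in>F. pr e) * Pr E pr (\<lambda>A. P (A \<union> F))"
  unfolding Pr_def by (subst expect_filter[OF assms, symmetric]) (intro expect_cong, auto)

lemma Pr_superset:
  assumes "finite E" "F \<subseteq> E"
  shows "Pr E pr (\<lambda>A. F \<subseteq> A) = (\<Prod>e\<in>F. pr e)"
  using Pr_filter[OF assms, of pr "\<lambda>_. True"] assms by (simp add: Pr_def expect_const)

lemma Pr_superset_const:
  assumes "finite E" "F \<subseteq> E"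
  shows "Pr E (\<lambda>_. p) (\<lambda>A. F \<subseteq> A) = p ^ card F"
  using Pr_superset[OF assms, of "\<lambda>_. p"] by simp

text \<open>
  Sprinkling: an element is missed by both rounds with probability \<open>(1 - a)(1 - b)\<close>.
\<close>

lemma expect_two_rounds:
  assumes "finite E"
  shows "expect E (\<lambda>_. a) (\<lambda>A. expect E (\<lambda>_. b) (\<lambda>B. f (A \<union> B))) = expect E (\<lambda>_. 1 - (1 - a) * (1 - b)) f"
  using assms
proof (induction E arbitrary: f rule: finite_induct)
  case (insert e E)
  let ?G = "\<lambda>g. expect E (\<lambda>_. 1 - (1 - a) * (1 - b)) g"
  have "expect (insert e E) (\<lambda>_. a) (\<lambda>A. expect (insert e E) (\<lambda>_. b) (\<lambda>B. f (A \<union> B)))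
     = a * (b * ?G (\<lambda>A. f (insert e A)) + (1 - b) * ?G (\<lambda>A. f (insert e A)))
      + (1 - a) * (b * ?G (\<lambda>A. f (insert e A)) + (1 - b) * ?G f)"
    using insert unfolding insert.IH[symmetric]
    by (simp add: expect_insert expect_add expect_diff expect_cmult insert_commute algebra_simps)
  also have "\<dots> = expect (insert e E) (\<lambda>_. 1 - (1 - a) * (1 - b)) f"
    using insert by (simp add: expect_insert algebra_simps)
  finally show ?case .
qed simp

text \<open>
  A union bound over the subsets of size \<open>t\<close>; for small \<open>card F * p\<close> this is all that is needed.
\<close>

lemma Pr_card_ge:
  assumes "finite E" "F \<subseteq> E" "0 \<le> p" "p \<le> 1"
  shows "Pr E (\<lambda>_. p) (\<lambda>A. t \<le> card (A \<inter> F)) \<le> (real (card F) * p) ^ t"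
proof -
  have fF: "finite F" using assms finite_subset by auto
  have "Pr E (\<lambda>_. p) (\<lambda>A. t \<le> card (A \<inter> F)) \<le> Pr E (\<lambda>_. p) (\<lambda>A. \<exists>T\<in>nsets F t. T \<subseteq> A)"
  proof (intro Pr_mono)
    fix A assume A: "A \<subseteq> E" "t \<le> card (A \<inter> F)"
    then obtain T where "T \<subseteq> A \<inter> F" "card T = t" "finite T" by (meson obtain_subset_with_card_n)
    then show "\<exists>T\<in>nsets F t. T \<subseteq> A" by (auto simp: nsets_def)
  qed (use assms in \<open>auto simp: is_prob_def\<close>)
  also have "\<dots> \<le> (\<Sum>T\<in>nsets F t. Pr E (\<lambda>_. p) (\<lambda>A. T \<subseteq> A))"
    using assms fF by (intro Pr_Bex_le) (auto simp: is_prob_def finite_imp_finite_nsets)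
  also have "\<dots> = (\<Sum>T\<in>nsets F t. p ^ t)"
    using assms by (intro sum.cong refl) (auto simp: nsets_def Pr_superset_const)
  also have "\<dots> = real (card F choose t) * p ^ t"
    by (simp add: card_nsets)
  also have "\<dots> \<le> real (card F ^ t) * p ^ t"
  proof -
    have "card F choose t \<le> card F ^ t" by (cases "t \<le> card F") (auto simp: binomial_le_pow binomial_eq_0)
    then show ?thesis using assms by (intro mult_right_mono) (auto simp del: of_nat_power)
  qed
  finally show ?thesis by (simp add: power_mult_distrib)
qed

text \<open>
  The moment generating function at \<open>1\<close>: each element contributes a factor
  \<open>1 + p (e - 1) \<le> exp (2 p)\<close>.
\<close>

lemma expect_exp_card:
  assumes "finite E" "F \<subseteq> E" "0 \<le> p" "p \<le> 1"
  shows "expect E (\<lambda>_. p) (\<lambda>A. exp (real (card (A \<inter> F)))) \<le> exp (2 * real (card F) * p)"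
proof -
  have fF: "finite F" using assms finite_subset by auto
  have eq: "expect F (\<lambda>_. p) (\<lambda>A. exp (real (card A))) = (1 - p + p * exp 1) ^ card F"
    using fF
  proof (induction F rule: finite_induct)
    case (insert e F)
    have "expect F (\<lambda>_. p) (\<lambda>A. exp (real (card (insert e A)))) = expect F (\<lambda>_. p) (\<lambda>A. exp 1 * exp (real (card A)))"
    proof (intro expect_cong)
      fix A assume "A \<subseteq> F"
      then have "finite A" "e \<notin> A" using insert finite_subset by auto
      then show "exp (real (card (insert e A))) = exp 1 * exp (real (card A))"
        by (simp add: exp_add)
    qed
    then show ?case using insert by (simp add: expect_insert expect_cmult algebra_simps)
  qed simp
  have "expect E (\<lambda>_. p) (\<lambda>A. exp (real (card (A \<inter> F)))) = (1 - p + p * exp 1) ^ card F"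
    using expect_marginal[OF assms(1,2), of "\<lambda>_. p" "\<lambda>A. exp (real (card A))"] eq by simp
  also have "\<dots> \<le> exp (2 * p) ^ card F"
  proof (intro power_mono)
    have "exp (1::real) \<le> 3" using exp_le by simp
    then have "p * exp 1 \<le> p * 3" using assms by (intro mult_left_mono) auto
    then have "1 - p + p * exp 1 \<le> 1 + 2 * p" by simp
    also have "\<dots> \<le> exp (2 * p)" by (rule exp_ge_add_one_self)
    finally show "1 - p + p * exp 1 \<le> exp (2 * p)" .
  qed (use assms in auto)
  also have "\<dots> = exp (2 * real (card F) * p)"
    by (simp add: exp_of_nat_mult[symmetric] mult_ac)
  finally show ?thesis .
qed

definition Var :: "'a set \<Rightarrow> ('a \<Rightarrow> real) \<Rightarrow> ('a set \<Rightarrow> real) \<Rightarrow> real" where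
  "Var E pr f = expect E pr (\<lambda>A. (f A - expect E pr f)\<^sup>2)"

lemma Var_eq: "finite E \<Longrightarrow> Var E pr f = expect E pr (\<lambda>A. (f A)\<^sup>2) - (expect E pr f)\<^sup>2"
proof -
  assume fin: "finite E"
  have "Var E pr f = expect E pr (\<lambda>A. (f A)\<^sup>2 - (2 * expect E pr f) * f A + (expect E pr f)\<^sup>2)"
    unfolding Var_def by (intro expect_cong) (auto simp: power2_eq_square algebra_simps)
  then show ?thesis using fin
    by (simp add: expect_add expect_diff expect_cmult expect_const power2_eq_square)
qed

lemma Var_nonneg: "is_prob pr \<Longrightarrow> 0 \<le> Var E pr f"
  unfolding Var_def by (rule expect_nonneg) auto

lemma expect_power2_le:
  assumes "finite E" "is_prob pr"
  shows "(expect E pr f)\<^sup>2 \<le> expect E pr (\<lambda>A. (f A)\<^sup>2)"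
  using Var_nonneg[OF assms(2), of E f] Var_eq[OF assms(1), of pr f] by simp

text \<open>
  By induction: conditioning on the last element splits the variance into the average conditional
  variance, to which the induction hypothesis applies, and \<open>p(1 - p)\<close> times the squared difference of
  the conditional means, which is at most the mean squared difference.
\<close>

lemma efron_stein:
  assumes "finite E" "is_prob pr"
  shows "Var E pr f \<le> (\<Sum>e\<in>E. pr e * (1 - pr e) * expect E pr (\<lambda>A. (f (insert e A) - f (A - {e}))\<^sup>2))"
  using assms
proof (induction E arbitrary: f rule: finite_induct)
  case empty
  then show ?case by (simp add: Var_def)
next
  case (insert e E)
  define f1 where "f1 = (\<lambda>A. f (insert e A))"
  define D :: "('a set \<Rightarrow> real) \<Rightarrow> 'a \<Rightarrow> 'a set \<Rightarrow> real"
    where "D = (\<lambda>g x A. (g (insert x A) - g (A - {x}))\<^sup>2)"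
  let ?E = "expect E pr" and ?p = "pr e"
  have p: "0 \<le> ?p" "?p \<le> 1" using insert.prems by (auto simp: is_prob_def)
  have var: "Var (insert e E) pr f = ?p * Var E pr f1 + (1 - ?p) * Var E pr f + ?p * (1 - ?p) * (?E f1 - ?E f)\<^sup>2"
    using insert by (simp add: Var_eq expect_insert f1_def power2_eq_square algebra_simps)
  have "(?E f1 - ?E f)\<^sup>2 = (?E (\<lambda>A. f1 A - f A))\<^sup>2" by (simp add: expect_diff)
  also have "\<dots> \<le> ?E (\<lambda>A. (f1 A - f A)\<^sup>2)" using insert by (intro expect_power2_le) auto
  also have "\<dots> = ?E (D f e)"
  proof (intro expect_cong)
    fix A assume "A \<subseteq> E"
    then have "A - {e} = A" using insert by auto
    then show "(f1 A - f A)\<^sup>2 = D f e A" by (simp add: f1_def D_def)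
  qed
  also have "\<dots> = expect (insert e E) pr (D f e)"
  proof -
    have "?E (\<lambda>A. D f e (insert e A)) = ?E (D f e)"
      using insert by (intro expect_cong) (auto simp: D_def insert_Diff_if intro!: arg_cong[where f = f])
    then show ?thesis using insert by (simp add: expect_insert algebra_simps)
  qed
  finally have e_term: "(?E f1 - ?E f)\<^sup>2 \<le> expect (insert e E) pr (D f e)" .
  have x_term: "?p * ?E (D f1 x) + (1 - ?p) * ?E (D f x) = expect (insert e E) pr (D f x)" if "x \<in> E" for x
  proof -
    have "?E (D f1 x) = ?E (\<lambda>A. D f x (insert e A))"
      using insert that
      by (intro expect_cong) (auto simp: D_def f1_def insert_Diff_if insert_commute intro!: arg_cong[where f = f])
    then show ?thesis using insert by (simp add: expect_insert)
  qed
  have "Var (insert e E) pr f \<le> ?p * (\<Sum>x\<in>E. pr x * (1 - pr x) * ?E (D f1 x))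
     + (1 - ?p) * (\<Sum>x\<in>E. pr x * (1 - pr x) * ?E (D f x)) + ?p * (1 - ?p) * expect (insert e E) pr (D f e)"
    unfolding var D_def using insert p e_term[unfolded D_def]
    by (intro add_mono mult_left_mono) auto
  also have "\<dots> = (\<Sum>x\<in>E. pr x * (1 - pr x) * (?p * ?E (D f1 x) + (1 - ?p) * ?E (D f x)))
      + ?p * (1 - ?p) * expect (insert e E) pr (D f e)"
    unfolding sum_distrib_left sum.distrib[symmetric]
    by (intro arg_cong2[of _ _ _ _ "(+)"] sum.cong refl) (simp add: algebra_simps)
  also have "\<dots> = (\<Sum>x\<in>insert e E. pr x * (1 - pr x) * expect (insert e E) pr (D f x))"
    using insert x_term by simp
  finally show ?case by (simp add: D_def)
qed

lemma expectation_Pi_bernoulli: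
  assumes "finite E" "0 \<le> p" "p \<le> 1"
  shows "measure_pmf.expectation (Pi_pmf E False (\<lambda>_. bernoulli_pmf p)) (\<lambda>f. g {e \<in> E. f e}) = expect E (\<lambda>_. p) g"
  using assms(1)
proof (induction E arbitrary: g rule: finite_induct)
  case empty
  then show ?case by simp
next
  case (insert e E)
  let ?M = "Pi_pmf E False (\<lambda>_. bernoulli_pmf p)"
  have fin: "finite (set_pmf ?M)"
    by (rule finite_subset[OF set_Pi_pmf_subset']) (use insert in \<open>auto intro!: finite_PiE_dflt\<close>)
  have E: "{x \<in> insert e E. (f(e := b)) x} = (if b then insert e {x \<in> E. f x} else {x \<in> E. f x})" for f b
    using insert by auto
  have "measure_pmf.expectation (Pi_pmf (insert e E) False (\<lambda>_. bernoulli_pmf p)) (\<lambda>f. g {e' \<in> insert e E. f e'})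
     = measure_pmf.expectation (pair_pmf (bernoulli_pmf p) ?M) (\<lambda>x. g {e' \<in> insert e E. ((snd x)(e := fst x)) e'})"
    using insert by (simp add: Pi_pmf_insert case_prod_beta)
  also have "\<dots> = measure_pmf.expectation (pair_pmf (bernoulli_pmf p) ?M)
        (\<lambda>x. g (if fst x then insert e {x' \<in> E. (snd x) x'} else {x' \<in> E. (snd x) x'}))"
    unfolding E ..
  also have "\<dots> = p * measure_pmf.expectation ?M (\<lambda>f. g (insert e {x \<in> E. f x}))
       + (1 - p) * measure_pmf.expectation ?M (\<lambda>f. g {x \<in> E. f x})"
    unfolding pair_pmf_def
    by (subst pmf_expectation_bind[where A = UNIV])
       (use fin assms in \<open>auto simp: map_pmf_def[symmetric] UNIV_bool\<close>)
  also have "\<dots> = expect (insert e E) (\<lambda>_. p) g"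
    using insert by (simp add: expect_insert insert.IH[of g] insert.IH[of "\<lambda>A. g (insert e A)"])
  finally show ?case .
qed

text \<open>
  From here on the random graph is a random subset of the pairs.
\<close>

lemma expectation_gnp:
  assumes "0 \<le> p" "p \<le> 1"
  shows "measure_pmf.expectation (gnp n p) g = expect (nsets {1..n} 2) (\<lambda>_. p) g"
  unfolding gnp_def using expectation_Pi_bernoulli[OF finite_imp_finite_nsets assms, of "{1..n}" 2 g]
  by simp

section \<open>Spread families\<close>

text \<open>
  If \<open>i\<close> is chosen uniformly from \<open>I\<close>, then \<open>S i\<close> contains a given \<open>A\<close> with probability at most
  \<open>\<kappa>\<^bsup>-|A|\<^esup>\<close>.  Indexing allows repetitions among the sets.
\<close>

definition spread_family :: "'i set \<Rightarrow> ('i \<Rightarrow> 'a set) \<Rightarrow> real \<Rightarrow> bool" where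
  "spread_family I S \<kappa> \<longleftrightarrow> finite I \<and> I \<noteq> {} \<and>
     (\<forall>A. finite A \<longrightarrow> real (card {i\<in>I. A \<subseteq> S i}) * \<kappa> ^ card A \<le> real (card I))"

text \<open>
  Some member \<open>S j\<close> of the family can be completed from \<open>W\<close> by at most \<open>m\<close> elements, all of which lie
  in \<open>S i\<close>: the index \<open>i\<close> need not be close to completion itself.
\<close>

definition small_fragment :: "'i set \<Rightarrow> ('i \<Rightarrow> 'a set) \<Rightarrow> 'a set \<Rightarrow> nat \<Rightarrow> 'i \<Rightarrow> bool" where
  "small_fragment I S W m i \<longleftrightarrow> (\<exists>j\<in>I. S j \<subseteq> W \<union> S i \<and> card (S j - W) \<le> m)"

lemma small_fragment_mono:
  assumes "small_fragment I S W m i" "\<And>j. j \<in> I \<Longrightarrow> finite (S j)"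
  shows "small_fragment I S (W \<union> Y) m i"
proof -
  obtain j where j: "j \<in> I" "S j \<subseteq> W \<union> S i" "card (S j - W) \<le> m"
    using assms by (auto simp: small_fragment_def)
  have "card (S j - (W \<union> Y)) \<le> card (S j - W)"
    using assms(2)[OF j(1)] by (intro card_mono) auto
  with j show ?thesis unfolding small_fragment_def by (intro bexI[of _ j]) auto
qed

lemma weight_const_extend:
  assumes "finite X" "Y \<subseteq> X" "T \<subseteq> X" "T \<inter> Y = {}" "0 \<le> q" "q \<le> 1"
  shows "weight X (\<lambda>_. q) Y * q ^ card T \<le> weight X (\<lambda>_. q) (Y \<union> T)"
proof -
  have fin: "finite Y" "finite T" using assms by (auto intro: finite_subset)
  have "card (X - (Y \<union> T)) \<le> card (X - Y)" using assms by (intro card_mono) auto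
  then have "(1 - q) ^ card (X - Y) \<le> (1 - q) ^ card (X - (Y \<union> T))"
    using assms by (intro power_decreasing) auto
  moreover have "card (Y \<union> T) = card Y + card T"
    using fin assms by (intro card_Un_disjoint) auto
  ultimately show ?thesis using assms
    by (simp add: weight_def power_add mult_ac mult_left_mono)
qed

text \<open>
  One round of sprinkling turns fragments of size \<open>m\<close> into fragments of size \<open>m'\<close> for most indices.
  If this fails for \<open>i\<close>, whose fragment is \<open>T0 \<subseteq> S i\<close>, let \<open>T\<close> be a smallest remainder \<open>C - Y\<close> among the
  fragments \<open>C\<close> inside \<open>Y \<union> T0\<close>; then \<open>T \<subseteq> S i\<close> is large.  Encode the failure by \<open>Z = Y \<union> T\<close> and \<open>T\<close>.  By minimality \<open>T\<close>
  is contained in a fragment \<open>c Z\<close> of size at most \<open>m\<close> chosen from \<open>Z\<close> alone, so given \<open>Z\<close> there are at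
  most \<open>2\<^sup>m\<close> choices for \<open>T\<close>.  Spreadness pays \<open>\<kappa>\<^bsup>-|T|\<^esup>\<close> for \<open>T \<subseteq> S i\<close>, and passing from \<open>Y\<close> to \<open>Z\<close> costs
  \<open>q\<^bsup>-|T|\<^esup>\<close>; together at most \<open>64\<^bsup>-|T|\<^esup>\<close>.
\<close>

lemma expected_large_fragments:
  fixes S :: "'i \<Rightarrow> 'a set"
  assumes "finite X" and SX: "\<And>i. i \<in> I \<Longrightarrow> S i \<subseteq> X" and spread: "spread_family I S \<kappa>"
    and q: "0 < q" "q \<le> 1" and "\<kappa> > 0" and L: "64 \<le> q * \<kappa>"
  shows "expect X (\<lambda>_. q) (\<lambda>Y. real (card {i\<in>I. small_fragment I S W m i \<and> \<not> small_fragment I S (W \<union> Y) m' i}))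
      \<le> real (card I) * 2 ^ m * (1 / 64) ^ Suc m'"
proof -
  have finI: "finite I" using spread by (simp add: spread_family_def)
  have finS: "finite (S i)" if "i \<in> I" for i using SX[OF that] \<open>finite X\<close> finite_subset by auto
  define cand where "cand Z C \<longleftrightarrow> (\<exists>j\<in>I. C = S j - W) \<and> card C \<le> m \<and> C \<subseteq> Z" for Z C
  define c where "c Z = (if \<exists>C. cand Z C then SOME C. cand Z C else {})" for Z
  have c_cand: "cand Z (c Z)" if "cand Z C" for Z C
    unfolding c_def using that by (auto intro: someI)
  have c_card: "card (c Z) \<le> m" "finite (c Z)" for Z
  proof -
    have "card (c Z) \<le> m \<and> finite (c Z)"
    proof (cases "\<exists>C. cand Z C")
      case True
      then have "cand Z (c Z)" using c_cand by blast
      then show ?thesis unfolding cand_def using finS by auto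
    qed (auto simp: c_def)
    then show "card (c Z) \<le> m" "finite (c Z)" by auto
  qed
  define \<T> where "\<T> Y = {T\<in>Pow X. T \<inter> Y = {} \<and> T \<subseteq> c (Y \<union> T) \<and> m' < card T}" for Y
  have bad_in: "\<exists>T\<in>\<T> Y. T \<subseteq> S i"
    if Y: "Y \<subseteq> X" and i: "i \<in> I" "small_fragment I S W m i" "\<not> small_fragment I S (W \<union> Y) m' i" for Y i
  proof -
    obtain j where j: "j \<in> I" "S j \<subseteq> W \<union> S i" "card (S j - W) \<le> m"
      using i by (auto simp: small_fragment_def)
    define T0 where "T0 = S j - W"
    have T0: "cand (Y \<union> T0) T0" "T0 \<subseteq> S i" using j by (auto simp: cand_def T0_def)
    \<comment> \<open>minimality makes the remainder readable from \<open>Y \<union> T\<close> alone\<close>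
    obtain C where C: "cand (Y \<union> T0) C" and Cmin: "\<And>C'. cand (Y \<union> T0) C' \<Longrightarrow> card (C - Y) \<le> card (C' - Y)"
      using ex_has_least_nat[of "cand (Y \<union> T0)" T0 "\<lambda>C. card (C - Y)"] T0(1) by blast
    define T where "T = C - Y"
    have "C \<subseteq> X" using C SX unfolding cand_def by blast
    then have finC: "finite C" "C \<subseteq> X" using \<open>finite X\<close> by (auto intro: finite_subset)
    have T: "T \<subseteq> T0" "T \<inter> Y = {}" "T \<subseteq> X" "finite T" using C finC unfolding T_def cand_def by auto
    obtain j' where j': "j' \<in> I" "C = S j' - W" using C unfolding cand_def by auto
    have "S j' \<subseteq> W \<union> Y \<union> S i" using j' C T0(2) unfolding cand_def by auto
    moreover have "S j' - (W \<union> Y) = T" using j' by (auto simp: T_def)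
    ultimately have big: "m' < card T"
      using i(3) j'(1) unfolding small_fragment_def by (metis linorder_not_le)
    have "cand (Y \<union> T) C" using C unfolding cand_def T_def by auto
    then have cc: "cand (Y \<union> T) (c (Y \<union> T))" by (rule c_cand)
    then have "cand (Y \<union> T0) (c (Y \<union> T))" using T unfolding cand_def by auto
    then have "card T \<le> card (c (Y \<union> T) - Y)" unfolding T_def[symmetric] using Cmin T_def by simp
    moreover have "c (Y \<union> T) - Y \<subseteq> T" using cc unfolding cand_def by auto
    ultimately have "c (Y \<union> T) - Y = T" using T(4) by (meson card_seteq)
    then have "T \<in> \<T> Y" using T big unfolding \<T>_def by auto
    moreover have "T \<subseteq> S i" using T(1) T0(2) by blast
    ultimately show ?thesis by blast
  qed
  have fin\<T>: "finite (\<T> Y)" for Y unfolding \<T>_def using \<open>finite X\<close> by auto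
  have count: "real (card {i\<in>I. T \<subseteq> S i}) \<le> real (card I) * (1 / \<kappa>) ^ card T" if "finite T" for T
  proof -
    have "real (card {i\<in>I. T \<subseteq> S i}) * \<kappa> ^ card T \<le> real (card I)"
      using spread that by (auto simp: spread_family_def)
    then show ?thesis using \<open>\<kappa> > 0\<close> by (simp add: field_simps)
  qed
  have bound_Y: "real (card {i\<in>I. small_fragment I S W m i \<and> \<not> small_fragment I S (W \<union> Y) m' i})
      \<le> (\<Sum>T\<in>\<T> Y. real (card I) * (1 / \<kappa>) ^ card T)" if Y: "Y \<subseteq> X" for Y
  proof -
    have "{i\<in>I. small_fragment I S W m i \<and> \<not> small_fragment I S (W \<union> Y) m' i} \<subseteq> (\<Union>T\<in>\<T> Y. {i\<in>I. T \<subseteq> S i})"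
      using bad_in[OF Y] by auto
    then have "card {i\<in>I. small_fragment I S W m i \<and> \<not> small_fragment I S (W \<union> Y) m' i}
        \<le> card (\<Union>T\<in>\<T> Y. {i\<in>I. T \<subseteq> S i})"
      using finI fin\<T> by (intro card_mono) auto
    also have "\<dots> \<le> (\<Sum>T\<in>\<T> Y. card {i\<in>I. T \<subseteq> S i})"
      by (rule card_UN_le) (rule fin\<T>)
    finally have "real (card {i\<in>I. small_fragment I S W m i \<and> \<not> small_fragment I S (W \<union> Y) m' i})
        \<le> (\<Sum>T\<in>\<T> Y. real (card {i\<in>I. T \<subseteq> S i}))" by (simp flip: of_nat_sum)
    also have "\<dots> \<le> (\<Sum>T\<in>\<T> Y. real (card I) * (1 / \<kappa>) ^ card T)"
      using \<open>finite X\<close> finite_subset by (intro sum_mono count) (auto simp: \<T>_def)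
    finally show ?thesis .
  qed
  let ?w = "weight X (\<lambda>_. q)"
  have pr: "is_prob (\<lambda>_. q)" using q by (auto simp: is_prob_def)
  have "expect X (\<lambda>_. q) (\<lambda>Y. real (card {i\<in>I. small_fragment I S W m i \<and> \<not> small_fragment I S (W \<union> Y) m' i}))
     \<le> expect X (\<lambda>_. q) (\<lambda>Y. \<Sum>T\<in>\<T> Y. real (card I) * (1 / \<kappa>) ^ card T)"
    using pr by (intro expect_mono bound_Y) auto
  also have "\<dots> = (\<Sum>Y\<in>Pow X. \<Sum>T\<in>\<T> Y. real (card I) * (?w Y * (1 / \<kappa>) ^ card T))"
    unfolding expect_def sum_distrib_left by (simp add: mult_ac)
  \<comment> \<open>trade the weight of \<open>Y\<close> for that of \<open>Y \<union> T\<close>\<close>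
  also have "\<dots> \<le> (\<Sum>Y\<in>Pow X. \<Sum>T\<in>\<T> Y. real (card I) * (?w (Y \<union> T) * (1 / 64) ^ card T))"
  proof (intro sum_mono mult_left_mono)
    fix Y T assume Y: "Y \<in> Pow X" and T: "T \<in> \<T> Y"
    have "?w Y * (1 / \<kappa>) ^ card T = ?w Y * q ^ card T * (1 / (q * \<kappa>)) ^ card T"
      using q by (simp add: power_mult_distrib power_divide field_simps)
    also have "\<dots> \<le> ?w (Y \<union> T) * (1 / 64) ^ card T"
      using Y T q \<open>finite X\<close> L \<open>\<kappa> > 0\<close> weight_nonneg[OF pr]
      by (intro mult_mono weight_const_extend power_mono) (auto simp: \<T>_def field_simps)
    finally show "?w Y * (1 / \<kappa>) ^ card T \<le> ?w (Y \<union> T) * (1 / 64) ^ card T" .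
  qed auto
  also have "\<dots> = (\<Sum>(Y, T)\<in>Sigma (Pow X) \<T>. real (card I) * (?w (Y \<union> T) * (1 / 64) ^ card T))"
    using \<open>finite X\<close> fin\<T> by (subst sum.Sigma) auto
  also have "\<dots> = (\<Sum>(Z, T)\<in>(\<lambda>(Y, T). (Y \<union> T, T)) ` Sigma (Pow X) \<T>. real (card I) * (?w Z * (1 / 64) ^ card T))"
    by (subst sum.reindex) (auto simp: inj_on_def \<T>_def case_prod_beta)
  also have "\<dots> \<le> (\<Sum>(Z, T)\<in>Sigma (Pow X) (\<lambda>Z. {T. T \<subseteq> c Z \<and> m' < card T}). real (card I) * (?w Z * (1 / 64) ^ card T))"
    using \<open>finite X\<close> c_card(2) weight_nonneg[OF pr]
    by (intro sum_mono2 finite_SigmaI) (auto simp: \<T>_def intro: finite_subset[of _ "Pow (c _)"] intro!: mult_nonneg_nonneg)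
  also have "\<dots> = (\<Sum>Z\<in>Pow X. \<Sum>T\<in>{T. T \<subseteq> c Z \<and> m' < card T}. real (card I) * (?w Z * (1 / 64) ^ card T))"
    using \<open>finite X\<close> c_card(2) by (subst sum.Sigma) (auto intro: finite_subset[of _ "Pow (c _)"])
  also have "\<dots> \<le> (\<Sum>Z\<in>Pow X. \<Sum>T\<in>{T. T \<subseteq> c Z \<and> m' < card T}. real (card I) * (?w Z * (1 / 64) ^ Suc m'))"
    using weight_nonneg[OF pr] by (intro sum_mono mult_left_mono power_decreasing) auto
  also have "\<dots> \<le> (\<Sum>Z\<in>Pow X. 2 ^ m * (real (card I) * (?w Z * (1 / 64) ^ Suc m')))"
  proof (intro sum_mono)
    fix Z
    have "card {T. T \<subseteq> c Z \<and> m' < card T} \<le> card (Pow (c Z))"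
      using c_card(2) by (intro card_mono) auto
    also have "\<dots> \<le> 2 ^ m" using c_card by (simp add: card_Pow)
    finally have "real (card {T. T \<subseteq> c Z \<and> m' < card T}) \<le> 2 ^ m"
      by (metis of_nat_le_iff of_nat_numeral of_nat_power)
    then show "(\<Sum>T\<in>{T. T \<subseteq> c Z \<and> m' < card T}. real (card I) * (?w Z * (1 / 64) ^ Suc m'))
       \<le> 2 ^ m * (real (card I) * (?w Z * (1 / 64) ^ Suc m'))"
      using weight_nonneg[OF pr] by (simp only: sum_constant) (intro mult_right_mono mult_nonneg_nonneg, auto)
  qed
  also have "\<dots> = expect X (\<lambda>_. q) (\<lambda>Z. 2 ^ m * (real (card I) * (1 / 64) ^ Suc m'))"
    by (simp add: expect_def mult_ac)
  also have "\<dots> = real (card I) * 2 ^ m * (1 / 64) ^ Suc m'"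
    using \<open>finite X\<close> by (simp add: expect_const)
  finally show ?thesis .
qed

lemma sixteen_power_bound: "(2::real) ^ (k + 2) * (1/16) ^ (2 ^ k) \<le> 1 / 4"
proof -
  have "k + 4 \<le> 4 * 2 ^ k" by (induction k) auto
  then have "(2::real) ^ (k + 4) \<le> 2 ^ (4 * 2 ^ k)" by (intro power_increasing) auto
  also have "\<dots> = 16 ^ (2 ^ k)" by (simp add: power_mult)
  finally show ?thesis by (simp add: power_add field_simps)
qed

text \<open>
  Level \<open>k\<close> means that all but a \<open>2\<^bsup>-k-1\<^esup>\<close> part of the indices have fragments of size below \<open>2\<^sup>k\<close>.  A
  round lowers the level by one except with probability \<open>1/4\<close>, and never raises it.  The potential
  \<open>4\<^sup>k / 2\<^sup>R\<close> is the failure bound with \<open>R\<close> rounds to go: it quarters with the level, doubles with a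
  used round, and \<open>1/4 + 1/4 = 1/2\<close>.  At level \<open>0\<close> some member is contained.
\<close>

lemma spread_rounds:
  fixes S :: "'i \<Rightarrow> 'a set"
  assumes "finite X" and SX: "\<And>i. i \<in> I \<Longrightarrow> S i \<subseteq> X" and spread: "spread_family I S \<kappa>"
    and q: "0 < q" "q \<le> 1" and "\<kappa> > 0" and L: "64 \<le> q * \<kappa>"
    and state: "(1 - 1 / 2 ^ Suc k) * real (card I) \<le> real (card {i\<in>I. small_fragment I S W (2 ^ k - 1) i})"
  shows "Pr X (\<lambda>_. 1 - (1 - q) ^ R) (\<lambda>H. \<not> (\<exists>i\<in>I. S i \<subseteq> W \<union> H)) \<le> 4 ^ k / 2 ^ R"
  using state
proof (induction R arbitrary: k W)
  have finI: "finite I" "I \<noteq> {}" using spread by (auto simp: spread_family_def)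
  have cI: "0 < real (card I)" using finI by (simp add: card_gt_0_iff)
  have finS: "finite (S i)" if "i \<in> I" for i using SX[OF that] \<open>finite X\<close> finite_subset by auto
  have done0: "\<exists>i\<in>I. S i \<subseteq> W"
    if "(1 - 1 / 2 ^ Suc 0) * real (card I) \<le> real (card {i\<in>I. small_fragment I S W (2 ^ 0 - 1) i})" for W
  proof -
    have "0 < real (card {i\<in>I. small_fragment I S W (2 ^ 0 - 1) i})" using that cI by simp
    then have "{i\<in>I. small_fragment I S W (2 ^ 0 - 1) i} \<noteq> {}" by (metis card.empty of_nat_0 less_irrefl)
    then show ?thesis using finS by (auto simp: small_fragment_def)
  qed
  {
    case 0
    show ?case
    proof (cases k)
      case 0
      then obtain i where "i \<in> I" "S i \<subseteq> W" using "0.prems" done0[of W] by auto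
      then have "Pr X (\<lambda>_. 1 - (1 - q) ^ 0) (\<lambda>H. \<not> (\<exists>i\<in>I. S i \<subseteq> W \<union> H)) = 0"
        using \<open>finite X\<close> unfolding Pr_def by (subst expect_cong[where g = "\<lambda>_. 0"]) (auto simp: expect_const)
      then show ?thesis by simp
    next
      case (Suc k')
      have "Pr X (\<lambda>_. 1 - (1 - q) ^ 0) (\<lambda>H. \<not> (\<exists>i\<in>I. S i \<subseteq> W \<union> H)) \<le> 1"
        using \<open>finite X\<close> by (intro Pr_le_1) (auto simp: is_prob_def)
      also have "1 \<le> (4::real) ^ k / 2 ^ 0" by simp
      finally show ?thesis .
    qed
  next
    case (Suc R)
    show ?case
    proof (cases k)
      case 0
      then obtain i where "i \<in> I" "S i \<subseteq> W" using Suc.prems done0[of W] by auto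
      then have "Pr X (\<lambda>_. 1 - (1 - q) ^ Suc R) (\<lambda>H. \<not> (\<exists>i\<in>I. S i \<subseteq> W \<union> H)) = 0"
        using \<open>finite X\<close> unfolding Pr_def by (subst expect_cong[where g = "\<lambda>_. 0"]) (auto simp: expect_const)
      then show ?thesis by simp
    next
      case (Suc k')
      define st where "st k W \<longleftrightarrow> (1 - 1 / 2 ^ Suc k) * real (card I)
          \<le> real (card {i\<in>I. small_fragment I S W (2 ^ k - 1) i})" for k W
      let ?F = "\<lambda>W. Pr X (\<lambda>_. 1 - (1 - q) ^ R) (\<lambda>H. \<not> (\<exists>i\<in>I. S i \<subseteq> W \<union> H))"
      have pr: "is_prob (\<lambda>_. q)" using q by (auto simp: is_prob_def)
      have stW: "st k W" using Suc.prems unfolding st_def .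
      have mono: "st k (W \<union> Y)" for Y
      proof -
        have "card {i\<in>I. small_fragment I S W (2 ^ k - 1) i} \<le> card {i\<in>I. small_fragment I S (W \<union> Y) (2 ^ k - 1) i}"
          using finI finS by (intro card_mono) (auto intro: small_fragment_mono)
        then show ?thesis using stW unfolding st_def by linarith
      qed
      \<comment> \<open>if the level does not drop, a \<open>2\<^bsup>-k-1\<^esup>\<close> part of the indices lost their small fragments\<close>
      have fail: "Pr X (\<lambda>_. q) (\<lambda>Y. \<not> st k' (W \<union> Y)) \<le> 1 / 4"
      proof -
        let ?lost = "\<lambda>Y. real (card {i\<in>I. small_fragment I S W (2 ^ k - 1) i \<and> \<not> small_fragment I S (W \<union> Y) (2 ^ k' - 1) i})"
        have lost: "real (card I) / 2 ^ Suc k \<le> ?lost Y" if "\<not> st k' (W \<union> Y)" for Y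
        proof -
          have "card {i\<in>I. small_fragment I S W (2 ^ k - 1) i} \<le>
             card ({i\<in>I. small_fragment I S (W \<union> Y) (2 ^ k' - 1) i} \<union>
              {i\<in>I. small_fragment I S W (2 ^ k - 1) i \<and> \<not> small_fragment I S (W \<union> Y) (2 ^ k' - 1) i})"
            using finI by (intro card_mono) auto
          also have "\<dots> \<le> card {i\<in>I. small_fragment I S (W \<union> Y) (2 ^ k' - 1) i} +
              card {i\<in>I. small_fragment I S W (2 ^ k - 1) i \<and> \<not> small_fragment I S (W \<union> Y) (2 ^ k' - 1) i}"
            by (rule card_Un_le)
          finally have "(1 - 1 / 2 ^ Suc k) * real (card I) \<le> (1 - 1 / 2 ^ Suc k') * real (card I) + ?lost Y"
            using that stW unfolding st_def by linarith
          moreover have "(1 - 1 / 2 ^ Suc k) * real (card I) - (1 - 1 / 2 ^ Suc k') * real (card I) = real (card I) / 2 ^ Suc k"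
            using Suc by (simp add: field_simps)
          ultimately show ?thesis by linarith
        qed
        have "Pr X (\<lambda>_. q) (\<lambda>Y. \<not> st k' (W \<union> Y)) \<le> Pr X (\<lambda>_. q) (\<lambda>Y. real (card I) / 2 ^ Suc k \<le> ?lost Y)"
          using pr lost by (intro Pr_mono) auto
        also have "\<dots> \<le> expect X (\<lambda>_. q) ?lost / (real (card I) / 2 ^ Suc k)"
          using pr cI by (intro Pr_markov) auto
        also have "\<dots> \<le> (real (card I) * 2 ^ (2 ^ k - 1) * (1 / 64) ^ Suc (2 ^ k' - 1)) / (real (card I) / 2 ^ Suc k)"
          using cI by (intro divide_right_mono expected_large_fragments[OF \<open>finite X\<close> SX spread q \<open>\<kappa> > 0\<close> L]) auto
        also have "\<dots> = 2 ^ Suc k * 2 ^ (2 ^ k - 1) * (1 / 64) ^ (2 ^ k')"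
          using cI by (simp add: field_simps)
        also have "\<dots> \<le> 2 ^ Suc k * 2 ^ (2 ^ k) * (1 / 64) ^ (2 ^ k')"
          by (intro mult_right_mono mult_left_mono power_increasing) auto
        also have "\<dots> = 2 ^ (k' + 2) * (1 / 16) ^ (2 ^ k')"
        proof -
          have "(2::real) ^ (2 ^ k) = 4 ^ (2 ^ k')" using Suc by (simp add: power_mult)
          moreover have "(4::real) ^ (2 ^ k') * (1 / 64) ^ (2 ^ k') = (1 / 16) ^ (2 ^ k')"
            by (simp flip: power_mult_distrib)
          ultimately show ?thesis using Suc by (simp add: mult_ac)
        qed
        also have "\<dots> \<le> 1 / 4" by (rule sixteen_power_bound)
        finally show ?thesis .
      qed
      have "Pr X (\<lambda>_. 1 - (1 - q) ^ Suc R) (\<lambda>H. \<not> (\<exists>i\<in>I. S i \<subseteq> W \<union> H))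
         = expect X (\<lambda>_. q) (\<lambda>Y. ?F (W \<union> Y))"
        unfolding Pr_def using expect_two_rounds[OF \<open>finite X\<close>, of q "1 - (1 - q) ^ R"
            "\<lambda>H. of_bool (\<not> (\<exists>i\<in>I. S i \<subseteq> W \<union> H))"] by (simp add: Un_assoc)
      also have "\<dots> \<le> expect X (\<lambda>_. q) (\<lambda>Y. 4 ^ k' / 2 ^ R + 4 ^ k / 2 ^ R * of_bool (\<not> st k' (W \<union> Y)))"
      proof (rule expect_mono[OF pr])
        fix Y
        show "?F (W \<union> Y) \<le> 4 ^ k' / 2 ^ R + 4 ^ k / 2 ^ R * of_bool (\<not> st k' (W \<union> Y))"
        proof (cases "st k' (W \<union> Y)")
          case True
          then show ?thesis using Suc.IH[of k' "W \<union> Y"] unfolding st_def by simp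
        next
          case False
          have "?F (W \<union> Y) \<le> 4 ^ k / 2 ^ R" using mono[of Y] Suc.IH[of k "W \<union> Y"] unfolding st_def by blast
          also have "\<dots> \<le> 4 ^ k' / 2 ^ R + 4 ^ k / 2 ^ R * of_bool (\<not> st k' (W \<union> Y))" using False by simp
          finally show ?thesis .
        qed
      qed
      also have "\<dots> = 4 ^ k' / 2 ^ R + 4 ^ k / 2 ^ R * Pr X (\<lambda>_. q) (\<lambda>Y. \<not> st k' (W \<union> Y))"
        using \<open>finite X\<close> by (simp only: expect_add expect_cmult expect_const Pr_def)
      also have "\<dots> \<le> 4 ^ k' / 2 ^ R + 4 ^ k / 2 ^ R * (1 / 4)"
        using fail by (intro add_left_mono mult_left_mono) auto
      also have "\<dots> = 4 ^ k / 2 ^ Suc R" using Suc by simp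
      finally show ?thesis .
    qed
  }
qed

text \<open>
  With nothing exposed, every index is its own fragment, and so the family starts at level \<open>k\<close>.
\<close>

theorem spread_family_contained:
  fixes S :: "'i \<Rightarrow> 'a set"
  assumes "finite X" "\<And>i. i \<in> I \<Longrightarrow> S i \<subseteq> X" "spread_family I S \<kappa>"
    and "0 < q" "q \<le> 1" "\<kappa> > 0" "64 \<le> q * \<kappa>"
    and "\<And>i. i \<in> I \<Longrightarrow> card (S i) < 2 ^ k"
  shows "Pr X (\<lambda>_. 1 - (1 - q) ^ R) (\<lambda>H. \<not> (\<exists>i\<in>I. S i \<subseteq> H)) \<le> 4 ^ k / 2 ^ R"
proof -
  have "small_fragment I S {} (2 ^ k - 1) i" if "i \<in> I" for i
    using assms(8)[OF that] that unfolding small_fragment_def by (intro bexI[of _ i]) auto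
  then have "{i\<in>I. small_fragment I S {} (2 ^ k - 1) i} = I" by auto
  then have "(1 - 1 / 2 ^ Suc k) * real (card I) \<le> real (card {i\<in>I. small_fragment I S {} (2 ^ k - 1) i})"
    using mult_right_mono[of "1 - 1 / 2 ^ Suc k" 1 "real (card I)"] by simp
  from spread_rounds[OF assms(1-7) this, of R] show ?thesis by simp
qed

section \<open>Stochastic domination under negative information\<close>

text \<open>
  The negative information: no set of \<open>N\<close> is completely present.
\<close>

definition avoids :: "'g set set \<Rightarrow> 'g set \<Rightarrow> bool" where
  "avoids N A \<longleftrightarrow> (\<forall>F\<in>N. \<not> F \<subseteq> A)"

lemma avoids_subset: "avoids N B \<Longrightarrow> A \<subseteq> B \<Longrightarrow> avoids N A"
  by (auto simp: avoids_def)

text \<open>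
  Only sets \<open>F\<close> that meet \<open>E - R\<close> become easier to complete when \<open>E\<close> is added.  Given that the others
  are avoided, a decreasing event, the Harris inequality (in the form of \<open>Pr_filter\<close>) bounds the
  probability that such an \<open>F\<close> is completed by the product over its missing elements; these products sum to at
  most \<open>1/2\<close>.
\<close>

lemma avoids_given_superset:
  assumes "finite G" and pr: "is_prob pr" and "finite N" and NG: "\<And>F. F \<in> N \<Longrightarrow> F \<subseteq> G"
    and Q: "(\<Sum>F | F \<in> N \<and> F \<inter> (E - R) \<noteq> {}. \<Prod>x\<in>F - (R \<union> E). pr x) \<le> 1 / 2"
  shows "Pr G pr (\<lambda>\<omega>. avoids N (\<omega> \<union> R)) \<le> 2 * Pr G pr (\<lambda>\<omega>. avoids N (\<omega> \<union> (R \<union> E)))"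
proof -
  define N1 where "N1 = {F\<in>N. F \<inter> (E - R) \<noteq> {}}"
  define N0 where "N0 = N - N1"
  define h where "h = Pr G pr (\<lambda>\<omega>. avoids N0 (\<omega> \<union> R))"
  have finN1: "finite N1" using \<open>finite N\<close> by (simp add: N1_def)
  have N0: "avoids N0 (\<omega> \<union> (R \<union> E)) = avoids N0 (\<omega> \<union> R)" for \<omega>
    unfolding avoids_def N0_def N1_def by blast
  have split: "avoids N A \<longleftrightarrow> avoids N0 A \<and> avoids N1 A" for A
    unfolding avoids_def N0_def N1_def by blast
  have one: "Pr G pr (\<lambda>\<omega>. avoids N0 (\<omega> \<union> R) \<and> F \<subseteq> \<omega> \<union> (R \<union> E)) \<le> (\<Prod>x\<in>F - (R \<union> E). pr x) * h" if "F \<in> N1" for F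
  proof -
    have FG: "F - (R \<union> E) \<subseteq> G" using that NG by (auto simp: N1_def)
    have "Pr G pr (\<lambda>\<omega>. avoids N0 (\<omega> \<union> R) \<and> F \<subseteq> \<omega> \<union> (R \<union> E))
        = Pr G pr (\<lambda>\<omega>. F - (R \<union> E) \<subseteq> \<omega> \<and> avoids N0 (\<omega> \<union> R))"
      by (intro Pr_cong) auto
    also have "\<dots> = (\<Prod>x\<in>F - (R \<union> E). pr x) * Pr G pr (\<lambda>\<omega>. avoids N0 (\<omega> \<union> (F - (R \<union> E)) \<union> R))"
      using Pr_filter[OF \<open>finite G\<close> FG] by simp
    also have "\<dots> \<le> (\<Prod>x\<in>F - (R \<union> E). pr x) * h"
      unfolding h_def using pr
      by (intro mult_left_mono Pr_mono prod_nonneg) (auto simp: is_probD intro: avoids_subset)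
    finally show ?thesis .
  qed
  have "h = Pr G pr (\<lambda>\<omega>. avoids N0 (\<omega> \<union> R))" by (simp add: h_def)
  also have "\<dots> \<le> Pr G pr (\<lambda>\<omega>. avoids N (\<omega> \<union> (R \<union> E)) \<or> (\<exists>F\<in>N1. avoids N0 (\<omega> \<union> R) \<and> F \<subseteq> \<omega> \<union> (R \<union> E)))"
    using pr
  proof (intro Pr_mono)
    fix A assume "avoids N0 (A \<union> R)"
    then have "avoids N0 (A \<union> (R \<union> E))" by (simp only: N0)
    then show "avoids N (A \<union> (R \<union> E)) \<or> (\<exists>F\<in>N1. avoids N0 (A \<union> R) \<and> F \<subseteq> A \<union> (R \<union> E))"
      using \<open>avoids N0 (A \<union> R)\<close> unfolding split by (auto simp: avoids_def)
  qed
  also have "\<dots> \<le> Pr G pr (\<lambda>\<omega>. avoids N (\<omega> \<union> (R \<union> E))) + (\<Sum>F\<in>N1. (\<Prod>x\<in>F - (R \<union> E). pr x) * h)"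
    using pr finN1
    by (intro order_trans[OF Pr_disj_le] add_left_mono order_trans[OF Pr_Bex_le] sum_mono one) auto
  also have "(\<Sum>F\<in>N1. (\<Prod>x\<in>F - (R \<union> E). pr x) * h) \<le> 1 / 2 * h"
    unfolding sum_distrib_right[symmetric] using Q pr
    by (intro mult_right_mono) (auto simp: N1_def h_def intro: Pr_nonneg)
  finally have "h \<le> 2 * Pr G pr (\<lambda>\<omega>. avoids N (\<omega> \<union> (R \<union> E)))" by simp
  moreover have "Pr G pr (\<lambda>\<omega>. avoids N (\<omega> \<union> R)) \<le> h"
    unfolding h_def using pr by (intro Pr_mono) (auto simp: split)
  ultimately show ?thesis by simp
qed

lemma Pr_split_superset:
  assumes "finite G" "is_prob pr" "E \<subseteq> G"
  shows "Pr G pr (\<lambda>\<omega>. P (\<omega> \<union> R))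
     = (\<Prod>x\<in>E - R. pr x) * Pr G pr (\<lambda>\<omega>. P (\<omega> \<union> (R \<union> E))) + Pr G pr (\<lambda>\<omega>. P (\<omega> \<union> R) \<and> \<not> E \<subseteq> \<omega> \<union> R)"
proof -
  have "Pr G pr (\<lambda>\<omega>. P (\<omega> \<union> R)) = Pr G pr (\<lambda>\<omega>. E - R \<subseteq> \<omega> \<and> P (\<omega> \<union> R)) + Pr G pr (\<lambda>\<omega>. P (\<omega> \<union> R) \<and> \<not> E \<subseteq> \<omega> \<union> R)"
    unfolding Pr_def expect_add[symmetric] by (intro expect_cong) auto
  also have "Pr G pr (\<lambda>\<omega>. E - R \<subseteq> \<omega> \<and> P (\<omega> \<union> R)) = (\<Prod>x\<in>E - R. pr x) * Pr G pr (\<lambda>\<omega>. P (\<omega> \<union> (E - R) \<union> R))"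
    using assms by (intro Pr_filter) auto
  also have "Pr G pr (\<lambda>\<omega>. P (\<omega> \<union> (E - R) \<union> R)) = Pr G pr (\<lambda>\<omega>. P (\<omega> \<union> (R \<union> E)))"
    by (intro Pr_cong arg_cong[where f = P]) auto
  finally show ?thesis .
qed

text \<open>
  Expose the events \<open>E i \<subseteq> \<omega>\<close> one index at a time; \<open>W\<close> holds the indices answered yes, \<open>Neg\<close> those
  answered no, which become negative information.  The assumption \<open>key\<close> says that the next answer is
  yes with conditional probability at least \<open>\<pi>\<close>, so that \<open>\<pi>\<close>-random indices are dominated.  It is
  required only while the positive answers extend to some \<open>H\<close> with the target property \<open>\<G>\<close>; this is what
  provides degree bounds in the application.
\<close>

theorem sequential_domination:
  fixes E :: "'i \<Rightarrow> 'g set"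
  assumes "finite G" and pr: "is_prob pr" and "finite I" and EG: "\<And>i. i \<in> I \<Longrightarrow> E i \<subseteq> G"
    and \<pi>: "0 \<le> \<pi>" "\<pi> \<le> 1"
    and good: "\<And>H A. H \<subseteq> I \<Longrightarrow> \<G> H \<Longrightarrow> R0 \<union> \<Union> (E ` H) \<subseteq> A \<Longrightarrow> good A"
    and key: "\<And>W Neg i. W \<subseteq> I \<Longrightarrow> Neg \<subseteq> I \<Longrightarrow> W \<inter> Neg = {} \<Longrightarrow> i \<in> I \<Longrightarrow> i \<notin> W \<Longrightarrow> i \<notin> Neg \<Longrightarrow>
        (\<exists>H\<subseteq>I. \<G> H \<and> insert i W \<subseteq> H) \<Longrightarrow>
        \<pi> * Pr G pr (\<lambda>\<omega>. avoids (N0 \<union> E ` Neg) (\<omega> \<union> (R0 \<union> \<Union> (E ` W))))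
        \<le> (\<Prod>x\<in>E i - (R0 \<union> \<Union> (E ` W)). pr x) *
           Pr G pr (\<lambda>\<omega>. avoids (N0 \<union> E ` Neg) (\<omega> \<union> (R0 \<union> \<Union> (E ` insert i W))))"
  shows "Pr I (\<lambda>_. \<pi>) \<G> * Pr G pr (\<lambda>\<omega>. avoids N0 (\<omega> \<union> R0))
     \<le> Pr G pr (\<lambda>\<omega>. avoids N0 (\<omega> \<union> R0) \<and> good (\<omega> \<union> R0))"
proof -
  define f where "f R N = Pr G pr (\<lambda>\<omega>. avoids N (\<omega> \<union> R))" for R N
  define g where "g R N = Pr G pr (\<lambda>\<omega>. avoids N (\<omega> \<union> R) \<and> good (\<omega> \<union> R))" for R N
  have prI: "is_prob (\<lambda>_. \<pi>)" using \<pi> by (auto simp: is_prob_def)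
  have f0: "0 \<le> f R N" and g0: "0 \<le> g R N" for R N using pr by (auto simp: f_def g_def Pr_nonneg)
  have main: "Pr T (\<lambda>_. \<pi>) (\<lambda>H. \<G> (W \<union> H)) * f (R0 \<union> \<Union> (E ` W)) (N0 \<union> E ` Neg)
      \<le> g (R0 \<union> \<Union> (E ` W)) (N0 \<union> E ` Neg)"
    if "finite T" "T \<subseteq> I" "W \<subseteq> I" "Neg \<subseteq> I" "W \<inter> Neg = {}" "T \<inter> W = {}" "T \<inter> Neg = {}" for T W Neg
    using that
  proof (induction T arbitrary: W Neg rule: finite_induct)
    case empty
    have "Pr {} (\<lambda>_. \<pi>) (\<lambda>H. \<G> (W \<union> H)) = of_bool (\<G> W)" by (simp add: Pr_def)
    moreover have "g (R0 \<union> \<Union> (E ` W)) N = f (R0 \<union> \<Union> (E ` W)) N" if "\<G> W" for N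
      unfolding f_def g_def using good[OF \<open>W \<subseteq> I\<close> that] by (intro Pr_cong) blast
    ultimately show ?case using g0 by auto
  next
    case (insert i T)
    define R where "R = R0 \<union> \<Union> (E ` W)"
    define N where "N = N0 \<union> E ` Neg"
    define Vp where "Vp = Pr T (\<lambda>_. \<pi>) (\<lambda>H. \<G> (insert i W \<union> H))"
    define Vm where "Vm = Pr T (\<lambda>_. \<pi>) (\<lambda>H. \<G> (W \<union> H))"
    define \<rho> where "\<rho> = (\<Prod>x\<in>E i - R. pr x)"
    have V: "Pr (insert i T) (\<lambda>_. \<pi>) (\<lambda>H. \<G> (W \<union> H)) = \<pi> * Vp + (1 - \<pi>) * Vm"
      using insert by (simp add: Pr_def expect_insert Vp_def Vm_def)
    have iI: "i \<in> I" "i \<notin> W" "i \<notin> Neg" "E i \<subseteq> G" using insert EG by auto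
    have R': "R0 \<union> \<Union> (E ` insert i W) = R \<union> E i" by (auto simp: R_def)
    have N': "N0 \<union> E ` insert i Neg = insert (E i) N" by (auto simp: N_def)
    have IHm: "Vm * f R N \<le> g R N"
      unfolding Vm_def R_def N_def using insert by (intro insert.IH) auto
    show ?case
    \<comment> \<open>if a yes does not help, simply do not ask; otherwise some extension has the target property\<close>
    proof (cases "Vp \<le> Vm")
      case True
      then have "\<pi> * Vp + (1 - \<pi>) * Vm \<le> \<pi> * Vm + (1 - \<pi>) * Vm" using \<pi> by (intro add_mono mult_left_mono) auto
      also have "\<dots> = Vm" by (simp add: algebra_simps)
      finally show ?thesis
        unfolding V R_def[symmetric] N_def[symmetric] using IHm mult_right_mono[OF _ f0] order_trans by blast
    next
      case False
      have "\<exists>H\<subseteq>I. \<G> H \<and> insert i W \<subseteq> H"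
      proof (rule ccontr)
        assume "\<not> ?thesis"
        then have "\<not> \<G> (insert i W \<union> H)" if "H \<subseteq> T" for H
          using that insert by (metis Un_upper1 insert_subset le_sup_iff order_trans)
        then have "Vp = Pr T (\<lambda>_. \<pi>) (\<lambda>_. False)" unfolding Vp_def by (intro Pr_cong) auto
        also have "\<dots> = 0" using insert by (simp add: Pr_def expect_const)
        finally show False using False Pr_nonneg[OF prI, of T "\<lambda>H. \<G> (W \<union> H)"] unfolding Vm_def by simp
      qed
      then have key': "\<pi> * f R N \<le> \<rho> * f (R \<union> E i) N"
        using key[of W Neg i] insert iI unfolding f_def R_def N_def \<rho>_def R'[unfolded R_def] by auto
      have IHp: "Vp * f (R \<union> E i) N \<le> g (R \<union> E i) N"
      proof -
        have "T \<subseteq> I" "insert i W \<subseteq> I" "Neg \<subseteq> I" "insert i W \<inter> Neg = {}" "T \<inter> insert i W = {}" "T \<inter> Neg = {}"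
          using insert by auto
        from insert.IH[OF this] show ?thesis unfolding R' N_def[symmetric] Vp_def .
      qed
      have IHn: "Vm * f R (insert (E i) N) \<le> g R (insert (E i) N)"
      proof -
        have "T \<subseteq> I" "W \<subseteq> I" "insert i Neg \<subseteq> I" "W \<inter> insert i Neg = {}" "T \<inter> W = {}" "T \<inter> insert i Neg = {}"
          using insert by auto
        from insert.IH[OF this] show ?thesis unfolding N' R_def[symmetric] Vm_def .
      qed
      have ins: "avoids (insert (E i) N) A \<longleftrightarrow> avoids N A \<and> \<not> E i \<subseteq> A" for A by (auto simp: avoids_def)
      have fs: "f R N = \<rho> * f (R \<union> E i) N + f R (insert (E i) N)"
        unfolding f_def \<rho>_def ins
        using Pr_split_superset[OF \<open>finite G\<close> pr iI(4), of "avoids N" R] by simp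
      have gs: "g R N = \<rho> * g (R \<union> E i) N + g R (insert (E i) N)"
        unfolding g_def \<rho>_def ins
        using Pr_split_superset[OF \<open>finite G\<close> pr iI(4), of "\<lambda>A. avoids N A \<and> good A" R] by (simp add: conj_ac)
      have \<rho>0: "0 \<le> \<rho>" unfolding \<rho>_def using pr by (intro prod_nonneg) (auto simp: is_probD)
      have "(\<pi> * Vp + (1 - \<pi>) * Vm) * f R N = Vm * f R N + (Vp - Vm) * (\<pi> * f R N)"
        by (simp add: algebra_simps)
      also have "\<dots> \<le> Vm * f R N + (Vp - Vm) * (\<rho> * f (R \<union> E i) N)"
        using False key' by (intro add_left_mono mult_left_mono) auto
      also have "\<dots> = \<rho> * (Vp * f (R \<union> E i) N) + Vm * f R (insert (E i) N)"
        unfolding fs by (simp add: algebra_simps)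
      also have "\<dots> \<le> g R N"
        unfolding gs using \<rho>0 IHp IHn by (intro add_mono mult_left_mono) auto
      finally show ?thesis unfolding V R_def[symmetric] N_def[symmetric] .
    qed
  qed
  from main[of I "{}" "{}"] show ?thesis using \<open>finite I\<close> by (simp add: f_def g_def)
qed

section \<open>Weighted sums over vertex sets\<close>

text \<open>
  So \<open>p ^ uncovered \<Gamma> S\<close> is the probability that \<open>S\<close> becomes a clique once the edges \<open>\<Gamma>\<close> are given.
\<close>

definition uncovered :: "'a set set \<Rightarrow> 'a set \<Rightarrow> nat" where
  "uncovered \<Gamma> S = card (nsets S 2 - \<Gamma>)"

lemma nsets_2_disjoint_union:
  assumes "finite A" "finite B" "A \<inter> B = {}"
  shows "nsets (A \<union> B) 2 = nsets A 2 \<union> nsets B 2 \<union> (\<lambda>(a, b). {a, b}) ` (A \<times> B)"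
proof
  show "nsets (A \<union> B) 2 \<subseteq> nsets A 2 \<union> nsets B 2 \<union> (\<lambda>(a, b). {a, b}) ` (A \<times> B)"
  proof
    fix e assume "e \<in> nsets (A \<union> B) 2"
    then obtain x y where "e = {x, y}" "x \<in> A \<union> B" "y \<in> A \<union> B" "x \<noteq> y" by (auto elim!: nsets2_E)
    then show "e \<in> nsets A 2 \<union> nsets B 2 \<union> (\<lambda>(a, b). {a, b}) ` (A \<times> B)"
      by (auto simp: image_iff doubleton_eq_iff)
  qed
  show "nsets A 2 \<union> nsets B 2 \<union> (\<lambda>(a, b). {a, b}) ` (A \<times> B) \<subseteq> nsets (A \<union> B) 2"
    using assms nsets_mono[of A "A \<union> B" 2] nsets_mono[of B "A \<union> B" 2] by auto
qed

lemma uncovered_split: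
  assumes fin: "finite A" "finite B" and disj: "A \<inter> B = {}"
    and none: "\<And>a b. a \<in> A \<Longrightarrow> b \<in> B \<Longrightarrow> {a, b} \<notin> \<Gamma>"
  shows "uncovered \<Gamma> (A \<union> B) = uncovered \<Gamma> A + uncovered \<Gamma> B + card A * card B"
proof -
  let ?X = "(\<lambda>(a, b). {a, b}) ` (A \<times> B)"
  have inj: "inj_on (\<lambda>(a, b). {a, b}) (A \<times> B)"
    using disj by (auto simp: inj_on_def doubleton_eq_iff)
  have cX: "card ?X = card A * card B" using inj by (simp add: card_image card_cartesian_product)
  have "nsets (A \<union> B) 2 - \<Gamma> = (nsets A 2 - \<Gamma>) \<union> (nsets B 2 - \<Gamma>) \<union> ?X"
    unfolding nsets_2_disjoint_union[OF fin disj] using none by auto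
  moreover have "(nsets A 2 - \<Gamma>) \<inter> (nsets B 2 - \<Gamma>) = {}" using disj by (auto simp: nsets_2_eq)
  moreover have "((nsets A 2 - \<Gamma>) \<union> (nsets B 2 - \<Gamma>)) \<inter> ?X = {}" using disj by (auto simp: nsets_2_eq doubleton_eq_iff)
  ultimately show ?thesis unfolding uncovered_def using fin
    by (simp add: card_Un_disjoint finite_imp_finite_nsets cX)
qed

text \<open>
  Grow \<open>B\<close> along \<open>\<Gamma>\<close>.  Either the rest of \<open>S\<close> has no \<open>\<Gamma>\<close>-edge to \<open>B\<close>, and then all \<open>b (k - b)\<close> cross
  pairs are uncovered, which is the hypothesis \<open>parts\<close>; or \<open>S\<close> contains one of the at most \<open>D\<close> neighbours of
  \<open>B\<close>, which is added to \<open>B\<close>.  The process stops with \<open>S = B\<close>, and there \<open>full\<close> is used.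
\<close>

lemma sum_ksets_containing:
  fixes p D \<xi> :: real
  assumes "finite V" and deg: "\<And>v. v \<in> V \<Longrightarrow> card {u\<in>V. {u, v} \<in> \<Gamma>} \<le> \<Delta>"
    and p: "0 < p" "p \<le> 1" and D: "1 \<le> D" "real (k * \<Delta>) \<le> D" and "0 \<le> \<xi>"
    and B: "B \<subseteq> V" "B \<noteq> {}" "card B \<le> k"
    and parts: "\<And>b. card B \<le> b \<Longrightarrow> b < k \<Longrightarrow> p ^ (b * (k - b)) * (\<Sum>S\<in>nsets V (k - b). p ^ uncovered \<Gamma> S) \<le> \<xi>"
    and full: "\<And>S. S \<in> \<F> \<Longrightarrow> p ^ uncovered \<Gamma> S \<le> \<xi>"
  shows "(\<Sum>S | S \<in> nsets V k \<and> S \<in> \<F> \<and> B \<subseteq> S. p ^ uncovered \<Gamma> S) \<le> real (k - card B + 1) * D ^ (k - card B) * \<xi>"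
  using B parts
proof (induction "k - card B" arbitrary: B)
  case 0
  then have k: "card B = k" by simp
  have finB: "finite B" using finite_subset[OF 0(2) \<open>finite V\<close>] .
  have "{S. S \<in> nsets V k \<and> S \<in> \<F> \<and> B \<subseteq> S} \<subseteq> {B} \<inter> \<F>"
  proof
    fix S assume "S \<in> {S. S \<in> nsets V k \<and> S \<in> \<F> \<and> B \<subseteq> S}"
    then have "finite S" "B \<subseteq> S" "card S = card B" "S \<in> \<F>" using k by (auto simp: nsets_def)
    then have "B = S" by (metis card_subset_eq)
    then show "S \<in> {B} \<inter> \<F>" using \<open>S \<in> \<F>\<close> by simp
  qed
  then have "(\<Sum>S | S \<in> nsets V k \<and> S \<in> \<F> \<and> B \<subseteq> S. p ^ uncovered \<Gamma> S) \<le> (\<Sum>S\<in>{B} \<inter> \<F>. p ^ uncovered \<Gamma> S)"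
    using p by (intro sum_mono2) auto
  also have "\<dots> \<le> (\<Sum>S\<in>{B} \<inter> \<F>. \<xi>)" by (intro sum_mono full) auto
  also have "\<dots> \<le> \<xi>" using \<open>0 \<le> \<xi>\<close> by (cases "B \<in> \<F>") auto
  finally show ?case using k by simp
next
  case (Suc d)
  have finB: "finite B" using finite_subset[OF Suc.prems(1) \<open>finite V\<close>] .
  have bk: "card B < k" using Suc by simp
  have kd: "k - card B = Suc d" using Suc by simp
  define \<A> where "\<A> = {S. S \<in> nsets V k \<and> S \<in> \<F> \<and> B \<subseteq> S}"
  have fin\<A>: "finite \<A>" unfolding \<A>_def using finite_imp_finite_nsets[OF \<open>finite V\<close>, of k] by auto
  define Nb where "Nb = {v\<in>V - B. \<exists>u\<in>B. {v, u} \<in> \<Gamma>}"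
  have finNb: "finite Nb" using \<open>finite V\<close> by (simp add: Nb_def)
  define \<A>0 where "\<A>0 = {S\<in>\<A>. S \<inter> Nb = {}}"
  define \<A>1 where "\<A>1 v = {S\<in>\<A>. v \<in> S}" for v
  \<comment> \<open>\<open>\<A>0\<close>: no edge of \<open>\<Gamma>\<close> leaves \<open>B\<close> inside \<open>S\<close>; \<open>\<A>1 v\<close>: the neighbour \<open>v\<close> of \<open>B\<close> belongs to \<open>S\<close>\<close>
  have cover: "\<A> \<subseteq> \<A>0 \<union> (\<Union>v\<in>Nb. \<A>1 v)" by (auto simp: \<A>0_def \<A>1_def)
  have "(\<Sum>S\<in>\<A>. p ^ uncovered \<Gamma> S) \<le> (\<Sum>S\<in>\<A>0 \<union> (\<Union>v\<in>Nb. \<A>1 v). p ^ uncovered \<Gamma> S)"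
    using p fin\<A> finNb cover by (intro sum_mono2) (auto simp: \<A>0_def \<A>1_def)
  also have "\<dots> \<le> (\<Sum>S\<in>\<A>0. p ^ uncovered \<Gamma> S) + (\<Sum>S\<in>(\<Union>v\<in>Nb. \<A>1 v). p ^ uncovered \<Gamma> S)"
    using p fin\<A> finNb by (subst sum_Un) (auto simp: \<A>0_def \<A>1_def intro!: sum_nonneg)
  also have "(\<Sum>S\<in>(\<Union>v\<in>Nb. \<A>1 v). p ^ uncovered \<Gamma> S) \<le> (\<Sum>v\<in>Nb. \<Sum>S\<in>\<A>1 v. p ^ uncovered \<Gamma> S)"
  proof -
    have "sum (\<lambda>S. p ^ uncovered \<Gamma> S) (\<Union>v\<in>Nb. \<A>1 v) \<le> sum (\<lambda>(v, S). p ^ uncovered \<Gamma> S) (Sigma Nb \<A>1)"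
      using finNb fin\<A> p by (intro sum_le_included[where i = snd]) (auto simp: \<A>1_def)
    also have "\<dots> = (\<Sum>v\<in>Nb. \<Sum>S\<in>\<A>1 v. p ^ uncovered \<Gamma> S)"
      using finNb fin\<A> by (subst sum.Sigma) (auto simp: \<A>1_def)
    finally show ?thesis .
  qed
  also have "(\<Sum>S\<in>\<A>0. p ^ uncovered \<Gamma> S) \<le> \<xi>"
  proof -
    have inj: "inj_on (\<lambda>S. S - B) \<A>0" by (auto simp: inj_on_def \<A>0_def \<A>_def)
    have "(\<Sum>S\<in>\<A>0. p ^ uncovered \<Gamma> S) \<le> (\<Sum>S\<in>\<A>0. p ^ (card B * (k - card B)) * p ^ uncovered \<Gamma> (S - B))"
    proof (intro sum_mono)
      fix S assume S: "S \<in> \<A>0"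
      then have S': "S \<subseteq> V" "finite S" "card S = k" "B \<subseteq> S" "S \<inter> Nb = {}"
        by (auto simp: \<A>0_def \<A>_def nsets_def)
      have eq: "uncovered \<Gamma> (B \<union> (S - B)) = uncovered \<Gamma> B + uncovered \<Gamma> (S - B) + card B * card (S - B)"
      proof (intro uncovered_split)
        fix a b assume "a \<in> B" "b \<in> S - B"
        then have "b \<notin> Nb" "b \<in> V - B" using S' by auto
        then have "{b, a} \<notin> \<Gamma>" using \<open>a \<in> B\<close> by (auto simp: Nb_def)
        then show "{a, b} \<notin> \<Gamma>" by (simp add: insert_commute)
      qed (use finB S' in auto)
      have "card (S - B) = k - card B" using S' finB by (simp add: card_Diff_subset)
      moreover have "B \<union> (S - B) = S" using S' by auto
      ultimately have "uncovered \<Gamma> S = uncovered \<Gamma> B + uncovered \<Gamma> (S - B) + card B * (k - card B)" using eq by simp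
      then have "p ^ uncovered \<Gamma> S = p ^ uncovered \<Gamma> B * (p ^ (card B * (k - card B)) * p ^ uncovered \<Gamma> (S - B))"
        by (simp add: power_add mult_ac)
      also have "\<dots> \<le> 1 * (p ^ (card B * (k - card B)) * p ^ uncovered \<Gamma> (S - B))"
        using p by (intro mult_right_mono power_le_one) auto
      finally show "p ^ uncovered \<Gamma> S \<le> p ^ (card B * (k - card B)) * p ^ uncovered \<Gamma> (S - B)" by simp
    qed
    also have "\<dots> = p ^ (card B * (k - card B)) * (\<Sum>S\<in>(\<lambda>S. S - B) ` \<A>0. p ^ uncovered \<Gamma> S)"
      using inj by (simp add: sum.reindex sum_distrib_left)
    also have "\<dots> \<le> p ^ (card B * (k - card B)) * (\<Sum>S\<in>nsets V (k - card B). p ^ uncovered \<Gamma> S)"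
      using p finB finite_imp_finite_nsets[OF \<open>finite V\<close>]
      by (intro mult_left_mono sum_mono2) (auto simp: \<A>0_def \<A>_def nsets_def card_Diff_subset)
    also have "\<dots> \<le> \<xi>" using Suc.prems(4)[of "card B"] bk by simp
    finally show ?thesis .
  qed
  also have "(\<Sum>v\<in>Nb. \<Sum>S\<in>\<A>1 v. p ^ uncovered \<Gamma> S) \<le> (\<Sum>v\<in>Nb. real (d + 1) * D ^ d * \<xi>)"
  proof (intro sum_mono)
    fix v assume v: "v \<in> Nb"
    have c: "card (insert v B) = Suc (card B)" using v finB by (simp add: Nb_def)
    have eq: "\<A>1 v = {S. S \<in> nsets V k \<and> S \<in> \<F> \<and> insert v B \<subseteq> S}" by (auto simp: \<A>1_def \<A>_def)
    have "(\<Sum>S | S \<in> nsets V k \<and> S \<in> \<F> \<and> insert v B \<subseteq> S. p ^ uncovered \<Gamma> S)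
        \<le> real (k - card (insert v B) + 1) * D ^ (k - card (insert v B)) * \<xi>"
      using v c kd bk Suc.prems by (intro Suc.hyps(1)) (auto simp: Nb_def)
    moreover have "k - card (insert v B) = d" using c kd by simp
    ultimately show "(\<Sum>S\<in>\<A>1 v. p ^ uncovered \<Gamma> S) \<le> real (d + 1) * D ^ d * \<xi>" unfolding eq by simp
  qed
  also have "\<dots> \<le> D * (real (d + 1) * D ^ d * \<xi>)"
  proof -
    have "Nb \<subseteq> (\<Union>u\<in>B. {v\<in>V. {v, u} \<in> \<Gamma>})" by (auto simp: Nb_def)
    then have "card Nb \<le> card (\<Union>u\<in>B. {v\<in>V. {v, u} \<in> \<Gamma>})"
      using finB \<open>finite V\<close> by (intro card_mono) auto
    also have "\<dots> \<le> (\<Sum>u\<in>B. card {v\<in>V. {v, u} \<in> \<Gamma>})" using finB by (rule card_UN_le)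
    also have "\<dots> \<le> (\<Sum>u\<in>B. \<Delta>)" using Suc.prems by (intro sum_mono deg) auto
    also have "\<dots> \<le> k * \<Delta>" using bk by simp
    finally have "real (card Nb) \<le> D" using D by (meson of_nat_mono order_trans)
    then show ?thesis using D \<open>0 \<le> \<xi>\<close> by (simp only: sum_constant) (intro mult_right_mono, auto)
  qed
  finally have "(\<Sum>S\<in>\<A>. p ^ uncovered \<Gamma> S) \<le> \<xi> + D * (real (d + 1) * D ^ d * \<xi>)" by simp
  also have "\<dots> \<le> D ^ Suc d * \<xi> + real (d + 1) * D ^ Suc d * \<xi>"
    using D \<open>0 \<le> \<xi>\<close> one_le_power[of D "Suc d"] mult_right_mono[of 1 "D ^ Suc d" \<xi>] by (simp add: mult_ac)
  also have "\<dots> = real (k - card B + 1) * D ^ (k - card B) * \<xi>"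
    unfolding kd by (simp add: algebra_simps)
  finally show ?case unfolding \<A>_def .
qed

lemma choose_two_add: "(a + b) choose 2 = (a choose 2) + (b choose 2) + a * (b::nat)"
  by (induction a) (auto simp: numeral_2_eq_2)

text \<open>
  Up to powers of the maximum degree, the edges of \<open>\<Gamma>\<close> do not increase the expected number of
  \<open>m\<close>-cliques: by \<open>dense\<close> the expected number of \<open>b\<close>-cliques at a vertex is at least one, so it is no
  advantage for \<open>S\<close> to contain a connected piece of \<open>\<Gamma>\<close> on \<open>b\<close> vertices.
\<close>

lemma sum_ksets_bound:
  fixes p D n :: real
  assumes "finite V" "real (card V) \<le> n" and deg: "\<And>v. v \<in> V \<Longrightarrow> card {u\<in>V. {u, v} \<in> \<Gamma>} \<le> \<Delta>"
    and p: "0 < p" "p \<le> 1" and D: "1 \<le> D" "real (M * \<Delta>) \<le> D" and "0 \<le> n"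
    and dense: "\<And>b. 1 \<le> b \<Longrightarrow> b \<le> M \<Longrightarrow> 1 \<le> n ^ (b - 1) * p ^ (b choose 2)"
    and "m \<le> M"
  shows "(\<Sum>S\<in>nsets V m. p ^ uncovered \<Gamma> S) \<le> fact m * D ^ (m\<^sup>2) * (n ^ m * p ^ (m choose 2))"
  using \<open>m \<le> M\<close>
proof (induction m rule: less_induct)
  case (less m)
  show ?case
  proof (cases "m = 0")
    case True
    then show ?thesis by (simp add: uncovered_def nsets_empty_iff numeral_2_eq_2)
  next
    case False
    define \<xi> where "\<xi> = fact (m - 1) * D ^ ((m - 1)\<^sup>2) * (n ^ (m - 1) * p ^ (m choose 2))"
    have full: "1 \<le> \<xi>"
    proof -
      have "1 * 1 * 1 \<le> \<xi>" unfolding \<xi>_def using dense[of m] False less.prems D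
        by (intro mult_mono) (auto simp: fact_ge_1)
      then show ?thesis by simp
    qed
    have parts: "p ^ (b * (m - b)) * (\<Sum>S\<in>nsets V (m - b). p ^ uncovered \<Gamma> S) \<le> \<xi>" if b: "1 \<le> b" "b < m" for b
    proof -
      have "p ^ (b * (m - b)) * (\<Sum>S\<in>nsets V (m - b). p ^ uncovered \<Gamma> S)
        \<le> p ^ (b * (m - b)) * (fact (m - b) * D ^ ((m - b)\<^sup>2) * (n ^ (m - b) * p ^ ((m - b) choose 2)))"
        using p b less.prems by (intro mult_left_mono less.IH) auto
      also have "\<dots> \<le> p ^ (b * (m - b)) * (fact (m - 1) * D ^ ((m - 1)\<^sup>2) * (n ^ (m - b) * p ^ ((m - b) choose 2)))"
        using p b D \<open>0 \<le> n\<close>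
        by (intro mult_left_mono mult_right_mono mult_mono fact_mono power_increasing power_mono) auto
      also have "\<dots> = fact (m - 1) * D ^ ((m - 1)\<^sup>2) * (n ^ (m - b) * p ^ (((m - b) choose 2) + b * (m - b)) * 1)"
        by (simp add: power_add mult_ac)
      also have "\<dots> \<le> fact (m - 1) * D ^ ((m - 1)\<^sup>2) * (n ^ (m - b) * p ^ (((m - b) choose 2) + b * (m - b)) * (n ^ (b - 1) * p ^ (b choose 2)))"
        using dense[of b] b less.prems p D \<open>0 \<le> n\<close> by (intro mult_left_mono) auto
      also have "\<dots> = fact (m - 1) * D ^ ((m - 1)\<^sup>2) * (n ^ ((m - b) + (b - 1)) * p ^ ((b choose 2) + ((m - b) choose 2) + b * (m - b)))"
        by (simp add: power_add mult_ac)
      also have "(b choose 2) + ((m - b) choose 2) + b * (m - b) = m choose 2"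
        using choose_two_add[of b "m - b"] b by simp
      also have "(m - b) + (b - 1) = m - 1" using b by simp
      finally show ?thesis unfolding \<xi>_def .
    qed
    have one: "(\<Sum>S | S \<in> nsets V m \<and> S \<in> UNIV \<and> {v} \<subseteq> S. p ^ uncovered \<Gamma> S) \<le> real m * D ^ (m - 1) * \<xi>" if "v \<in> V" for v
    proof -
      have "real (m * \<Delta>) \<le> D" using D(2) less.prems
        by (meson mult_le_mono1 of_nat_mono order_trans)
      then have "(\<Sum>S | S \<in> nsets V m \<and> S \<in> UNIV \<and> {v} \<subseteq> S. p ^ uncovered \<Gamma> S)
         \<le> real (m - card {v} + 1) * D ^ (m - card {v}) * \<xi>"
        using that False full p D
        by (intro sum_ksets_containing[OF \<open>finite V\<close> deg] parts)
           (auto intro: order_trans[OF power_le_one])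
      then show ?thesis using False by simp
    qed
    have "(\<Sum>S\<in>nsets V m. p ^ uncovered \<Gamma> S) \<le> sum (\<lambda>(v, S). p ^ uncovered \<Gamma> S) (Sigma V (\<lambda>v. {S. S \<in> nsets V m \<and> S \<in> UNIV \<and> {v} \<subseteq> S}))"
    proof (intro sum_le_included[where i = snd])
      show "\<forall>S\<in>nsets V m. \<exists>y\<in>Sigma V (\<lambda>v. {S. S \<in> nsets V m \<and> S \<in> UNIV \<and> {v} \<subseteq> S}). snd y = S \<and> p ^ uncovered \<Gamma> S \<le> (case y of (v, S) \<Rightarrow> p ^ uncovered \<Gamma> S)"
      proof
        fix S assume S: "S \<in> nsets V m"
        then have "S \<noteq> {}" using False by (auto simp: nsets_def)
        then obtain v where "v \<in> S" by auto
        then show "\<exists>y\<in>Sigma V (\<lambda>v. {S. S \<in> nsets V m \<and> S \<in> UNIV \<and> {v} \<subseteq> S}). snd y = S \<and> p ^ uncovered \<Gamma> S \<le> (case y of (v, S) \<Rightarrow> p ^ uncovered \<Gamma> S)"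
          using S by (intro bexI[of _ "(v, S)"]) (auto simp: nsets_def)
      qed
    qed (use \<open>finite V\<close> finite_imp_finite_nsets[OF \<open>finite V\<close>] p in auto)
    also have "\<dots> = (\<Sum>v\<in>V. \<Sum>S | S \<in> nsets V m \<and> S \<in> UNIV \<and> {v} \<subseteq> S. p ^ uncovered \<Gamma> S)"
      using \<open>finite V\<close> finite_imp_finite_nsets[OF \<open>finite V\<close>] by (subst sum.Sigma) auto
    also have "\<dots> \<le> (\<Sum>v\<in>V. real m * D ^ (m - 1) * \<xi>)" by (intro sum_mono one)
    also have "\<dots> \<le> n * (real m * D ^ (m - 1) * \<xi>)"
      using assms(2) D full by (simp only: sum_constant) (intro mult_right_mono, auto)
    also have "\<dots> = (real m * fact (m - 1)) * D ^ ((m - 1) + (m - 1)\<^sup>2) * (n ^ Suc (m - 1) * p ^ (m choose 2))"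
      unfolding \<xi>_def by (simp add: power_add mult_ac)
    also have "\<dots> = fact m * D ^ ((m - 1) + (m - 1)\<^sup>2) * (n ^ m * p ^ (m choose 2))"
      using False by (simp add: fact_reduce[of m])
    also have "\<dots> \<le> fact m * D ^ (m\<^sup>2) * (n ^ m * p ^ (m choose 2))"
    proof -
      have "(m - 1) + (m - 1)\<^sup>2 \<le> m\<^sup>2" using False by (cases m) (auto simp: power2_eq_square)
      then show ?thesis using D p \<open>0 \<le> n\<close> by (intro mult_right_mono mult_left_mono power_increasing) auto
    qed
    finally show ?thesis .
  qed
qed

section \<open>Clique covers and clique packings\<close>

definition cliques :: "nat \<Rightarrow> 'a set \<Rightarrow> 'a set set \<Rightarrow> 'a set set" where
  "cliques k V A = {S \<in> nsets V k. nsets S 2 \<subseteq> A}"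

definition packing_number :: "'a set set \<Rightarrow> nat" where
  "packing_number K = Max (card ` {P. P \<subseteq> K \<and> disjoint P})"

lemma clique_iff: "clique S A \<longleftrightarrow> nsets S 2 \<subseteq> A"
  unfolding clique_def nsets_2_eq by auto

lemma clique_count_eq: "clique_count k V A = card (cliques k V A)"
  by (simp add: clique_count_def cliques_def clique_iff)

lemma finite_cliques: "finite V \<Longrightarrow> finite (cliques k V A)"
  unfolding cliques_def using finite_imp_finite_nsets[of V k] by auto

lemma packing_number_ge:
  assumes "finite K" "P \<subseteq> K" "disjoint P"
  shows "card P \<le> packing_number K"
  unfolding packing_number_def using assms by (intro Max_ge) auto

lemma packing_number_attained:
  assumes "finite K"
  obtains P where "P \<subseteq> K" "disjoint P" "card P = packing_number K"
proof -
  have "packing_number K \<in> card ` {P. P \<subseteq> K \<and> disjoint P}"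
    unfolding packing_number_def using assms by (intro Max_in) auto
  then show ?thesis using that by auto
qed

text \<open>
  Used to charge the vertices of a colour class beyond the first \<open>k - 1\<close> to its \<open>k\<close>-subsets.
\<close>

lemma choose_ge_diff: "1 \<le> k \<Longrightarrow> m + 1 - k \<le> m choose k"
proof (induction m)
  case (Suc m)
  show ?case
  proof (cases "Suc m < k")
    case False
    obtain k' where k: "k = Suc k'" using Suc.prems by (cases k) auto
    have "1 \<le> m choose k'" using False k by (simp add: Suc_le_eq zero_less_binomial)
    then show ?thesis using Suc k by simp
  qed simp
qed simp

lemma chromatic_number_attained:
  assumes "finite V" "E \<subseteq> nsets V 2"
  obtains c where "proper_coloring V E (chromatic_number V E) c"
proof -
  obtain h where h: "bij_betw h V {0..<card V}" using assms ex_bij_betw_finite_nat by blast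
  have "proper_coloring V E (card V) h"
    unfolding proper_coloring_def
  proof (intro conjI ballI impI)
    show "h ` V \<subseteq> {..<card V}" using h by (auto simp: bij_betw_def)
    fix u v assume uv: "u \<in> V" "v \<in> V" "{u, v} \<in> E"
    then have "u \<noteq> v" using assms by (auto simp: nsets_def)
    then show "h u \<noteq> h v" using uv h by (auto simp: bij_betw_def inj_on_def)
  qed
  then have "\<exists>k c. proper_coloring V E k c" by blast
  from LeastI_ex[OF this] show ?thesis using that unfolding chromatic_number_def by blast
qed

text \<open>
  A colour class is a clique of \<open>A\<close>.  One with at least \<open>r + 1\<close> vertices contributes a member to a
  packing, and its vertices beyond \<open>r + 1\<close> are paid for by its subsets of size \<open>r + 2\<close>.
\<close>

lemma card_le_packing_plus_cliques:
  assumes "finite V" "1 \<le> r"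
  shows "card V \<le> r * chromatic_number V (graph_complement V A)
      + packing_number (cliques (r + 1) V A) + card (cliques (r + 2) V A)"
proof -
  define E where "E = graph_complement V A"
  define k where "k = chromatic_number V E"
  have "E \<subseteq> nsets V 2" by (auto simp: E_def graph_complement_def)
  then obtain c where c: "proper_coloring V E k c"
    using chromatic_number_attained[OF \<open>finite V\<close>] unfolding k_def by blast
  define C where "C j = {v\<in>V. c v = j}" for j
  have finC: "finite (C j)" for j using \<open>finite V\<close> by (simp add: C_def)
  have CV: "V = (\<Union>j<k. C j)" using c by (auto simp: C_def proper_coloring_def)
  have disjC: "C i \<inter> C j = {}" if "i \<noteq> j" for i j using that by (auto simp: C_def)
  have clq: "nsets (C j) 2 \<subseteq> A" for j
  proof
    fix e assume "e \<in> nsets (C j) 2"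
    then obtain x y where xy: "e = {x, y}" "x \<in> C j" "y \<in> C j" "x \<noteq> y" by (auto elim!: nsets2_E)
    then have "x \<in> V" "y \<in> V" "c x = c y" by (auto simp: C_def)
    then have "e \<notin> E" using c xy(1) unfolding proper_coloring_def by blast
    moreover have "e \<in> nsets V 2" using xy by (auto simp: C_def)
    ultimately show "e \<in> A" by (auto simp: E_def graph_complement_def)
  qed
  define Big where "Big = {j\<in>{..<k}. r + 1 \<le> card (C j)}"
  define Tw where "Tw j = (SOME T. T \<subseteq> C j \<and> card T = r + 1 \<and> finite T)" for j
  have Tw: "Tw j \<subseteq> C j" "card (Tw j) = r + 1" "finite (Tw j)" if "j \<in> Big" for j
  proof -
    have "\<exists>T. T \<subseteq> C j \<and> card T = r + 1 \<and> finite T"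
      using that obtain_subset_with_card_n[of "r + 1" "C j"] by (auto simp: Big_def)
    from someI_ex[OF this] show "Tw j \<subseteq> C j" "card (Tw j) = r + 1" "finite (Tw j)" by (auto simp: Tw_def)
  qed
  have sub: "S \<in> cliques m V A" if "S \<in> nsets (C j) m" for S m j
    using that clq[of j] nsets_mono[of S "C j" 2] by (auto simp: cliques_def nsets_def C_def)
  have inj: "inj_on Tw Big"
  proof
    fix i j assume ij: "i \<in> Big" "j \<in> Big" "Tw i = Tw j"
    show "i = j"
    proof (rule ccontr)
      assume "i \<noteq> j"
      then have "Tw i \<subseteq> {}" using Tw(1)[OF ij(1)] Tw(1)[OF ij(2)] ij(3) disjC[of i j] by auto
      then show False using Tw(2)[OF ij(1)] by auto
    qed
  qed
  have "card Big = card (Tw ` Big)" using inj by (simp add: card_image)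
  also have "\<dots> \<le> packing_number (cliques (r + 1) V A)"
  proof (rule packing_number_ge)
    show "finite (cliques (r + 1) V A)" by (rule finite_cliques) fact
    show "Tw ` Big \<subseteq> cliques (r + 1) V A"
    proof safe
      fix j assume "j \<in> Big"
      from Tw[OF this] show "Tw j \<in> cliques (r + 1) V A" by (intro sub[of _ j]) (auto simp: nsets_def)
    qed
    show "disjoint (Tw ` Big)"
    proof (rule disjointI)
      fix a b assume "a \<in> Tw ` Big" "b \<in> Tw ` Big" "a \<noteq> b"
      then obtain i j where "i \<in> Big" "j \<in> Big" "a = Tw i" "b = Tw j" "i \<noteq> j" by auto
      then show "a \<inter> b = {}" using Tw(1)[of i] Tw(1)[of j] disjC[of i j] by auto
    qed
  qed
  finally have Big: "card Big \<le> packing_number (cliques (r + 1) V A)" .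
  have one: "card (C j) \<le> r + of_bool (j \<in> Big) + card (nsets (C j) (r + 2))" if "j < k" for j
    using choose_ge_diff[of "r + 2" "card (C j)"] that by (auto simp: Big_def card_nsets)
  have "card V = (\<Sum>j<k. card (C j))"
    using disjC finC by (subst CV, subst card_UN_disjoint) auto
  also have "\<dots> \<le> (\<Sum>j<k. r + of_bool (j \<in> Big) + card (nsets (C j) (r + 2)))"
    by (intro sum_mono one) auto
  also have "\<dots> = r * k + card Big + (\<Sum>j<k. card (nsets (C j) (r + 2)))"
  proof -
    have "(\<Sum>j<k. of_bool (j \<in> Big)) = (\<Sum>j\<in>Big. 1::nat)"
      by (rule sum.mono_neutral_cong_right) (auto simp: Big_def)
    then show ?thesis by (simp add: sum.distrib)
  qed
  also have "(\<Sum>j<k. card (nsets (C j) (r + 2))) = card (\<Union>j<k. nsets (C j) (r + 2))"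
  proof (rule card_UN_disjoint[symmetric])
    show "\<forall>i\<in>{..<k}. \<forall>j\<in>{..<k}. i \<noteq> j \<longrightarrow> nsets (C i) (r + 2) \<inter> nsets (C j) (r + 2) = {}"
    proof (intro ballI impI)
      fix i j :: nat assume "i \<noteq> j"
      show "nsets (C i) (r + 2) \<inter> nsets (C j) (r + 2) = {}"
      proof (rule ccontr)
        assume "\<not> ?thesis"
        then obtain S where "S \<subseteq> C i" "S \<subseteq> C j" "card S = r + 2" by (auto simp: nsets_def)
        then show False using disjC[OF \<open>i \<noteq> j\<close>] by (metis Int_greatest add_eq_0_iff_both_eq_0 card.empty subset_empty zero_neq_numeral)
      qed
    qed
  qed (use finC in \<open>auto intro: finite_imp_finite_nsets\<close>)
  also have "\<dots> \<le> card (cliques (r + 2) V A)"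
    using sub by (intro card_mono finite_cliques \<open>finite V\<close>) auto
  finally show ?thesis using Big unfolding k_def E_def by linarith
qed

lemma chromatic_number_le_clique_partition:
  assumes "finite V" "finite \<Q>" "\<Union>\<Q> = V" "disjoint \<Q>" and clq: "\<And>S. S \<in> \<Q> \<Longrightarrow> nsets S 2 \<subseteq> A"
  shows "chromatic_number V (graph_complement V A) \<le> card \<Q>"
proof -
  obtain h where h: "bij_betw h \<Q> {0..<card \<Q>}" using assms ex_bij_betw_finite_nat by blast
  define cl where "cl v = (SOME S. S \<in> \<Q> \<and> v \<in> S)" for v
  have cl: "cl v \<in> \<Q>" "v \<in> cl v" if "v \<in> V" for v
  proof -
    have "\<exists>S. S \<in> \<Q> \<and> v \<in> S" using that assms(3) by auto
    from someI_ex[OF this] show "cl v \<in> \<Q>" "v \<in> cl v" by (auto simp: cl_def)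
  qed
  have "proper_coloring V (graph_complement V A) (card \<Q>) (h \<circ> cl)"
    unfolding proper_coloring_def
  proof (intro conjI ballI impI)
    show "(h \<circ> cl) ` V \<subseteq> {..<card \<Q>}" using h cl by (fastforce simp: bij_betw_def)
    fix u v assume uv: "u \<in> V" "v \<in> V" "{u, v} \<in> graph_complement V A"
    then have "u \<noteq> v" "{u, v} \<notin> A" by (auto simp: graph_complement_def)
    show "(h \<circ> cl) u \<noteq> (h \<circ> cl) v"
    proof
      assume "(h \<circ> cl) u = (h \<circ> cl) v"
      then have "cl u = cl v" using h cl uv by (auto simp: bij_betw_def inj_on_def)
      then have "u \<in> cl u" "v \<in> cl u" using cl uv by metis+
      then have "{u, v} \<in> nsets (cl u) 2" using \<open>u \<noteq> v\<close> by simp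
      then show False using clq[OF cl(1)[OF uv(1)]] \<open>{u, v} \<notin> A\<close> by blast
    qed
  qed
  then show ?thesis unfolding chromatic_number_def by (intro Least_le) blast
qed

text \<open>
  Use \<open>P\<close>, \<open>\<S>\<close> and singletons as colour classes.
\<close>

lemma chromatic_number_le_packings:
  assumes "finite V" "P \<subseteq> cliques (r + 1) V A" "\<S> \<subseteq> cliques r V A" "disjoint (P \<union> \<S>)" "2 \<le> r"
    and left: "card (V - \<Union>P - \<Union>\<S>) \<le> l"
  shows "r * chromatic_number V (graph_complement V A) + card P \<le> card V + r * l"
proof -
  have fin: "finite P" "finite \<S>" using assms finite_cliques[OF \<open>finite V\<close>] by (auto intro: finite_subset)
  define U where "U = V - \<Union>P - \<Union>\<S>"
  have szP: "card S = r + 1" "S \<subseteq> V" "finite S" "nsets S 2 \<subseteq> A" if "S \<in> P" for S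
    using assms that by (auto simp: cliques_def nsets_def)
  have szS: "card S = r" "S \<subseteq> V" "finite S" "nsets S 2 \<subseteq> A" if "S \<in> \<S>" for S
    using assms that by (auto simp: cliques_def nsets_def)
  have PS: "P \<inter> \<S> = {}"
  proof (rule ccontr)
    assume "\<not> ?thesis"
    then obtain S where "S \<in> P" "S \<in> \<S>" by auto
    then show False using szP(1) szS(1) by fastforce
  qed
  have PSV: "\<Union>P \<subseteq> V" "\<Union>\<S> \<subseteq> V" using szP(2) szS(2) by (auto intro!: Union_least)
  define \<Q> where "\<Q> = P \<union> \<S> \<union> (\<lambda>v. {v}) ` U"
  have finU: "finite U" using \<open>finite V\<close> by (simp add: U_def)
  have finQ: "finite \<Q>" using fin finU by (simp add: \<Q>_def)
  have "chromatic_number V (graph_complement V A) \<le> card \<Q>"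
  proof (rule chromatic_number_le_clique_partition[OF \<open>finite V\<close> finQ])
    have "\<Union>\<Q> = \<Union>P \<union> \<Union>\<S> \<union> U" by (auto simp: \<Q>_def)
    then show "\<Union>\<Q> = V" using PSV by (auto simp: U_def)
    show "disjoint \<Q>"
    proof (rule disjointI)
      fix a b assume "a \<in> \<Q>" "b \<in> \<Q>" "a \<noteq> b"
      then show "a \<inter> b = {}" using disjointD[OF assms(4)] by (auto simp: \<Q>_def U_def)
    qed
    show "nsets S 2 \<subseteq> A" if "S \<in> \<Q>" for S
    proof -
      from that consider "S \<in> P" | "S \<in> \<S>" | v where "S = {v}" by (auto simp: \<Q>_def)
      then show ?thesis using szP(4) szS(4) by cases (simp_all add: nsets_singleton_iff)
    qed
  qed
  also have "card \<Q> \<le> card P + card \<S> + card U"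
  proof -
    have "card \<Q> \<le> card (P \<union> \<S>) + card ((\<lambda>v. {v}) ` U)" unfolding \<Q>_def by (rule card_Un_le)
    also have "\<dots> \<le> card P + card \<S> + card U" using card_Un_le[of P \<S>] card_image_le[OF finU, of "\<lambda>v. {v}"] by linarith
    finally show ?thesis .
  qed
  finally have chi: "chromatic_number V (graph_complement V A) \<le> card P + card \<S> + card U" .
  have "card (\<Union>(P \<union> \<S>)) = (\<Sum>S\<in>P \<union> \<S>. card S)"
    using assms(4) szP szS by (intro card_Union_disjoint) auto
  also have "\<dots> = (\<Sum>S\<in>P. card S) + (\<Sum>S\<in>\<S>. card S)"
    using fin PS by (intro sum.union_disjoint) auto
  also have "\<dots> = (r + 1) * card P + r * card \<S>" using szP szS by simp
  finally have "card (\<Union>(P \<union> \<S>)) = (r + 1) * card P + r * card \<S>" .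
  moreover have "card V = card (\<Union>(P \<union> \<S>)) + card U"
  proof -
    have "V = \<Union>(P \<union> \<S>) \<union> U" using PSV by (auto simp: U_def)
    moreover have "\<Union>(P \<union> \<S>) \<inter> U = {}" by (auto simp: U_def)
    moreover have "finite (\<Union>(P \<union> \<S>))" using fin szP szS by auto
    ultimately show ?thesis using finU by (metis card_Un_disjoint)
  qed
  ultimately have cV: "card V = (r + 1) * card P + r * card \<S> + card U" by simp
  have "r * chromatic_number V (graph_complement V A) \<le> r * (card P + card \<S> + card U)"
    using chi by (rule mult_le_mono2)
  also have "\<dots> + card P = (r + 1) * card P + r * card \<S> + r * card U" by (simp add: algebra_simps)
  also have "\<dots> \<le> card V + r * card U" using cV by simp
  also have "\<dots> \<le> card V + r * l" using left by (auto simp: U_def intro: mult_le_mono2)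
  finally show ?thesis by simp
qed

lemma packing_number_mono: "finite K' \<Longrightarrow> K \<subseteq> K' \<Longrightarrow> packing_number K \<le> packing_number K'"
  by (metis packing_number_attained packing_number_ge finite_subset order_trans)

text \<open>
  \<open>N\<close> plays the role of the cliques on one edge; they share a vertex \<open>x\<close>, so removing them lowers the
  packing number by at most one.  With at least two cliques in \<open>N\<close> they intersect each other,
  and the squared change, at most \<open>|N|\<^sup>2\<close>, is at most twice the number of intersecting pairs.  A single
  clique that meets no other clique belongs to a maximum packing, so that both counts drop by one.
\<close>

lemma packing_deficit_change:
  assumes "finite K" and x: "\<And>S. S \<in> N \<Longrightarrow> x \<in> S" and NK: "N \<subseteq> K" and K: "{} \<notin> K"
  defines "f \<equiv> \<lambda>K. real (card K) - real (packing_number K)"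
  shows "(f K - f (K - N))\<^sup>2 \<le> 2 * real (card {(J, J'). J \<in> N \<and> J' \<in> K \<and> J \<noteq> J' \<and> J \<inter> J' \<noteq> {}})"
proof -
  define T where "T = {(J, J'). J \<in> N \<and> J' \<in> K \<and> J \<noteq> J' \<and> J \<inter> J' \<noteq> {}}"
  have finN: "finite N" using assms finite_subset by auto
  have finT: "finite T" by (rule finite_subset[of _ "K \<times> K"]) (use assms in \<open>auto simp: T_def\<close>)
  have cK: "card K = card (K - N) + card N"
    using card_Diff_subset[OF finN NK] card_mono[OF \<open>finite K\<close> NK] by simp
  have up: "packing_number (K - N) \<le> packing_number K" using \<open>finite K\<close> by (intro packing_number_mono) auto
  have lo: "packing_number K \<le> packing_number (K - N) + min 1 (card N)"
  proof -
    obtain P where P: "P \<subseteq> K" "disjoint P" "card P = packing_number K"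
      using packing_number_attained[OF \<open>finite K\<close>] by blast
    have finP: "finite P" using P \<open>finite K\<close> finite_subset by auto
    have "card (P - N) \<le> packing_number (K - N)"
      using P \<open>finite K\<close> by (intro packing_number_ge) (auto intro: disjointI dest: disjointD)
    moreover have "card (P \<inter> N) \<le> 1"
    proof -
      have "J = J'" if "J \<in> P \<inter> N" "J' \<in> P \<inter> N" for J J'
        using that x disjointD[OF P(2)] by blast
      then have "P \<inter> N \<subseteq> {SOME J. J \<in> P \<inter> N}" by (metis someI subsetI singletonI)
      then have "card (P \<inter> N) \<le> card {SOME J. J \<in> P \<inter> N}" by (intro card_mono) auto
      then show ?thesis by simp
    qed
    moreover have "card (P \<inter> N) \<le> card N" using finN by (intro card_mono) auto
    moreover have "card P = card (P - N) + card (P \<inter> N)"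
      using finP by (metis card_Diff_subset_Int finite_Int le_add_diff_inverse2 card_mono inf_le1)
    ultimately show ?thesis using P(3) by linarith
  qed
  have df: "f K - f (K - N) = real (card N) - real (packing_number K - packing_number (K - N))"
    unfolding f_def using cK up by simp
  consider "card N = 0" | "2 \<le> card N" | J where "N = {J}"
    by (metis One_nat_def card_1_singletonE less_2_cases not_le_imp_less)
  then show ?thesis
  proof cases
    case 1
    then show ?thesis using df lo by simp
  next
    case 2
    let ?n = "card N"
    have "{(J, J'). J \<in> N \<and> J' \<in> N \<and> J \<noteq> J'} \<subseteq> T" using x NK unfolding T_def by auto
    moreover have "{(J, J'). J \<in> N \<and> J' \<in> N \<and> J \<noteq> J'} = Sigma N (\<lambda>J. N - {J})" by auto
    ultimately have "card (Sigma N (\<lambda>J. N - {J})) \<le> card T" using finT by (metis card_mono)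
    moreover have "card (Sigma N (\<lambda>J. N - {J})) = ?n * (?n - 1)"
      using finN by (simp add: card_SigmaI)
    ultimately have T: "?n * (?n - 1) \<le> card T" by simp
    have "0 \<le> f K - f (K - N)" "f K - f (K - N) \<le> real ?n" using df lo 2 by auto
    then have "(f K - f (K - N))\<^sup>2 \<le> (real ?n)\<^sup>2" by (intro power_mono) auto
    also have "\<dots> = real (?n * ?n)" by (simp add: power2_eq_square)
    also have "?n * ?n \<le> 2 * (?n * (?n - 1))" using 2 by (cases ?n) auto
    then have "real (?n * ?n) \<le> real (2 * (?n * (?n - 1)))" by (simp only: of_nat_le_iff)
    also have "\<dots> \<le> 2 * real (card T)" using T by (simp only: of_nat_mult of_nat_numeral) (simp flip: of_nat_mult)
    finally show ?thesis unfolding T_def .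
  next
    case (3 J)
    show ?thesis
    proof (cases "\<exists>J'\<in>K. J \<noteq> J' \<and> J \<inter> J' \<noteq> {}")
      case True
      then have "T \<noteq> {}" using 3 by (auto simp: T_def)
      then have "1 \<le> card T" using finT by (simp add: Suc_le_eq card_gt_0_iff)
      moreover have "(f K - f (K - N))\<^sup>2 \<le> 1\<^sup>2" using df lo 3 by (intro power_mono) auto
      ultimately show ?thesis unfolding T_def by simp
    next
      case False
      obtain P where P: "P \<subseteq> K - N" "disjoint P" "card P = packing_number (K - N)"
        using packing_number_attained[of "K - N"] \<open>finite K\<close> by auto
      have finP: "finite P" using P \<open>finite K\<close> by (auto intro: finite_subset)
      have "card (insert J P) \<le> packing_number K"
      proof (rule packing_number_ge[OF \<open>finite K\<close>])
        show "insert J P \<subseteq> K" using P 3 NK by auto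
        show "disjoint (insert J P)"
        proof (rule disjointI)
          fix a b assume "a \<in> insert J P" "b \<in> insert J P" "a \<noteq> b"
          then show "a \<inter> b = {}" using False P(1) disjointD[OF P(2)] by blast
        qed
      qed
      moreover have "J \<notin> P" using P 3 by auto
      ultimately have "packing_number (K - N) + 1 \<le> packing_number K" using finP P(3) by simp
      then show ?thesis using df lo 3 by simp
    qed
  qed
qed

section \<open>Moments and tails of clique counts\<close>

definition edges_of :: "'a set list \<Rightarrow> 'a set set" where
  "edges_of L = (\<Union>J\<in>set L. nsets J 2)"

text \<open>
  Sequences of potential cliques in which each new member satisfies a condition relative to the earlier
  ones.  Their expected number in the random graph controls the tails below.
\<close>

fun clique_seqs :: "'a set \<Rightarrow> nat \<Rightarrow> ('a set list \<Rightarrow> 'a set \<Rightarrow> bool) \<Rightarrow> nat \<Rightarrow> 'a set list set" where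
  "clique_seqs V k ok 0 = {[]}"
| "clique_seqs V k ok (Suc m) = (\<Union>L\<in>clique_seqs V k ok m. (\<lambda>J. J # L) ` {J\<in>nsets V k. ok L J})"

lemma finite_clique_seqs: "finite V \<Longrightarrow> finite (clique_seqs V k ok m)"
  by (induction m) (simp_all add: finite_imp_finite_nsets)

lemma clique_seqs_set: "L \<in> clique_seqs V k ok m \<Longrightarrow> length L = m \<and> set L \<subseteq> nsets V k"
proof (induction m arbitrary: L)
  case (Suc m)
  then obtain J L' where "L = J # L'" "L' \<in> clique_seqs V k ok m" "J \<in> nsets V k" by auto
  with Suc.IH[of L'] show ?case by auto
qed simp

lemma nsets_2_of_kset: "J \<in> nsets V k \<Longrightarrow> nsets J 2 \<subseteq> nsets V 2"
  by (rule nsets_mono) (simp add: nsets_def)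

lemma edges_of_subset: "set L \<subseteq> nsets V k \<Longrightarrow> edges_of L \<subseteq> nsets V 2"
  unfolding edges_of_def nsets_def by auto

lemma expect_card_family:
  assumes "finite E" "finite \<L>" "\<And>l. l \<in> \<L> \<Longrightarrow> F l \<subseteq> E"
  shows "expect E (\<lambda>_. p) (\<lambda>A. real (card {l\<in>\<L>. F l \<subseteq> A})) = (\<Sum>l\<in>\<L>. p ^ card (F l))"
proof -
  have "real (card {l\<in>\<L>. F l \<subseteq> A}) = (\<Sum>l\<in>\<L>. of_bool (F l \<subseteq> A))" for A
    using assms(2) by (simp add: sum.If_cases of_bool_def Int_def)
  then have "expect E (\<lambda>_. p) (\<lambda>A. real (card {l\<in>\<L>. F l \<subseteq> A})) = (\<Sum>l\<in>\<L>. Pr E (\<lambda>_. p) (\<lambda>A. F l \<subseteq> A))"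
    by (simp add: expect_sum Pr_def)
  also have "\<dots> = (\<Sum>l\<in>\<L>. p ^ card (F l))"
    using assms by (intro sum.cong refl Pr_superset_const) auto
  finally show ?thesis .
qed

text \<open>
  The expected number of present sequences, one factor for each step: a new clique costs \<open>p\<close> for each
  pair that the earlier ones do not contain.
\<close>

lemma sum_clique_seqs:
  fixes p s :: real
  assumes "finite V" "0 \<le> p" "0 \<le> s"
    and step: "\<And>m L. m < M \<Longrightarrow> L \<in> clique_seqs V k ok m \<Longrightarrow>
      (\<Sum>J | J \<in> nsets V k \<and> ok L J. p ^ card (nsets J 2 - edges_of L)) \<le> s"
    and "m \<le> M"
  shows "(\<Sum>L\<in>clique_seqs V k ok m. p ^ card (edges_of L)) \<le> s ^ m"
  using \<open>m \<le> M\<close>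
proof (induction m)
  case 0
  then show ?case by (simp add: edges_of_def)
next
  case (Suc m)
  let ?S = "clique_seqs V k ok m"
  have fin: "finite ?S" "finite {J\<in>nsets V k. ok L J}" for L
    using finite_clique_seqs[OF \<open>finite V\<close>] finite_imp_finite_nsets[OF \<open>finite V\<close>] by auto
  have "(\<Sum>L\<in>clique_seqs V k ok (Suc m). p ^ card (edges_of L))
     = (\<Sum>L\<in>?S. \<Sum>L'\<in>(\<lambda>J. J # L) ` {J\<in>nsets V k. ok L J}. p ^ card (edges_of L'))"
    using fin by (simp only: clique_seqs.simps) (rule sum.UNION_disjoint, auto)
  also have "\<dots> = (\<Sum>L\<in>?S. \<Sum>J | J \<in> nsets V k \<and> ok L J. p ^ card (edges_of (J # L)))"
    by (intro sum.cong refl, subst sum.reindex) (auto simp: inj_on_def)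
  also have "\<dots> = (\<Sum>L\<in>?S. p ^ card (edges_of L) * (\<Sum>J | J \<in> nsets V k \<and> ok L J. p ^ card (nsets J 2 - edges_of L)))"
    unfolding sum_distrib_left
  proof (intro sum.cong refl)
    fix L J assume L: "L \<in> ?S" and J: "J \<in> {J. J \<in> nsets V k \<and> ok L J}"
    have "finite (edges_of L)"
      using edges_of_subset clique_seqs_set[OF L] finite_imp_finite_nsets[OF \<open>finite V\<close>] finite_subset by metis
    moreover have "finite (nsets J 2)" using J by (auto simp: nsets_def intro: finite_imp_finite_nsets[unfolded nsets_def])
    moreover have "edges_of (J # L) = edges_of L \<union> (nsets J 2 - edges_of L)" by (auto simp: edges_of_def)
    ultimately have "card (edges_of (J # L)) = card (edges_of L) + card (nsets J 2 - edges_of L)"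
      by (metis Diff_disjoint card_Un_disjoint finite_Diff)
    then show "p ^ card (edges_of (J # L)) = p ^ card (edges_of L) * p ^ card (nsets J 2 - edges_of L)"
      by (simp add: power_add)
  qed
  also have "\<dots> \<le> (\<Sum>L\<in>?S. p ^ card (edges_of L) * s)"
    using step[of m] Suc.prems assms by (intro sum_mono mult_left_mono) auto
  also have "\<dots> \<le> s ^ m * s"
    unfolding sum_distrib_right[symmetric] using Suc assms by (intro mult_right_mono) auto
  finally show ?case by (simp add: mult.commute)
qed

text \<open>
  Up to constants, the expected number of ways in which a given \<open>s\<close>-clique extends to a \<open>k\<close>-clique.
\<close>

definition ext_weight :: "nat \<Rightarrow> nat \<Rightarrow> real \<Rightarrow> nat \<Rightarrow> real" where
  "ext_weight n k p s = real n ^ (k - s) * p ^ ((k choose 2) - (s choose 2))"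

lemma ext_weight_nonneg: "0 \<le> p \<Longrightarrow> 0 \<le> ext_weight n k p s"
  by (simp add: ext_weight_def)

text \<open>
  Choose the part inside \<open>U\<close>, then the part outside; the pairs outside \<open>U\<close> are all new.
\<close>

lemma sum_overlap:
  fixes p :: real
  assumes "finite V" "U \<subseteq> V" "B \<subseteq> U" "0 \<le> p" "p \<le> 1" "F \<subseteq> nsets U 2" "card B \<le> s" "s \<le> k"
  shows "(\<Sum>J | J \<in> nsets V k \<and> B \<subseteq> J \<and> card (J \<inter> U) = s. p ^ card (nsets J 2 - F))
     \<le> real (card U) ^ (s - card B) * ext_weight (card V) k p s"
proof -
  define \<J> where "\<J> = {J. J \<in> nsets V k \<and> B \<subseteq> J \<and> card (J \<inter> U) = s}"
  have finU: "finite U" and finB: "finite B" using assms by (auto intro: finite_subset)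
  have fin\<J>: "finite \<J>" unfolding \<J>_def using finite_imp_finite_nsets[OF \<open>finite V\<close>, of k] by auto
  have tm: "p ^ card (nsets J 2 - F) \<le> p ^ ((k choose 2) - (s choose 2))" if "J \<in> \<J>" for J
  proof (rule power_decreasing)
    have J: "finite J" "card J = k" "card (J \<inter> U) = s" using that by (auto simp: \<J>_def nsets_def)
    have "card (nsets J 2) - card (nsets (J \<inter> U) 2) \<le> card (nsets J 2 - nsets (J \<inter> U) 2)"
      using J by (intro diff_card_le_card_Diff finite_imp_finite_nsets) auto
    also have "\<dots> \<le> card (nsets J 2 - F)"
      using assms(6) J by (intro card_mono finite_Diff finite_imp_finite_nsets) (auto simp: nsets_def)
    finally show "(k choose 2) - (s choose 2) \<le> card (nsets J 2 - F)" using J by (simp add: card_nsets)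
  qed (use assms in auto)
  have "card \<J> \<le> card (nsets (U - B) (s - card B) \<times> nsets (V - U) (k - s))"
  proof (rule card_inj_on_le[where f = "\<lambda>J. (J \<inter> U - B, J - U)"])
    show "inj_on (\<lambda>J. (J \<inter> U - B, J - U)) \<J>"
    proof (rule inj_onI)
      fix J J' assume J: "J \<in> \<J>" "J' \<in> \<J>" "(J \<inter> U - B, J - U) = (J' \<inter> U - B, J' - U)"
      then have "J = (J \<inter> U - B) \<union> B \<union> (J - U)" "J' = (J' \<inter> U - B) \<union> B \<union> (J' - U)"
        using assms(3) by (auto simp: \<J>_def)
      then show "J = J'" using J(3) by auto
    qed
    show "(\<lambda>J. (J \<inter> U - B, J - U)) ` \<J> \<subseteq> nsets (U - B) (s - card B) \<times> nsets (V - U) (k - s)"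
    proof safe
      fix J assume J: "J \<in> \<J>"
      then have J': "finite J" "card J = k" "card (J \<inter> U) = s" "B \<subseteq> J \<inter> U" "J \<subseteq> V"
        using assms(3) by (auto simp: \<J>_def nsets_def)
      show "J \<inter> U - B \<in> nsets (U - B) (s - card B)" using J' finB by (auto simp: nsets_def card_Diff_subset)
      have "card (J - U) = k - s" using J' by (metis card_Diff_subset_Int finite_Int)
      then show "J - U \<in> nsets (V - U) (k - s)" using J' by (auto simp: nsets_def)
    qed
    show "finite (nsets (U - B) (s - card B) \<times> nsets (V - U) (k - s))"
      using finU \<open>finite V\<close> by (auto intro!: finite_imp_finite_nsets)
  qed
  also have "\<dots> = (card (U - B) choose (s - card B)) * (card (V - U) choose (k - s))"
    by (simp add: card_cartesian_product card_nsets)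
  also have "\<dots> \<le> card U ^ (s - card B) * card V ^ (k - s)"
  proof (rule mult_le_mono)
    have pw: "a choose b \<le> c ^ b" if "a \<le> c" for a b c :: nat
    proof -
      have "a choose b \<le> a ^ b" by (cases "b \<le> a") (auto simp: binomial_le_pow binomial_eq_0)
      also have "\<dots> \<le> c ^ b" using that by (rule power_mono) simp
      finally show ?thesis .
    qed
    show "card (U - B) choose (s - card B) \<le> card U ^ (s - card B)" using finU by (intro pw card_mono) auto
    show "card (V - U) choose (k - s) \<le> card V ^ (k - s)" using assms by (intro pw card_mono) auto
  qed
  finally have card\<J>: "real (card \<J>) \<le> real (card U) ^ (s - card B) * real (card V) ^ (k - s)"
    by (metis of_nat_le_iff of_nat_mult of_nat_power)
  have "(\<Sum>J\<in>\<J>. p ^ card (nsets J 2 - F)) \<le> (\<Sum>J\<in>\<J>. p ^ ((k choose 2) - (s choose 2)))"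
    by (intro sum_mono tm)
  also have "\<dots> = real (card \<J>) * p ^ ((k choose 2) - (s choose 2))" by simp
  also have "\<dots> \<le> real (card U) ^ (s - card B) * real (card V) ^ (k - s) * p ^ ((k choose 2) - (s choose 2))"
    using card\<J> assms by (intro mult_right_mono) auto
  finally show ?thesis unfolding \<J>_def ext_weight_def by (simp add: mult_ac)
qed

lemma sum_overlaps:
  fixes p :: real
  assumes "finite V" "U \<subseteq> V" "B \<subseteq> U" "0 \<le> p" "p \<le> 1" "F \<subseteq> nsets U 2" "finite I"
    "\<And>s. s \<in> I \<Longrightarrow> card B \<le> s \<and> s \<le> k" "real (card U) \<le> u"
    and ok: "\<And>J. J \<in> nsets V k \<Longrightarrow> P J \<Longrightarrow> B \<subseteq> J \<and> card (J \<inter> U) \<in> I"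
  shows "(\<Sum>J | J \<in> nsets V k \<and> P J. p ^ card (nsets J 2 - F)) \<le> (\<Sum>s\<in>I. u ^ (s - card B) * ext_weight (card V) k p s)"
proof -
  have finN: "finite (nsets V k)" by (rule finite_imp_finite_nsets) fact
  have "(\<Sum>J | J \<in> nsets V k \<and> P J. p ^ card (nsets J 2 - F))
     \<le> (\<Sum>J\<in>(\<Union>s\<in>I. {J. J \<in> nsets V k \<and> B \<subseteq> J \<and> card (J \<inter> U) = s}). p ^ card (nsets J 2 - F))"
    using finN assms(7) ok \<open>0 \<le> p\<close> by (intro sum_mono2) auto
  also have "\<dots> = (\<Sum>s\<in>I. \<Sum>J | J \<in> nsets V k \<and> B \<subseteq> J \<and> card (J \<inter> U) = s. p ^ card (nsets J 2 - F))"
    using finN assms(7) by (intro sum.UNION_disjoint) auto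
  also have "\<dots> \<le> (\<Sum>s\<in>I. real (card U) ^ (s - card B) * ext_weight (card V) k p s)"
    using assms by (intro sum_mono sum_overlap) auto
  also have "\<dots> \<le> (\<Sum>s\<in>I. u ^ (s - card B) * ext_weight (card V) k p s)"
    using assms by (intro sum_mono mult_right_mono power_mono ext_weight_nonneg) auto
  finally show ?thesis .
qed

lemma expect_clique_count:
  assumes "finite V"
  shows "expect (nsets V 2) (\<lambda>_. p) (\<lambda>A. real (card (cliques k V A))) = real (card V choose k) * p ^ (k choose 2)"
proof -
  have "expect (nsets V 2) (\<lambda>_. p) (\<lambda>A. real (card (cliques k V A))) = (\<Sum>J\<in>nsets V k. p ^ card (nsets J 2))"
    unfolding cliques_def using assms
    by (intro expect_card_family finite_imp_finite_nsets) (auto simp: nsets_def)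
  also have "\<dots> = (\<Sum>J\<in>nsets V k. p ^ (k choose 2))"
    by (intro sum.cong refl) (auto simp: nsets_def card_nsets[unfolded nsets_def])
  finally show ?thesis by (simp add: card_nsets)
qed

text \<open>
  With at least \<open>y\<close> cliques there are at least \<open>(y - m)\<^sup>m\<close> sequences of \<open>m\<close> distinct cliques.
\<close>

lemma clique_count_tail:
  assumes "finite V" "0 \<le> p" "p \<le> 1" "m < y"
  shows "Pr (nsets V 2) (\<lambda>_. p) (\<lambda>A. y \<le> card (cliques k V A))
      \<le> ((\<Sum>s\<le>k. real (m * k) ^ s * ext_weight (card V) k p s) / real (y - m)) ^ m"
proof -
  define ok :: "'a set list \<Rightarrow> 'a set \<Rightarrow> bool" where "ok L J \<longleftrightarrow> J \<notin> set L" for L J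
  define \<sigma> where "\<sigma> = (\<Sum>s\<le>k. real (m * k) ^ s * ext_weight (card V) k p s)"
  have \<sigma>0: "0 \<le> \<sigma>" unfolding \<sigma>_def using assms by (intro sum_nonneg mult_nonneg_nonneg ext_weight_nonneg) auto
  have finE: "finite (nsets V 2)" by (rule finite_imp_finite_nsets) fact
  have finS: "finite (clique_seqs V k ok m)" by (rule finite_clique_seqs) fact
  have pr: "is_prob (\<lambda>_. p)" using assms by (auto simp: is_prob_def)
  let ?N = "\<lambda>A. real (card {L\<in>clique_seqs V k ok m. edges_of L \<subseteq> A})"
  have step: "(\<Sum>J | J \<in> nsets V k \<and> ok L J. p ^ card (nsets J 2 - edges_of L)) \<le> \<sigma>"
    if "j < m" "L \<in> clique_seqs V k ok j" for j L
  proof -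
    have L: "length L = j" "set L \<subseteq> nsets V k" using clique_seqs_set[OF that(2)] by auto
    have "card (\<Union>(set L)) \<le> (\<Sum>J\<in>set L. card J)" using L by (intro card_Union_le_sum_card)
    also have "\<dots> = (\<Sum>J\<in>set L. k)" using L by (intro sum.cong) (auto simp: nsets_def)
    also have "\<dots> \<le> j * k" using L card_length[of L] by simp
    also have "\<dots> \<le> m * k" using that by (intro mult_le_mono1) auto
    finally have U: "real (card (\<Union>(set L))) \<le> real (m * k)" by (simp only: of_nat_le_iff)
    have "(\<Sum>J | J \<in> nsets V k \<and> ok L J. p ^ card (nsets J 2 - edges_of L))
        \<le> (\<Sum>s\<in>{..k}. real (m * k) ^ (s - card ({}::'a set)) * ext_weight (card V) k p s)"
    proof (rule sum_overlaps[OF \<open>finite V\<close> _ _ assms(2,3) _ _ _ U])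
      show "\<Union>(set L) \<subseteq> V" using L by (auto simp: nsets_def)
      show "edges_of L \<subseteq> nsets (\<Union>(set L)) 2" by (auto simp: edges_of_def nsets_def)
      show "{} \<subseteq> J \<and> card (J \<inter> \<Union>(set L)) \<in> {..k}" if "J \<in> nsets V k" for J
        using that by (auto simp: nsets_def intro: card_mono)
    qed auto
    then show ?thesis by (simp add: \<sigma>_def)
  qed
  have lists: "{L\<in>clique_seqs V k ok j. edges_of L \<subseteq> A} = {L. length L = j \<and> distinct L \<and> set L \<subseteq> cliques k V A}" for j A
  proof (induction j)
    case 0
    then show ?case by (auto simp: edges_of_def)
  next
    case (Suc j)
    show ?case
    proof (intro set_eqI iffI)
      fix L assume "L \<in> {L\<in>clique_seqs V k ok (Suc j). edges_of L \<subseteq> A}"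
      then obtain J L' where L: "L = J # L'" "L' \<in> clique_seqs V k ok j" "J \<in> nsets V k" "J \<notin> set L'" "edges_of L \<subseteq> A"
        by (auto simp: ok_def)
      then have "L' \<in> {L\<in>clique_seqs V k ok j. edges_of L \<subseteq> A}" by (auto simp: edges_of_def)
      then show "L \<in> {L. length L = Suc j \<and> distinct L \<and> set L \<subseteq> cliques k V A}"
        using L unfolding Suc.IH by (auto simp: edges_of_def cliques_def)
    next
      fix L assume L: "L \<in> {L. length L = Suc j \<and> distinct L \<and> set L \<subseteq> cliques k V A}"
      then obtain J L' where L': "L = J # L'" by (cases L) auto
      then have "L' \<in> {L\<in>clique_seqs V k ok j. edges_of L \<subseteq> A}" using L unfolding Suc.IH by auto
      moreover have "J \<in> cliques k V A" "J \<notin> set L'" using L L' by auto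
      ultimately show "L \<in> {L\<in>clique_seqs V k ok (Suc j). edges_of L \<subseteq> A}"
        using L' by (auto simp: ok_def cliques_def edges_of_def)
    qed
  qed
  have many: "real (y - m) ^ m \<le> ?N A" if "y \<le> card (cliques k V A)" for A
  proof -
    let ?X = "card (cliques k V A)"
    have "card {L\<in>clique_seqs V k ok m. edges_of L \<subseteq> A} = \<Prod>{?X - m + 1..?X}"
      unfolding lists using that assms by (intro card_lists_distinct_length_eq finite_cliques) auto
    moreover have "(y - m) ^ m \<le> \<Prod>{?X - m + 1..?X}"
    proof -
      have "(y - m) ^ m = (\<Prod>i\<in>{?X - m + 1..?X}. y - m)" using that assms by simp
      also have "\<dots> \<le> (\<Prod>i\<in>{?X - m + 1..?X}. i)" using that by (intro prod_mono) auto
      finally show ?thesis by simp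
    qed
    ultimately show ?thesis by (metis of_nat_le_iff of_nat_power)
  qed
  have "Pr (nsets V 2) (\<lambda>_. p) (\<lambda>A. y \<le> card (cliques k V A)) \<le> Pr (nsets V 2) (\<lambda>_. p) (\<lambda>A. real (y - m) ^ m \<le> ?N A)"
    using pr many by (intro Pr_mono) auto
  also have "\<dots> \<le> expect (nsets V 2) (\<lambda>_. p) ?N / real (y - m) ^ m"
    using pr assms by (intro Pr_markov) auto
  also have "expect (nsets V 2) (\<lambda>_. p) ?N = (\<Sum>L\<in>clique_seqs V k ok m. p ^ card (edges_of L))"
    using finE finS by (intro expect_card_family) (auto dest!: clique_seqs_set simp: edges_of_subset[THEN subsetD])
  also have "\<dots> \<le> \<sigma> ^ m"
    using step \<sigma>0 assms by (intro sum_clique_seqs[where M = m]) auto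
  finally show ?thesis unfolding \<sigma>_def[symmetric] by (simp add: power_divide divide_right_mono)
qed

definition clique_nbrs :: "'a set set \<Rightarrow> 'a \<Rightarrow> 'a set" where
  "clique_nbrs K v = \<Union>{J\<in>K. v \<in> J}"

text \<open>
  A vertex with more than \<open>m k\<close> clique neighbours lies on \<open>m\<close> cliques each of which has a vertex outside
  the earlier ones.  The overlap of a new clique with the earlier ones and the vertex itself is then
  between \<open>1\<close> and \<open>k - 1\<close>.
\<close>

lemma clique_nbrs_tail:
  assumes "finite V" "0 \<le> p" "p \<le> 1" "2 \<le> k" "1 \<le> m"
  shows "Pr (nsets V 2) (\<lambda>_. p) (\<lambda>A. \<exists>v\<in>V. m * k < card (clique_nbrs (cliques k V A) v))
      \<le> real (card V) * (\<Sum>s\<in>{1..<k}. real (m * k) ^ (s - 1) * ext_weight (card V) k p s) ^ m"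
proof -
  define \<sigma> where "\<sigma> = (\<Sum>s\<in>{1..<k}. real (m * k) ^ (s - 1) * ext_weight (card V) k p s)"
  have \<sigma>0: "0 \<le> \<sigma>" unfolding \<sigma>_def using assms by (intro sum_nonneg mult_nonneg_nonneg ext_weight_nonneg) auto
  have finE: "finite (nsets V 2)" by (rule finite_imp_finite_nsets) fact
  have pr: "is_prob (\<lambda>_. p)" using assms by (auto simp: is_prob_def)
  have one: "Pr (nsets V 2) (\<lambda>_. p) (\<lambda>A. m * k < card (clique_nbrs (cliques k V A) v)) \<le> \<sigma> ^ m" if v: "v \<in> V" for v
  proof -
    define ok where "ok L J \<longleftrightarrow> v \<in> J \<and> \<not> J \<subseteq> insert v (\<Union>(set L))" for L J
    have finS: "finite (clique_seqs V k ok m)" by (rule finite_clique_seqs) fact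
    let ?N = "\<lambda>A. real (card {L\<in>clique_seqs V k ok m. edges_of L \<subseteq> A})"
    have cU: "card (insert v (\<Union>(set L))) \<le> j * k + 1" if "L \<in> clique_seqs V k ok j" for j L
    proof -
      have L: "length L = j" "set L \<subseteq> nsets V k" using clique_seqs_set[OF that] by auto
      have "card (\<Union>(set L)) \<le> (\<Sum>J\<in>set L. card J)" using L by (intro card_Union_le_sum_card)
      also have "\<dots> = (\<Sum>J\<in>set L. k)" using L by (intro sum.cong) (auto simp: nsets_def)
      also have "\<dots> \<le> j * k" using L card_length[of L] by simp
      finally show ?thesis using card_insert_le_m1 by (metis Suc_eq_plus1 card_insert_if finite_insert le_SucI not_less_eq_eq card.infinite le0 add_le_mono1)
    qed
    have step: "(\<Sum>J | J \<in> nsets V k \<and> ok L J. p ^ card (nsets J 2 - edges_of L)) \<le> \<sigma>"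
      if "j < m" "L \<in> clique_seqs V k ok j" for j L
    proof -
      have L: "length L = j" "set L \<subseteq> nsets V k" using clique_seqs_set[OF that(2)] by auto
      have "j * k + 1 \<le> Suc j * k" using assms by simp
      also have "\<dots> \<le> m * k" using that by (intro mult_le_mono1) auto
      finally have U: "real (card (insert v (\<Union>(set L)))) \<le> real (m * k)"
        using cU[OF that(2)] by linarith
      have "(\<Sum>J | J \<in> nsets V k \<and> ok L J. p ^ card (nsets J 2 - edges_of L))
          \<le> (\<Sum>s\<in>{1..<k}. real (m * k) ^ (s - card {v}) * ext_weight (card V) k p s)"
      proof (rule sum_overlaps[OF \<open>finite V\<close> _ _ assms(2,3) _ _ _ U])
        show "insert v (\<Union>(set L)) \<subseteq> V" using L v by (auto simp: nsets_def)
        show "edges_of L \<subseteq> nsets (insert v (\<Union>(set L))) 2" by (auto simp: edges_of_def nsets_def)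
        show "{v} \<subseteq> J \<and> card (J \<inter> insert v (\<Union>(set L))) \<in> {1..<k}" if J: "J \<in> nsets V k" "ok L J" for J
        proof -
          have "finite J" "card J = k" "v \<in> J" using J by (auto simp: nsets_def ok_def)
          moreover have "J \<inter> insert v (\<Union>(set L)) \<subset> J" using J by (auto simp: ok_def)
          ultimately have "card (J \<inter> insert v (\<Union>(set L))) < k" by (metis psubset_card_mono)
          moreover have "0 < card (J \<inter> insert v (\<Union>(set L)))" using \<open>finite J\<close> \<open>v \<in> J\<close> by (auto simp: card_gt_0_iff)
          ultimately show ?thesis using \<open>v \<in> J\<close> by auto
        qed
      qed auto
      then show ?thesis by (simp add: \<sigma>_def)
    qed
    have ex: "\<exists>L\<in>clique_seqs V k ok j. edges_of L \<subseteq> A"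
      if "j \<le> m" "m * k < card (clique_nbrs (cliques k V A) v)" for j A
      using that(1)
    proof (induction j)
      case 0
      then show ?case by (simp add: edges_of_def)
    next
      case (Suc j)
      then obtain L where L: "L \<in> clique_seqs V k ok j" "edges_of L \<subseteq> A" by auto
      have "j * k + 1 \<le> Suc j * k" using assms by simp
      also have "\<dots> \<le> m * k" using Suc.prems by (intro mult_le_mono1) auto
      finally have "card (insert v (\<Union>(set L))) < card (clique_nbrs (cliques k V A) v)"
        using cU[OF L(1)] that(2) by linarith
      moreover have "finite (insert v (\<Union>(set L)))" using clique_seqs_set[OF L(1)] by (auto simp: nsets_def)
      ultimately have "\<not> clique_nbrs (cliques k V A) v \<subseteq> insert v (\<Union>(set L))" by (meson card_mono leD)
      then obtain J where J: "J \<in> cliques k V A" "v \<in> J" "\<not> J \<subseteq> insert v (\<Union>(set L))"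
        unfolding clique_nbrs_def by blast
      then have "J # L \<in> clique_seqs V k ok (Suc j)" using L by (auto simp: ok_def cliques_def)
      moreover have "edges_of (J # L) \<subseteq> A" using J L by (auto simp: edges_of_def cliques_def)
      ultimately show ?case by blast
    qed
    have "Pr (nsets V 2) (\<lambda>_. p) (\<lambda>A. m * k < card (clique_nbrs (cliques k V A) v)) \<le> Pr (nsets V 2) (\<lambda>_. p) (\<lambda>A. 1 \<le> ?N A)"
      using pr
    proof (rule Pr_mono)
      fix A assume "m * k < card (clique_nbrs (cliques k V A) v)"
      then have "{L\<in>clique_seqs V k ok m. edges_of L \<subseteq> A} \<noteq> {}" using ex[of m A] by auto
      then have "0 < card {L\<in>clique_seqs V k ok m. edges_of L \<subseteq> A}" using finS by (simp add: card_gt_0_iff)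
      then show "1 \<le> ?N A" by linarith
    qed
    also have "\<dots> \<le> expect (nsets V 2) (\<lambda>_. p) ?N / 1"
      using pr by (intro Pr_markov) auto
    also have "expect (nsets V 2) (\<lambda>_. p) ?N = (\<Sum>L\<in>clique_seqs V k ok m. p ^ card (edges_of L))"
      using finE finS by (intro expect_card_family) (auto dest!: clique_seqs_set simp: edges_of_subset[THEN subsetD])
    also have "\<dots> \<le> \<sigma> ^ m"
      using step \<sigma>0 assms by (intro sum_clique_seqs[where M = m]) auto
    finally show ?thesis by simp
  qed
  have "Pr (nsets V 2) (\<lambda>_. p) (\<lambda>A. \<exists>v\<in>V. m * k < card (clique_nbrs (cliques k V A) v))
     \<le> (\<Sum>v\<in>V. Pr (nsets V 2) (\<lambda>_. p) (\<lambda>A. m * k < card (clique_nbrs (cliques k V A) v)))"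
    using pr \<open>finite V\<close> by (rule Pr_Bex_le)
  also have "\<dots> \<le> (\<Sum>v\<in>V. \<sigma> ^ m)" by (intro sum_mono one)
  finally show ?thesis by (simp add: \<sigma>_def)
qed

lemma sum_clique_pairs:
  assumes "finite V" "0 \<le> p" "p \<le> 1" "finite I" "\<And>s. s \<in> I \<Longrightarrow> s \<le> k"
    and ok: "\<And>J J'. J \<in> nsets V k \<Longrightarrow> J' \<in> nsets V k \<Longrightarrow> P J J' \<Longrightarrow> card (J' \<inter> J) \<in> I"
  shows "(\<Sum>(J, J') | J \<in> nsets V k \<and> J' \<in> nsets V k \<and> P J J'. p ^ card (nsets J 2 \<union> nsets J' 2))
     \<le> real (card V choose k) * p ^ (k choose 2) * (\<Sum>s\<in>I. real k ^ s * ext_weight (card V) k p s)"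
proof -
  have finN: "finite (nsets V k)" by (rule finite_imp_finite_nsets) fact
  have "{(J, J'). J \<in> nsets V k \<and> J' \<in> nsets V k \<and> P J J'} = Sigma (nsets V k) (\<lambda>J. {J'. J' \<in> nsets V k \<and> P J J'})" by auto
  then have "(\<Sum>(J, J') | J \<in> nsets V k \<and> J' \<in> nsets V k \<and> P J J'. p ^ card (nsets J 2 \<union> nsets J' 2))
     = (\<Sum>J\<in>nsets V k. \<Sum>J' | J' \<in> nsets V k \<and> P J J'. p ^ card (nsets J 2 \<union> nsets J' 2))"
    using finN by (simp add: sum.Sigma)
  also have "\<dots> = (\<Sum>J\<in>nsets V k. p ^ (k choose 2) * (\<Sum>J' | J' \<in> nsets V k \<and> P J J'. p ^ card (nsets J' 2 - nsets J 2)))"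
    unfolding sum_distrib_left
  proof (intro sum.cong refl)
    fix J J' assume J: "J \<in> nsets V k" and J': "J' \<in> {J'. J' \<in> nsets V k \<and> P J J'}"
    have fin: "finite (nsets J 2)" "finite (nsets J' 2)" using J J' by (auto simp: nsets_def intro: finite_imp_finite_nsets[unfolded nsets_def])
    have "card (nsets J 2 \<union> nsets J' 2) = card (nsets J 2 \<union> (nsets J' 2 - nsets J 2))" by (simp add: Un_Diff_cancel)
    also have "\<dots> = card (nsets J 2) + card (nsets J' 2 - nsets J 2)" using fin by (intro card_Un_disjoint) auto
    also have "card (nsets J 2) = k choose 2" using J by (auto simp: card_nsets nsets_def[of V])
    finally show "p ^ card (nsets J 2 \<union> nsets J' 2) = p ^ (k choose 2) * p ^ card (nsets J' 2 - nsets J 2)"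
      by (simp add: power_add)
  qed
  also have "\<dots> \<le> (\<Sum>J\<in>nsets V k. p ^ (k choose 2) * (\<Sum>s\<in>I. real k ^ s * ext_weight (card V) k p s))"
  proof (intro sum_mono mult_left_mono)
    fix J assume J: "J \<in> nsets V k"
    have "(\<Sum>J' | J' \<in> nsets V k \<and> P J J'. p ^ card (nsets J' 2 - nsets J 2))
       \<le> (\<Sum>s\<in>I. real k ^ (s - card ({}::'a set)) * ext_weight (card V) k p s)"
      using J assms by (intro sum_overlaps[where U = J]) (auto simp: nsets_def[of V])
    then show "(\<Sum>J' | J' \<in> nsets V k \<and> P J J'. p ^ card (nsets J' 2 - nsets J 2)) \<le> (\<Sum>s\<in>I. real k ^ s * ext_weight (card V) k p s)" by simp
  qed (use assms in auto)
  finally show ?thesis by (simp add: card_nsets)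
qed

lemma card_cliques_square:
  assumes "finite V"
  shows "(real (card (cliques k V A)))\<^sup>2 =
    real (card {(J, J') \<in> nsets V k \<times> nsets V k. nsets J 2 \<union> nsets J' 2 \<subseteq> A})"
proof -
  have "{(J, J') \<in> nsets V k \<times> nsets V k. nsets J 2 \<union> nsets J' 2 \<subseteq> A} = cliques k V A \<times> cliques k V A"
    by (auto simp: cliques_def)
  then show ?thesis by (simp add: card_cartesian_product power2_eq_square)
qed

lemma expect_cliques_square:
  assumes "finite V"
  shows "expect (nsets V 2) (\<lambda>_. p) (\<lambda>A. (real (card (cliques k V A)))\<^sup>2)
     = (\<Sum>(J, J')\<in>nsets V k \<times> nsets V k. p ^ card (nsets J 2 \<union> nsets J' 2))"
proof -
  have "expect (nsets V 2) (\<lambda>_. p) (\<lambda>A. (real (card (cliques k V A)))\<^sup>2)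
     = expect (nsets V 2) (\<lambda>_. p) (\<lambda>A. real (card {x \<in> nsets V k \<times> nsets V k. nsets (fst x) 2 \<union> nsets (snd x) 2 \<subseteq> A}))"
    unfolding card_cliques_square[OF assms]
    by (intro expect_cong arg_cong[where f = "\<lambda>S. real (card S)"]) auto
  also have "\<dots> = (\<Sum>x\<in>nsets V k \<times> nsets V k. p ^ card (nsets (fst x) 2 \<union> nsets (snd x) 2))"
    using assms by (intro expect_card_family finite_imp_finite_nsets finite_cartesian_product)
       (auto intro: nsets_2_of_kset[THEN subsetD])
  finally show ?thesis by (simp add: case_prod_beta)
qed

lemma expect_cliques_square_le:
  assumes "finite V" "0 \<le> p" "p \<le> 1"
  shows "expect (nsets V 2) (\<lambda>_. p) (\<lambda>A. (real (card (cliques k V A)))\<^sup>2)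
     \<le> real (card V choose k) * p ^ (k choose 2) * (\<Sum>s\<le>k. real k ^ s * ext_weight (card V) k p s)"
proof -
  have "(\<Sum>(J, J')\<in>nsets V k \<times> nsets V k. p ^ card (nsets J 2 \<union> nsets J' 2))
     = (\<Sum>(J, J') | J \<in> nsets V k \<and> J' \<in> nsets V k \<and> True. p ^ card (nsets J 2 \<union> nsets J' 2))"
    by (intro sum.cong) auto
  also have "\<dots> \<le> real (card V choose k) * p ^ (k choose 2) * (\<Sum>s\<in>{..k}. real k ^ s * ext_weight (card V) k p s)"
    using assms by (intro sum_clique_pairs) (auto simp: nsets_def intro: card_mono)
  finally show ?thesis unfolding expect_cliques_square[OF assms(1)] .
qed

text \<open>
  All covariances are nonnegative, so the diagonal terms give a lower bound.
\<close>

lemma Var_cliques_ge: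
  fixes k :: nat
  assumes "finite V" "0 \<le> p" "p \<le> 1"
  defines "\<mu> \<equiv> real (card V choose k) * p ^ (k choose 2)"
  shows "\<mu> * (1 - p ^ (k choose 2)) \<le> Var (nsets V 2) (\<lambda>_. p) (\<lambda>A. real (card (cliques k V A)))"
proof -
  let ?C = "k choose 2" and ?N = "nsets V k"
  have finN: "finite ?N" by (rule finite_imp_finite_nsets) fact
  have cJ: "card (nsets J 2) = ?C" "finite (nsets J 2)" if "J \<in> ?N" for J
    using that by (auto simp: card_nsets nsets_def[of V] intro: finite_imp_finite_nsets)
  have "Var (nsets V 2) (\<lambda>_. p) (\<lambda>A. real (card (cliques k V A)))
     = (\<Sum>(J, J')\<in>?N \<times> ?N. p ^ card (nsets J 2 \<union> nsets J' 2)) - \<mu>\<^sup>2"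
    using assms by (subst Var_eq) (auto simp: expect_cliques_square expect_clique_count finite_imp_finite_nsets)
  also have "\<mu>\<^sup>2 = (\<Sum>(J, J')\<in>?N \<times> ?N. p ^ (2 * ?C))"
    by (simp add: \<mu>_def card_nsets power2_eq_square power_add mult_2 card_cartesian_product)
  also have "(\<Sum>(J, J')\<in>?N \<times> ?N. p ^ card (nsets J 2 \<union> nsets J' 2)) - (\<Sum>(J, J')\<in>?N \<times> ?N. p ^ (2 * ?C))
     = (\<Sum>(J, J')\<in>?N \<times> ?N. p ^ card (nsets J 2 \<union> nsets J' 2) - p ^ (2 * ?C))"
    by (simp add: sum_subtractf case_prod_beta)
  also have "\<dots> \<ge> (\<Sum>(J, J')\<in>(\<lambda>J. (J, J)) ` ?N. p ^ card (nsets J 2 \<union> nsets J' 2) - p ^ (2 * ?C))"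
  proof (intro sum_mono2)
    fix x assume "x \<in> ?N \<times> ?N - (\<lambda>J. (J, J)) ` ?N"
    then have x: "fst x \<in> ?N" "snd x \<in> ?N" by auto
    have "card (nsets (fst x) 2 \<union> nsets (snd x) 2) \<le> 2 * ?C"
      using card_Un_le[of "nsets (fst x) 2" "nsets (snd x) 2"] cJ x by simp
    then have "p ^ (2 * ?C) \<le> p ^ card (nsets (fst x) 2 \<union> nsets (snd x) 2)" using assms by (intro power_decreasing) auto
    then show "0 \<le> (case x of (J, J') \<Rightarrow> p ^ card (nsets J 2 \<union> nsets J' 2) - p ^ (2 * ?C))" by (simp add: case_prod_beta)
  qed (use finN in auto)
  also have "(\<Sum>(J, J')\<in>(\<lambda>J. (J, J)) ` ?N. p ^ card (nsets J 2 \<union> nsets J' 2) - p ^ (2 * ?C)) = (\<Sum>J\<in>?N. p ^ ?C - p ^ (2 * ?C))"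
    using cJ(1) by (subst sum.reindex) (simp_all add: inj_on_def)
  also have "\<dots> = \<mu> * (1 - p ^ ?C)"
    by (simp add: \<mu>_def card_nsets algebra_simps power_add mult_2)
  finally show ?thesis by simp
qed

text \<open>
  The Efron--Stein inequality and \<open>packing_deficit_change\<close> leave the expected number of
  intersecting pairs of cliques with a marked edge in the first of them, hence the factor \<open>k choose 2\<close>.
\<close>

lemma Var_packing_deficit:
  assumes "finite V" "0 \<le> p" "p \<le> 1" "2 \<le> k"
  shows "Var (nsets V 2) (\<lambda>_. p) (\<lambda>A. real (card (cliques k V A)) - real (packing_number (cliques k V A)))
    \<le> 2 * real (k choose 2) * (real (card V choose k) * p ^ (k choose 2) * (\<Sum>s\<in>{1..<k}. real k ^ s * ext_weight (card V) k p s))"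
proof -
  let ?E = "nsets V 2" and ?pr = "\<lambda>_::'a set. p"
  define K where "K A = cliques k V A" for A
  define f where "f = (\<lambda>A. real (card (K A)) - real (packing_number (K A)))"
  define T where "T e A = {(J, J') \<in> nsets V k \<times> nsets V k. J \<noteq> J' \<and> J \<inter> J' \<noteq> {} \<and> e \<in> nsets J 2 \<and> nsets J 2 \<union> nsets J' 2 \<subseteq> A}" for e A
  have pr: "is_prob ?pr" using assms by (auto simp: is_prob_def)
  have finE: "finite ?E" and finN: "finite (nsets V k)" using assms by (auto intro: finite_imp_finite_nsets)
  have change: "(f (insert e A) - f (A - {e}))\<^sup>2 \<le> 2 * real (card (T e (insert e A)))" if "e \<in> ?E" for e A
  proof -
    define N where "N = {J \<in> K (insert e A). e \<in> nsets J 2}"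
    have "e \<noteq> {}" using that by (auto simp: nsets_def)
    then obtain x where x: "x \<in> e" by auto
    have fin: "finite (K B)" for B unfolding K_def by (rule finite_cliques) fact
    have eq: "K (A - {e}) = K (insert e A) - N" by (auto simp: K_def N_def cliques_def)
    have "(f (insert e A) - f (A - {e}))\<^sup>2
        \<le> 2 * real (card {(J, J'). J \<in> N \<and> J' \<in> K (insert e A) \<and> J \<noteq> J' \<and> J \<inter> J' \<noteq> {}})"
      unfolding f_def eq
    proof (rule packing_deficit_change[OF fin, of N x])
      show "x \<in> S" if "S \<in> N" for S using that x by (auto simp: N_def nsets_def[of S])
      show "{} \<notin> K (insert e A)" using assms by (auto simp: K_def cliques_def nsets_def)
    qed (auto simp: N_def)
    also have "{(J, J'). J \<in> N \<and> J' \<in> K (insert e A) \<and> J \<noteq> J' \<and> J \<inter> J' \<noteq> {}} = T e (insert e A)"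
      by (auto simp: T_def N_def K_def cliques_def)
    finally show ?thesis .
  qed
  define \<P> where "\<P> = {(J, J'). J \<in> nsets V k \<and> J' \<in> nsets V k \<and> J \<noteq> J' \<and> J \<inter> J' \<noteq> {}}"
  have fin\<P>: "finite \<P>" by (rule finite_subset[of _ "nsets V k \<times> nsets V k"]) (use finN in \<open>auto simp: \<P>_def\<close>)
  have "Var ?E ?pr f \<le> (\<Sum>e\<in>?E. p * (1 - p) * expect ?E ?pr (\<lambda>A. (f (insert e A) - f (A - {e}))\<^sup>2))"
    using efron_stein[OF finE pr] .
  also have "\<dots> \<le> (\<Sum>e\<in>?E. p * (1 - p) * expect ?E ?pr (\<lambda>A. 2 * real (card (T e (insert e A)))))"
    using assms pr by (intro sum_mono mult_left_mono expect_mono change) auto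
  also have "\<dots> \<le> (\<Sum>e\<in>?E. p * expect ?E ?pr (\<lambda>A. 2 * real (card (T e (insert e A)))))"
    using assms pr by (intro sum_mono mult_right_mono expect_nonneg) (auto simp: mult_left_le)
  also have "\<dots> = (\<Sum>e\<in>?E. 2 * (\<Sum>x | x \<in> \<P> \<and> e \<in> nsets (fst x) 2. p ^ card (nsets (fst x) 2 \<union> nsets (snd x) 2)))"
  proof (intro sum.cong refl)
    fix e assume e: "e \<in> ?E"
    have "p * expect ?E ?pr (\<lambda>A. 2 * real (card (T e (insert e A)))) = 2 * (p * expect ?E ?pr (\<lambda>A. real (card (T e (insert e A)))))"
      by (simp add: expect_cmult)
    also have "p * expect ?E ?pr (\<lambda>A. real (card (T e (insert e A)))) = expect ?E ?pr (\<lambda>A. of_bool ({e} \<subseteq> A) * real (card (T e A)))"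
      using expect_filter[of ?E "{e}" ?pr "\<lambda>A. real (card (T e A))"] finE e by simp
    also have "\<dots> = expect ?E ?pr (\<lambda>A. real (card {x\<in>{x \<in> \<P>. e \<in> nsets (fst x) 2}. nsets (fst x) 2 \<union> nsets (snd x) 2 \<subseteq> A}))"
    proof (intro expect_cong)
      fix A
      have TP: "T e A = {x\<in>{x \<in> \<P>. e \<in> nsets (fst x) 2}. nsets (fst x) 2 \<union> nsets (snd x) 2 \<subseteq> A}"
        by (auto simp: T_def \<P>_def)
      have "T e A = {}" if "e \<notin> A" using that by (auto simp: T_def)
      then show "of_bool ({e} \<subseteq> A) * real (card (T e A)) = real (card {x\<in>{x \<in> \<P>. e \<in> nsets (fst x) 2}. nsets (fst x) 2 \<union> nsets (snd x) 2 \<subseteq> A})"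
        unfolding TP[symmetric] by auto
    qed
    also have "\<dots> = (\<Sum>x | x \<in> \<P> \<and> e \<in> nsets (fst x) 2. p ^ card (nsets (fst x) 2 \<union> nsets (snd x) 2))"
      using finE fin\<P> by (intro expect_card_family) (auto simp: \<P>_def intro: nsets_2_of_kset[THEN subsetD])
    finally show "p * expect ?E ?pr (\<lambda>A. 2 * real (card (T e (insert e A)))) = 2 * (\<Sum>x | x \<in> \<P> \<and> e \<in> nsets (fst x) 2. p ^ card (nsets (fst x) 2 \<union> nsets (snd x) 2))" .
  qed
  also have "\<dots> = 2 * (\<Sum>e\<in>?E. \<Sum>x\<in>\<P>. of_bool (e \<in> nsets (fst x) 2) * p ^ card (nsets (fst x) 2 \<union> nsets (snd x) 2))"
    unfolding sum_distrib_left using fin\<P>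
    by (intro sum.cong refl sum.mono_neutral_cong_left) auto
  also have "(\<Sum>e\<in>?E. \<Sum>x\<in>\<P>. of_bool (e \<in> nsets (fst x) 2) * p ^ card (nsets (fst x) 2 \<union> nsets (snd x) 2))
      = (\<Sum>x\<in>\<P>. \<Sum>e\<in>?E. of_bool (e \<in> nsets (fst x) 2) * p ^ card (nsets (fst x) 2 \<union> nsets (snd x) 2))"
    by (rule sum.swap)
  also have "\<dots> = (\<Sum>x\<in>\<P>. real (k choose 2) * p ^ card (nsets (fst x) 2 \<union> nsets (snd x) 2))"
  proof (intro sum.cong refl)
    fix x assume "x \<in> \<P>"
    then have x: "fst x \<in> nsets V k" by (auto simp: \<P>_def)
    have "(\<Sum>e\<in>?E. of_bool (e \<in> nsets (fst x) 2)) = (\<Sum>e\<in>nsets (fst x) 2. 1::real)"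
      using finE x nsets_mono[of "fst x" V 2] by (intro sum.mono_neutral_cong_right) (auto simp: nsets_def)
    also have "\<dots> = real (k choose 2)" using x by (auto simp: card_nsets nsets_def[of V])
    finally show "(\<Sum>e\<in>?E. of_bool (e \<in> nsets (fst x) 2) * p ^ card (nsets (fst x) 2 \<union> nsets (snd x) 2))
        = real (k choose 2) * p ^ card (nsets (fst x) 2 \<union> nsets (snd x) 2)"
      unfolding sum_distrib_right[symmetric] by simp
  qed
  also have "\<dots> = real (k choose 2) * (\<Sum>(J, J')\<in>\<P>. p ^ card (nsets J 2 \<union> nsets J' 2))"
    by (simp add: sum_distrib_left case_prod_beta)
  also have "(\<Sum>(J, J')\<in>\<P>. p ^ card (nsets J 2 \<union> nsets J' 2))
     \<le> real (card V choose k) * p ^ (k choose 2) * (\<Sum>s\<in>{1..<k}. real k ^ s * ext_weight (card V) k p s)"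
    unfolding \<P>_def
  proof (rule sum_clique_pairs[OF assms(1-3)])
    fix J J' :: "'a set" assume J: "J \<in> nsets V k" "J' \<in> nsets V k" "J \<noteq> J' \<and> J \<inter> J' \<noteq> {}"
    then have f: "finite J" "finite J'" "card J = k" "card J' = k" by (auto simp: nsets_def)
    have "J' \<inter> J \<subset> J'" using J f by (metis Int_lower1 card_subset_eq inf.orderE inf_commute psubsetI)
    then have "card (J' \<inter> J) < k" using f by (metis psubset_card_mono)
    moreover have "0 < card (J' \<inter> J)" using J f by (auto simp: card_gt_0_iff)
    ultimately show "card (J' \<inter> J) \<in> {1..<k}" by auto
  qed auto
  finally show ?thesis unfolding f_def K_def by (simp add: mult_left_mono)
qed

section \<open>Random transversals\<close>

lemma power_le_fact_exp: "x ^ t \<le> fact t * exp x" if "0 \<le> x" for x :: real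
proof -
  have "x ^ t / fact t = (\<Sum>n\<in>{t}. x ^ n /\<^sub>R fact n)" by (simp add: divide_inverse mult.commute)
  also have "\<dots> \<le> (\<Sum>n. x ^ n /\<^sub>R fact n)"
    using that summable_exp_generic[of x] by (intro sum_le_suminf) auto
  also have "\<dots> = exp x" by (simp add: exp_def)
  finally show ?thesis by (simp add: field_simps)
qed

text \<open>
  Write the falling factorial as \<open>(N choose t) t!\<close>, where \<open>N choose t \<ge> (N / t)\<^sup>t\<close> and \<open>t! \<ge> (t / e)\<^sup>t\<close>.
\<close>

lemma fact_falling_bound:
  assumes "t \<le> N"
  shows "fact (N - t) * (real N / exp 1) ^ t \<le> fact N"
proof (cases "t = 0")
  case False
  have "(real N / exp 1) ^ t = (real N / real t) ^ t * (real t ^ t / exp (real t))"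
    using False by (simp add: power_divide exp_of_nat_mult[symmetric])
  also have "\<dots> \<le> real (N choose t) * fact t"
  proof (intro mult_mono)
    show "(real N / real t) ^ t \<le> real (N choose t)" using binomial_ge_n_over_k_pow_k[OF assms] by simp
    show "real t ^ t / exp (real t) \<le> fact t" using power_le_fact_exp[of "real t" t] by (simp add: field_simps)
  qed auto
  finally have "fact (N - t) * (real N / exp 1) ^ t \<le> fact (N - t) * (real (N choose t) * fact t)"
    by (intro mult_left_mono) auto
  also have "\<dots> = fact N" using binomial_fact_lemma[OF assms]
    by (metis (no_types, lifting) mult.assoc mult.commute of_nat_fact of_nat_mult)
  finally show ?thesis .
qed simp

lemma card_permutations_agreeing:
  assumes "finite S" "D \<subseteq> S" "\<pi>0 permutes S"
  shows "card {\<pi>. \<pi> permutes S \<and> (\<forall>x\<in>D. \<pi> x = \<pi>0 x)} \<le> fact (card S - card D)"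
proof -
  have finD: "finite D" using assms finite_subset by auto
  have "card {\<pi>. \<pi> permutes S \<and> (\<forall>x\<in>D. \<pi> x = \<pi>0 x)} \<le> card {\<pi>. \<pi> permutes (S - D)}"
  proof (rule card_inj_on_le[where f = "\<lambda>\<pi>. inv \<pi>0 \<circ> \<pi>"])
    show "inj_on (\<lambda>\<pi>. inv \<pi>0 \<circ> \<pi>) {\<pi>. \<pi> permutes S \<and> (\<forall>x\<in>D. \<pi> x = \<pi>0 x)}"
    proof (rule inj_onI)
      fix \<pi> \<pi>' assume "inv \<pi>0 \<circ> \<pi> = inv \<pi>0 \<circ> \<pi>'"
      then have "\<pi>0 \<circ> (inv \<pi>0 \<circ> \<pi>) = \<pi>0 \<circ> (inv \<pi>0 \<circ> \<pi>')" by simp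
      then show "\<pi> = \<pi>'" using permutes_inv_o(1)[OF assms(3)] by (simp add: o_assoc)
    qed
    show "(\<lambda>\<pi>. inv \<pi>0 \<circ> \<pi>) ` {\<pi>. \<pi> permutes S \<and> (\<forall>x\<in>D. \<pi> x = \<pi>0 x)} \<subseteq> {\<pi>. \<pi> permutes (S - D)}"
    proof safe
      fix \<pi> assume \<pi>: "\<pi> permutes S" "\<forall>x\<in>D. \<pi> x = \<pi>0 x"
      have "inv \<pi>0 \<circ> \<pi> permutes S" using \<pi> assms by (intro permutes_compose permutes_inv) auto
      then show "inv \<pi>0 \<circ> \<pi> permutes (S - D)"
        by (rule permutes_superset) (use \<pi> assms permutes_inverses(2)[OF assms(3)] in auto)
    qed
    show "finite {\<pi>. \<pi> permutes (S - D)}" using assms by (intro finite_permutations) auto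
  qed
  also have "\<dots> = fact (card (S - D))" using assms by (intro card_permutations) auto
  finally show ?thesis using assms finD by (simp add: card_Diff_subset)
qed

text \<open>
  A slot \<open>(g, k, x)\<close> is position \<open>x\<close> in part \<open>k\<close> of group \<open>g\<close>.  An index \<open>(g, f)\<close> stands for the transversal
  of group \<open>g\<close> that takes position \<open>f k\<close> in each part \<open>k\<close>.
\<close>

type_synonym slot = "nat \<times> nat \<times> nat"
type_synonym tindex = "nat \<times> (nat \<Rightarrow> nat)"

definition Slots :: "nat \<Rightarrow> nat \<Rightarrow> nat \<Rightarrow> slot set" where
  "Slots q r N = {..<q} \<times> {..<r} \<times> {..<N}"

definition Idx :: "nat \<Rightarrow> nat \<Rightarrow> nat \<Rightarrow> tindex set" where
  "Idx q r N = {..<q} \<times> ({..<r} \<rightarrow>\<^sub>E {..<N})"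

definition slots :: "nat \<Rightarrow> tindex \<Rightarrow> slot set" where
  "slots r i = (\<lambda>k. (fst i, k, snd i k)) ` {..<r}"

lemma finite_Idx [simp]: "finite (Idx q r N)"
  by (simp add: Idx_def finite_PiE)

lemma finite_Slots [simp]: "finite (Slots q r N)"
  by (simp add: Slots_def)

lemma card_Slots: "card (Slots q r N) = q * r * N"
  by (simp add: Slots_def card_cartesian_product)

lemma slots_subset: "i \<in> Idx q r N \<Longrightarrow> slots r i \<subseteq> Slots q r N"
  by (auto simp: slots_def Idx_def Slots_def PiE_def Pi_def)

lemma finite_slots [simp]: "finite (slots r i)"
  by (simp add: slots_def)

lemma card_slots [simp]: "card (slots r i) = r"
  unfolding slots_def by (subst card_image) (auto simp: inj_on_def)

lemma mem_slots: "(g, k, x) \<in> slots r i \<longleftrightarrow> g = fst i \<and> k < r \<and> x = snd i k"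
  by (auto simp: slots_def)

lemma slots_inj:
  assumes "1 \<le> r" "i \<in> Idx q r N" "j \<in> Idx q r N" "slots r i = slots r j"
  shows "i = j"
proof -
  have "(fst i, 0, snd i 0) \<in> slots r j" using assms(1,4) by (auto simp: mem_slots simp flip: assms(4))
  then have "fst i = fst j" by (simp add: mem_slots)
  moreover have "snd i = snd j"
  proof (rule PiE_ext)
    show "snd i \<in> {..<r} \<rightarrow>\<^sub>E {..<N}" "snd j \<in> {..<r} \<rightarrow>\<^sub>E {..<N}" using assms by (auto simp: Idx_def)
    fix k assume "k \<in> {..<r}"
    then have "(fst i, k, snd i k) \<in> slots r j" by (auto simp: mem_slots simp flip: assms(4))
    then show "snd i k = snd j k" by (simp add: mem_slots)
  qed
  ultimately show ?thesis by (simp add: prod_eq_iff)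
qed

definition idx_at :: "nat \<Rightarrow> nat \<Rightarrow> nat \<Rightarrow> slot \<Rightarrow> tindex set" where
  "idx_at q r N v = {i\<in>Idx q r N. v \<in> slots r i}"

lemma finite_idx_at [simp]: "finite (idx_at q r N v)"
  by (simp add: idx_at_def)

lemma card_PiE_fixed:
  assumes "D \<subseteq> {..<r}"
  shows "card {f \<in> {..<r} \<rightarrow>\<^sub>E {..<N}. \<forall>k\<in>D. f k = y k} \<le> N ^ (r - card D)"
proof -
  have finD: "finite D" using assms finite_subset by auto
  have "{f \<in> {..<r} \<rightarrow>\<^sub>E {..<N}. \<forall>k\<in>D. f k = y k} \<subseteq> PiE {..<r} (\<lambda>k. if k \<in> D then {y k} else {..<N})"
    by (auto simp: PiE_def Pi_def)
  then have "card {f \<in> {..<r} \<rightarrow>\<^sub>E {..<N}. \<forall>k\<in>D. f k = y k} \<le> card (PiE {..<r} (\<lambda>k. if k \<in> D then {y k} else {..<N}))"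
    by (intro card_mono finite_PiE) auto
  also have "\<dots> = (\<Prod>k<r. if k \<in> D then 1 else N)"
    by (subst card_PiE) (auto intro!: prod.cong)
  also have "\<dots> = N ^ card ({..<r} - D)"
    by (simp add: prod.If_cases Diff_eq[symmetric] flip: set_diff_eq)
  also have "card ({..<r} - D) = r - card D" using assms finD by (simp add: card_Diff_subset)
  finally show ?thesis .
qed

lemma card_idx_at: "card (idx_at q r N v) \<le> N ^ (r - 1)"
proof (cases "fst (snd v) < r")
  case True
  obtain g k x where v: "v = (g, k, x)" by (cases v) auto
  have "idx_at q r N v \<subseteq> Pair g ` {f \<in> {..<r} \<rightarrow>\<^sub>E {..<N}. \<forall>k\<in>{k}. f k = x}"
    by (auto simp: idx_at_def Idx_def v mem_slots image_iff)
  then have "card (idx_at q r N v) \<le> card (Pair g ` {f \<in> {..<r} \<rightarrow>\<^sub>E {..<N}. \<forall>k\<in>{k}. f k = x})"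
    by (intro card_mono finite_imageI) (auto intro: finite_subset[OF _ finite_PiE[of "{..<r}" "\<lambda>_. {..<N}"]])
  also have "\<dots> \<le> card {f \<in> {..<r} \<rightarrow>\<^sub>E {..<N}. \<forall>k\<in>{k}. f k = x}"
    by (intro card_image_le) (auto intro: finite_subset[OF _ finite_PiE[of "{..<r}" "\<lambda>_. {..<N}"]])
  also have "\<dots> \<le> N ^ (r - card {k})" using True v by (intro card_PiE_fixed) auto
  finally show ?thesis by simp
next
  case False
  then have "idx_at q r N v = {}" by (cases v) (auto simp: idx_at_def mem_slots)
  then show ?thesis by simp
qed

lemma card_idx_at_two:
  assumes "v \<noteq> w"
  shows "card (idx_at q r N v \<inter> idx_at q r N w) \<le> N ^ (r - 2)"
proof (cases "idx_at q r N v \<inter> idx_at q r N w = {}")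
  case False
  obtain g k x where v: "v = (g, k, x)" by (cases v) auto
  obtain g' k' x' where w: "w = (g', k', x')" by (cases w) auto
  have kk: "k < r" "k' < r" "g = g'" "k \<noteq> k'" using False assms by (auto simp: idx_at_def v w mem_slots)
  define y where "y = (\<lambda>l. if l = k then x else x')"
  have "idx_at q r N v \<inter> idx_at q r N w \<subseteq> Pair g ` {f \<in> {..<r} \<rightarrow>\<^sub>E {..<N}. \<forall>l\<in>{k, k'}. f l = y l}"
    using kk by (auto simp: idx_at_def Idx_def v w mem_slots image_iff y_def)
  then have "card (idx_at q r N v \<inter> idx_at q r N w) \<le> card (Pair g ` {f \<in> {..<r} \<rightarrow>\<^sub>E {..<N}. \<forall>l\<in>{k, k'}. f l = y l})"
    by (intro card_mono finite_imageI) (auto intro: finite_subset[OF _ finite_PiE[of "{..<r}" "\<lambda>_. {..<N}"]])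
  also have "\<dots> \<le> card {f \<in> {..<r} \<rightarrow>\<^sub>E {..<N}. \<forall>l\<in>{k, k'}. f l = y l}"
    by (intro card_image_le) (auto intro: finite_subset[OF _ finite_PiE[of "{..<r}" "\<lambda>_. {..<N}"]])
  also have "\<dots> \<le> N ^ (r - card {k, k'})" using kk by (intro card_PiE_fixed) auto
  also have "card {k, k'} = 2" using kk by simp
  finally show ?thesis .
qed simp

text \<open>
  A perfect matching of a group by transversals: the transversal through position \<open>x\<close> of part \<open>0\<close> takes
  position \<open>\<sigma> k x\<close> of part \<open>k\<close>.
\<close>

definition perm_tuples :: "nat \<Rightarrow> nat \<Rightarrow> (nat \<Rightarrow> nat \<Rightarrow> nat) set" where
  "perm_tuples r N = PiE {1..<r} (\<lambda>_. {\<pi>. \<pi> permutes {..<N}})"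

definition matching_row :: "nat \<Rightarrow> (nat \<Rightarrow> nat \<Rightarrow> nat) \<Rightarrow> nat \<Rightarrow> nat \<Rightarrow> nat" where
  "matching_row r \<sigma> x = (\<lambda>k\<in>{..<r}. if k = 0 then x else \<sigma> k x)"

definition matching :: "nat \<Rightarrow> nat \<Rightarrow> nat \<Rightarrow> (nat \<Rightarrow> nat \<Rightarrow> nat) \<Rightarrow> tindex set" where
  "matching r N g \<sigma> = (\<lambda>x. (g, matching_row r \<sigma> x)) ` {..<N}"

lemma matching_subset:
  assumes "\<sigma> \<in> perm_tuples r N" "g < q"
  shows "matching r N g \<sigma> \<subseteq> Idx q r N"
proof -
  have "\<sigma> k x < N" if "x < N" "k < r" "k \<noteq> 0" for k x
  proof -
    have "\<sigma> k permutes {..<N}" using assms that by (auto simp: perm_tuples_def PiE_def Pi_def)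
    then have "\<sigma> k x \<in> {..<N} \<longleftrightarrow> x \<in> {..<N}" by (rule permutes_in_image)
    then show ?thesis using that by auto
  qed
  then show ?thesis using assms by (auto simp: matching_def Idx_def matching_row_def split: if_splits)
qed

lemma card_matching: "card (matching r N g \<sigma>) \<le> N"
  unfolding matching_def using card_image_le[of "{..<N}"] by fastforce

text \<open>
  Requiring \<open>t\<close> given transversals fixes each of the \<open>r - 1\<close> permutations at \<open>t\<close> points.
\<close>

lemma perm_tuples_spread:
  assumes "1 \<le> r"
  shows "spread_family (perm_tuples r N) (matching r N g) ((real N / exp 1) ^ (r - 1))"
  unfolding spread_family_def
proof (intro conjI allI impI)
  have finP: "finite {\<pi>. \<pi> permutes {..<N}}" by (intro finite_permutations) auto
  show fin: "finite (perm_tuples r N)" unfolding perm_tuples_def using finP by (intro finite_PiE) auto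
  show "perm_tuples r N \<noteq> {}"
  proof -
    have "{\<pi>. \<pi> permutes {..<N}} \<noteq> {}" using permutes_id[of "{..<N}"] by blast
    then show ?thesis unfolding perm_tuples_def by (simp add: PiE_eq_empty_iff)
  qed
  have cI: "real (card (perm_tuples r N)) = fact N ^ (r - 1)"
    unfolding perm_tuples_def by (subst card_PiE) (auto simp: card_permutations[of "{..<N}" N])
  fix A :: "tindex set" assume finA: "finite A"
  define t where "t = card A"
  show "real (card {\<sigma> \<in> perm_tuples r N. A \<subseteq> matching r N g \<sigma>}) * ((real N / exp 1) ^ (r - 1)) ^ card A
     \<le> real (card (perm_tuples r N))"
  proof (cases "{\<sigma> \<in> perm_tuples r N. A \<subseteq> matching r N g \<sigma>} = {}")
    case True
    then show ?thesis by (simp only: True) simp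
  next
    case False
    then obtain \<sigma>0 where \<sigma>0: "\<sigma>0 \<in> perm_tuples r N" "A \<subseteq> matching r N g \<sigma>0" by blast
    define D where "D = (\<lambda>i. snd i 0) ` A"
    have row0: "matching_row r \<sigma> x 0 = x" for \<sigma> x using assms by (simp add: matching_row_def)
    have D: "D \<subseteq> {..<N}" using \<sigma>0(2) row0 by (auto simp: D_def matching_def)
    have "inj_on (\<lambda>i. snd i 0) A"
    proof (rule inj_onI)
      fix i j assume ij: "i \<in> A" "j \<in> A" "snd i 0 = snd j 0"
      obtain x y where "i = (g, matching_row r \<sigma>0 x)" "j = (g, matching_row r \<sigma>0 y)"
        using ij(1,2) \<sigma>0(2) unfolding matching_def by blast
      then show "i = j" using ij(3) row0 by simp
    qed
    then have cD: "card D = t" by (simp add: D_def card_image t_def)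
    have tN: "t \<le> N" using card_mono[OF _ D] cD by simp
    have "{\<sigma> \<in> perm_tuples r N. A \<subseteq> matching r N g \<sigma>}
        \<subseteq> PiE {1..<r} (\<lambda>k. {\<pi>. \<pi> permutes {..<N} \<and> (\<forall>x\<in>D. \<pi> x = \<sigma>0 k x)})"
    proof
      fix \<sigma> assume \<sigma>: "\<sigma> \<in> {\<sigma> \<in> perm_tuples r N. A \<subseteq> matching r N g \<sigma>}"
      have "\<sigma> k x = \<sigma>0 k x" if k: "k \<in> {1..<r}" and x: "x \<in> D" for k x
      proof -
        obtain i where i: "i \<in> A" "x = snd i 0" using x by (auto simp: D_def)
        obtain y where y: "i = (g, matching_row r \<sigma> y)" using i \<sigma> by (auto simp: matching_def)
        obtain z where z: "i = (g, matching_row r \<sigma>0 z)" using i \<sigma>0 by (auto simp: matching_def)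
        have "snd i 0 = y" by (simp only: y snd_conv row0)
        moreover have "snd i 0 = z" by (simp only: z snd_conv row0)
        ultimately have "y = x" "z = x" using i by auto
        then have "matching_row r \<sigma> x k = matching_row r \<sigma>0 x k" using y z by auto
        then show ?thesis using k by (simp add: matching_row_def)
      qed
      then show "\<sigma> \<in> PiE {1..<r} (\<lambda>k. {\<pi>. \<pi> permutes {..<N} \<and> (\<forall>x\<in>D. \<pi> x = \<sigma>0 k x)})"
        using \<sigma> by (auto simp: perm_tuples_def PiE_def Pi_def)
    qed
    then have "card {\<sigma> \<in> perm_tuples r N. A \<subseteq> matching r N g \<sigma>}
        \<le> card (PiE {1..<r} (\<lambda>k. {\<pi>. \<pi> permutes {..<N} \<and> (\<forall>x\<in>D. \<pi> x = \<sigma>0 k x)}))"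
      by (intro card_mono finite_PiE) (auto intro: finite_subset[OF _ finP])
    also have "\<dots> = (\<Prod>k\<in>{1..<r}. card {\<pi>. \<pi> permutes {..<N} \<and> (\<forall>x\<in>D. \<pi> x = \<sigma>0 k x)})"
      by (subst card_PiE) auto
    also have "\<dots> \<le> (\<Prod>k\<in>{1..<r}. fact (N - t))"
    proof (intro prod_mono conjI)
      fix k assume "k \<in> {1..<r}"
      then have "\<sigma>0 k permutes {..<N}" using \<sigma>0 by (auto simp: perm_tuples_def PiE_def Pi_def)
      then show "card {\<pi>. \<pi> permutes {..<N} \<and> (\<forall>x\<in>D. \<pi> x = \<sigma>0 k x)} \<le> fact (N - t)"
        using card_permutations_agreeing[OF _ D, of "\<sigma>0 k"] cD by simp
    qed auto
    also have "\<dots> = fact (N - t) ^ (r - 1)" by simp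
    finally have "real (card {\<sigma> \<in> perm_tuples r N. A \<subseteq> matching r N g \<sigma>}) \<le> fact (N - t) ^ (r - 1)"
      by (metis of_nat_fact of_nat_le_iff of_nat_power)
    then have "real (card {\<sigma> \<in> perm_tuples r N. A \<subseteq> matching r N g \<sigma>}) * ((real N / exp 1) ^ (r - 1)) ^ t
       \<le> fact (N - t) ^ (r - 1) * ((real N / exp 1) ^ (r - 1)) ^ t"
      by (intro mult_right_mono) auto
    also have "\<dots> = (fact (N - t) * (real N / exp 1) ^ t) ^ (r - 1)"
      by (simp add: power_mult_distrib power_mult[symmetric] mult.commute)
    also have "\<dots> \<le> fact N ^ (r - 1)" using fact_falling_bound[OF tN] by (intro power_mono) auto
    finally show ?thesis unfolding cI t_def .
  qed
qed

text \<open>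
  The slots that \<open>H\<close> joins to both \<open>a\<close> and \<open>b\<close>, possibly by two different transversals.
\<close>

definition codeg :: "nat \<Rightarrow> tindex set \<Rightarrow> slot \<Rightarrow> slot \<Rightarrow> slot set" where
  "codeg r H a b = {x. x \<noteq> a \<and> x \<noteq> b \<and> (\<exists>h\<in>H. a \<in> slots r h \<and> x \<in> slots r h) \<and> (\<exists>h\<in>H. b \<in> slots r h \<and> x \<in> slots r h)}"

lemma codeg_mono: "H \<subseteq> H' \<Longrightarrow> codeg r H a b \<subseteq> codeg r H' a b"
  by (auto simp: codeg_def)

lemma finite_codeg: "finite H \<Longrightarrow> finite (codeg r H a b)"
  by (rule finite_subset[of _ "\<Union>h\<in>H. slots r h"]) (auto simp: codeg_def)

text \<open>
  Markov's inequality for the exponential of the degree, whose mean is at most \<open>\<Lambda>\<close>.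
\<close>

lemma degree_tail:
  assumes p: "0 \<le> p" "p \<le> 1" and \<Lambda>: "real N ^ (r - 1) * p \<le> \<Lambda>"
  shows "Pr (Idx q r N) (\<lambda>_. p) (\<lambda>H. \<Delta> \<le> card (H \<inter> idx_at q r N v)) \<le> exp (2 * \<Lambda> - real \<Delta>)"
proof -
  let ?X = "Idx q r N" and ?F = "idx_at q r N v"
  have pr: "is_prob (\<lambda>_. p)" using p by (auto simp: is_prob_def)
  have FX: "?F \<subseteq> ?X" by (auto simp: idx_at_def)
  have "Pr ?X (\<lambda>_. p) (\<lambda>H. \<Delta> \<le> card (H \<inter> ?F)) \<le> Pr ?X (\<lambda>_. p) (\<lambda>H. exp (real \<Delta>) \<le> exp (real (card (H \<inter> ?F))))"
    using pr by (intro Pr_mono) auto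
  also have "\<dots> \<le> expect ?X (\<lambda>_. p) (\<lambda>H. exp (real (card (H \<inter> ?F)))) / exp (real \<Delta>)"
    using pr by (intro Pr_markov) auto
  also have "\<dots> \<le> exp (2 * real (card ?F) * p) / exp (real \<Delta>)"
    using p FX by (intro divide_right_mono expect_exp_card) auto
  also have "\<dots> \<le> exp (2 * \<Lambda>) / exp (real \<Delta>)"
  proof -
    have "real (card ?F) \<le> real N ^ (r - 1)" using card_idx_at[of q r N v] by (metis of_nat_le_iff of_nat_power)
    then have "real (card ?F) * p \<le> \<Lambda>" using \<Lambda> p mult_right_mono order_trans by blast
    then show ?thesis by (intro divide_right_mono) auto
  qed
  finally show ?thesis by (simp add: exp_diff)
qed

text \<open>
  A common neighbour of \<open>a\<close> and \<open>b\<close> comes either from a transversal through both, of which few are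
  expected, or from a transversal through \<open>a\<close> and one through \<open>b\<close> that meet elsewhere.  For the second
  kind expose the transversals through \<open>a\<close> but not \<open>b\<close> first: each of those is met by at most
  \<open>r \<Lambda> / N\<close> transversals through \<open>b\<close> on average.
\<close>

lemma codegree_tail:
  assumes p: "0 \<le> p" "p \<le> 1" and ab: "a \<noteq> b" and r: "2 \<le> r" and N: "1 \<le> N" and \<Lambda>: "real N ^ (r - 1) * p \<le> \<Lambda>"
  shows "Pr (Idx q r N) (\<lambda>_. p) (\<lambda>H. 2 * r * t \<le> card (codeg r H a b))
    \<le> (\<Lambda> / real N) ^ t + fact t * exp (2 * \<Lambda>) * (real r * \<Lambda> / real N) ^ t"
proof (cases "t = 0")
  case True
  have "Pr (Idx q r N) (\<lambda>_. p) (\<lambda>H. 2 * r * t \<le> card (codeg r H a b)) \<le> 1"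
    using p by (intro Pr_le_1) (auto simp: is_prob_def)
  also have "1 \<le> (\<Lambda> / real N) ^ t + fact t * exp (2 * \<Lambda>) * (real r * \<Lambda> / real N) ^ t" using True by simp
  finally show ?thesis .
next
  case False
  let ?X = "Idx q r N"
  define Fa where "Fa = idx_at q r N a"
  define Fb where "Fb = idx_at q r N b"
  define nb where "nb A = {h'\<in>Fb - Fa. \<exists>h\<in>A. slots r h \<inter> slots r h' \<noteq> {}}" for A
  have pr: "is_prob (\<lambda>_. p)" using p by (auto simp: is_prob_def)
  have finF: "finite Fa" "finite Fb" "Fa \<subseteq> ?X" "Fb \<subseteq> ?X" by (auto simp: Fa_def Fb_def idx_at_def)
  have \<Lambda>0: "0 \<le> \<Lambda>" using \<Lambda> p by (meson mult_nonneg_nonneg of_nat_0_le_iff order_trans zero_le_power)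
  have pair: "real N ^ (r - 2) * p \<le> \<Lambda> / real N"
  proof -
    have eq: "real N * (real N ^ (r - 2) * p) = real N ^ (r - 1) * p"
    proof -
      have "r - 1 = Suc (r - 2)" using r by simp
      then show ?thesis by (simp only: power_Suc mult.assoc)
    qed
    have "real N * (real N ^ (r - 2) * p) \<le> \<Lambda>" unfolding eq by (rule \<Lambda>)
    then show ?thesis using N by (simp add: pos_le_divide_eq mult.commute)
  qed
  have split: "t \<le> card (H \<inter> (Fa \<inter> Fb)) \<or> t \<le> card (H \<inter> nb (H \<inter> (Fa - Fb)))"
    if H: "H \<subseteq> ?X" "2 * r * t \<le> card (codeg r H a b)" for H
  proof -
    let ?H1 = "H \<inter> (Fa \<inter> Fb)" and ?H2 = "H \<inter> nb (H \<inter> (Fa - Fb))"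
    have fin: "finite ?H1" "finite ?H2" using finF by (auto simp: nb_def)
    have "codeg r H a b \<subseteq> (\<Union>h\<in>?H1. slots r h) \<union> (\<Union>h\<in>?H2. slots r h)"
    proof
      fix x assume "x \<in> codeg r H a b"
      then obtain h h' where h: "h \<in> H" "a \<in> slots r h" "x \<in> slots r h" "h' \<in> H" "b \<in> slots r h'" "x \<in> slots r h'"
        by (auto simp: codeg_def)
      then have mem: "h \<in> Fa" "h' \<in> Fb" using H by (auto simp: Fa_def Fb_def idx_at_def)
      show "x \<in> (\<Union>h\<in>?H1. slots r h) \<union> (\<Union>h\<in>?H2. slots r h)"
      proof (cases "h \<in> Fb \<or> h' \<in> Fa")
        case True
        then show ?thesis using h mem by auto
      next
        case False
        then have "h' \<in> nb (H \<inter> (Fa - Fb))" using h mem by (auto simp: nb_def)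
        then show ?thesis using h by auto
      qed
    qed
    then have "card (codeg r H a b) \<le> card ((\<Union>h\<in>?H1. slots r h) \<union> (\<Union>h\<in>?H2. slots r h))"
      using fin by (intro card_mono) auto
    also have "\<dots> \<le> card (\<Union>h\<in>?H1. slots r h) + card (\<Union>h\<in>?H2. slots r h)" by (rule card_Un_le)
    also have "\<dots> \<le> (\<Sum>h\<in>?H1. card (slots r h)) + (\<Sum>h\<in>?H2. card (slots r h))"
      using fin by (intro add_mono card_UN_le)
    also have "\<dots> = r * (card ?H1 + card ?H2)" by (simp add: algebra_simps)
    finally have le: "card (codeg r H a b) \<le> r * (card ?H1 + card ?H2)" .
    have "r * (2 * t) \<le> card (codeg r H a b)" using H(2) by (simp add: mult_ac)
    then have "r * (2 * t) \<le> r * (card ?H1 + card ?H2)" using le by (rule order_trans)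
    then have "2 * t \<le> card ?H1 + card ?H2" using r by simp
    then show ?thesis by linarith
  qed
  have one: "Pr ?X (\<lambda>_. p) (\<lambda>H. t \<le> card (H \<inter> (Fa \<inter> Fb))) \<le> (\<Lambda> / real N) ^ t"
  proof -
    have "Pr ?X (\<lambda>_. p) (\<lambda>H. t \<le> card (H \<inter> (Fa \<inter> Fb))) \<le> (real (card (Fa \<inter> Fb)) * p) ^ t"
      using finF p by (intro Pr_card_ge) auto
    also have "\<dots> \<le> (\<Lambda> / real N) ^ t"
    proof (intro power_mono)
      have "real (card (Fa \<inter> Fb)) \<le> real N ^ (r - 2)"
        using card_idx_at_two[OF ab, of q r N] unfolding Fa_def Fb_def by (metis of_nat_le_iff of_nat_power)
      then show "real (card (Fa \<inter> Fb)) * p \<le> \<Lambda> / real N" using pair p mult_right_mono order_trans by blast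
    qed (use p in auto)
    finally show ?thesis .
  qed
  have two: "Pr ?X (\<lambda>_. p) (\<lambda>H. t \<le> card (H \<inter> nb (H \<inter> (Fa - Fb)))) \<le> fact t * exp (2 * \<Lambda>) * (real r * \<Lambda> / real N) ^ t"
  proof -
    define X1 where "X1 = Fa - Fb"
    define X2 where "X2 = ?X - X1"
    have X: "?X = X1 \<union> X2" "X1 \<inter> X2 = {}" "finite X1" "finite X2" using finF by (auto simp: X1_def X2_def)
    have card_nb: "real (card (nb A)) * p \<le> real (card A) * (real r * \<Lambda> / real N)" if "A \<subseteq> X1" for A
    proof -
      have finA: "finite A" using finite_subset[OF that X(3)] .
      have "nb A \<subseteq> (\<Union>h\<in>A. \<Union>x\<in>slots r h. idx_at q r N b \<inter> idx_at q r N x)"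
        by (auto simp: nb_def Fb_def idx_at_def)
      then have "card (nb A) \<le> card (\<Union>h\<in>A. \<Union>x\<in>slots r h. idx_at q r N b \<inter> idx_at q r N x)"
        using finA by (intro card_mono) auto
      also have "\<dots> \<le> (\<Sum>h\<in>A. card (\<Union>x\<in>slots r h. idx_at q r N b \<inter> idx_at q r N x))"
        using finA by (rule card_UN_le)
      also have "\<dots> \<le> (\<Sum>h\<in>A. r * N ^ (r - 2))"
      proof (intro sum_mono)
        fix h assume h: "h \<in> A"
        have "card (\<Union>x\<in>slots r h. idx_at q r N b \<inter> idx_at q r N x) \<le> (\<Sum>x\<in>slots r h. card (idx_at q r N b \<inter> idx_at q r N x))"
          by (rule card_UN_le) simp
        also have "\<dots> \<le> (\<Sum>x\<in>slots r h. N ^ (r - 2))"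
        proof (intro sum_mono card_idx_at_two)
          fix x assume "x \<in> slots r h"
          then show "b \<noteq> x" using h that by (auto simp: X1_def Fb_def Fa_def idx_at_def)
        qed
        finally show "card (\<Union>x\<in>slots r h. idx_at q r N b \<inter> idx_at q r N x) \<le> r * N ^ (r - 2)" by simp
      qed
      finally have "card (nb A) \<le> card A * (r * N ^ (r - 2))" by simp
      then have "real (card (nb A)) \<le> real (card A) * (real r * real N ^ (r - 2))"
        by (metis of_nat_le_iff of_nat_mult of_nat_power)
      then have "real (card (nb A)) * p \<le> real (card A) * (real r * real N ^ (r - 2)) * p"
        using p by (intro mult_right_mono) auto
      also have "\<dots> = real (card A) * (real r * (real N ^ (r - 2) * p))" by (simp add: mult_ac)
      also have "\<dots> \<le> real (card A) * (real r * (\<Lambda> / real N))"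
        using pair by (intro mult_left_mono) auto
      finally show ?thesis by simp
    qed
    have "Pr ?X (\<lambda>_. p) (\<lambda>H. t \<le> card (H \<inter> nb (H \<inter> (Fa - Fb))))
       = expect X1 (\<lambda>_. p) (\<lambda>A. expect X2 (\<lambda>_. p) (\<lambda>B. of_bool (t \<le> card ((A \<union> B) \<inter> nb ((A \<union> B) \<inter> (Fa - Fb))))))"
      unfolding Pr_def X(1)
      by (rule expect_union[OF X(3,4,2), of "\<lambda>_. p" "\<lambda>H. of_bool (t \<le> card (H \<inter> nb (H \<inter> (Fa - Fb))))"])
    also have "\<dots> = expect X1 (\<lambda>_. p) (\<lambda>A. Pr X2 (\<lambda>_. p) (\<lambda>B. t \<le> card (B \<inter> nb A)))"
      unfolding Pr_def
    proof (intro expect_cong)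
      fix A B assume AB: "A \<subseteq> X1" "B \<subseteq> X2"
      have "(A \<union> B) \<inter> (Fa - Fb) = A" using AB unfolding X1_def X2_def by blast
      moreover have "(A \<union> B) \<inter> nb A = B \<inter> nb A" using AB by (auto simp: X1_def nb_def)
      ultimately show "of_bool (t \<le> card ((A \<union> B) \<inter> nb ((A \<union> B) \<inter> (Fa - Fb)))) = of_bool (t \<le> card (B \<inter> nb A))" by simp
    qed
    also have "\<dots> \<le> expect X1 (\<lambda>_. p) (\<lambda>A. (real r * \<Lambda> / real N) ^ t * fact t * exp (real (card (A \<inter> X1))))"
    proof (intro expect_mono pr)
      fix A assume A: "A \<subseteq> X1"
      have "nb A \<subseteq> X2" using finF by (auto simp: nb_def X2_def X1_def)
      then have "Pr X2 (\<lambda>_. p) (\<lambda>B. t \<le> card (B \<inter> nb A)) \<le> (real (card (nb A)) * p) ^ t"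
        using X(4) p by (intro Pr_card_ge)
      also have "\<dots> \<le> (real (card A) * (real r * \<Lambda> / real N)) ^ t"
        using card_nb[OF A] p by (intro power_mono) auto
      also have "\<dots> = (real r * \<Lambda> / real N) ^ t * real (card A) ^ t" by (simp add: power_mult_distrib mult_ac power_divide)
      also have "\<dots> \<le> (real r * \<Lambda> / real N) ^ t * (fact t * exp (real (card A)))"
        using \<Lambda>0 by (intro mult_left_mono power_le_fact_exp) auto
      finally show "Pr X2 (\<lambda>_. p) (\<lambda>B. t \<le> card (B \<inter> nb A)) \<le> (real r * \<Lambda> / real N) ^ t * fact t * exp (real (card (A \<inter> X1)))"
        using A by (simp add: Int_absorb2 mult.assoc)
    qed
    also have "\<dots> = (real r * \<Lambda> / real N) ^ t * fact t * expect X1 (\<lambda>_. p) (\<lambda>A. exp (real (card (A \<inter> X1))))"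
      by (rule expect_cmult)
    also have "\<dots> \<le> (real r * \<Lambda> / real N) ^ t * fact t * exp (2 * \<Lambda>)"
    proof (intro mult_left_mono)
      have "expect X1 (\<lambda>_. p) (\<lambda>A. exp (real (card (A \<inter> X1)))) \<le> exp (2 * real (card X1) * p)"
        using X(3) p by (intro expect_exp_card) auto
      also have "\<dots> \<le> exp (2 * \<Lambda>)"
      proof -
        have "card X1 \<le> N ^ (r - 1)"
          using card_mono[OF finF(1), of X1] card_idx_at[of q r N a] by (auto simp: X1_def Fa_def)
        then have "real (card X1) \<le> real N ^ (r - 1)" by (metis of_nat_le_iff of_nat_power)
        then have "real (card X1) * p \<le> \<Lambda>" using \<Lambda> p mult_right_mono order_trans by blast
        then show ?thesis by simp
      qed
      finally show "expect X1 (\<lambda>_. p) (\<lambda>A. exp (real (card (A \<inter> X1)))) \<le> exp (2 * \<Lambda>)" .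
    qed (use \<Lambda>0 in auto)
    finally show ?thesis by (simp add: mult_ac)
  qed
  have "Pr ?X (\<lambda>_. p) (\<lambda>H. 2 * r * t \<le> card (codeg r H a b))
     \<le> Pr ?X (\<lambda>_. p) (\<lambda>H. t \<le> card (H \<inter> (Fa \<inter> Fb)) \<or> t \<le> card (H \<inter> nb (H \<inter> (Fa - Fb))))"
    using pr split by (intro Pr_mono) auto
  also have "\<dots> \<le> Pr ?X (\<lambda>_. p) (\<lambda>H. t \<le> card (H \<inter> (Fa \<inter> Fb))) + Pr ?X (\<lambda>_. p) (\<lambda>H. t \<le> card (H \<inter> nb (H \<inter> (Fa - Fb))))"
    using pr by (rule Pr_disj_le)
  finally show ?thesis using one two by linarith
qed

text \<open>
  What the coupling needs from a family of transversals: it contains a perfect matching of each group,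
  and its degrees and codegrees are small enough to control the negative information.
\<close>

definition good_transversals :: "nat \<Rightarrow> nat \<Rightarrow> nat \<Rightarrow> nat \<Rightarrow> nat \<Rightarrow> tindex set \<Rightarrow> bool" where
  "good_transversals q r N \<Delta> K H \<longleftrightarrow>
     (\<forall>g<q. \<exists>\<sigma>\<in>perm_tuples r N. matching r N g \<sigma> \<subseteq> H) \<and>
     (\<forall>v\<in>Slots q r N. card (H \<inter> idx_at q r N v) < \<Delta>) \<and>
     (\<forall>a\<in>Slots q r N. \<forall>b\<in>Slots q r N. a \<noteq> b \<longrightarrow> card (codeg r H a b) < K)"

lemma good_transversals_likely:
  assumes q0: "0 < q0" "q0 \<le> 1" "64 \<le> q0 * (real N / exp 1) ^ (r - 1)" and r: "2 \<le> r" and N: "1 \<le> N" "N < 2 ^ k"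
    and p: "p = 1 - (1 - q0) ^ R" and \<Lambda>: "real N ^ (r - 1) * p \<le> \<Lambda>"
  shows "Pr (Idx q r N) (\<lambda>_. p) (\<lambda>H. \<not> good_transversals q r N \<Delta> (2 * r * t) H)
    \<le> real q * (4 ^ k / 2 ^ R) + real (q * r * N) * exp (2 * \<Lambda> - real \<Delta>)
     + (real (q * r * N))\<^sup>2 * ((\<Lambda> / real N) ^ t + fact t * exp (2 * \<Lambda>) * (real r * \<Lambda> / real N) ^ t)"
proof -
  let ?X = "Idx q r N" and ?S = "Slots q r N"
  have p01: "0 \<le> p" "p \<le> 1" using q0 p by (auto simp: power_le_one)
  have pr: "is_prob (\<lambda>_. p)" using p01 by (auto simp: is_prob_def)
  define B1 where "B1 H \<longleftrightarrow> (\<exists>g\<in>{..<q}. \<not> (\<exists>\<sigma>\<in>perm_tuples r N. matching r N g \<sigma> \<subseteq> H))" for H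
  define B2 where "B2 H \<longleftrightarrow> (\<exists>v\<in>?S. \<Delta> \<le> card (H \<inter> idx_at q r N v))" for H
  define B3 where "B3 H \<longleftrightarrow> (\<exists>ab\<in>{ab\<in>?S \<times> ?S. fst ab \<noteq> snd ab}. 2 * r * t \<le> card (codeg r H (fst ab) (snd ab)))" for H
  have "Pr ?X (\<lambda>_. p) (\<lambda>H. \<not> good_transversals q r N \<Delta> (2 * r * t) H) \<le> Pr ?X (\<lambda>_. p) (\<lambda>H. B1 H \<or> B2 H \<or> B3 H)"
  proof (rule Pr_mono[OF pr])
    fix H assume ng: "\<not> good_transversals q r N \<Delta> (2 * r * t) H"
    show "B1 H \<or> B2 H \<or> B3 H"
    proof (rule ccontr)
      assume n: "\<not> (B1 H \<or> B2 H \<or> B3 H)"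
      have "card (codeg r H a b) < 2 * r * t" if "a \<in> ?S" "b \<in> ?S" "a \<noteq> b" for a b
        using n that unfolding B3_def by (metis (mono_tags, lifting) SigmaI fst_conv snd_conv mem_Collect_eq not_less)
      moreover have "\<forall>g<q. \<exists>\<sigma>\<in>perm_tuples r N. matching r N g \<sigma> \<subseteq> H" using n unfolding B1_def by blast
      moreover have "\<forall>v\<in>?S. card (H \<inter> idx_at q r N v) < \<Delta>" using n unfolding B2_def by (meson not_le)
      ultimately show False using ng unfolding good_transversals_def by blast
    qed
  qed
  also have "\<dots> \<le> Pr ?X (\<lambda>_. p) B1 + (Pr ?X (\<lambda>_. p) B2 + Pr ?X (\<lambda>_. p) B3)"
    using pr by (intro order_trans[OF Pr_disj_le] add_left_mono) (auto intro: Pr_disj_le)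
  also have "Pr ?X (\<lambda>_. p) B1 \<le> real q * (4 ^ k / 2 ^ R)"
  proof -
    have "Pr ?X (\<lambda>_. p) B1 \<le> (\<Sum>g\<in>{..<q}. Pr ?X (\<lambda>_. p) (\<lambda>H. \<not> (\<exists>\<sigma>\<in>perm_tuples r N. matching r N g \<sigma> \<subseteq> H)))"
      unfolding B1_def using pr by (intro Pr_Bex_le) auto
    also have "\<dots> \<le> (\<Sum>g\<in>{..<q}. 4 ^ k / 2 ^ R)"
    proof (intro sum_mono)
      fix g assume g: "g \<in> {..<q}"
      show "Pr ?X (\<lambda>_. p) (\<lambda>H. \<not> (\<exists>\<sigma>\<in>perm_tuples r N. matching r N g \<sigma> \<subseteq> H)) \<le> 4 ^ k / 2 ^ R"
        unfolding p
      proof (rule spread_family_contained[OF finite_Idx])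
        show "spread_family (perm_tuples r N) (matching r N g) ((real N / exp 1) ^ (r - 1))"
          using r by (intro perm_tuples_spread) auto
        show "matching r N g \<sigma> \<subseteq> ?X" if "\<sigma> \<in> perm_tuples r N" for \<sigma>
          using that g by (intro matching_subset) auto
        show "card (matching r N g \<sigma>) < 2 ^ k" for \<sigma>
          using card_matching[of r N g \<sigma>] N by linarith
      qed (use q0 N in auto)
    qed
    finally show ?thesis by simp
  qed
  also have "Pr ?X (\<lambda>_. p) B2 \<le> real (q * r * N) * exp (2 * \<Lambda> - real \<Delta>)"
  proof -
    have "Pr ?X (\<lambda>_. p) B2 \<le> (\<Sum>v\<in>?S. Pr ?X (\<lambda>_. p) (\<lambda>H. \<Delta> \<le> card (H \<inter> idx_at q r N v)))"
      unfolding B2_def using pr by (intro Pr_Bex_le) auto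
    also have "\<dots> \<le> (\<Sum>v\<in>?S. exp (2 * \<Lambda> - real \<Delta>))" using p01 \<Lambda> by (intro sum_mono degree_tail) auto
    finally show ?thesis by (simp add: card_Slots)
  qed
  also have "Pr ?X (\<lambda>_. p) B3 \<le> (real (q * r * N))\<^sup>2 * ((\<Lambda> / real N) ^ t + fact t * exp (2 * \<Lambda>) * (real r * \<Lambda> / real N) ^ t)"
  proof -
    let ?P = "{ab\<in>?S \<times> ?S. fst ab \<noteq> snd ab}" and ?b = "(\<Lambda> / real N) ^ t + fact t * exp (2 * \<Lambda>) * (real r * \<Lambda> / real N) ^ t"
    have \<Lambda>0: "0 \<le> \<Lambda>" using \<Lambda> p01 by (meson mult_nonneg_nonneg of_nat_0_le_iff order_trans zero_le_power)
    have "Pr ?X (\<lambda>_. p) B3 \<le> (\<Sum>ab\<in>?P. Pr ?X (\<lambda>_. p) (\<lambda>H. 2 * r * t \<le> card (codeg r H (fst ab) (snd ab))))"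
      unfolding B3_def using pr by (intro Pr_Bex_le) auto
    also have "\<dots> \<le> (\<Sum>ab\<in>?P. ?b)" using p01 \<Lambda> r N by (intro sum_mono codegree_tail) auto
    also have "\<dots> = real (card ?P) * ?b" by simp
    also have "\<dots> \<le> real (card (?S \<times> ?S)) * ?b"
    proof (rule mult_right_mono)
      have "card ?P \<le> card (?S \<times> ?S)" by (intro card_mono) auto
      then show "real (card ?P) \<le> real (card (?S \<times> ?S))" by (rule of_nat_mono)
    qed (use \<Lambda>0 in auto)
    also have "real (card (?S \<times> ?S)) = (real (q * r * N))\<^sup>2" by (simp add: card_cartesian_product card_Slots power2_eq_square)
    finally show ?thesis .
  qed
  finally show ?thesis by simp
qed

definition covered_by :: "nat \<Rightarrow> tindex set \<Rightarrow> slot \<Rightarrow> slot \<Rightarrow> bool" where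
  "covered_by r H x y \<longleftrightarrow> (\<exists>h\<in>H. x \<in> slots r h \<and> y \<in> slots r h)"

text \<open>
  If all pairs of slots of \<open>j\<close> are covered and \<open>j\<close> shares two slots \<open>a\<close>, \<open>b\<close> with \<open>i\<close>, then its other slots
  are common neighbours of \<open>a\<close> and \<open>b\<close>.  So \<open>j\<close> lives on boundedly many slots.
\<close>

lemma card_forced_transversals:
  assumes r: "2 \<le> r" and H: "H \<subseteq> Idx q r N" and i: "i \<in> H"
    and K: "\<And>a b. a \<in> Slots q r N \<Longrightarrow> b \<in> Slots q r N \<Longrightarrow> a \<noteq> b \<Longrightarrow> card (codeg r H a b) < K"
  shows "card {j \<in> Idx q r N. (\<exists>a b. a \<noteq> b \<and> {a, b} \<subseteq> slots r i \<inter> slots r j) \<and>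
      (\<forall>x\<in>slots r j. \<forall>y\<in>slots r j. x \<noteq> y \<longrightarrow> covered_by r H x y)} \<le> 2 ^ (r + r\<^sup>2 * K)"
proof -
  define Z where "Z = slots r i \<union> (\<Union>a\<in>slots r i. \<Union>b\<in>slots r i - {a}. codeg r H a b)"
  have finH: "finite H" using H finite_Idx finite_subset by blast
  have finZ: "finite Z" unfolding Z_def using finite_codeg[OF finH] by auto
  have iI: "slots r i \<subseteq> Slots q r N" using slots_subset H i by blast
  have cardZ: "card Z \<le> r + r\<^sup>2 * K"
  proof -
    have "card (\<Union>a\<in>slots r i. \<Union>b\<in>slots r i - {a}. codeg r H a b) \<le> (\<Sum>a\<in>slots r i. card (\<Union>b\<in>slots r i - {a}. codeg r H a b))"
      by (rule card_UN_le) simp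
    also have "\<dots> \<le> (\<Sum>a\<in>slots r i. r * K)"
    proof (intro sum_mono)
      fix a assume a: "a \<in> slots r i"
      have "card (\<Union>b\<in>slots r i - {a}. codeg r H a b) \<le> (\<Sum>b\<in>slots r i - {a}. card (codeg r H a b))"
        by (rule card_UN_le) simp
      also have "\<dots> \<le> (\<Sum>b\<in>slots r i - {a}. K)"
        using a iI by (intro sum_mono less_imp_le K) auto
      also have "\<dots> \<le> r * K" using a by (simp add: card_Diff_singleton)
      finally show "card (\<Union>b\<in>slots r i - {a}. codeg r H a b) \<le> r * K" .
    qed
    also have "\<dots> = r\<^sup>2 * K" by (simp add: power2_eq_square)
    finally show ?thesis unfolding Z_def by (intro order_trans[OF card_Un_le]) simp
  qed
  let ?J = "{j \<in> Idx q r N. (\<exists>a b. a \<noteq> b \<and> {a, b} \<subseteq> slots r i \<inter> slots r j) \<and>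
      (\<forall>x\<in>slots r j. \<forall>y\<in>slots r j. x \<noteq> y \<longrightarrow> covered_by r H x y)}"
  have "card ?J \<le> card (Pow Z)"
  proof (rule card_inj_on_le[where f = "slots r"])
    show "inj_on (slots r) ?J"
    proof (rule inj_onI)
      fix i' j assume "i' \<in> ?J" "j \<in> ?J" "slots r i' = slots r j"
      then show "i' = j" using r slots_inj[of r i' q N j] by simp
    qed
    show "slots r ` ?J \<subseteq> Pow Z"
    proof
      fix Y assume "Y \<in> slots r ` ?J"
      then obtain j a b where Y: "Y = slots r j" and j0: "j \<in> Idx q r N" "a \<noteq> b" "{a, b} \<subseteq> slots r i \<inter> slots r j"
        and cov: "\<forall>x\<in>slots r j. \<forall>y\<in>slots r j. x \<noteq> y \<longrightarrow> covered_by r H x y"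
        by blast
      have "x \<in> Z" if j1: "x \<in> slots r j" for x
      proof (cases "x \<in> slots r i")
        case False
        then have "x \<noteq> a" "x \<noteq> b" using j0 by auto
        then have "covered_by r H a x" "covered_by r H b x" using cov j0 j1 by auto
        then have "x \<in> codeg r H a b" using \<open>x \<noteq> a\<close> \<open>x \<noteq> b\<close> by (auto simp: codeg_def covered_by_def)
        then show ?thesis using j0 by (auto simp: Z_def)
      qed (simp add: Z_def)
      then show "Y \<in> Pow Z" using Y by blast
    qed
  qed (use finZ in auto)
  also have "\<dots> = 2 ^ card Z" using finZ by (rule card_Pow)
  also have "\<dots> \<le> 2 ^ (r + r\<^sup>2 * K)" using cardZ by (intro power_increasing) auto
  finally show ?thesis .
qed

section \<open>Placing vertices into slots\<close>

text \<open>
  Greedy colouring with classes of size at most \<open>N\<close>: at most half of the \<open>q\<close> colours are full, and fewer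
  than half are used by neighbours.
\<close>

lemma bounded_class_coloring:
  assumes "finite X" and sym: "\<And>x y. adj x y \<Longrightarrow> adj y x"
    and deg: "\<And>x. x \<in> X \<Longrightarrow> card {y\<in>X. adj x y} \<le> d"
    and "2 * d < q" "2 * card X \<le> q * N" "1 \<le> N"
  shows "\<exists>g. g ` X \<subseteq> {..<q} \<and> (\<forall>x\<in>X. \<forall>y\<in>X. x \<noteq> y \<longrightarrow> adj x y \<longrightarrow> g x \<noteq> g y) \<and> (\<forall>c. card {x\<in>X. g x = c} \<le> (N::nat))"
  using assms(1) deg assms(5)
proof (induction X rule: finite_induct)
  case empty
  then show ?case by auto
next
  case (insert z X)
  have "card {y\<in>X. adj x y} \<le> d" if "x \<in> X" for x
  proof -
    have "card {y\<in>X. adj x y} \<le> card {y\<in>insert z X. adj x y}" using insert by (intro card_mono) auto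
    then show ?thesis using insert.prems(1)[of x] that by simp
  qed
  moreover have "2 * card X \<le> q * N" using insert by simp
  ultimately obtain g where g: "g ` X \<subseteq> {..<q}" "\<forall>x\<in>X. \<forall>y\<in>X. x \<noteq> y \<longrightarrow> adj x y \<longrightarrow> g x \<noteq> g y"
      "\<And>c. card {x\<in>X. g x = c} \<le> N" using insert.IH by blast
  define Full where "Full = {c\<in>{..<q}. card {x\<in>X. g x = c} = N}"
  define Nb where "Nb = g ` {y\<in>X. adj z y}"
  have "card Full * N = (\<Sum>c\<in>Full. card {x\<in>X. g x = c})" by (simp add: Full_def)
  also have "\<dots> = card (\<Union>c\<in>Full. {x\<in>X. g x = c})"
    using insert by (intro card_UN_disjoint[symmetric]) (auto simp: Full_def)
  also have "\<dots> \<le> card X" using insert by (intro card_mono) auto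
  finally have "2 * (card Full * N) \<le> q * N" using \<open>2 * card X \<le> q * N\<close> by linarith
  then have "(2 * card Full) * N \<le> q * N" by (simp add: mult.assoc)
  then have F: "2 * card Full \<le> q" using \<open>1 \<le> N\<close> by simp
  have "card Nb \<le> card {y\<in>X. adj z y}" unfolding Nb_def using insert by (intro card_image_le) auto
  also have "\<dots> \<le> card {y\<in>insert z X. adj z y}" using insert by (intro card_mono) auto
  also have "\<dots> \<le> d" using insert.prems by simp
  finally have "card (Full \<union> Nb) < q" using F \<open>2 * d < q\<close> card_Un_le[of Full Nb] by linarith
  moreover have "finite (Full \<union> Nb)" using insert by (auto simp: Full_def Nb_def)
  ultimately have "\<not> {..<q} \<subseteq> Full \<union> Nb" by (metis card_lessThan card_mono leD)
  then obtain c where c: "c < q" "c \<notin> Full" "c \<notin> Nb" by auto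
  define g' where "g' = g(z := c)"
  have g'X: "g' x = g x" if "x \<in> X" for x using that insert by (auto simp: g'_def)
  have "g' ` insert z X \<subseteq> {..<q}" using g(1) c by (auto simp: g'_def)
  moreover have "\<forall>x\<in>insert z X. \<forall>y\<in>insert z X. x \<noteq> y \<longrightarrow> adj x y \<longrightarrow> g' x \<noteq> g' y"
  proof (intro ballI impI)
    fix x y assume xy: "x \<in> insert z X" "y \<in> insert z X" "x \<noteq> y" "adj x y"
    consider "x \<in> X" "y \<in> X" | "x = z" "y \<in> X" | "y = z" "x \<in> X" using xy by auto
    then show "g' x \<noteq> g' y"
    proof cases
      case 1
      then show ?thesis using g(2) xy g'X by auto
    next
      case 2
      then have "g y \<in> Nb" using xy by (auto simp: Nb_def)
      then show ?thesis using 2 c g'X by (auto simp: g'_def)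
    next
      case 3
      then have "g x \<in> Nb" using xy sym by (auto simp: Nb_def)
      then show ?thesis using 3 c g'X by (auto simp: g'_def)
    qed
  qed
  moreover have "card {x\<in>insert z X. g' x = c'} \<le> N" for c'
  proof (cases "c' = c")
    case True
    have "{x\<in>insert z X. g' x = c'} = insert z {x\<in>X. g x = c}" using True g'X by (auto simp: g'_def)
    moreover have "card {x\<in>X. g x = c} < N" using c g(3)[of c] by (auto simp: Full_def)
    ultimately show ?thesis using insert by simp
  next
    case False
    then have "{x\<in>insert z X. g' x = c'} = {x\<in>X. g x = c'}" using g'X insert.hyps by (auto simp: g'_def)
    then show ?thesis using g(3) by simp
  qed
  ultimately show ?case by blast
qed

text \<open>
  The vertices of \<open>X\<close> are put into the first part of the group named by their colour, and all other slots
  are filled with vertices outside \<open>X\<close>.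
\<close>

lemma slot_assignment:
  assumes "finite V'" "X \<subseteq> V'" "1 \<le> r" and g: "g ` X \<subseteq> {..<q}" "\<And>c. card {x\<in>X. g x = c} \<le> N"
    and sz: "q * r * N \<le> card V'"
  shows "\<exists>vtx. inj_on vtx (Slots q r N) \<and> vtx ` Slots q r N \<subseteq> V' \<and>
     (\<forall>s\<in>Slots q r N. vtx s \<in> X \<longrightarrow> fst (snd s) = 0 \<and> fst s = g (vtx s))"
proof -
  have finX: "finite X" using finite_subset[OF assms(2,1)] .
  have "\<exists>h. inj_on h {x\<in>X. g x = c} \<and> h ` {x\<in>X. g x = c} \<subseteq> {..<N}" for c
  proof -
    have "card {x\<in>X. g x = c} \<le> card {..<N}" using g(2) by simp
    then show ?thesis using finX card_le_inj[of "{x\<in>X. g x = c}" "{..<N}"] by auto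
  qed
  then obtain h where h: "\<And>c. inj_on (h c) {x\<in>X. g x = c}" "\<And>c. h c ` {x\<in>X. g x = c} \<subseteq> {..<N}" by metis
  define \<iota> where "\<iota> x = (g x, 0::nat, h (g x) x)" for x
  have inj\<iota>: "inj_on \<iota> X"
  proof (rule inj_onI)
    fix x y assume "x \<in> X" "y \<in> X" "\<iota> x = \<iota> y"
    then show "x = y" using h(1)[of "g x"] by (auto simp: \<iota>_def inj_on_def)
  qed
  have \<iota>S: "\<iota> ` X \<subseteq> Slots q r N"
    using g(1) h(2) \<open>1 \<le> r\<close> by (fastforce simp: \<iota>_def Slots_def)
  have "card (Slots q r N - \<iota> ` X) \<le> card (V' - X)"
    using inj\<iota> \<iota>S finX assms(1,2) sz by (simp add: card_Diff_subset card_image card_Slots)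
  then obtain h2 where h2: "inj_on h2 (Slots q r N - \<iota> ` X)" "h2 ` (Slots q r N - \<iota> ` X) \<subseteq> V' - X"
    using card_le_inj[of "Slots q r N - \<iota> ` X" "V' - X"] assms(1) by auto
  define vtx where "vtx s = (if s \<in> \<iota> ` X then inv_into X \<iota> s else h2 s)" for s
  have v1: "vtx (\<iota> x) = x" if "x \<in> X" for x using that inj\<iota> by (auto simp: vtx_def)
  have v2: "vtx s = h2 s" "vtx s \<in> V' - X" if "s \<in> Slots q r N - \<iota> ` X" for s
    using that h2(2) by (auto simp: vtx_def)
  have cases: "(\<exists>x\<in>X. s = \<iota> x) \<or> s \<in> Slots q r N - \<iota> ` X" if "s \<in> Slots q r N" for s using that by auto
  have "inj_on vtx (Slots q r N)"
  proof (rule inj_onI)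
    fix s t assume st: "s \<in> Slots q r N" "t \<in> Slots q r N" "vtx s = vtx t"
    show "s = t"
      using cases[OF st(1)] cases[OF st(2)]
    proof (elim disjE bexE)
      assume "s \<in> Slots q r N - \<iota> ` X" "t \<in> Slots q r N - \<iota> ` X"
      then show "s = t" using st(3) v2(1) h2(1) by (auto simp: inj_on_def)
    next
      fix x assume "t \<in> Slots q r N - \<iota> ` X" "x \<in> X" "s = \<iota> x"
      then show "s = t" using st(3) v1[of x] v2(2)[of t] by auto
    next
      fix x assume "s \<in> Slots q r N - \<iota> ` X" "x \<in> X" "t = \<iota> x"
      then show "s = t" using st(3) v1[of x] v2(2)[of s] by auto
    qed (use st(3) v1 in auto)
  qed
  moreover have "vtx ` Slots q r N \<subseteq> V'"
  proof (rule image_subsetI)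
    fix s assume "s \<in> Slots q r N"
    from cases[OF this] show "vtx s \<in> V'"
    proof (elim disjE bexE)
      fix x assume "x \<in> X" "s = \<iota> x"
      then show ?thesis using v1 assms(2) by auto
    qed (use v2(2) in auto)
  qed
  moreover have "\<forall>s\<in>Slots q r N. vtx s \<in> X \<longrightarrow> fst (snd s) = 0 \<and> fst s = g (vtx s)"
  proof (intro ballI impI)
    fix s assume s: "s \<in> Slots q r N" "vtx s \<in> X"
    then obtain x where "x \<in> X" "s = \<iota> x" using cases[OF s(1)] v2(2)[of s] by auto
    then show "fst (snd s) = 0 \<and> fst s = g (vtx s)" using v1 by (auto simp: \<iota>_def)
  qed
  ultimately show ?thesis by blast
qed

lemma expect_image:
  assumes "finite E" "inj_on \<phi> E"
  shows "expect (\<phi> ` E) pr f = expect E (pr \<circ> \<phi>) (\<lambda>A. f (\<phi> ` A))"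
  using assms
proof (induction E arbitrary: f rule: finite_induct)
  case (insert e E)
  then have "\<phi> e \<notin> \<phi> ` E" "inj_on \<phi> E" by (auto simp: inj_on_def)
  with insert.hyps insert.IH show ?case by (simp add: expect_insert)
qed simp

text \<open>
  \<open>K\<close> is the set of all \<open>(r + 1)\<close>-cliques on which one conditions; \<open>closed\<close> says that their edges
  form no further \<open>(r + 1)\<close>-clique.  Slots carry distinct vertices.  The last two assumptions make
  conditioned edges and edges of transversals incompatible with a common new \<open>(r + 1)\<close>-clique.
\<close>

locale transversal_setup =
  fixes V :: "'a set" and K :: "'a set set" and r q N :: nat and vtx :: "slot \<Rightarrow> 'a"
  assumes finV: "finite V" and r2: "2 \<le> r" and KV: "K \<subseteq> nsets V (r + 1)"
    and closed: "\<And>J. J \<in> nsets V (r + 1) \<Longrightarrow> nsets J 2 \<subseteq> (\<Union>J\<in>K. nsets J 2) \<Longrightarrow> J \<in> K"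
    and inj: "inj_on vtx (Slots q r N)" and vtxV: "vtx ` Slots q r N \<subseteq> V"
    and part0: "\<And>a. a \<in> Slots q r N \<Longrightarrow> vtx a \<in> \<Union>K \<Longrightarrow> fst (snd a) = 0"
    and groups: "\<And>a b. a \<in> Slots q r N \<Longrightarrow> b \<in> Slots q r N \<Longrightarrow> {vtx a, vtx b} \<in> (\<Union>J\<in>K. nsets J 2) \<Longrightarrow> fst a \<noteq> fst b"
begin

definition R0 :: "'a set set" where "R0 = (\<Union>J\<in>K. nsets J 2)"

definition verts :: "tindex \<Rightarrow> 'a set" where "verts i = vtx ` slots r i"

definition hedges :: "tindex \<Rightarrow> 'a set set" where "hedges i = nsets (verts i) 2"

lemma finite_verts [simp]: "finite (verts i)" by (simp add: verts_def)

lemma card_verts: "i \<in> Idx q r N \<Longrightarrow> card (verts i) = r"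
  unfolding verts_def using inj slots_subset[of i q r N] by (subst card_image) (auto intro: inj_on_subset)

lemma verts_subset: "i \<in> Idx q r N \<Longrightarrow> verts i \<subseteq> V"
  unfolding verts_def using vtxV slots_subset[of i q r N] by auto

lemma verts_nsets: "i \<in> Idx q r N \<Longrightarrow> verts i \<in> nsets V r"
  by (simp add: nsets_def card_verts verts_subset)

lemma verts_inj: "inj_on verts (Idx q r N)"
proof (rule inj_onI)
  fix i j assume ij: "i \<in> Idx q r N" "j \<in> Idx q r N" "verts i = verts j"
  then have "slots r i = slots r j"
    unfolding verts_def using inj_on_image_eq_iff[OF inj] slots_subset[OF ij(1)] slots_subset[OF ij(2)] by blast
  then show "i = j" using slots_inj[of r i q N j] ij r2 by simp
qed

lemma hedges_subset: "i \<in> Idx q r N \<Longrightarrow> hedges i \<subseteq> nsets V 2"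
  unfolding hedges_def by (rule nsets_mono) (rule verts_subset)

lemma card_hedges: "i \<in> Idx q r N \<Longrightarrow> card (hedges i) = r choose 2"
  unfolding hedges_def by (simp add: card_nsets card_verts)

lemma hedges_pair:
  assumes "i \<in> Idx q r N" "a \<in> Slots q r N" "b \<in> Slots q r N" "{vtx a, vtx b} \<in> hedges i"
  shows "a \<in> slots r i \<and> b \<in> slots r i \<and> fst a = fst b \<and> fst (snd a) \<noteq> fst (snd b)"
proof -
  have m: "x \<in> slots r i" if x: "x \<in> Slots q r N" "vtx x \<in> verts i" for x
  proof -
    obtain y where "y \<in> slots r i" "vtx x = vtx y" using x(2) unfolding verts_def by auto
    then show ?thesis using inj x(1) slots_subset[OF assms(1)] by (auto simp: inj_on_def)
  qed
  have "vtx a \<noteq> vtx b" "vtx a \<in> verts i" "vtx b \<in> verts i" using assms(4) unfolding hedges_def by auto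
  then have "a \<noteq> b" "a \<in> slots r i" "b \<in> slots r i" using m assms(2,3) by auto
  then show ?thesis by (auto simp: slots_def)
qed

lemma hedges_slots:
  assumes "i \<in> Idx q r N" "e \<in> hedges i"
  obtains a b where "e = {vtx a, vtx b}" "a \<in> slots r i" "b \<in> slots r i" "a \<noteq> b" "a \<in> Slots q r N" "b \<in> Slots q r N"
proof -
  obtain x y where xy: "e = {x, y}" "x \<in> verts i" "y \<in> verts i" "x \<noteq> y"
    using assms(2) unfolding hedges_def by (auto elim!: nsets2_E)
  then obtain a b where "x = vtx a" "y = vtx b" "a \<in> slots r i" "b \<in> slots r i" unfolding verts_def by auto
  then show ?thesis using that[of a b] xy slots_subset[OF assms(1)] by auto
qed

lemma hedges_disjoint_R0: "i \<in> Idx q r N \<Longrightarrow> hedges i \<inter> R0 = {}"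
proof (rule ccontr)
  assume i: "i \<in> Idx q r N" and "hedges i \<inter> R0 \<noteq> {}"
  then obtain e where e: "e \<in> hedges i" "e \<in> R0" by auto
  obtain a b where ab: "e = {vtx a, vtx b}" "a \<in> Slots q r N" "b \<in> Slots q r N" using hedges_slots[OF i e(1)] by metis
  then have "fst a = fst b" using hedges_pair[OF i] e by auto
  then show False using groups[OF ab(2,3)] e(2) ab(1) by (auto simp: R0_def)
qed

lemma R0_vertices: "{x, y} \<in> R0 \<Longrightarrow> x \<in> \<Union>K"
  by (auto simp: R0_def nsets_def)

text \<open>
  Suppose that \<open>J\<close> uses an edge of a transversal and is covered.  That edge has an end \<open>b\<close> outside the
  first part, which touches no clique of \<open>K\<close>.  So every vertex of \<open>J\<close> is joined to \<open>b\<close> by a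
  transversal and lies in the group of \<open>b\<close>.  Inside a group there are no conditioned edges, so the vertices
  of \<open>J\<close> lie in different parts; but there are only \<open>r\<close> parts.
\<close>

lemma no_forced_clique:
  assumes J: "J \<in> nsets V (r + 1)" and H: "H \<subseteq> Idx q r N" and cov: "nsets J 2 \<subseteq> R0 \<union> \<Union>(hedges ` H)"
    and e: "e \<in> nsets J 2" "e \<in> hedges i" "i \<in> Idx q r N"
  shows False
proof -
  obtain a b where ab: "e = {vtx a, vtx b}" "a \<in> Slots q r N" "b \<in> Slots q r N" using hedges_slots[OF e(3,2)] by metis
  have p: "fst (snd a) \<noteq> fst (snd b)" using hedges_pair[OF e(3) ab(2,3)] e ab by auto
  obtain b where b: "b \<in> Slots q r N" "vtx b \<in> J" "fst (snd b) \<noteq> 0"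
  proof (cases "fst (snd a) = 0")
    case True
    then show ?thesis using that[of b] ab p e by auto
  next
    case False
    then show ?thesis using that[of a] ab e by auto
  qed
  have untouched: "vtx b \<notin> \<Union>K" using part0[OF b(1)] b(3) by auto
  have J': "finite J" "card J = r + 1" "J \<subseteq> V" using J by (auto simp: nsets_def)
  have other: "\<exists>c\<in>Slots q r N. w = vtx c \<and> fst c = fst b" if w: "w \<in> J" for w
  proof (cases "w = vtx b")
    case False
    then have wb: "{w, vtx b} \<in> nsets J 2" using w b by auto
    moreover have "{w, vtx b} \<notin> R0" using R0_vertices[of "vtx b" w] untouched by (auto simp: insert_commute)
    ultimately obtain h where h: "h \<in> H" "{w, vtx b} \<in> hedges h" using cov by blast
    then have hI: "h \<in> Idx q r N" using H by auto
    obtain c d where cd: "{w, vtx b} = {vtx c, vtx d}" "c \<in> Slots q r N" "d \<in> Slots q r N" using hedges_slots[OF hI h(2)] by metis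
    then have "w = vtx c \<or> w = vtx d" by auto
    then obtain c where c: "w = vtx c" "c \<in> Slots q r N" using cd(2,3) by blast
    then show ?thesis using hedges_pair[OF hI c(2) b(1)] h by auto
  qed (use b in auto)
  define C where "C = {c\<in>Slots q r N. vtx c \<in> J}"
  have finC: "finite C" by (simp add: C_def)
  have "J \<subseteq> vtx ` C" using other by (fastforce simp: C_def)
  then have "card J \<le> card C" using finC by (meson card_image_le card_mono finite_imageI order_trans)
  have Cg: "fst c = fst b" if c: "c \<in> C" for c
  proof -
    have "vtx c \<in> J" "c \<in> Slots q r N" using c by (auto simp: C_def)
    then show ?thesis using other[of "vtx c"] inj by (metis inj_on_def)
  qed
  have "inj_on (\<lambda>c. fst (snd c)) C"
  proof (rule inj_onI)
    fix c d assume cd: "c \<in> C" "d \<in> C" "fst (snd c) = fst (snd d)"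
    show "c = d"
    proof (rule ccontr)
      assume "c \<noteq> d"
      have S: "c \<in> Slots q r N" "d \<in> Slots q r N" using cd by (auto simp: C_def)
      then have "vtx c \<noteq> vtx d" using inj \<open>c \<noteq> d\<close> by (auto simp: inj_on_def)
      then have "{vtx c, vtx d} \<in> nsets J 2" using cd by (auto simp: C_def)
      then consider "{vtx c, vtx d} \<in> R0" | h where "h \<in> H" "{vtx c, vtx d} \<in> hedges h" using cov by blast
      then show False
      proof cases
        case 1
        then show False using groups[OF S] Cg cd by (auto simp: R0_def)
      next
        case 2
        then show False using hedges_pair[of h c d] H S cd(3) by auto
      qed
    qed
  qed
  moreover have "(\<lambda>c. fst (snd c)) ` C \<subseteq> {..<r}" by (auto simp: C_def Slots_def)
  ultimately have "card C \<le> r" by (metis card_inj_on_le card_lessThan finite_lessThan)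
  then show False using \<open>card J \<le> card C\<close> J' by simp
qed

text \<open>
  Conditioned edges never lie inside a transversal, so only other transversals can cover its pairs.
\<close>

lemma forced_covered:
  assumes i: "i \<in> Idx q r N" and H: "H \<subseteq> Idx q r N" and cov: "hedges i \<subseteq> R0 \<union> \<Union>(hedges ` H)"
    and xy: "x \<in> slots r i" "y \<in> slots r i" "x \<noteq> y"
  shows "covered_by r H x y"
proof -
  have S: "x \<in> Slots q r N" "y \<in> Slots q r N" using xy slots_subset[OF i] by auto
  then have "vtx x \<noteq> vtx y" using inj xy by (auto simp: inj_on_def)
  then have e: "{vtx x, vtx y} \<in> hedges i" using xy by (auto simp: hedges_def verts_def)
  then have "{vtx x, vtx y} \<notin> R0" using hedges_disjoint_R0[OF i] by auto
  then obtain h where "h \<in> H" "{vtx x, vtx y} \<in> hedges h" using cov e by blast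
  then show ?thesis using hedges_pair[of h x y] H S by (auto simp: covered_by_def)
qed

text \<open>
  Conditioned edges contribute the clique neighbours, transversals \<open>r\<close> vertices each.
\<close>

lemma degree_bound:
  assumes H: "H \<subseteq> Idx q r N" and d0: "\<And>v. v \<in> V \<Longrightarrow> card (clique_nbrs K v) \<le> d0"
    and d1: "\<And>s. s \<in> Slots q r N \<Longrightarrow> card (H \<inter> idx_at q r N s) < d1" and v: "v \<in> V"
  shows "card {u\<in>V. {u, v} \<in> R0 \<union> \<Union>(hedges ` H)} \<le> d0 + r * d1"
proof -
  have finH: "finite H" using H finite_Idx finite_subset by blast
  have finK: "finite K" using KV finite_imp_finite_nsets[OF finV] finite_subset by blast
  define B where "B = \<Union>(verts ` {h\<in>H. v \<in> verts h})"
  have "{u\<in>V. {u, v} \<in> R0 \<union> \<Union>(hedges ` H)} \<subseteq> clique_nbrs K v \<union> B"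
    by (auto simp: R0_def clique_nbrs_def B_def hedges_def nsets_def)
  then have "card {u\<in>V. {u, v} \<in> R0 \<union> \<Union>(hedges ` H)} \<le> card (clique_nbrs K v \<union> B)"
    using KV finK finH by (intro card_mono) (auto simp: clique_nbrs_def B_def nsets_def)
  also have "\<dots> \<le> card (clique_nbrs K v) + card B" by (rule card_Un_le)
  also have "card B \<le> r * d1"
  proof (cases "v \<in> vtx ` Slots q r N")
    case True
    then obtain s where s: "s \<in> Slots q r N" "v = vtx s" by auto
    have sub: "{h\<in>H. v \<in> verts h} \<subseteq> H \<inter> idx_at q r N s"
    proof
      fix h assume h: "h \<in> {h\<in>H. v \<in> verts h}"
      then obtain t where "t \<in> slots r h" "vtx t = vtx s" using s by (auto simp: verts_def)
      moreover have "h \<in> Idx q r N" using h H by auto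
      ultimately have "s \<in> slots r h" using inj s slots_subset[of h q r N] by (auto simp: inj_on_def)
      then show "h \<in> H \<inter> idx_at q r N s" using h \<open>h \<in> Idx q r N\<close> by (auto simp: idx_at_def)
    qed
    have "card B \<le> (\<Sum>h\<in>{h\<in>H. v \<in> verts h}. card (verts h))"
      unfolding B_def using finH by (intro card_UN_le) auto
    also have "\<dots> = (\<Sum>h\<in>{h\<in>H. v \<in> verts h}. r)" using H by (intro sum.cong refl card_verts) auto
    also have "\<dots> = card {h\<in>H. v \<in> verts h} * r" by simp
    also have "\<dots> \<le> card (H \<inter> idx_at q r N s) * r" using sub finH by (intro mult_le_mono1 card_mono) auto
    also have "\<dots> \<le> d1 * r" using d1[OF s(1)] by (intro mult_le_mono1) auto
    finally show ?thesis by (simp add: mult.commute)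
  next
    case False
    then have "{h\<in>H. v \<in> verts h} = {}" using H slots_subset by (fastforce simp: verts_def)
    then show ?thesis unfolding B_def by (simp only: image_empty Union_empty card.empty)
  qed
  finally show ?thesis using d0[OF v] by simp
qed

lemma matchings_give_packing:
  assumes \<sigma>: "\<And>g. g < q \<Longrightarrow> \<sigma> g \<in> perm_tuples r N"
  defines "\<S> \<equiv> verts ` (\<Union>g<q. matching r N g (\<sigma> g))"
  shows "disjoint \<S>" "\<Union>\<S> = vtx ` Slots q r N"
proof -
  have mI: "matching r N g (\<sigma> g) \<subseteq> Idx q r N" if "g < q" for g using matching_subset[OF \<sigma>[OF that] that] .
  have perm: "\<sigma> g k permutes {..<N}" if "g < q" "k \<in> {1..<r}" for g k
    using \<sigma>[OF that(1)] that(2) by (auto simp: perm_tuples_def PiE_def Pi_def)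
  have slot_disj: "i = j"
    if ij: "i \<in> matching r N g (\<sigma> g)" "j \<in> matching r N g' (\<sigma> g')" and gq: "g < q" "g' < q" and s: "s \<in> slots r i" "s \<in> slots r j" for i j g g' s
  proof -
    obtain x y where xy: "i = (g, matching_row r (\<sigma> g) x)" "j = (g', matching_row r (\<sigma> g') y)" using ij by (auto simp: matching_def)
    obtain k where k: "k < r" "s = (fst i, k, snd i k)" using s(1) by (auto simp: slots_def)
    then have "(fst i, k, snd i k) \<in> slots r j" using s by simp
    then have e: "g = g'" "matching_row r (\<sigma> g) x k = matching_row r (\<sigma> g) y k" using xy by (auto simp: mem_slots)
    have "x = y"
    proof (cases "k = 0")
      case True
      then show ?thesis using e k by (simp add: matching_row_def)
    next
      case False
      then have "\<sigma> g k x = \<sigma> g k y" using e k by (simp add: matching_row_def)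
      then show ?thesis using permutes_inj[OF perm[of g k]] gq k False by (auto simp: inj_on_def)
    qed
    then show ?thesis using xy e by simp
  qed
  show "disjoint \<S>"
  proof (rule disjointI)
    fix A B assume AB: "A \<in> \<S>" "B \<in> \<S>" "A \<noteq> B"
    then obtain i j g g' where ij: "A = verts i" "B = verts j" "g < q" "g' < q" "i \<in> matching r N g (\<sigma> g)" "j \<in> matching r N g' (\<sigma> g')"
      unfolding \<S>_def by blast
    have I: "i \<in> Idx q r N" "j \<in> Idx q r N" using ij mI by auto
    show "A \<inter> B = {}"
    proof (rule ccontr)
      assume "A \<inter> B \<noteq> {}"
      then obtain s t where "s \<in> slots r i" "t \<in> slots r j" "vtx s = vtx t" using ij by (auto simp: verts_def)
      then have "s \<in> slots r i" "s \<in> slots r j" using inj slots_subset[OF I(1)] slots_subset[OF I(2)] by (auto simp: inj_on_def)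
      then have "i = j" using slot_disj[OF ij(5,6,3,4)] by blast
      then show False using AB(3) ij by simp
    qed
  qed
  show "\<Union>\<S> = vtx ` Slots q r N"
  proof
    show "\<Union>\<S> \<subseteq> vtx ` Slots q r N" using mI slots_subset by (fastforce simp: \<S>_def verts_def)
    show "vtx ` Slots q r N \<subseteq> \<Union>\<S>"
    proof
      fix v assume "v \<in> vtx ` Slots q r N"
      then obtain g k x where s: "v = vtx (g, k, x)" "g < q" "k < r" "x < N" by (auto simp: Slots_def)
      obtain y where y: "y < N" "matching_row r (\<sigma> g) y k = x"
      proof (cases "k = 0")
        case True
        then show ?thesis using that[of x] s by (simp add: matching_row_def)
      next
        case False
        then have "\<sigma> g k ` {..<N} = {..<N}" using permutes_image[OF perm[of g k]] s by auto
        then obtain y where "y < N" "\<sigma> g k y = x" using s(4) by (metis imageE lessThan_iff)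
        then show ?thesis using that[of y] False s by (simp add: matching_row_def)
      qed
      have "(g, k, x) \<in> slots r (g, matching_row r (\<sigma> g) y)" using y s by (simp add: mem_slots)
      then show "v \<in> \<Union>\<S>" using s y unfolding \<S>_def verts_def matching_def by blast
    qed
  qed
qed

end

section \<open>Transversals given all larger cliques\<close>

lemma Pr_Inl_marginal:
  fixes E :: "'a set" and X :: "'b set"
  assumes "finite E" "finite X"
  shows "Pr (Inl ` E \<union> Inr ` X) (case_sum (\<lambda>_. p) (\<lambda>_. c)) (\<lambda>A. P (Inl -` A)) = Pr E (\<lambda>_. p) P"
proof -
  have "Pr (Inl ` E \<union> Inr ` X) (case_sum (\<lambda>_. p) (\<lambda>_. c)) (\<lambda>A. P (Inl -` A))
     = expect (Inl ` E) (case_sum (\<lambda>_. p) (\<lambda>_. c)) (\<lambda>A. expect (Inr ` X) (case_sum (\<lambda>_. p) (\<lambda>_. c)) (\<lambda>B. of_bool (P (Inl -` (A \<union> B)))))"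
    unfolding Pr_def using assms by (intro expect_union) auto
  also have "\<dots> = expect (Inl ` E) (case_sum (\<lambda>_. p) (\<lambda>_. c)) (\<lambda>A. expect (Inr ` X :: ('a + 'b) set) (case_sum (\<lambda>_. p) (\<lambda>_. c)) (\<lambda>B. of_bool (P (Inl -` (A :: ('a + 'b) set)))))"
  proof (intro expect_cong)
    fix A B :: "('a + 'b) set" assume "B \<subseteq> Inr ` X"
    then have "Inl -` (A \<union> B) = Inl -` A" by auto
    then show "of_bool (P (Inl -` (A \<union> B))) = of_bool (P (Inl -` A))" by simp
  qed
  also have "\<dots> = expect (Inl ` E) (case_sum (\<lambda>_. p) (\<lambda>_. c)) (\<lambda>A. of_bool (P (Inl -` (A :: ('a + 'b) set))))"
    using assms by (simp add: expect_const)
  also have "\<dots> = Pr E (\<lambda>_. p) P"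
    using assms by (subst expect_image) (auto simp: Pr_def inj_vimage_image_eq comp_def)
  finally show ?thesis .
qed

text \<open>
  The random objects are the edges, with probability \<open>p\<close>, and one bit for each index, with probability
  \<open>c\<close>.  Here \<open>D\<close> bounds degrees in the exposed graph, and \<open>\<xi>\<close> is a common small upper bound for the expected
  number of ways to complete a nontrivial partial clique (\<open>sparse1\<close>, \<open>sparse2\<close>, \<open>p\<xi>\<close>).
\<close>

locale transversal_coupling = transversal_setup V K r q N vtx
  for V :: "'a set" and K :: "'a set set" and r q N :: nat and vtx :: "slot \<Rightarrow> 'a" +
  fixes p c n D \<xi> :: real and d0 d1 K1 :: nat
  assumes p: "0 < p" "p \<le> 1" and c: "0 < c" "c \<le> 1"
    and n: "real (card V) \<le> n" and D: "1 \<le> D" "real ((r + 1) * (d0 + r * d1)) \<le> D"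
    and nbrs: "\<And>v. v \<in> V \<Longrightarrow> card (clique_nbrs K v) \<le> d0"
    and dense: "\<And>b. 1 \<le> b \<Longrightarrow> b \<le> r \<Longrightarrow> 1 \<le> n ^ (b - 1) * p ^ (b choose 2)"
    and sparse1: "\<And>b. 2 \<le> b \<Longrightarrow> b \<le> r \<Longrightarrow>
        p ^ (b * (r + 1 - b)) * (fact r * D ^ (r\<^sup>2) * (n ^ (r + 1 - b) * p ^ ((r + 1 - b) choose 2))) \<le> \<xi>"
    and sparse2: "\<And>b. 2 \<le> b \<Longrightarrow> b < r \<Longrightarrow>
        c * (p ^ (b * (r - b)) * (fact r * D ^ (r\<^sup>2) * (n ^ (r - b) * p ^ ((r - b) choose 2)))) \<le> \<xi>"
    and p\<xi>: "p \<le> \<xi>"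
    and small1: "real (r choose 2) * (real r * D ^ r * \<xi>) \<le> 1 / 8"
    and small2: "c * 2 ^ (r + r\<^sup>2 * K1) \<le> 1 / 4"
begin

text \<open>
  The event tested at index \<open>i\<close>: the transversal is complete and its bit is set.
\<close>

definition lift :: "tindex \<Rightarrow> ('a set + tindex) set" where
  "lift i = Inl ` hedges i \<union> {Inr i}"

definition G :: "('a set + tindex) set" where
  "G = Inl ` nsets V 2 \<union> Inr ` Idx q r N"

definition gpr :: "'a set + tindex \<Rightarrow> real" where
  "gpr = case_sum (\<lambda>_. p) (\<lambda>_. c)"

definition \<N> :: "('a set + tindex) set set" where
  "\<N> = (\<lambda>J. Inl ` nsets J 2) ` (nsets V (r + 1) - K)"

lemma finite_G: "finite G"
  using finV by (simp add: G_def finite_imp_finite_nsets)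

lemma is_prob_gpr: "is_prob gpr"
  using p c by (auto simp: is_prob_def gpr_def split: sum.split)

lemma lift_subset: "i \<in> Idx q r N \<Longrightarrow> lift i \<subseteq> G"
  using hedges_subset[of i] by (auto simp: lift_def G_def)

lemma \<xi>_nonneg: "0 \<le> \<xi>"
  using p\<xi> p by simp

text \<open>
  The expected numbers of completions of \<open>(r + 1)\<close>-sets and, weighted with the bit, of \<open>r\<close>-sets through a
  pair \<open>e\<close>.  Sets that are already covered have to be excluded; they are handled by \<open>no_forced_clique\<close>
  and \<open>card_forced_transversals\<close>.
\<close>

lemma uncovered_sums:
  assumes H: "H \<subseteq> Idx q r N" and deg: "\<And>s. s \<in> Slots q r N \<Longrightarrow> card (H \<inter> idx_at q r N s) < d1"
    and e: "e \<in> nsets V 2"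
  defines "\<Gamma> \<equiv> R0 \<union> \<Union>(hedges ` H)"
  shows "(\<Sum>S | S \<in> nsets V (r + 1) \<and> S \<in> {S. \<not> nsets S 2 \<subseteq> \<Gamma>} \<and> e \<subseteq> S. p ^ uncovered \<Gamma> S) \<le> real r * D ^ r * \<xi>"
    and "c * (\<Sum>S | S \<in> nsets V r \<and> S \<in> {S. \<not> nsets S 2 \<subseteq> \<Gamma>} \<and> e \<subseteq> S. p ^ uncovered \<Gamma> S) \<le> real r * D ^ r * \<xi>"
proof -
  have deg\<Gamma>: "card {u\<in>V. {u, v} \<in> \<Gamma>} \<le> d0 + r * d1" if "v \<in> V" for v
    unfolding \<Gamma>_def using degree_bound[OF H nbrs deg that] by simp
  have e': "e \<subseteq> V" "e \<noteq> {}" "card e = 2" using e by (auto simp: nsets_def)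
  have n0: "0 \<le> n" using n by linarith
  have psi: "(\<Sum>S\<in>nsets V m. p ^ uncovered \<Gamma> S) \<le> fact r * D ^ (r\<^sup>2) * (n ^ m * p ^ (m choose 2))" if "m \<le> r" for m
  proof -
    have "real (r * (d0 + r * d1)) \<le> real ((r + 1) * (d0 + r * d1))" by (intro of_nat_mono mult_le_mono1) auto
    then have rD: "real (r * (d0 + r * d1)) \<le> D" using D by linarith
    have "(\<Sum>S\<in>nsets V m. p ^ uncovered \<Gamma> S) \<le> fact m * D ^ (m\<^sup>2) * (n ^ m * p ^ (m choose 2))"
      by (rule sum_ksets_bound[OF finV n deg\<Gamma> p D(1) rD n0 dense that])
    also have "\<dots> \<le> fact r * D ^ (r\<^sup>2) * (n ^ m * p ^ (m choose 2))"
      using that D p n0 by (intro mult_right_mono mult_mono fact_mono power_increasing power_mono) auto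
    finally show ?thesis .
  qed
  have full: "p ^ uncovered \<Gamma> S \<le> p" if "S \<in> {S. \<not> nsets S 2 \<subseteq> \<Gamma>}" "finite S" for S
  proof -
    have "0 < uncovered \<Gamma> S"
      unfolding uncovered_def using that by (auto simp: card_gt_0_iff finite_imp_finite_nsets)
    then have "p ^ uncovered \<Gamma> S \<le> p ^ 1" using p by (intro power_decreasing) auto
    then show ?thesis by simp
  qed
  have \<xi>0: "0 \<le> \<xi>" by (rule \<xi>_nonneg)
  have "(\<Sum>S | S \<in> nsets V (r + 1) \<and> S \<in> {S. \<not> nsets S 2 \<subseteq> \<Gamma>} \<inter> Collect finite \<and> e \<subseteq> S. p ^ uncovered \<Gamma> S)
      \<le> real (r + 1 - card e + 1) * D ^ (r + 1 - card e) * \<xi>"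
  proof (rule sum_ksets_containing[OF finV deg\<Gamma> p D \<xi>0 e'(1,2)])
    show "p ^ (b * (r + 1 - b)) * (\<Sum>S\<in>nsets V (r + 1 - b). p ^ uncovered \<Gamma> S) \<le> \<xi>" if "card e \<le> b" "b < r + 1" for b
    proof -
      have "p ^ (b * (r + 1 - b)) * (\<Sum>S\<in>nsets V (r + 1 - b). p ^ uncovered \<Gamma> S)
         \<le> p ^ (b * (r + 1 - b)) * (fact r * D ^ (r\<^sup>2) * (n ^ (r + 1 - b) * p ^ ((r + 1 - b) choose 2)))"
        using p that e' by (intro mult_left_mono psi) auto
      also have "\<dots> \<le> \<xi>" using that e' by (intro sparse1) auto
      finally show ?thesis .
    qed
    show "p ^ uncovered \<Gamma> S \<le> \<xi>" if "S \<in> {S. \<not> nsets S 2 \<subseteq> \<Gamma>} \<inter> Collect finite" for S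
      using full[of S] that p\<xi> by auto
  qed (use e' r2 in auto)
  also have "\<dots> = real r * D ^ (r - 1) * \<xi>" using e' r2 by simp
  also have "\<dots> \<le> real r * D ^ r * \<xi>" using D \<xi>0 by (intro mult_right_mono mult_left_mono power_increasing) auto
  also have "{S. S \<in> nsets V (r + 1) \<and> S \<in> {S. \<not> nsets S 2 \<subseteq> \<Gamma>} \<inter> Collect finite \<and> e \<subseteq> S}
     = {S. S \<in> nsets V (r + 1) \<and> S \<in> {S. \<not> nsets S 2 \<subseteq> \<Gamma>} \<and> e \<subseteq> S}" by (auto simp: nsets_def)
  finally show "(\<Sum>S | S \<in> nsets V (r + 1) \<and> S \<in> {S. \<not> nsets S 2 \<subseteq> \<Gamma>} \<and> e \<subseteq> S. p ^ uncovered \<Gamma> S) \<le> real r * D ^ r * \<xi>" .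
  have "real (r * (d0 + r * d1)) \<le> real ((r + 1) * (d0 + r * d1))" by (intro of_nat_mono mult_le_mono1) auto
  then have rD: "real (r * (d0 + r * d1)) \<le> D" using D by linarith
  have \<xi>c: "0 \<le> \<xi> / c" using \<xi>0 c by simp
  have "(\<Sum>S | S \<in> nsets V r \<and> S \<in> {S. \<not> nsets S 2 \<subseteq> \<Gamma>} \<inter> Collect finite \<and> e \<subseteq> S. p ^ uncovered \<Gamma> S)
      \<le> real (r - card e + 1) * D ^ (r - card e) * (\<xi> / c)"
  proof (rule sum_ksets_containing[OF finV deg\<Gamma> p D(1) rD \<xi>c e'(1,2)])
    show "p ^ (b * (r - b)) * (\<Sum>S\<in>nsets V (r - b). p ^ uncovered \<Gamma> S) \<le> \<xi> / c" if "card e \<le> b" "b < r" for b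
    proof -
      have "p ^ (b * (r - b)) * (\<Sum>S\<in>nsets V (r - b). p ^ uncovered \<Gamma> S)
         \<le> p ^ (b * (r - b)) * (fact r * D ^ (r\<^sup>2) * (n ^ (r - b) * p ^ ((r - b) choose 2)))"
        using p that by (intro mult_left_mono psi) auto
      also have "\<dots> \<le> \<xi> / c" using sparse2[of b] that e' c by (simp add: field_simps)
      finally show ?thesis .
    qed
    show "p ^ uncovered \<Gamma> S \<le> \<xi> / c" if "S \<in> {S. \<not> nsets S 2 \<subseteq> \<Gamma>} \<inter> Collect finite" for S
    proof -
      have "p ^ uncovered \<Gamma> S \<le> \<xi>" using full[of S] that p\<xi> by auto
      also have "\<dots> \<le> \<xi> / c" using c \<xi>0 by (simp add: field_simps mult_left_le)
      finally show ?thesis .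
    qed
  qed (use e' r2 in auto)
  also have "\<dots> \<le> real r * D ^ r * (\<xi> / c)"
    using D \<xi>c e' r2 by (intro mult_right_mono mult_mono power_increasing) auto
  also have "{S. S \<in> nsets V r \<and> S \<in> {S. \<not> nsets S 2 \<subseteq> \<Gamma>} \<inter> Collect finite \<and> e \<subseteq> S}
     = {S. S \<in> nsets V r \<and> S \<in> {S. \<not> nsets S 2 \<subseteq> \<Gamma>} \<and> e \<subseteq> S}" by (auto simp: nsets_def)
  finally have "c * (\<Sum>S | S \<in> nsets V r \<and> S \<in> {S. \<not> nsets S 2 \<subseteq> \<Gamma>} \<and> e \<subseteq> S. p ^ uncovered \<Gamma> S) \<le> c * (real r * D ^ r * (\<xi> / c))"
    using c by (intro mult_left_mono) auto
  then show "c * (\<Sum>S | S \<in> nsets V r \<and> S \<in> {S. \<not> nsets S 2 \<subseteq> \<Gamma>} \<and> e \<subseteq> S. p ^ uncovered \<Gamma> S) \<le> real r * D ^ r * \<xi>"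
    using c by simp
qed

lemma sum_over_pairs_le:
  fixes f :: "'a set \<Rightarrow> real"
  assumes "finite \<A>" "\<And>S. S \<in> \<A> \<Longrightarrow> \<exists>e\<in>E. e \<subseteq> S" "finite E" "\<And>S. 0 \<le> f S"
    and "\<And>e. e \<in> E \<Longrightarrow> (\<Sum>S | S \<in> \<A> \<and> e \<subseteq> S. f S) \<le> b"
  shows "(\<Sum>S\<in>\<A>. f S) \<le> real (card E) * b"
proof -
  have "(\<Sum>S\<in>\<A>. f S) \<le> sum (\<lambda>(e, S). f S) (Sigma E (\<lambda>e. {S. S \<in> \<A> \<and> e \<subseteq> S}))"
    using assms by (intro sum_le_included[where i = snd]) fastforce+
  also have "\<dots> = (\<Sum>e\<in>E. \<Sum>S | S \<in> \<A> \<and> e \<subseteq> S. f S)" using assms by (subst sum.Sigma) auto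
  also have "\<dots> \<le> (\<Sum>e\<in>E. b)" using assms by (intro sum_mono) auto
  finally show ?thesis by simp
qed

text \<open>
  Three kinds of negative information meet the edges of \<open>i\<close>: \<open>(r + 1)\<close>-sets outside \<open>K\<close>, which
  by \<open>no_forced_clique\<close> are never covered; indices answered no that still have an uncovered pair; and covered
  indices answered no.  Of the last kind there are boundedly many, and each costs only its bit
  probability \<open>c\<close>, the reason for introducing the bits.
\<close>

lemma negative_information_small:
  assumes W: "W \<subseteq> Idx q r N" and Neg: "Neg \<subseteq> Idx q r N" and disj: "W \<inter> Neg = {}"
    and i: "i \<in> Idx q r N" "i \<notin> W" "i \<notin> Neg"
    and H: "H \<subseteq> Idx q r N" "good_transversals q r N d1 K1 H" "insert i W \<subseteq> H"
  defines "R \<equiv> Inl ` R0 \<union> \<Union>(lift ` W)"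
  shows "(\<Sum>F | F \<in> \<N> \<union> lift ` Neg \<and> F \<inter> (lift i - R) \<noteq> {}. \<Prod>x\<in>F - (R \<union> lift i). gpr x) \<le> 1 / 2"
proof -
  define \<Gamma> where "\<Gamma> = R0 \<union> \<Union>(hedges ` insert i W)"
  define w where "w F = (\<Prod>x\<in>F - (R \<union> lift i). gpr x)" for F
  have w0: "0 \<le> w F" for F unfolding w_def using is_prob_gpr by (intro prod_nonneg) (auto simp: is_probD)
  have iW: "insert i W \<subseteq> Idx q r N" using i W by auto
  have finH: "finite H" using H finite_Idx finite_subset by blast
  have deg: "card (insert i W \<inter> idx_at q r N s) < d1" if "s \<in> Slots q r N" for s
  proof -
    have "card (insert i W \<inter> idx_at q r N s) \<le> card (H \<inter> idx_at q r N s)" using H finH by (intro card_mono) auto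
    also have "\<dots> < d1" using H(2) that by (auto simp: good_transversals_def)
    finally show ?thesis .
  qed
  have RE: "R \<union> lift i = Inl ` \<Gamma> \<union> Inr ` insert i W" by (auto simp: R_def \<Gamma>_def lift_def)
  have finE: "finite (hedges i)" unfolding hedges_def by (simp add: finite_imp_finite_nsets)
  have finN: "finite (nsets V m)" for m using finV by (rule finite_imp_finite_nsets)
  have cE: "real (card (hedges i)) = real (r choose 2)" using card_hedges[OF i(1)] by simp
  have eV: "e \<in> nsets V 2" if "e \<in> hedges i" for e using hedges_subset[OF i(1)] that by auto
  define \<J> where "\<J> = {J \<in> nsets V (r + 1) - K. nsets J 2 \<inter> hedges i \<noteq> {}}"
  have wJ: "w (Inl ` nsets J 2) = p ^ uncovered \<Gamma> J" for J
  proof -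
    have "Inl ` nsets J 2 - (R \<union> lift i) = Inl ` (nsets J 2 - \<Gamma>)" unfolding RE by auto
    then show ?thesis unfolding w_def by (simp add: prod.reindex gpr_def uncovered_def)
  qed
  have sum1: "(\<Sum>J\<in>\<J>. p ^ uncovered \<Gamma> J) \<le> real (r choose 2) * (real r * D ^ r * \<xi>)"
    unfolding cE[symmetric]
  proof (rule sum_over_pairs_le)
    show "finite \<J>" unfolding \<J>_def using finN by auto
    show "\<exists>e\<in>hedges i. e \<subseteq> J" if "J \<in> \<J>" for J using that by (auto simp: \<J>_def nsets_def[of J])
    fix e assume e: "e \<in> hedges i"
    have "(\<Sum>S | S \<in> \<J> \<and> e \<subseteq> S. p ^ uncovered \<Gamma> S)
        \<le> (\<Sum>S | S \<in> nsets V (r + 1) \<and> S \<in> {S. \<not> nsets S 2 \<subseteq> \<Gamma>} \<and> e \<subseteq> S. p ^ uncovered \<Gamma> S)"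
    proof (rule sum_mono2)
      show "{S. S \<in> \<J> \<and> e \<subseteq> S} \<subseteq> {S. S \<in> nsets V (r + 1) \<and> S \<in> {S. \<not> nsets S 2 \<subseteq> \<Gamma>} \<and> e \<subseteq> S}"
      proof safe
        fix S assume S: "S \<in> \<J>" "e \<subseteq> S"
        then show SN: "S \<in> nsets V (r + 1)" by (auto simp: \<J>_def)
        assume "nsets S 2 \<subseteq> \<Gamma>"
        moreover obtain e' where "e' \<in> nsets S 2" "e' \<in> hedges i" using S by (auto simp: \<J>_def)
        ultimately show False using no_forced_clique[OF SN iW, of e' i] i(1) unfolding \<Gamma>_def by blast
      qed
    qed (use finN p in auto)
    also have "\<dots> \<le> real r * D ^ r * \<xi>"
      unfolding \<Gamma>_def by (rule uncovered_sums(1)[OF iW deg eV[OF e]])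
    finally show "(\<Sum>S | S \<in> \<J> \<and> e \<subseteq> S. p ^ uncovered \<Gamma> S) \<le> real r * D ^ r * \<xi>" .
  qed (use finE p in auto)
  define \<F> where "\<F> = {j \<in> Neg. hedges j \<inter> hedges i \<noteq> {}}"
  have finNeg: "finite Neg" using Neg finite_Idx finite_subset by blast
  have w\<F>: "w (lift j) = c * p ^ uncovered \<Gamma> (verts j)" if j: "j \<in> Neg" for j
  proof -
    have "lift j - (R \<union> lift i) = insert (Inr j) (Inl ` (hedges j - \<Gamma>))"
      unfolding RE using j disj i(3) by (auto simp: lift_def)
    moreover have "finite (hedges j)" by (simp add: hedges_def finite_imp_finite_nsets)
    ultimately show ?thesis unfolding w_def
      by (simp add: prod.reindex gpr_def uncovered_def hedges_def image_iff)
  qed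
  define \<F>0 where "\<F>0 = {j\<in>\<F>. hedges j \<subseteq> \<Gamma>}"
  have sum2: "(\<Sum>j\<in>\<F>0. c * p ^ uncovered \<Gamma> (verts j)) \<le> 1 / 4"
  proof -
    have "\<F>0 \<subseteq> {j \<in> Idx q r N. (\<exists>a b. a \<noteq> b \<and> {a, b} \<subseteq> slots r i \<inter> slots r j) \<and>
      (\<forall>x\<in>slots r j. \<forall>y\<in>slots r j. x \<noteq> y \<longrightarrow> covered_by r (insert i W) x y)}"
    proof
      fix j assume j: "j \<in> \<F>0"
      then have jI: "j \<in> Idx q r N" using Neg by (auto simp: \<F>0_def \<F>_def)
      obtain e where e: "e \<in> hedges j" "e \<in> hedges i" using j by (auto simp: \<F>0_def \<F>_def)
      obtain a b where ab: "e = {vtx a, vtx b}" "a \<in> slots r j" "b \<in> slots r j" "a \<noteq> b" "a \<in> Slots q r N" "b \<in> Slots q r N"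
        using hedges_slots[OF jI e(1)] by metis
      have "a \<in> slots r i" "b \<in> slots r i" using hedges_pair[OF i(1) ab(5,6)] e ab by auto
      moreover have "covered_by r (insert i W) x y" if "x \<in> slots r j" "y \<in> slots r j" "x \<noteq> y" for x y
        using forced_covered[OF jI iW _ that] j by (auto simp: \<F>0_def \<Gamma>_def)
      ultimately show "j \<in> {j \<in> Idx q r N. (\<exists>a b. a \<noteq> b \<and> {a, b} \<subseteq> slots r i \<inter> slots r j) \<and>
        (\<forall>x\<in>slots r j. \<forall>y\<in>slots r j. x \<noteq> y \<longrightarrow> covered_by r (insert i W) x y)}" using jI ab by blast
    qed
    then have "card \<F>0 \<le> card {j \<in> Idx q r N. (\<exists>a b. a \<noteq> b \<and> {a, b} \<subseteq> slots r i \<inter> slots r j) \<and>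
      (\<forall>x\<in>slots r j. \<forall>y\<in>slots r j. x \<noteq> y \<longrightarrow> covered_by r (insert i W) x y)}"
      by (intro card_mono) auto
    also have "\<dots> \<le> 2 ^ (r + r\<^sup>2 * K1)"
    proof (rule card_forced_transversals[OF r2 iW])
      fix a b assume ab: "a \<in> Slots q r N" "b \<in> Slots q r N" "a \<noteq> b"
      have "card (codeg r (insert i W) a b) \<le> card (codeg r H a b)"
        using H finH by (intro card_mono finite_codeg codeg_mono) auto
      also have "\<dots> < K1" using H(2) ab by (auto simp: good_transversals_def)
      finally show "card (codeg r (insert i W) a b) < K1" .
    qed simp
    finally have cF: "real (card \<F>0) \<le> 2 ^ (r + r\<^sup>2 * K1)" by (metis of_nat_le_iff of_nat_numeral of_nat_power)
    have "(\<Sum>j\<in>\<F>0. c * p ^ uncovered \<Gamma> (verts j)) \<le> (\<Sum>j\<in>\<F>0. c)"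
      using p c by (intro sum_mono) (simp add: power_le_one mult_left_le)
    also have "\<dots> = c * real (card \<F>0)" by simp
    also have "\<dots> \<le> c * 2 ^ (r + r\<^sup>2 * K1)" using cF c by (intro mult_left_mono) auto
    also have "\<dots> \<le> 1 / 4" by (rule small2)
    finally show ?thesis .
  qed
  have sum3: "(\<Sum>j\<in>\<F> - \<F>0. c * p ^ uncovered \<Gamma> (verts j)) \<le> real (r choose 2) * (real r * D ^ r * \<xi>)"
  proof -
    have FI: "\<F> - \<F>0 \<subseteq> Idx q r N" using Neg by (auto simp: \<F>_def)
    have finF: "finite (\<F> - \<F>0)" using finNeg by (auto simp: \<F>_def)
    have "inj_on verts (\<F> - \<F>0)" using verts_inj FI by (rule inj_on_subset)
    then have "(\<Sum>j\<in>\<F> - \<F>0. c * p ^ uncovered \<Gamma> (verts j)) = (\<Sum>S\<in>verts ` (\<F> - \<F>0). c * p ^ uncovered \<Gamma> S)"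
      by (simp add: sum.reindex)
    also have "\<dots> \<le> real (r choose 2) * (real r * D ^ r * \<xi>)"
      unfolding cE[symmetric]
    proof (rule sum_over_pairs_le)
      show "\<exists>e\<in>hedges i. e \<subseteq> S" if S: "S \<in> verts ` (\<F> - \<F>0)" for S
      proof -
        obtain j where "S = verts j" "j \<in> \<F>" using S by auto
        then obtain e where e: "e \<in> hedges i" "e \<in> hedges j" unfolding \<F>_def by auto
        then have "e \<subseteq> S" using \<open>S = verts j\<close> unfolding hedges_def[of j] nsets_def by auto
        then show ?thesis using e by auto
      qed
      fix e assume e: "e \<in> hedges i"
      have "(\<Sum>S | S \<in> verts ` (\<F> - \<F>0) \<and> e \<subseteq> S. c * p ^ uncovered \<Gamma> S)
        \<le> (\<Sum>S | S \<in> nsets V r \<and> S \<in> {S. \<not> nsets S 2 \<subseteq> \<Gamma>} \<and> e \<subseteq> S. c * p ^ uncovered \<Gamma> S)"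
      proof (rule sum_mono2)
        show "{S. S \<in> verts ` (\<F> - \<F>0) \<and> e \<subseteq> S} \<subseteq> {S. S \<in> nsets V r \<and> S \<in> {S. \<not> nsets S 2 \<subseteq> \<Gamma>} \<and> e \<subseteq> S}"
        proof
          fix S assume "S \<in> {S. S \<in> verts ` (\<F> - \<F>0) \<and> e \<subseteq> S}"
          then obtain j where "S = verts j" "j \<in> \<F>" "j \<notin> \<F>0" "e \<subseteq> S" by auto
          then show "S \<in> {S. S \<in> nsets V r \<and> S \<in> {S. \<not> nsets S 2 \<subseteq> \<Gamma>} \<and> e \<subseteq> S}"
            using Neg verts_nsets[of j] by (auto simp: \<F>0_def \<F>_def hedges_def)
        qed
      qed (use finN p c in auto)
      also have "\<dots> = c * (\<Sum>S | S \<in> nsets V r \<and> S \<in> {S. \<not> nsets S 2 \<subseteq> \<Gamma>} \<and> e \<subseteq> S. p ^ uncovered \<Gamma> S)"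
        by (simp add: sum_distrib_left)
      also have "\<dots> \<le> real r * D ^ r * \<xi>"
        unfolding \<Gamma>_def by (rule uncovered_sums(2)[OF iW deg eV[OF e]])
      finally show "(\<Sum>S | S \<in> verts ` (\<F> - \<F>0) \<and> e \<subseteq> S. c * p ^ uncovered \<Gamma> S) \<le> real r * D ^ r * \<xi>" .
    qed (use finE finF p c in auto)
    finally show ?thesis .
  qed
  have fin\<J>: "finite \<J>" unfolding \<J>_def using finN by auto
  have fin\<F>: "finite \<F>" using finNeg by (auto simp: \<F>_def)
  have "{F. F \<in> \<N> \<union> lift ` Neg \<and> F \<inter> (lift i - R) \<noteq> {}} \<subseteq> (\<lambda>J. Inl ` nsets J 2) ` \<J> \<union> lift ` \<F>"
    using i(3) by (auto simp: \<N>_def \<J>_def \<F>_def lift_def)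
  then have "(\<Sum>F | F \<in> \<N> \<union> lift ` Neg \<and> F \<inter> (lift i - R) \<noteq> {}. w F) \<le> (\<Sum>F\<in>(\<lambda>J. Inl ` nsets J 2) ` \<J> \<union> lift ` \<F>. w F)"
    using fin\<J> fin\<F> w0 by (intro sum_mono2) auto
  also have "\<dots> \<le> (\<Sum>F\<in>(\<lambda>J. Inl ` nsets J 2) ` \<J>. w F) + (\<Sum>F\<in>lift ` \<F>. w F)"
    using fin\<J> fin\<F> w0 by (subst sum_Un) (auto intro!: sum_nonneg)
  also have "(\<Sum>F\<in>(\<lambda>J. Inl ` nsets J 2) ` \<J>. w F) \<le> (\<Sum>J\<in>\<J>. w (Inl ` nsets J 2))"
    using sum_image_le[OF fin\<J>, of w "\<lambda>J. Inl ` nsets J 2"] w0 by (simp add: comp_def)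
  also have "(\<Sum>F\<in>lift ` \<F>. w F) \<le> (\<Sum>j\<in>\<F>. w (lift j))"
    using sum_image_le[OF fin\<F>, of w lift] w0 by (simp add: comp_def)
  also have "(\<Sum>j\<in>\<F>. w (lift j)) = (\<Sum>j\<in>\<F>. c * p ^ uncovered \<Gamma> (verts j))"
    by (intro sum.cong refl w\<F>) (auto simp: \<F>_def)
  also have "\<dots> = (\<Sum>j\<in>\<F> - \<F>0. c * p ^ uncovered \<Gamma> (verts j)) + (\<Sum>j\<in>\<F>0. c * p ^ uncovered \<Gamma> (verts j))"
    using fin\<F> by (intro sum.subset_diff) (auto simp: \<F>0_def)
  finally have "(\<Sum>F | F \<in> \<N> \<union> lift ` Neg \<and> F \<inter> (lift i - R) \<noteq> {}. w F) \<le> 1 / 2"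
    using sum1 sum2 sum3 small1 unfolding wJ by linarith
  then show ?thesis unfolding w_def .
qed

definition has_transversals :: "'a set set \<Rightarrow> bool" where
  "has_transversals A \<longleftrightarrow> (\<exists>\<sigma>. \<forall>g<q. \<sigma> g \<in> perm_tuples r N \<and> (\<forall>i\<in>matching r N g (\<sigma> g). hedges i \<subseteq> A))"

definition no_new_cliques :: "'a set set \<Rightarrow> bool" where
  "no_new_cliques A \<longleftrightarrow> (\<forall>J\<in>nsets V (r + 1) - K. \<not> nsets J 2 \<subseteq> A)"

text \<open>
  The factor \<open>1/2\<close> in the rate of the dominated family is the loss allowed by
  \<open>avoids_given_superset\<close>.
\<close>

theorem transversals_given_cliques:
  "Pr (Idx q r N) (\<lambda>_. c * p ^ (r choose 2) / 2) (good_transversals q r N d1 K1)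
     * Pr (nsets V 2) (\<lambda>_. p) (\<lambda>A. no_new_cliques (A \<union> R0))
   \<le> Pr (nsets V 2) (\<lambda>_. p) (\<lambda>A. no_new_cliques (A \<union> R0) \<and> has_transversals (A \<union> R0))"
proof -
  define \<pi> where "\<pi> = c * p ^ (r choose 2) / 2"
  have \<pi>: "0 \<le> \<pi>" "\<pi> \<le> 1" unfolding \<pi>_def using p c mult_le_one[of c "p ^ (r choose 2)"]
    by (auto simp: power_le_one)
  have R0V: "R0 \<subseteq> nsets V 2"
  proof
    fix e assume "e \<in> R0"
    then obtain J where J: "J \<in> K" "e \<in> nsets J 2" by (auto simp: R0_def)
    then have "J \<in> nsets V (r + 1)" using KV by auto
    from nsets_2_of_kset[OF this] J show "e \<in> nsets V 2" by auto
  qed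
  have avoid: "avoids \<N> (A \<union> Inl ` R0) = no_new_cliques (Inl -` A \<union> R0)" for A
  proof -
    have "Inl ` S \<subseteq> A \<union> Inl ` R0 \<longleftrightarrow> S \<subseteq> Inl -` A \<union> R0" for S by auto
    then show ?thesis unfolding avoids_def \<N>_def no_new_cliques_def by simp
  qed
  define good where "good A \<longleftrightarrow> has_transversals (Inl -` A)" for A :: "('a set + tindex) set"
  have "Pr (Idx q r N) (\<lambda>_. \<pi>) (good_transversals q r N d1 K1) * Pr G gpr (\<lambda>\<omega>. avoids \<N> (\<omega> \<union> Inl ` R0))
     \<le> Pr G gpr (\<lambda>\<omega>. avoids \<N> (\<omega> \<union> Inl ` R0) \<and> good (\<omega> \<union> Inl ` R0))"
  proof (rule sequential_domination[OF finite_G is_prob_gpr finite_Idx lift_subset \<pi>])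
    fix H :: "tindex set" and A :: "('a set + tindex) set"
    assume H: "H \<subseteq> Idx q r N" "good_transversals q r N d1 K1 H" "Inl ` R0 \<union> \<Union>(lift ` H) \<subseteq> A"
    have "\<forall>g. \<exists>\<sigma>. g < q \<longrightarrow> \<sigma> \<in> perm_tuples r N \<and> matching r N g \<sigma> \<subseteq> H"
      using H(2) by (auto simp: good_transversals_def)
    then obtain \<sigma> where \<sigma>: "\<And>g. g < q \<Longrightarrow> \<sigma> g \<in> perm_tuples r N \<and> matching r N g (\<sigma> g) \<subseteq> H" by metis
    have "hedges i \<subseteq> Inl -` A" if "i \<in> H" for i
    proof -
      have "lift i \<subseteq> A" using H(3) that by blast
      then show ?thesis by (auto simp: lift_def)
    qed
    then show "good A" unfolding good_def has_transversals_def using \<sigma> by (intro exI[of _ \<sigma>]) blast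
  next
    fix W Neg i assume W: "W \<subseteq> Idx q r N" "Neg \<subseteq> Idx q r N" "W \<inter> Neg = {}" "i \<in> Idx q r N" "i \<notin> W" "i \<notin> Neg"
      and ex: "\<exists>H\<subseteq>Idx q r N. good_transversals q r N d1 K1 H \<and> insert i W \<subseteq> H"
    define R where "R = Inl ` R0 \<union> \<Union>(lift ` W)"
    obtain H where H: "H \<subseteq> Idx q r N" "good_transversals q r N d1 K1 H" "insert i W \<subseteq> H" using ex by blast
    let ?N = "\<N> \<union> lift ` Neg"
    have finN: "finite ?N" using finV W(2) finite_subset[OF W(2) finite_Idx] by (auto simp: \<N>_def finite_imp_finite_nsets)
    have NG: "F \<subseteq> G" if "F \<in> ?N" for F
    proof -
      from that consider J where "J \<in> nsets V (r + 1)" "F = Inl ` nsets J 2" | j where "j \<in> Idx q r N" "F = lift j"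
        using W(2) by (auto simp: \<N>_def)
      then show ?thesis
      proof cases
        case (1 J)
        then show ?thesis using nsets_2_of_kset[OF 1(1)] by (auto simp: G_def)
      qed (use lift_subset in auto)
    qed
    have Q: "(\<Sum>F | F \<in> ?N \<and> F \<inter> (lift i - R) \<noteq> {}. \<Prod>x\<in>F - (R \<union> lift i). gpr x) \<le> 1 / 2"
      unfolding R_def by (rule negative_information_small[OF W H])
    have half: "Pr G gpr (\<lambda>\<omega>. avoids ?N (\<omega> \<union> R)) \<le> 2 * Pr G gpr (\<lambda>\<omega>. avoids ?N (\<omega> \<union> (R \<union> lift i)))"
      by (rule avoids_given_superset[OF finite_G is_prob_gpr finN NG Q])
    have \<rho>: "c * p ^ (r choose 2) \<le> (\<Prod>x\<in>lift i - R. gpr x)"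
    proof -
      have finl: "finite (lift i)" using finite_subset[OF lift_subset[OF W(4)] finite_G] .
      have "c * p ^ (r choose 2) = (\<Prod>x\<in>lift i. gpr x)"
        using card_hedges[OF W(4)] finl by (simp add: lift_def prod.reindex gpr_def image_iff)
      also have "\<dots> \<le> (\<Prod>x\<in>lift i - R. gpr x)"
      proof -
        have "(\<Prod>x\<in>lift i. gpr x) = (\<Prod>x\<in>lift i - R. gpr x) * (\<Prod>x\<in>lift i \<inter> R. gpr x)"
          using prod.Int_Diff[OF finl, of gpr R] by (simp add: mult.commute)
        also have "\<dots> \<le> (\<Prod>x\<in>lift i - R. gpr x) * 1"
          using is_prob_gpr by (intro mult_left_mono prod_le_1 prod_nonneg) (auto simp: is_probD)
        finally show ?thesis by simp
      qed
      finally show ?thesis .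
    qed
    have "\<pi> * Pr G gpr (\<lambda>\<omega>. avoids ?N (\<omega> \<union> R)) \<le> \<pi> * (2 * Pr G gpr (\<lambda>\<omega>. avoids ?N (\<omega> \<union> (R \<union> lift i))))"
      using half \<pi> by (intro mult_left_mono) auto
    also have "\<dots> = c * p ^ (r choose 2) * Pr G gpr (\<lambda>\<omega>. avoids ?N (\<omega> \<union> (R \<union> lift i)))" by (simp add: \<pi>_def)
    also have "\<dots> \<le> (\<Prod>x\<in>lift i - R. gpr x) * Pr G gpr (\<lambda>\<omega>. avoids ?N (\<omega> \<union> (R \<union> lift i)))"
      using \<rho> is_prob_gpr by (intro mult_right_mono Pr_nonneg)
    also have "R \<union> lift i = Inl ` R0 \<union> \<Union>(lift ` insert i W)" by (auto simp: R_def)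
    finally show "\<pi> * Pr G gpr (\<lambda>\<omega>. avoids ?N (\<omega> \<union> (Inl ` R0 \<union> \<Union>(lift ` W))))
        \<le> (\<Prod>x\<in>lift i - (Inl ` R0 \<union> \<Union>(lift ` W)). gpr x) *
           Pr G gpr (\<lambda>\<omega>. avoids ?N (\<omega> \<union> (Inl ` R0 \<union> \<Union>(lift ` insert i W))))"
      unfolding R_def .
  qed
  moreover have "Pr G gpr (\<lambda>\<omega>. avoids \<N> (\<omega> \<union> Inl ` R0)) = Pr (nsets V 2) (\<lambda>_. p) (\<lambda>A. no_new_cliques (A \<union> R0))"
    unfolding avoid G_def gpr_def using finV by (intro Pr_Inl_marginal finite_imp_finite_nsets) auto
  moreover have "Pr G gpr (\<lambda>\<omega>. avoids \<N> (\<omega> \<union> Inl ` R0) \<and> good (\<omega> \<union> Inl ` R0))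
     = Pr (nsets V 2) (\<lambda>_. p) (\<lambda>A. no_new_cliques (A \<union> R0) \<and> has_transversals (A \<union> R0))"
  proof -
    have "Inl -` (\<omega> \<union> Inl ` R0) = Inl -` \<omega> \<union> R0" for \<omega> :: "('a set + tindex) set" by auto
    then show ?thesis unfolding avoid good_def G_def gpr_def
      using Pr_Inl_marginal[of "nsets V 2" "Idx q r N" p c "\<lambda>A. no_new_cliques (A \<union> R0) \<and> has_transversals (A \<union> R0)"] finV
      by (simp add: finite_imp_finite_nsets)
  qed
  ultimately show ?thesis by (simp add: \<pi>_def)
qed

end

section \<open>Upper tail of the chromatic number\<close>

lemma Pr_partition_le:
  assumes "finite E" "is_prob pr" "finite \<K>" and part: "\<And>A. A \<subseteq> E \<Longrightarrow> h A \<in> \<K>"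
    and each: "\<And>k. k \<in> \<K> \<Longrightarrow> Pr E pr (\<lambda>A. h A = k \<and> B A) \<le> \<eta> * Pr E pr (\<lambda>A. h A = k)"
  shows "Pr E pr B \<le> \<eta>"
proof -
  have one: "of_bool (B A) = (\<Sum>k\<in>\<K>. of_bool (h A = k \<and> B A) :: real)"
    and two: "(\<Sum>k\<in>\<K>. of_bool (h A = k) :: real) = 1" if "A \<subseteq> E" for A
  proof -
    have "(\<Sum>k\<in>\<K>. of_bool (h A = k) :: real) = (\<Sum>k\<in>{h A}. 1)"
      using part[OF that] assms(3) by (intro sum.mono_neutral_cong_right) auto
    then show "(\<Sum>k\<in>\<K>. of_bool (h A = k) :: real) = 1" by simp
    have "(\<Sum>k\<in>\<K>. of_bool (h A = k \<and> B A) :: real) = (\<Sum>k\<in>{h A}. of_bool (B A))"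
      using part[OF that] assms(3) by (intro sum.mono_neutral_cong_right) auto
    then show "of_bool (B A) = (\<Sum>k\<in>\<K>. of_bool (h A = k \<and> B A) :: real)" by simp
  qed
  have "Pr E pr B = expect E pr (\<lambda>A. \<Sum>k\<in>\<K>. of_bool (h A = k \<and> B A))"
    unfolding Pr_def by (intro expect_cong one)
  also have "\<dots> = (\<Sum>k\<in>\<K>. Pr E pr (\<lambda>A. h A = k \<and> B A))" by (simp add: expect_sum Pr_def)
  also have "\<dots> \<le> (\<Sum>k\<in>\<K>. \<eta> * Pr E pr (\<lambda>A. h A = k))" by (intro sum_mono each)
  also have "\<dots> = \<eta> * expect E pr (\<lambda>A. \<Sum>k\<in>\<K>. of_bool (h A = k))"
    by (simp add: expect_sum Pr_def sum_distrib_left)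
  also have "expect E pr (\<lambda>A. \<Sum>k\<in>\<K>. of_bool (h A = k)) = expect E pr (\<lambda>A. 1)"
    by (intro expect_cong two)
  finally show ?thesis using assms(1) by (simp add: expect_const)
qed

lemma cliques_eq_iff:
  assumes "finite V" and K: "K \<subseteq> nsets V k"
  shows "cliques k V A = K \<longleftrightarrow> (\<Union>J\<in>K. nsets J 2) \<subseteq> A \<and> (\<forall>J\<in>nsets V k - K. \<not> nsets J 2 \<subseteq> A)"
  using K unfolding cliques_def by blast

text \<open>
  Partition by the set \<open>K\<close> of all \<open>(r + 1)\<close>-cliques.  The event that \<open>K\<close> is this set says that its edges
  are present and that no other \<open>(r + 1)\<close>-set is complete, so \<open>transversals_given_cliques\<close> applies.
  The vertices outside a maximum packing are distributed greedily; matchings in all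
  groups then leave fewer than \<open>q r\<close> vertices, the remainder of a division by \<open>q r\<close>.
\<close>

theorem chromatic_upper_likely:
  fixes p D \<xi> \<eta> :: real and r q y d0 d1 K1 :: nat
  assumes finV: "finite V" and r: "2 \<le> r" and p: "0 < p" "p \<le> 1" and D: "1 \<le> D" "real ((r + 1) * (d0 + r * d1)) \<le> D"
    and q: "2 * d0 < q" and y: "2 * ((r + 1) * y) \<le> card V" and \<eta>: "0 \<le> \<eta>"
    and dense: "\<And>b. 1 \<le> b \<Longrightarrow> b \<le> r \<Longrightarrow> 1 \<le> real (card V) ^ (b - 1) * p ^ (b choose 2)"
    and sparse1: "\<And>b. 2 \<le> b \<Longrightarrow> b \<le> r \<Longrightarrow>
        p ^ (b * (r + 1 - b)) * (fact r * D ^ (r\<^sup>2) * (real (card V) ^ (r + 1 - b) * p ^ ((r + 1 - b) choose 2))) \<le> \<xi>"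
    and p\<xi>: "p \<le> \<xi>" and small1: "real (r choose 2) * (real r * D ^ r * \<xi>) \<le> 1 / 8"
    and size: "\<And>N. card V \<le> 2 * (q * r * (N + 1)) \<Longrightarrow> q * r * N \<le> card V \<Longrightarrow>
       1 \<le> N \<and> 2 * ((r + 1) * y) \<le> q * N \<and> (\<exists>c. 0 < c \<and> c \<le> 1 \<and> c * 2 ^ (r + r\<^sup>2 * K1) \<le> 1 / 4 \<and>
       (\<forall>b. 2 \<le> b \<longrightarrow> b < r \<longrightarrow> c * (p ^ (b * (r - b)) * (fact r * D ^ (r\<^sup>2) * (real (card V) ^ (r - b) * p ^ ((r - b) choose 2)))) \<le> \<xi>) \<and>
       1 - \<eta> \<le> Pr (Idx q r N) (\<lambda>_. c * p ^ (r choose 2) / 2) (good_transversals q r N d1 K1))"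
  shows "Pr (nsets V 2) (\<lambda>_. p) (\<lambda>A. card (cliques (r + 1) V A) < y \<and> (\<forall>v\<in>V. card (clique_nbrs (cliques (r + 1) V A) v) \<le> d0) \<and>
      \<not> r * chromatic_number V (graph_complement V A) + packing_number (cliques (r + 1) V A) \<le> card V + r * (q * r)) \<le> \<eta>"
proof (rule Pr_partition_le)
  let ?E = "nsets V 2" and ?pr = "\<lambda>_::'a set. p"
  show finE: "finite ?E" and pr: "is_prob ?pr" and "finite (Pow (nsets V (r + 1)))"
    using finV p by (auto simp: finite_imp_finite_nsets is_prob_def)
  show "cliques (r + 1) V A \<in> Pow (nsets V (r + 1))" for A by (auto simp: cliques_def)
  fix K assume "K \<in> Pow (nsets V (r + 1))"
  then have KV: "K \<subseteq> nsets V (r + 1)" by simp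
  define bad where "bad A \<longleftrightarrow> card (cliques (r + 1) V A) < y \<and> (\<forall>v\<in>V. card (clique_nbrs (cliques (r + 1) V A) v) \<le> d0) \<and>
      \<not> r * chromatic_number V (graph_complement V A) + packing_number (cliques (r + 1) V A) \<le> card V + r * (q * r)" for A
  have "Pr ?E ?pr (\<lambda>A. cliques (r + 1) V A = K \<and> bad A) \<le> \<eta> * Pr ?E ?pr (\<lambda>A. cliques (r + 1) V A = K)"
  proof (cases "\<exists>A\<subseteq>?E. cliques (r + 1) V A = K \<and> bad A")
    case False
    then have "Pr ?E ?pr (\<lambda>A. cliques (r + 1) V A = K \<and> bad A) = Pr ?E ?pr (\<lambda>_. False)"
      by (intro Pr_cong) auto
    also have "\<dots> = 0" using finE by (simp add: Pr_def expect_const)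
    finally show ?thesis using \<eta> pr by (simp add: Pr_nonneg)
  next
    case True
    then obtain A0 where A0: "A0 \<subseteq> ?E" "cliques (r + 1) V A0 = K" "bad A0" by auto
    then have goodK: "card K < y" "\<And>v. v \<in> V \<Longrightarrow> card (clique_nbrs K v) \<le> d0" by (auto simp: bad_def)
    define E0 where "E0 = (\<Union>J\<in>K. nsets J 2)"
    \<comment> \<open>realisability of \<open>K\<close> by \<open>A0\<close> makes it closed\<close>
    have closed: "J \<in> K" if "J \<in> nsets V (r + 1)" "nsets J 2 \<subseteq> E0" for J
    proof -
      have "E0 \<subseteq> A0" using A0(2) by (auto simp: cliques_def E0_def)
      then show ?thesis using that A0(2) by (auto simp: cliques_def)
    qed
    have finK: "finite K" using finite_subset[OF KV finite_imp_finite_nsets[OF finV]] .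
    have szK: "finite J" "card J = r + 1" "J \<subseteq> V" if "J \<in> K" for J using that KV by (auto simp: nsets_def)
    obtain P where P: "P \<subseteq> K" "disjoint P" "card P = packing_number K"
      using packing_number_attained[OF finK] by blast
    have finP: "finite P" using finite_subset[OF P(1) finK] .
    define V' where "V' = V - \<Union>P"
    have finV': "finite V'" using finV by (simp add: V'_def)
    have cUP: "card (\<Union>P) = (r + 1) * card P"
    proof -
      have "card (\<Union>P) = (\<Sum>J\<in>P. card J)" using P szK by (intro card_Union_disjoint) auto
      also have "\<dots> = (\<Sum>J\<in>P. r + 1)" using P szK by (intro sum.cong) auto
      finally show ?thesis by simp
    qed
    have UPV: "\<Union>P \<subseteq> V" using P(1) szK(3) by blast
    have cV': "card V = card V' + (r + 1) * card P"
      using UPV finV cUP card_mono[OF finV UPV] by (simp add: V'_def card_Diff_subset finite_subset)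
    have "card P \<le> card K" using P(1) finK by (rule card_mono[rotated])
    then have "(r + 1) * card P \<le> (r + 1) * y" using goodK(1) by (intro mult_le_mono2) auto
    then have half: "card V \<le> 2 * card V'" using cV' y by linarith
    define N where "N = card V' div (q * r)"
    have qr: "0 < q * r" using q r by simp
    have N1: "q * r * N \<le> card V'" unfolding N_def by (simp add: mult.commute div_times_less_eq_dividend)
    have N2: "card V' < q * r * (N + 1)"
      using dividend_less_div_times[OF qr, of "card V'"] by (simp add: N_def algebra_simps)
    have "card V \<le> 2 * (q * r * (N + 1))" using half N2 by linarith
    moreover have "q * r * N \<le> card V" using N1 cV' by linarith
    ultimately obtain c where N: "1 \<le> N" "2 * ((r + 1) * y) \<le> q * N" and c: "0 < c" "c \<le> 1" "c * 2 ^ (r + r\<^sup>2 * K1) \<le> 1 / 4"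
      and sparse2: "\<And>b. 2 \<le> b \<Longrightarrow> b < r \<Longrightarrow> c * (p ^ (b * (r - b)) * (fact r * D ^ (r\<^sup>2) * (real (card V) ^ (r - b) * p ^ ((r - b) choose 2)))) \<le> \<xi>"
      and likely: "1 - \<eta> \<le> Pr (Idx q r N) (\<lambda>_. c * p ^ (r choose 2) / 2) (good_transversals q r N d1 K1)"
      using size[of N] by blast
    define X where "X = V' \<inter> \<Union>K"
    have XV': "X \<subseteq> V'" by (simp add: X_def)
    have finX: "finite X" using finite_subset[OF XV' finV'] .
    have cX: "card X \<le> (r + 1) * y"
    proof -
      have "card X \<le> card (\<Union>K)" using finK szK by (intro card_mono) (auto simp: X_def)
      also have "\<dots> \<le> (\<Sum>J\<in>K. card J)" by (rule card_Union_le_sum_card) 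
      also have "\<dots> = (r + 1) * card K" using szK by simp
      also have "\<dots> \<le> (r + 1) * y" using goodK(1) by (intro mult_le_mono2) auto
      finally show ?thesis .
    qed
    have degX: "card {w\<in>X. {x, w} \<in> E0} \<le> d0" if "x \<in> X" for x
    proof -
      have "finite (clique_nbrs K x)" using finK szK by (auto simp: clique_nbrs_def)
      moreover have "{w\<in>X. {x, w} \<in> E0} \<subseteq> clique_nbrs K x" by (auto simp: E0_def clique_nbrs_def nsets_def)
      ultimately have "card {w\<in>X. {x, w} \<in> E0} \<le> card (clique_nbrs K x)" by (intro card_mono)
      also have "\<dots> \<le> d0" using goodK(2) that by (auto simp: X_def V'_def)
      finally show ?thesis .
    qed
    have "\<exists>g. g ` X \<subseteq> {..<q} \<and> (\<forall>x\<in>X. \<forall>w\<in>X. x \<noteq> w \<longrightarrow> {x, w} \<in> E0 \<longrightarrow> g x \<noteq> g w) \<and> (\<forall>c. card {x\<in>X. g x = c} \<le> N)"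
    proof (rule bounded_class_coloring[OF finX _ degX q])
      show "2 * card X \<le> q * N" using cX N by linarith
    qed (use N in \<open>auto simp: insert_commute\<close>)
    then obtain g where g: "g ` X \<subseteq> {..<q}" "\<And>x w. x \<in> X \<Longrightarrow> w \<in> X \<Longrightarrow> x \<noteq> w \<Longrightarrow> {x, w} \<in> E0 \<Longrightarrow> g x \<noteq> g w"
      "\<And>c. card {x\<in>X. g x = c} \<le> N" by blast
    have r1: "1 \<le> r" using r by simp
    obtain vtx where vtx: "inj_on vtx (Slots q r N)" "vtx ` Slots q r N \<subseteq> V'"
      "\<And>s. s \<in> Slots q r N \<Longrightarrow> vtx s \<in> X \<Longrightarrow> fst (snd s) = 0 \<and> fst s = g (vtx s)"
      using slot_assignment[OF finV' XV' r1 g(1,3) N1] by blast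
    interpret transversal_setup V K r q N vtx
    proof
      show "vtx ` Slots q r N \<subseteq> V" using vtx(2) by (auto simp: V'_def)
      show "J \<in> K" if "J \<in> nsets V (r + 1)" "nsets J 2 \<subseteq> (\<Union>J\<in>K. nsets J 2)" for J
        using closed that by (simp add: E0_def)
      have inX: "vtx a \<in> X" if "a \<in> Slots q r N" "vtx a \<in> \<Union>K" for a using that vtx(2) by (auto simp: X_def)
      show "fst (snd a) = 0" if "a \<in> Slots q r N" "vtx a \<in> \<Union>K" for a using vtx(3)[OF that(1) inX[OF that]] by simp
      show "fst a \<noteq> fst b" if ab: "a \<in> Slots q r N" "b \<in> Slots q r N" "{vtx a, vtx b} \<in> (\<Union>J\<in>K. nsets J 2)" for a b
      proof -
        have "vtx a \<noteq> vtx b" "vtx a \<in> \<Union>K" "vtx b \<in> \<Union>K" using ab(3) by auto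
        moreover from this have "vtx a \<in> X" "vtx b \<in> X" using inX ab by auto
        ultimately show ?thesis using g(2)[of "vtx a" "vtx b"] vtx(3)[OF ab(1)] vtx(3)[OF ab(2)] ab(3) by (auto simp: E0_def)
      qed
    qed (use finV r KV vtx(1) in auto)
    have R0eq: "R0 = E0" unfolding R0_def E0_def ..
    interpret transversal_coupling V K r q N vtx p c "real (card V)" D \<xi> d0 d1 K1
      by unfold_locales (use p c D goodK dense sparse1 sparse2 p\<xi> small1 in auto)
    have E0E: "E0 \<subseteq> ?E"
    proof
      fix e assume "e \<in> E0"
      then obtain J where J: "J \<in> K" "e \<in> nsets J 2" by (auto simp: E0_def)
      then have "J \<in> nsets V (r + 1)" using KV by auto
      from nsets_2_of_kset[OF this] J show "e \<in> ?E" by auto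
    qed
    have eqK: "cliques (r + 1) V A = K \<longleftrightarrow> E0 \<subseteq> A \<and> no_new_cliques A" for A
      using cliques_eq_iff[OF finV KV, of A] by (simp add: E0_def no_new_cliques_def)
    have ok: "\<not> bad A" if A: "A \<subseteq> ?E" "cliques (r + 1) V A = K" "has_transversals A" for A
    proof -
      obtain \<sigma> where \<sigma>: "\<And>g. g < q \<Longrightarrow> \<sigma> g \<in> perm_tuples r N" "\<And>g i. g < q \<Longrightarrow> i \<in> matching r N g (\<sigma> g) \<Longrightarrow> hedges i \<subseteq> A"
        using A(3) by (auto simp: has_transversals_def)
      define \<S> where "\<S> = verts ` (\<Union>g<q. matching r N g (\<sigma> g))"
      have \<S>: "disjoint \<S>" "\<Union>\<S> = vtx ` Slots q r N"
        using matchings_give_packing[OF \<sigma>(1)] by (auto simp: \<S>_def)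
      have "r * chromatic_number V (graph_complement V A) + card P \<le> card V + r * (q * r)"
      proof (rule chromatic_number_le_packings[OF finV _ _ _ r])
        show "P \<subseteq> cliques (r + 1) V A" using P A by simp
        show "\<S> \<subseteq> cliques r V A"
        proof
          fix S assume "S \<in> \<S>"
          then obtain g i where i: "S = verts i" "g < q" "i \<in> matching r N g (\<sigma> g)" by (auto simp: \<S>_def)
          then have "i \<in> Idx q r N" using matching_subset[OF \<sigma>(1)] by blast
          then show "S \<in> cliques r V A" using i \<sigma>(2)[OF i(2,3)] verts_nsets by (auto simp: cliques_def hedges_def)
        qed
        show "disjoint (P \<union> \<S>)"
        proof (rule disjointI)
          have cross: "a \<inter> b = {}" if "a \<in> P" "b \<in> \<S>" for a b
            using that \<S>(2) vtx(2) by (auto simp: V'_def)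
          fix a b assume "a \<in> P \<union> \<S>" "b \<in> P \<union> \<S>" "a \<noteq> b"
          then show "a \<inter> b = {}" using cross[of a b] cross[of b a] disjointD[OF P(2), of a b] disjointD[OF \<S>(1), of a b] by auto
        qed
        have "V - \<Union>P - \<Union>\<S> = V' - vtx ` Slots q r N" using \<S>(2) by (auto simp: V'_def)
        then have "card (V - \<Union>P - \<Union>\<S>) = card V' - q * r * N"
          using vtx(1,2) finV' by (simp add: card_Diff_subset finite_subset[OF vtx(2)] card_image card_Slots)
        then show "card (V - \<Union>P - \<Union>\<S>) \<le> q * r" using N2 by simp
      qed
      then show ?thesis using A(2) P(3) by (simp add: bad_def)
    qed
    have filt: "Pr ?E ?pr (\<lambda>A. cliques (r + 1) V A = K \<and> \<psi> A) = p ^ card E0 * Pr ?E ?pr (\<lambda>A. no_new_cliques (A \<union> E0) \<and> \<psi> (A \<union> E0))" for \<psi>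
      unfolding eqK using Pr_filter[OF finE E0E, of ?pr "\<lambda>A. no_new_cliques A \<and> \<psi> A"] by (simp add: conj_assoc)
    let ?f = "Pr ?E ?pr (\<lambda>A. no_new_cliques (A \<union> E0))"
    let ?g = "Pr ?E ?pr (\<lambda>A. no_new_cliques (A \<union> E0) \<and> has_transversals (A \<union> E0))"
    have f0: "0 \<le> ?f" by (rule Pr_nonneg[OF pr])
    have "(1 - \<eta>) * ?f \<le> Pr (Idx q r N) (\<lambda>_. c * p ^ (r choose 2) / 2) (good_transversals q r N d1 K1) * ?f"
      using likely f0 by (intro mult_right_mono) auto
    also have "\<dots> \<le> ?g" using transversals_given_cliques unfolding R0eq .
    finally have fg: "(1 - \<eta>) * ?f \<le> ?g" .
    have "Pr ?E ?pr (\<lambda>A. cliques (r + 1) V A = K \<and> bad A) \<le> Pr ?E ?pr (\<lambda>A. cliques (r + 1) V A = K \<and> \<not> has_transversals A)"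
      using pr ok by (intro Pr_mono) auto
    also have "\<dots> = p ^ card E0 * Pr ?E ?pr (\<lambda>A. no_new_cliques (A \<union> E0) \<and> \<not> has_transversals (A \<union> E0))" by (rule filt)
    also have "Pr ?E ?pr (\<lambda>A. no_new_cliques (A \<union> E0) \<and> \<not> has_transversals (A \<union> E0)) = ?f - ?g"
      unfolding Pr_def expect_diff[symmetric] by (intro expect_cong) auto
    also have "p ^ card E0 * (?f - ?g) \<le> p ^ card E0 * (\<eta> * ?f)"
      using fg p by (intro mult_left_mono) (auto simp: algebra_simps)
    also have "\<dots> = \<eta> * (p ^ card E0 * ?f)" by simp
    also have "p ^ card E0 * ?f = Pr ?E ?pr (\<lambda>A. cliques (r + 1) V A = K)" using filt[of "\<lambda>_. True"] by simp
    finally show ?thesis .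
  qed
  then show "Pr ?E ?pr (\<lambda>A. cliques (r + 1) V A = K \<and> card (cliques (r + 1) V A) < y \<and> (\<forall>v\<in>V. card (clique_nbrs (cliques (r + 1) V A) v) \<le> d0) \<and>
      \<not> r * chromatic_number V (graph_complement V A) + packing_number (cliques (r + 1) V A) \<le> card V + r * (q * r))
      \<le> \<eta> * Pr ?E ?pr (\<lambda>A. cliques (r + 1) V A = K)" by (simp add: bad_def)
qed

section \<open>Numerical estimates\<close>

lemma two_choose: "2 * (b choose 2) = b * (b - 1)"
  by (cases b) (auto simp: choose_two)

text \<open>
  Relates the mean number of \<open>(r + 1)\<close>-cliques to the mean number of \<open>r\<close>-cliques at a vertex.
\<close>

lemma clique_mean_power:
  "(x ^ (r + 1) * p ^ ((r + 1) choose 2)) ^ (r - 1) = (x ^ (r - 1) * p ^ (r choose 2)) ^ (r + 1)" for x p :: real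
proof -
  have "2 * (((r + 1) choose 2) * (r - 1)) = 2 * ((r choose 2) * (r + 1))"
    using two_choose[of "r + 1"] two_choose[of r] by (metis (no_types, lifting) diff_add_inverse2 mult.assoc mult.commute)
  then have "((r + 1) choose 2) * (r - 1) = (r choose 2) * (r + 1)" by simp
  then show ?thesis unfolding power_mult_distrib power_mult[symmetric] by (simp only: mult.commute)
qed

text \<open>
  The square of \<open>x\<^bsup>b-1\<^esup> p\<^bsup>b(b-1)/2\<^esup>\<close> is \<open>(x\<^sup>2 p\<^sup>b)\<^bsup>b-1\<^esup>\<close>.
\<close>

lemma dense_ge_one:
  fixes x p :: real
  assumes "0 \<le> x" "0 < p" "p \<le> 1" "1 \<le> x\<^sup>2 * p ^ r" "1 \<le> b" "b \<le> r"
  shows "1 \<le> x ^ (b - 1) * p ^ (b choose 2)"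
proof (rule power2_le_imp_le)
  have "x\<^sup>2 * p ^ r \<le> x\<^sup>2 * p ^ b" using assms by (intro mult_left_mono power_decreasing) auto
  then have "1 \<le> (x\<^sup>2 * p ^ b) ^ (b - 1)" using assms by (intro one_le_power) linarith
  also have "\<dots> = x ^ (2 * (b - 1)) * p ^ (b * (b - 1))" by (simp add: power_mult_distrib power_mult)
  also have "\<dots> = (x ^ (b - 1) * p ^ (b choose 2))\<^sup>2"
    unfolding two_choose[symmetric] by (simp add: power_mult_distrib power_mult[symmetric] mult.commute)
  finally show "1\<^sup>2 \<le> (x ^ (b - 1) * p ^ (b choose 2))\<^sup>2" by simp
qed (use assms in auto)

text \<open>
  The square of \<open>x\<^sup>a p\<^sup>g\<close> is at most \<open>(x\<^sup>2 p\<^bsup>r+1\<^esup>)\<^sup>a\<close>.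
\<close>

lemma sparse_le_one:
  fixes x p :: real
  assumes "0 \<le> x" "0 < p" "p \<le> 1" "x\<^sup>2 * p ^ (r + 1) \<le> 1" "a * (r + 1) \<le> 2 * g"
  shows "x ^ a * p ^ g \<le> 1"
proof (rule power2_le_imp_le)
  have "(x ^ a * p ^ g)\<^sup>2 = x ^ (2 * a) * p ^ (2 * g)" by (simp add: power_mult_distrib power_mult[symmetric] mult.commute)
  also have "\<dots> \<le> x ^ (2 * a) * p ^ (a * (r + 1))" using assms by (intro mult_left_mono power_decreasing) auto
  also have "\<dots> = (x\<^sup>2 * p ^ (r + 1)) ^ a"
    unfolding power_mult_distrib power_mult[symmetric] by (simp only: mult.commute)
  also have "\<dots> \<le> 1" using assms by (intro power_le_one) auto
  finally show "(x ^ a * p ^ g)\<^sup>2 \<le> 1\<^sup>2" by simp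
qed simp

lemma sparse_le_sqrt:
  fixes x p :: real
  assumes "0 \<le> x" "0 < p" "p \<le> 1" "x\<^sup>2 * p ^ (r + 1) \<le> 1" "1 \<le> a" "a * (r + 2) \<le> 2 * g"
  shows "x ^ a * p ^ g \<le> sqrt p"
proof (rule real_le_rsqrt)
  have "(x ^ a * p ^ g)\<^sup>2 = x ^ (2 * a) * p ^ (2 * g)" by (simp add: power_mult_distrib power_mult[symmetric] mult.commute)
  also have "\<dots> \<le> x ^ (2 * a) * p ^ (a * (r + 2))" using assms by (intro mult_left_mono power_decreasing) auto
  also have "\<dots> = (x\<^sup>2 * p ^ (r + 2)) ^ a"
    unfolding power_mult_distrib power_mult[symmetric] by (simp only: mult.commute)
  also have "\<dots> = (x\<^sup>2 * p ^ (r + 1)) ^ a * p ^ a" by (simp add: power_mult_distrib[symmetric] mult_ac)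
  also have "\<dots> \<le> 1 * p ^ 1" using assms by (intro mult_mono power_le_one power_decreasing) auto
  finally show "(x ^ a * p ^ g)\<^sup>2 \<le> p" by simp
qed

lemma choose_two_minus:
  assumes "s \<le> k"
  shows "2 * ((k choose 2) - (s choose 2)) = (k - s) * (k + s - 1)"
proof -
  obtain a where k: "k = a + s" using assms by (metis le_add_diff_inverse2)
  have "2 * ((k choose 2) - (s choose 2)) = 2 * (a choose 2) + 2 * (a * s)" unfolding k choose_two_add by simp
  also have "\<dots> = a * (a - 1) + 2 * (a * s)" by (simp only: two_choose)
  also have "\<dots> = a * (a + s + s - 1)" by (cases a) (auto simp: algebra_simps)
  finally show ?thesis using k by simp
qed

lemma ext_weight_le_one:
  assumes p: "0 < p" "p \<le> 1" and F: "(real n)\<^sup>2 * p ^ (r + 1) \<le> 1" and s: "1 \<le> s" "s \<le> r + 1"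
  shows "ext_weight n (r + 1) p s \<le> 1"
  unfolding ext_weight_def
proof (rule sparse_le_one[OF _ p F])
  have "(r + 1 - s) * (r + 1) \<le> (r + 1 - s) * (r + 1 + s - 1)" using s by (intro mult_le_mono2) auto
  then show "(r + 1 - s) * (r + 1) \<le> 2 * ((r + 1 choose 2) - (s choose 2))" using choose_two_minus[OF s(2)] by simp
qed simp

lemma ext_weight_le_sqrt:
  assumes p: "0 < p" "p \<le> 1" and F: "(real n)\<^sup>2 * p ^ (r + 1) \<le> 1" and s: "2 \<le> s" "s \<le> r"
  shows "ext_weight n (r + 1) p s \<le> sqrt p"
  unfolding ext_weight_def
proof (rule sparse_le_sqrt[OF _ p F])
  have "(r + 1 - s) * (r + 2) \<le> (r + 1 - s) * (r + 1 + s - 1)" using s by (intro mult_le_mono2) auto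
  then show "(r + 1 - s) * (r + 2) \<le> 2 * ((r + 1 choose 2) - (s choose 2))" using choose_two_minus[of s "r + 1"] s by simp
qed (use s in auto)

lemma ext_weight_larger_le_one:
  assumes p: "0 < p" "p \<le> 1" and F: "(real n)\<^sup>2 * p ^ (r + 1) \<le> 1" and s: "s \<le> r + 2"
  shows "ext_weight n (r + 2) p s \<le> 1"
  unfolding ext_weight_def
proof (rule sparse_le_one[OF _ p F])
  have "(r + 2 - s) * (r + 1) \<le> (r + 2 - s) * (r + 2 + s - 1)" using s by (intro mult_le_mono2) auto
  then show "(r + 2 - s) * (r + 1) \<le> 2 * ((r + 2 choose 2) - (s choose 2))" using choose_two_minus[OF s] by simp
qed simp

text \<open>
  The family of transversals is built in \<open>R \<approx> 20 L\<close> rounds of density \<open>64 / \<kappa>\<close> with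
  \<open>\<kappa> = (N / e)\<^bsup>r-1\<^esup>\<close>, where \<open>L = ln n\<close>; so the mean degree of a slot is at most \<open>64 * 21 * e\<^bsup>r-1\<^esup> L\<close>.  The second
  constant is an exponent \<open>t\<close> for which the powers \<open>(r \<Lambda> / N)\<^sup>t\<close> in \<open>codegree_tail\<close> beat both the factor
  \<open>exp (2 \<Lambda>)\<close>, itself a power of \<open>n\<close>, and the number of pairs of slots.
\<close>

definition degree_const :: "nat \<Rightarrow> real" where "degree_const r = 64 * 21 * exp 1 ^ (r - 1)"
definition codegree_exponent :: "nat \<Rightarrow> nat" where "codegree_exponent r = nat \<lceil>8 * degree_const r\<rceil> + 40"

lemma degree_const_ge: "1 \<le> degree_const r"
proof -
  have "1 \<le> exp (1::real) ^ (r - 1)" by (intro one_le_power) simp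
  then show ?thesis unfolding degree_const_def by linarith
qed

lemma codegree_exponent_ge: "8 * degree_const r + 40 \<le> real (codegree_exponent r)"
  unfolding codegree_exponent_def by (simp add: real_nat_ceiling_ge)

lemma good_transversals_numeric:
  fixes x s L :: real and r q N d1 :: nat
  assumes r: "2 \<le> r" and L: "x = exp L" "1 \<le> L" and N: "1 \<le> N" "real N \<le> x" "x \<le> s\<^sup>2 * real N" and q: "real (q * r * N) \<le> x"
    and s: "real r \<le> s" "s ^ 8 \<le> x" "64 * exp 1 * s\<^sup>2 \<le> x" "degree_const r * L \<le> s" "(2 * degree_const r + 8) * L \<le> s" "s \<le> real d1"
    and x: "8 \<le> x" "2 * fact (codegree_exponent r) \<le> x"
  shows "\<exists>\<pi>. 0 < \<pi> \<and> \<pi> \<le> 1 \<and> real N ^ (r - 1) * \<pi> \<le> degree_const r * L \<and>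
     Pr (Idx q r N) (\<lambda>_. \<pi>) (\<lambda>H. \<not> good_transversals q r N d1 (2 * r * codegree_exponent r) H) \<le> 1 / x ^ 4"
proof -
  have s2: "2 \<le> s" using r s(1) by (meson of_nat_mono of_nat_numeral order_trans numeral_le_real_of_nat_iff)
  have x0: "0 < x" using x by simp
  define \<kappa> where "\<kappa> = (real N / exp 1) ^ (r - 1)"
  define q0 where "q0 = 64 / \<kappa>"
  define R where "R = nat \<lceil>20 * L\<rceil>"
  define \<pi> where "\<pi> = 1 - (1 - q0) ^ R"
  define \<Lambda> where "\<Lambda> = degree_const r * L"
  define t where "t = codegree_exponent r"
  have "64 * exp 1 * s\<^sup>2 \<le> s\<^sup>2 * real N" using s N by linarith
  then have "64 * exp 1 \<le> real N" using s2 by (simp add: mult.commute)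
  then have N64: "64 \<le> real N / exp 1" by (simp add: field_simps)
  have "64 ^ 1 \<le> (64::real) ^ (r - 1)" using r by (intro power_increasing) auto
  also have "\<dots> \<le> \<kappa>" unfolding \<kappa>_def using N64 by (intro power_mono) auto
  finally have \<kappa>: "64 \<le> \<kappa>" by simp
  have q0: "0 < q0" "q0 \<le> 1" "64 \<le> q0 * \<kappa>" using \<kappa> by (auto simp: q0_def)
  have R: "20 * L \<le> real R" "real R \<le> 21 * L" "1 \<le> R" using L unfolding R_def by linarith+
  have \<pi>: "0 < \<pi>" "\<pi> \<le> 1" "\<pi> \<le> real R * q0"
  proof -
    have "(1 - q0) ^ R < 1" using q0 R by (intro power_less_one_iff[THEN iffD2]) auto
    then show "0 < \<pi>" by (simp add: \<pi>_def)
    show "\<pi> \<le> 1" using q0 by (simp add: \<pi>_def)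
    have "1 + real R * (- q0) \<le> (1 + - q0) ^ R" using q0 by (intro Bernoulli_inequality) auto
    then show "\<pi> \<le> real R * q0" by (simp add: \<pi>_def)
  qed
  have N\<kappa>: "real N ^ (r - 1) = exp 1 ^ (r - 1) * \<kappa>" by (simp add: \<kappa>_def power_divide)
  have \<Lambda>: "real N ^ (r - 1) * \<pi> \<le> \<Lambda>"
  proof -
    have "real N ^ (r - 1) * \<pi> \<le> real N ^ (r - 1) * (real R * q0)" using \<pi> by (intro mult_left_mono) auto
    also have "\<dots> = 64 * exp 1 ^ (r - 1) * real R" unfolding N\<kappa> q0_def using \<kappa> by simp
    also have "\<dots> \<le> 64 * exp 1 ^ (r - 1) * (21 * L)" using R by (intro mult_left_mono) auto
    finally show ?thesis by (simp add: \<Lambda>_def degree_const_def)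
  qed
  define k where "k = (LEAST k. N < 2 ^ k)"
  have k1: "N < 2 ^ k" unfolding k_def by (rule LeastI[of _ N]) (rule less_exp)
  have k2: "2 ^ k \<le> 2 * N"
  proof (cases k)
    case 0
    then show ?thesis using k1 N by simp
  next
    case (Suc k')
    then have "\<not> N < 2 ^ k'" unfolding k_def by (metis lessI not_less_Least)
    then show ?thesis using Suc by simp
  qed
  have xp: "x ^ j = exp (real j * L)" for j unfolding L(1) by (simp add: exp_of_nat_mult)
  have qN: "real q \<le> x"
  proof -
    have "q * 1 \<le> q * (r * N)" using r N by (intro mult_le_mono2) auto
    then show ?thesis using q by (metis mult.assoc mult.right_neutral of_nat_mono order_trans)
  qed
  have T1: "real q * (4 ^ k / 2 ^ R) \<le> 4 / x ^ 7"
  proof -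
    have "real (2 ^ k) \<le> real (2 * N)" using k2 by (rule of_nat_mono)
    then have "(2::real) ^ k \<le> 2 * x" using N by simp
    then have "((2::real) ^ k)\<^sup>2 \<le> (2 * x)\<^sup>2" by (intro power_mono) auto
    then have four: "(4::real) ^ k \<le> 4 * x\<^sup>2" by (simp add: power2_eq_square flip: power_mult_distrib)
    have "exp (1 / 2) \<le> (2::real)"
    proof (rule power2_le_imp_le)
      have "(exp (1 / 2))\<^sup>2 = exp (1::real)" using exp_double[of "1 / 2 :: real"] by simp
      also have "\<dots> \<le> 2\<^sup>2" using exp_le by simp
      finally show "(exp (1 / 2))\<^sup>2 \<le> (2::real)\<^sup>2" .
    qed simp
    then have "exp (1 / 2) ^ R \<le> (2::real) ^ R" by (intro power_mono) auto
    moreover have "x ^ 10 \<le> exp (1 / 2) ^ R" unfolding xp using R by (simp add: exp_of_nat_mult[symmetric])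
    ultimately have two: "x ^ 10 \<le> 2 ^ R" by linarith
    have "real q * (4 ^ k / 2 ^ R) \<le> x * ((4 * x\<^sup>2) / x ^ 10)"
      using qN four two x0 by (intro mult_mono frac_le) auto
    also have "\<dots> = 4 / x ^ 7" using x0 by (simp add: field_simps eval_nat_numeral)
    finally show ?thesis .
  qed
  have T2: "real (q * r * N) * exp (2 * \<Lambda> - real d1) \<le> 1 / x ^ 7"
  proof -
    have "2 * \<Lambda> - real d1 \<le> - (8 * L)" using s by (simp add: \<Lambda>_def algebra_simps)
    then have "exp (2 * \<Lambda> - real d1) \<le> exp (- (8 * L))" by simp
    also have "\<dots> = 1 / x ^ 8" unfolding xp by (simp add: exp_minus field_simps)
    finally have "real (q * r * N) * exp (2 * \<Lambda> - real d1) \<le> x * (1 / x ^ 8)" using q x0 by (intro mult_mono) auto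
    also have "\<dots> = 1 / x ^ 7" using x0 by (simp add: field_simps eval_nat_numeral)
    finally show ?thesis .
  qed
  have \<Lambda>0: "0 \<le> \<Lambda>" using degree_const_ge[of r] L by (simp add: \<Lambda>_def)
  have ratio: "real r * \<Lambda> / real N \<le> exp (- (L / 2))"
  proof -
    have "1 / real N \<le> s\<^sup>2 / x" using N x0 by (simp add: field_simps)
    note one_over_N = this
    have rL: "real r * \<Lambda> \<le> s * s" using s(1) s(4)[folded \<Lambda>_def] \<Lambda>0 s2 by (intro mult_mono) linarith+
    have "real r * \<Lambda> * (1 / real N) \<le> s * s * (s\<^sup>2 / x)"
      by (rule mult_mono[OF rL one_over_N]) (use s2 in simp_all)
    also have "\<dots> = s ^ 4 / x" by (simp add: power2_eq_square power4_eq_xxxx)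
    also have "\<dots> \<le> exp (L / 2) / x"
    proof (rule divide_right_mono[OF power2_le_imp_le])
      have "(s ^ 4)\<^sup>2 = s ^ 8" by (simp add: power_mult[symmetric])
      also have "\<dots> \<le> (exp (L / 2))\<^sup>2" using s L(1) exp_double[of "L / 2"] by simp
      finally show "(s ^ 4)\<^sup>2 \<le> (exp (L / 2))\<^sup>2" .
    qed (use x0 in auto)
    also have "\<dots> = exp (- (L / 2))"
      unfolding L(1) by (simp add: exp_diff[symmetric]) 
    finally show ?thesis by simp
  qed
  have rat0: "0 \<le> real r * \<Lambda> / real N" using \<Lambda>0 by simp
  have T3: "(real (q * r * N))\<^sup>2 * ((\<Lambda> / real N) ^ t + fact t * exp (2 * \<Lambda>) * (real r * \<Lambda> / real N) ^ t) \<le> 1 / x ^ 7"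
  proof -
    have t: "8 * degree_const r + 40 \<le> real t" unfolding t_def by (rule codegree_exponent_ge)
    have pw: "(real r * \<Lambda> / real N) ^ t \<le> exp (- (real t * L / 2))"
    proof -
      have "(real r * \<Lambda> / real N) ^ t \<le> exp (- (L / 2)) ^ t" using ratio rat0 by (intro power_mono)
      then show ?thesis by (simp add: exp_of_nat_mult[symmetric])
    qed
    have "(\<Lambda> / real N) ^ t \<le> (real r * \<Lambda> / real N) ^ t"
    proof (intro power_mono divide_right_mono)
      show "\<Lambda> \<le> real r * \<Lambda>" using r \<Lambda>0 mult_right_mono[of 1 "real r" \<Lambda>] by simp
    qed (use \<Lambda>0 in auto)
    moreover have "(real r * \<Lambda> / real N) ^ t \<le> fact t * exp (2 * \<Lambda>) * (real r * \<Lambda> / real N) ^ t"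
    proof -
      have "1 * 1 \<le> fact t * exp (2 * \<Lambda>)" using \<Lambda>0 by (intro mult_mono) (auto simp: fact_ge_1)
      then show ?thesis using mult_right_mono[of 1 "fact t * exp (2 * \<Lambda>)" "(real r * \<Lambda> / real N) ^ t"] rat0 by simp
    qed
    ultimately have "(\<Lambda> / real N) ^ t + fact t * exp (2 * \<Lambda>) * (real r * \<Lambda> / real N) ^ t
        \<le> 2 * fact t * exp (2 * \<Lambda>) * (real r * \<Lambda> / real N) ^ t" by simp
    also have "\<dots> \<le> x * exp (2 * \<Lambda>) * exp (- (real t * L / 2))"
      using x pw rat0 unfolding t_def[symmetric] by (intro mult_mono) auto
    also have "\<dots> \<le> exp (- (9 * L))"
    proof -
      have "L * (8 * degree_const r + 40) \<le> L * real t" using t L by (intro mult_left_mono) auto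
      then have "L + 2 * \<Lambda> - real t * L / 2 \<le> L + 2 * \<Lambda> - (4 * \<Lambda> + 20 * L)" by (simp add: \<Lambda>_def algebra_simps)
      also have "\<dots> \<le> - (9 * L)" using \<Lambda>0 L by simp
      finally show ?thesis unfolding L(1) by (simp add: exp_add[symmetric] algebra_simps)
    qed
    also have "\<dots> = 1 / x ^ 9" unfolding xp by (simp add: exp_minus field_simps)
    finally have "(\<Lambda> / real N) ^ t + fact t * exp (2 * \<Lambda>) * (real r * \<Lambda> / real N) ^ t \<le> 1 / x ^ 9" .
    moreover have "(real (q * r * N))\<^sup>2 \<le> x\<^sup>2" using q by (intro power_mono) auto
    moreover have "0 \<le> (\<Lambda> / real N) ^ t + fact t * exp (2 * \<Lambda>) * (real r * \<Lambda> / real N) ^ t" using \<Lambda>0 by simp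
    ultimately have "(real (q * r * N))\<^sup>2 * ((\<Lambda> / real N) ^ t + fact t * exp (2 * \<Lambda>) * (real r * \<Lambda> / real N) ^ t) \<le> x\<^sup>2 * (1 / x ^ 9)"
      by (intro mult_mono) auto
    also have "\<dots> = 1 / x ^ 7" using x0 by (simp add: field_simps eval_nat_numeral)
    finally show ?thesis .
  qed
  have "Pr (Idx q r N) (\<lambda>_. \<pi>) (\<lambda>H. \<not> good_transversals q r N d1 (2 * r * t) H)
    \<le> real q * (4 ^ k / 2 ^ R) + real (q * r * N) * exp (2 * \<Lambda> - real d1)
     + (real (q * r * N))\<^sup>2 * ((\<Lambda> / real N) ^ t + fact t * exp (2 * \<Lambda>) * (real r * \<Lambda> / real N) ^ t)"
    by (rule good_transversals_likely[OF q0(1,2) q0(3)[unfolded \<kappa>_def] r N(1) k1 \<pi>_def \<Lambda>])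
  also have "\<dots> \<le> 4 / x ^ 7 + 1 / x ^ 7 + 1 / x ^ 7" using T1 T2 T3 by linarith
  also have "\<dots> = 6 / x ^ 7" by simp
  also have "\<dots> \<le> 1 / x ^ 4"
  proof -
    have "8 ^ 3 \<le> x ^ 3" using x by (intro power_mono) auto
    then have "6 * x ^ 4 \<le> x ^ 3 * x ^ 4" using x0 by (intro mult_right_mono) auto
    also have "\<dots> = x ^ 7" by (simp flip: power_add)
    finally show ?thesis using x0 by (simp add: field_simps)
  qed
  finally show ?thesis using \<pi> \<Lambda> unfolding t_def \<Lambda>_def by (intro exI[of _ \<pi>]) auto
qed

definition codegree_cap :: "nat \<Rightarrow> nat" where "codegree_cap r = 2 * r * codegree_exponent r"

text \<open>
  \<open>s\<close> will be a small power of \<open>n\<close>, \<open>s = n\<^bsup>1/(8(r+1)^3)\<^esup>\<close>.  The constants below collect what \<open>s\<close>, or the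
  mean number of \<open>r\<close>-cliques at a vertex, has to exceed.  \<open>richness_const\<close> makes the bit probability \<open>c\<close> small
  enough, \<open>sparsity_const\<close> comes from the expected number of completions of partial cliques, and
  \<open>scale_const\<close> is a sum of thresholds for \<open>s\<close>.
\<close>

definition richness_const :: "nat \<Rightarrow> real" where
  "richness_const r = 8 * degree_const r * (4 * real r) ^ (r - 1) * 2 ^ (r + r\<^sup>2 * codegree_cap r)"

definition sparsity_const :: "nat \<Rightarrow> real" where
  "sparsity_const r = real (r choose 2) * real r * fact r * (3 * (real r + 1)\<^sup>2) ^ (r + r\<^sup>2) * (3 * (12 * real r * (real r + 1)) ^ (r - 1))"

definition scale_const :: "nat \<Rightarrow> real" where
  "scale_const r = 64 * exp 1 + 2 * fact (codegree_exponent r) + 8 * sparsity_const r + 96 * real r * (real r + 1) * (real r + 1) ^ (r + 2)"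

lemma sparsity_const_nonneg: "0 \<le> sparsity_const r"
  by (simp add: sparsity_const_def)

lemma scale_const_ge:
  assumes "2 \<le> r"
  shows "64 * exp 1 \<le> scale_const r" "2 * fact (codegree_exponent r) \<le> scale_const r" "8 * sparsity_const r \<le> scale_const r"
    "96 * real r * (real r + 1) * (real r + 1) ^ (r + 2) \<le> scale_const r" "96 * real r * (real r + 1) \<le> scale_const r"
proof -
  have n: "0 \<le> 64 * exp (1::real)" "0 \<le> (2 * fact (codegree_exponent r) :: real)" "0 \<le> 8 * sparsity_const r"
    "0 \<le> 96 * real r * (real r + 1) * (real r + 1) ^ (r + 2)"
    using sparsity_const_nonneg by auto
  show "64 * exp 1 \<le> scale_const r" "2 * fact (codegree_exponent r) \<le> scale_const r" "8 * sparsity_const r \<le> scale_const r"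
    and b: "96 * real r * (real r + 1) * (real r + 1) ^ (r + 2) \<le> scale_const r" unfolding scale_const_def using n by linarith+
  have "1 \<le> (real r + 1) ^ (r + 2)" by (intro one_le_power) simp
  then have "96 * real r * (real r + 1) * 1 \<le> 96 * real r * (real r + 1) * (real r + 1) ^ (r + 2)"
    by (intro mult_left_mono) auto
  then show "96 * real r * (real r + 1) \<le> scale_const r" using b by simp
qed

text \<open>
  \<open>clique_count_tail\<close> with \<open>m \<approx> 5 ln n\<close>: its base is at most \<open>1/3 < 1/e\<close>, because the mean, by the last
  assumption, and the overlap terms are small fractions of \<open>n\<close>.
\<close>

lemma clique_count_tail_numeric:
  fixes n r :: nat and p s L x :: real
  assumes r: "2 \<le> r" and x: "x = real n" and L: "x = exp L" "1 \<le> L" and s: "s ^ (8 * (r + 1) ^ 3) = x" "scale_const r \<le> s" "8 * L \<le> s"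
    and p: "0 < p" "p \<le> 1" and F3: "x\<^sup>2 * p ^ (r + 1) \<le> 1"
    and e0: "x ^ (r + 1) * p ^ ((r + 1) choose 2) \<le> x / (96 * real r * (real r + 1))"
  shows "Pr (nsets {1..n} 2) (\<lambda>_. p) (\<lambda>A. n div (8 * r * (r + 1)) \<le> card (cliques (r + 1) {1..n} A)) \<le> 1 / x ^ 4"
proof -
  define m where "m = nat \<lceil>5 * L\<rceil>"
  define y where "y = n div (8 * r * (r + 1))"
  define \<epsilon> where "\<epsilon> = 1 / (96 * real r * (real r + 1))"
  have \<epsilon>0: "0 < \<epsilon>" using r by (simp add: \<epsilon>_def)
  note B = scale_const_ge[OF r]
  have s96: "96 * real r * (real r + 1) \<le> s" using B(5) s(2) by linarith
  have "2 * 1 \<le> real r * (real r + 1)" using r by (intro mult_mono) auto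
  then have s1: "100 \<le> s" using s96 by linarith
  have m: "5 * L \<le> real m" "real m \<le> 6 * L" using L by (auto simp: m_def) linarith+
  then have ms: "real m \<le> s" using s(3) L by linarith
  have pow: "s ^ j \<le> x" if "j \<le> 8 * (r + 1) ^ 3" for j
    unfolding s(1)[symmetric] using s1 that by (intro power_increasing) auto
  have big: "r + 2 \<le> 8 * (r + 1) ^ 3" "3 \<le> 8 * (r + 1) ^ 3"
  proof -
    have "(r + 1) ^ 1 \<le> (r + 1) ^ 3" by (intro power_increasing) auto
    then show "r + 2 \<le> 8 * (r + 1) ^ 3" by simp
    moreover have "3 \<le> r + 2" using r by simp
    ultimately show "3 \<le> 8 * (r + 1) ^ 3" by linarith
  qed
  have x0: "0 < x" using L by simp
  have s3: "s * (s * s) \<le> x" using pow[OF big(2)] by (simp add: eval_nat_numeral)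
  have ymr: "x / (16 * real r * (real r + 1)) \<le> real y - real m"
  proof -
    have "real n / real (8 * r * (r + 1)) < real y + 1"
    proof -
      have "n < 8 * r * (r + 1) * (y + 1)" unfolding y_def using r
        by (metis Suc_eq_plus1 add_gr_0 dividend_less_times_div mult_Suc_right nat_0_less_mult_iff not_gr0 not_numeral_le_zero zero_less_numeral zero_less_one add.commute)
      then have "real n < real (8 * r * (r + 1)) * (real y + 1)" by (metis of_nat_1 of_nat_add of_nat_less_iff of_nat_mult)
      moreover have "0 < real (8 * r * (r + 1))" unfolding of_nat_0_less_iff using r by simp
      ultimately show ?thesis by (simp only: pos_divide_less_eq mult.commute)
    qed
    moreover have "real n / real (8 * r * (r + 1)) = 2 * (x / (16 * real r * (real r + 1)))"
    proof -
      have "real (8 * r * (r + 1)) = 8 * (real r * (real r + 1))" by (simp add: algebra_simps)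
      moreover have "2 * (x / (16 * real r * (real r + 1))) = x / (8 * (real r * (real r + 1)))"
        using r by (simp add: divide_simps)
      ultimately show ?thesis by (simp only: x)
    qed
    moreover have "1 + s \<le> x / (16 * real r * (real r + 1))"
    proof -
      have "16 * real r * (real r + 1) * (1 + s) \<le> s * (s * s)"
      proof (rule mult_mono)
        have "0 \<le> real r * (real r + 1)" by simp
        then show "16 * real r * (real r + 1) \<le> s" using s96 by linarith
        have "100 * s \<le> s * s" using s1 by (intro mult_right_mono) auto
        then show "1 + s \<le> s * s" using s1 by linarith
      qed (use s1 in auto)
      then have "(1 + s) * (16 * real r * (real r + 1)) \<le> x" using s3 by (simp add: mult_ac)
      then show ?thesis using r by (simp add: pos_le_divide_eq)
    qed
    ultimately show ?thesis using ms by linarith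
  qed
  have pos16: "0 < x / (16 * real r * (real r + 1))" using x0 r by simp
  then have my: "m < y" using ymr by linarith
  define \<sigma> where "\<sigma> = (\<Sum>s'\<le>r + 1. real (m * (r + 1)) ^ s' * ext_weight n (r + 1) p s')"
  have \<sigma>0: "0 \<le> \<sigma>" unfolding \<sigma>_def using p by (intro sum_nonneg mult_nonneg_nonneg ext_weight_nonneg) auto
  have \<sigma>: "\<sigma> \<le> 2 * \<epsilon> * x"
  proof -
    have m1: "1 \<le> real (m * (r + 1))"
    proof -
      have "1 \<le> m" using m L by linarith
      then have "1 * 1 \<le> m * (r + 1)" by (intro mult_le_mono) auto
      then show ?thesis by linarith
    qed
    have "\<sigma> = ext_weight n (r + 1) p 0 + (\<Sum>s'\<in>{1..r + 1}. real (m * (r + 1)) ^ s' * ext_weight n (r + 1) p s')"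
    proof -
      have "{..r + 1} = insert 0 {1..r + 1}" by auto
      then show ?thesis unfolding \<sigma>_def by simp
    qed
    also have "ext_weight n (r + 1) p 0 \<le> \<epsilon> * x" using e0 by (simp add: ext_weight_def x \<epsilon>_def binomial_eq_0)
    also have "(\<Sum>s'\<in>{1..r + 1}. real (m * (r + 1)) ^ s' * ext_weight n (r + 1) p s') \<le> (\<Sum>s'\<in>{1..r + 1}. (s * (real r + 1)) ^ (r + 1) * 1)"
    proof (intro sum_mono mult_mono)
      fix s' assume s': "s' \<in> {1..r + 1}"
      have "real (m * (r + 1)) ^ s' \<le> real (m * (r + 1)) ^ (r + 1)" using s' m1 by (intro power_increasing) auto
      also have "\<dots> \<le> (s * (real r + 1)) ^ (r + 1)" using mult_right_mono[OF ms, of "real r + 1"] by (intro power_mono) (auto simp: algebra_simps)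
      finally show "real (m * (r + 1)) ^ s' \<le> (s * (real r + 1)) ^ (r + 1)" .
      show "ext_weight n (r + 1) p s' \<le> 1" using ext_weight_le_one[OF p, of n r s'] F3 s' x by simp
    qed (use p s1 ext_weight_nonneg in auto)
    also have "\<dots> = (real r + 1) * (s * (real r + 1)) ^ (r + 1)" by (simp add: algebra_simps)
    also have "\<dots> = (real r + 1) ^ (r + 2) * s ^ (r + 1)" by (simp add: power_mult_distrib mult_ac)
    also have "\<dots> \<le> \<epsilon> * x"
    proof -
      have "(96 * real r * (real r + 1) * (real r + 1) ^ (r + 2)) * s ^ (r + 1) \<le> s * s ^ (r + 1)"
        using B(4) s(2) s1 by (intro mult_right_mono) auto
      also have "\<dots> = s ^ (r + 2)" by simp
      also have "\<dots> \<le> x" by (rule pow[OF big(1)])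
      finally show ?thesis using r by (simp add: \<epsilon>_def pos_le_divide_eq mult_ac)
    qed
    finally show ?thesis by simp
  qed
  have ratio: "\<sigma> / real (y - m) \<le> exp (- 1)"
  proof -
    have "\<sigma> / real (y - m) \<le> 2 * \<epsilon> * x / (x / (16 * real r * (real r + 1)))"
      using \<sigma> ymr my pos16 \<epsilon>0 x0 by (intro frac_le) (auto simp: of_nat_diff)
    also have "\<dots> = 1 / 3"
    proof -
      define Z where "Z = real r * (real r + 1)"
      have "Z \<noteq> 0" "x \<noteq> 0" using r x0 by (auto simp: Z_def)
      moreover have "\<epsilon> = 1 / (96 * Z)" "16 * real r * (real r + 1) = 16 * Z" by (simp_all add: \<epsilon>_def Z_def mult.assoc)
      ultimately show ?thesis by simp
    qed
    also have "\<dots> \<le> exp (- 1)" using exp_le by (simp add: exp_minus field_simps)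
    finally show ?thesis .
  qed
  have "Pr (nsets {1..n} 2) (\<lambda>_. p) (\<lambda>A. y \<le> card (cliques (r + 1) {1..n} A)) \<le> (\<sigma> / real (y - m)) ^ m"
    using clique_count_tail[of "{1..n}" p m y "r + 1"] p my by (simp add: \<sigma>_def)
  also have "\<dots> \<le> exp (- 1) ^ m" using ratio \<sigma>0 by (intro power_mono) auto
  also have "\<dots> = exp (- real m)" by (simp add: exp_of_nat_mult[symmetric])
  also have "\<dots> \<le> exp (- (4 * L))" using m L by simp
  also have "\<dots> = 1 / x ^ 4" unfolding L(1) by (simp add: exp_minus exp_of_nat_mult[symmetric] field_simps)
  finally show ?thesis by (simp add: y_def)
qed

lemma sqrt_p_le:
  fixes x p s :: real
  assumes "s ^ (8 * (r + 1) ^ 3) = x" "0 \<le> s" "0 < p" "x\<^sup>2 * p ^ (r + 1) \<le> 1"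
  shows "s ^ (8 * (r + 1)\<^sup>2) * sqrt p \<le> 1"
proof -
  let ?v = "s ^ (8 * (r + 1)\<^sup>2) * sqrt p"
  have e1: "8 * (r + 1)\<^sup>2 * (2 * (r + 1)) = 8 * (r + 1) ^ 3 * 2" by (simp add: power2_eq_square power3_eq_cube algebra_simps)
  have "?v ^ (2 * (r + 1)) = s ^ (8 * (r + 1)\<^sup>2 * (2 * (r + 1))) * ((sqrt p)\<^sup>2) ^ (r + 1)"
    unfolding power_mult_distrib power_mult[symmetric] ..
  also have "\<dots> = (s ^ (8 * (r + 1) ^ 3))\<^sup>2 * p ^ (r + 1)" unfolding e1 power_mult using assms by simp
  also have "\<dots> \<le> 1" using assms by simp
  finally have "?v ^ Suc (2 * r + 1) \<le> 1 ^ Suc (2 * r + 1)" by simp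
  then show ?thesis by (rule power_le_imp_le_base) simp
qed

text \<open>
  The number of groups is \<open>q = 2 m (r + 1) + 1\<close>, twice the bound \<open>m (r + 1)\<close> on the number of clique
  neighbours plus one, as greedy colouring requires.  The three error terms \<open>1 / x\<^sup>4\<close> stand for too
  many \<open>(r + 1)\<close>-cliques, a vertex with too many clique neighbours, and a failure to find the
  matchings.  \<open>tail\<close> controls the second, \<open>rich\<close> keeps the bit probability of the third small.
\<close>

theorem chromatic_excess_numeric:
  fixes n r m :: nat and p s L x :: real
  assumes r: "2 \<le> r" and x: "x = real n" and L: "x = exp L" "1 \<le> L" and s: "s ^ (8 * (r + 1) ^ 3) = x" "scale_const r \<le> s" "(2 * degree_const r + 8) * L \<le> s"
    and p: "0 < p" "p \<le> 1" and F3: "x\<^sup>2 * p ^ (r + 1) \<le> 1" and F4: "1 \<le> x\<^sup>2 * p ^ r"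
    and m: "1 \<le> m" "real m \<le> s"
    and tail: "x * (\<Sum>s'\<in>{1..<r + 1}. real (m * (r + 1)) ^ (s' - 1) * ext_weight n (r + 1) p s') ^ m \<le> 1 / x ^ 4"
    and rich: "richness_const r * L * real (2 * (m * (r + 1)) + 1) ^ (r - 1) \<le> x ^ (r - 1) * p ^ (r choose 2)"
    and e0: "x ^ (r + 1) * p ^ ((r + 1) choose 2) \<le> x / (96 * real r * (real r + 1))"
  shows "Pr (nsets {1..n} 2) (\<lambda>_. p) (\<lambda>A. \<not> r * chromatic_number {1..n} (graph_complement {1..n} A)
      + packing_number (cliques (r + 1) {1..n} A) \<le> n + r * ((2 * (m * (r + 1)) + 1) * r)) \<le> 3 / x ^ 4"
proof -
  define V where "V = {1..n}"
  define q where "q = 2 * (m * (r + 1)) + 1"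
  define d0 where "d0 = m * (r + 1)"
  define d1 where "d1 = nat \<lceil>s\<rceil>"
  define y where "y = n div (8 * r * (r + 1))"
  define \<Lambda> where "\<Lambda> = degree_const r * L"
  define D where "D = 3 * (real r + 1)\<^sup>2 * s"
  define B where "B = fact r * D ^ (r\<^sup>2)"
  define \<xi> where "\<xi> = B * (1 + 2 * \<Lambda> * (4 * real q * real r) ^ (r - 1)) * sqrt p"
  note Bc = scale_const_ge[OF r]
  have finV: "finite V" "card V = n" by (auto simp: V_def)
  have rr: "6 \<le> real r * (real r + 1)"
  proof -
    have "2 * 3 \<le> real r * (real r + 1)" using r by (intro mult_mono) auto
    then show ?thesis by simp
  qed
  have s96: "96 * real r * (real r + 1) \<le> s" using Bc(5) s(2) by linarith
  have s1: "100 \<le> s" using s96 rr by linarith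
  have l0: "1 \<le> degree_const r" by (rule degree_const_ge)
  have \<Lambda>s: "\<Lambda> \<le> s" "0 \<le> \<Lambda>" "8 * L \<le> s" "1 \<le> \<Lambda>"
  proof -
    have "1 * 1 \<le> degree_const r * L" using l0 L by (intro mult_mono) auto
    then have a: "0 \<le> degree_const r * L" "1 \<le> degree_const r * L" by simp_all
    have "(2 * degree_const r + 8) * L = 2 * (degree_const r * L) + 8 * L" by (simp add: algebra_simps)
    then show "\<Lambda> \<le> s" "0 \<le> \<Lambda>" "8 * L \<le> s" "1 \<le> \<Lambda>" using a s(3) L by (auto simp: \<Lambda>_def)
  qed
  have x0: "0 < x" using L by simp
  have pow: "s ^ j \<le> x" if "j \<le> 8 * (r + 1) ^ 3" for j
    unfolding s(1)[symmetric] using s1 that by (intro power_increasing) auto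
  have e8: "8 \<le> 8 * (r + 1) ^ 3" by simp
  have s8: "s ^ 8 \<le> x" by (rule pow[OF e8])
  have s3: "s * (s * s) \<le> x" using pow[of 3] e8 by (simp add: eval_nat_numeral)
  have sx: "s \<le> x" using pow[of 1] e8 by simp
  have q3: "real q \<le> 3 * (real r + 1) * s"
  proof -
    have "real q = 2 * (real m * (real r + 1)) + 1" by (simp add: q_def algebra_simps)
    also have "\<dots> \<le> 2 * (s * (real r + 1)) + 1" using m by (intro add_mono mult_left_mono mult_right_mono) auto
    also have "\<dots> \<le> 2 * (s * (real r + 1)) + s * (real r + 1)"
      using s1 mult_mono[of 1 s 1 "real r + 1"] by simp
    finally show ?thesis by (simp add: algebra_simps)
  qed
  have q1: "1 \<le> q" by (simp add: q_def)
  have d1: "s \<le> real d1" "real d1 \<le> 2 * s" using s1 by (auto simp: d1_def) linarith+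
  have D1: "1 \<le> D"
  proof -
    have "1 * 1 \<le> (real r + 1)\<^sup>2 * s" using s1 by (intro mult_mono) auto
    then show ?thesis by (simp add: D_def)
  qed
  have D2: "real ((r + 1) * (d0 + r * d1)) \<le> D"
  proof -
    have "real ((r + 1) * (d0 + r * d1)) = (real r + 1) * (real m * (real r + 1) + real r * real d1)" by (simp add: d0_def algebra_simps)
    also have "\<dots> \<le> (real r + 1) * (s * (real r + 1) + real r * (2 * s))"
      using m d1 by (intro mult_left_mono add_mono mult_right_mono) auto
    also have "\<dots> \<le> (real r + 1) * (3 * (real r + 1) * s)" using s1 by (intro mult_left_mono) (auto simp: algebra_simps)
    also have "\<dots> = D" by (simp only: D_def power2_eq_square mult_ac)
    finally show ?thesis .
  qed
  have B0: "0 \<le> B" using D1 by (simp add: B_def)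
  have B1: "1 \<le> B"
  proof -
    have "1 * 1 \<le> B" unfolding B_def using D1 by (intro mult_mono one_le_power) (auto simp: fact_ge_1)
    then show ?thesis by simp
  qed
  have big1: "1 \<le> 1 + 2 * \<Lambda> * (4 * real q * real r) ^ (r - 1)" using \<Lambda>s by simp
  have sp: "0 \<le> sqrt p" "p \<le> sqrt p" using p
    by (auto intro!: real_le_rsqrt simp: power2_eq_square mult_left_le)
  have B\<xi>: "B * sqrt p \<le> \<xi>"
  proof -
    have "B * 1 \<le> B * (1 + 2 * \<Lambda> * (4 * real q * real r) ^ (r - 1))" using big1 B0 by (intro mult_left_mono)
    then show ?thesis unfolding \<xi>_def using sp by (intro mult_right_mono) auto
  qed
  have p\<xi>: "p \<le> \<xi>"
  proof -
    have "1 * sqrt p \<le> B * sqrt p" using B1 sp by (intro mult_right_mono) auto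
    then show ?thesis using B\<xi> sp by linarith
  qed
  have small1: "real (r choose 2) * (real r * D ^ r * \<xi>) \<le> 1 / 8"
  proof -
    have sr: "1 \<le> s" using s1 by simp
    have "4 * real q * real r \<le> 4 * (3 * (real r + 1) * s) * real r" using q3 by (intro mult_right_mono mult_left_mono) auto
    then have qb: "4 * real q * real r \<le> 12 * real r * (real r + 1) * s" by (simp add: mult_ac)
    have pb: "(4 * real q * real r) ^ (r - 1) \<le> (12 * real r * (real r + 1) * s) ^ (r - 1)"
      by (rule power_mono[OF qb]) simp
    have "2 * \<Lambda> * (4 * real q * real r) ^ (r - 1) \<le> 2 * s * (12 * real r * (real r + 1) * s) ^ (r - 1)"
      by (rule mult_mono[OF _ pb]) (use \<Lambda>s s1 in auto)
    then have "1 + 2 * \<Lambda> * (4 * real q * real r) ^ (r - 1) \<le> 1 + 2 * s * (12 * real r * (real r + 1) * s) ^ (r - 1)" by simp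
    also have "\<dots> = 1 + 2 * (12 * real r * (real r + 1)) ^ (r - 1) * s ^ r"
    proof -
      have "s ^ r = s * s ^ (r - 1)" using r by (cases r) auto
      then show ?thesis unfolding power_mult_distrib by (simp add: mult_ac)
    qed
    also have "\<dots> \<le> 3 * (12 * real r * (real r + 1)) ^ (r - 1) * s ^ r"
    proof -
      have "1 * 1 \<le> (12 * real r * (real r + 1)) ^ (r - 1) * s ^ r"
        using rr sr by (intro mult_mono one_le_power) auto
      then show ?thesis by (simp add: mult_ac)
    qed
    finally have three: "1 + 2 * \<Lambda> * (4 * real q * real r) ^ (r - 1) \<le> 3 * (12 * real r * (real r + 1)) ^ (r - 1) * s ^ r" .
    have "real (r choose 2) * (real r * D ^ r * \<xi>)
       = real (r choose 2) * real r * fact r * D ^ (r + r\<^sup>2) * ((1 + 2 * \<Lambda> * (4 * real q * real r) ^ (r - 1)) * sqrt p)"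
      by (simp add: \<xi>_def B_def power_add mult_ac)
    also have "\<dots> \<le> real (r choose 2) * real r * fact r * D ^ (r + r\<^sup>2) * ((3 * (12 * real r * (real r + 1)) ^ (r - 1) * s ^ r) * sqrt p)"
      using three sp D1 by (intro mult_left_mono mult_right_mono) auto
    also have "\<dots> = sparsity_const r * (s ^ (r + r\<^sup>2 + r) * sqrt p)"
      unfolding sparsity_const_def D_def power_mult_distrib[of _ s] by (simp add: power_add mult_ac)
    also have "\<dots> \<le> sparsity_const r * (1 / s)"
    proof (intro mult_left_mono sparsity_const_nonneg)
      have "s * (s ^ (r + r\<^sup>2 + r) * sqrt p) = s ^ (r + r\<^sup>2 + r + 1) * sqrt p" by simp
      also have "\<dots> \<le> s ^ (8 * (r + 1)\<^sup>2) * sqrt p"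
        using sr sp by (intro mult_right_mono power_increasing) (auto simp: power2_eq_square)
      also have "\<dots> \<le> 1" using sr p F3 by (intro sqrt_p_le[OF s(1)]) auto
      finally show "s ^ (r + r\<^sup>2 + r) * sqrt p \<le> 1 / s" using sr by (simp add: field_simps)
    qed
    also have "\<dots> \<le> 1 / 8"
    proof -
      have "8 * sparsity_const r \<le> s" using Bc(3) s(2) by linarith
      then show ?thesis using sr by (simp add: field_simps)
    qed
    finally show ?thesis .
  qed
  have sparse1: "p ^ (b * (r + 1 - b)) * (fact r * D ^ (r\<^sup>2) * (real (card V) ^ (r + 1 - b) * p ^ ((r + 1 - b) choose 2))) \<le> \<xi>"
    if b: "2 \<le> b" "b \<le> r" for b
  proof -
    have "x ^ (r + 1 - b) * p ^ (b * (r + 1 - b) + ((r + 1 - b) choose 2)) \<le> sqrt p"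
    proof (rule sparse_le_sqrt[OF _ p F3])
      have "2 * (b * (r + 1 - b) + ((r + 1 - b) choose 2)) = 2 * (b * (r + 1 - b)) + (r + 1 - b) * (r + 1 - b - 1)"
        using two_choose[of "r + 1 - b"] by simp
      also have "\<dots> = (r + 1 - b) * (2 * b + (r + 1 - b - 1))" by (simp add: algebra_simps)
      also have "\<dots> \<ge> (r + 1 - b) * (r + 2)" using b by (intro mult_le_mono2) auto
      finally show "(r + 1 - b) * (r + 2) \<le> 2 * (b * (r + 1 - b) + ((r + 1 - b) choose 2))" .
    qed (use b x0 in auto)
    then have "B * (x ^ (r + 1 - b) * p ^ (b * (r + 1 - b) + ((r + 1 - b) choose 2))) \<le> B * sqrt p"
      using B0 by (rule mult_left_mono)
    also have "\<dots> \<le> \<xi>" by (rule B\<xi>)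
    finally show ?thesis by (simp add: B_def finV x power_add mult_ac)
  qed
  have dense: "1 \<le> real (card V) ^ (b - 1) * p ^ (b choose 2)" if "1 \<le> b" "b \<le> r" for b
    using dense_ge_one[OF _ p F4 that] x0 by (simp add: finV x)
  have y2: "2 * ((r + 1) * y) \<le> card V"
  proof -
    have a: "8 * r * (r + 1) * y \<le> n" unfolding y_def by (rule times_div_less_eq_dividend)
    have "2 * ((r + 1) * y) = 2 * 1 * (r + 1) * y" by simp
    also have "\<dots> \<le> 8 * r * (r + 1) * y" using r by (intro mult_le_mono1) auto
    finally show ?thesis using a finV by simp
  qed
  have size: "1 \<le> N \<and> 2 * ((r + 1) * y) \<le> q * N \<and> (\<exists>c. 0 < c \<and> c \<le> 1 \<and> c * 2 ^ (r + r\<^sup>2 * codegree_cap r) \<le> 1 / 4 \<and>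
       (\<forall>b. 2 \<le> b \<longrightarrow> b < r \<longrightarrow> c * (p ^ (b * (r - b)) * (fact r * D ^ (r\<^sup>2) * (real (card V) ^ (r - b) * p ^ ((r - b) choose 2)))) \<le> \<xi>) \<and>
       1 - 1 / x ^ 4 \<le> Pr (Idx q r N) (\<lambda>_. c * p ^ (r choose 2) / 2) (good_transversals q r N d1 (codegree_cap r)))"
    if N1: "card V \<le> 2 * (q * r * (N + 1))" and N2: "q * r * N \<le> card V" for N
  proof -
    have qs: "4 * real q * real r \<le> s\<^sup>2"
    proof -
      have "4 * real q * real r \<le> 4 * (3 * (real r + 1) * s) * real r" using q3 by (intro mult_right_mono mult_left_mono) auto
      also have "\<dots> = (12 * real r * (real r + 1)) * s" by simp
      also have "\<dots> \<le> s * s" using s96 rr s1 by (intro mult_right_mono) linarith+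
      finally show ?thesis by (simp add: power2_eq_square)
    qed
    have Npos: "1 \<le> N"
    proof (rule ccontr)
      assume "\<not> 1 \<le> N"
      then have "N = 0" by simp
      then have "n \<le> 2 * (q * r)" using N1 finV by simp
      then have "real n \<le> real (2 * (q * r))" by (rule of_nat_mono)
      then have "x \<le> 4 * real q * real r" using x by simp
      also have "\<dots> \<le> s\<^sup>2" by (rule qs)
      also have "\<dots> < s * (s * s)" using s1 by (simp add: power2_eq_square)
      finally show False using s3 by linarith
    qed
    have "2 * (q * r * (N + 1)) \<le> 2 * (q * r * (2 * N))" using Npos by (intro mult_le_mono2) auto
    then have "n \<le> 2 * (q * r * (2 * N))" using N1 unfolding finV(2) by (rule order_trans[rotated])
    then have n4: "n \<le> 4 * (q * r * N)" by simp
    have yN: "2 * ((r + 1) * y) \<le> q * N"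
    proof -
      have "8 * r * (r + 1) * y \<le> n" unfolding y_def by (rule times_div_less_eq_dividend)
      also have "\<dots> \<le> 4 * (q * r * N)" by (rule n4)
      finally have "(4 * r) * (2 * ((r + 1) * y)) \<le> (4 * r) * (q * N)" by (simp add: algebra_simps)
      then show ?thesis unfolding mult_le_cancel1 using r by auto
    qed
    have "real n \<le> real (4 * (q * r * N))" using n4 by (rule of_nat_mono)
    then have xN: "x \<le> 4 * real q * real r * real N" using x by simp
    also have "\<dots> \<le> s\<^sup>2 * real N" using qs by (intro mult_right_mono) auto
    finally have xsN: "x \<le> s\<^sup>2 * real N" .
    have qrN: "real (q * r * N) \<le> x" using N2 finV x by (metis of_nat_mono)
    have Nx: "real N \<le> x"
    proof -
      have "1 * N \<le> (q * r) * N" using q1 r by (intro mult_le_mono1) auto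
      then have "real N \<le> real (q * r * N)" unfolding of_nat_le_iff by simp
      then show ?thesis using qrN by linarith
    qed
    have s64: "64 * exp 1 * s\<^sup>2 \<le> x"
    proof -
      have "64 * exp 1 * s\<^sup>2 \<le> s * s\<^sup>2" using Bc(1) s(2) by (intro mult_right_mono) auto
      also have "\<dots> \<le> x" using s3 by (simp add: power2_eq_square)
      finally show ?thesis .
    qed
    have rs: "real r \<le> s" using s96 rr r mult_left_mono[of 1 "real r + 1" "real r"] by linarith
    have x8: "8 \<le> x" "2 * fact (codegree_exponent r) \<le> x" using sx s1 Bc(2) s(2) by linarith+
    obtain \<pi> where \<pi>: "0 < \<pi>" "\<pi> \<le> 1" "real N ^ (r - 1) * \<pi> \<le> \<Lambda>"
      "Pr (Idx q r N) (\<lambda>_. \<pi>) (\<lambda>H. \<not> good_transversals q r N d1 (codegree_cap r) H) \<le> 1 / x ^ 4"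
      using good_transversals_numeric[OF r L Npos Nx xsN qrN rs s8 s64 \<Lambda>s(1)[unfolded \<Lambda>_def] s(3) d1(1) x8]
      unfolding codegree_cap_def \<Lambda>_def by blast
    \<comment> \<open>chosen so that half the probability of a test is the rate \<open>\<pi>\<close> of the random family\<close>
    define c where "c = 2 * \<pi> / p ^ (r choose 2)"
    have c0: "0 < c" using \<pi> p by (simp add: c_def)
    have \<pi>x: "\<pi> * x ^ (r - 1) \<le> \<Lambda> * (4 * real q * real r) ^ (r - 1)"
    proof -
      have "\<pi> * x ^ (r - 1) \<le> \<pi> * (4 * real q * real r * real N) ^ (r - 1)"
        using xN x0 \<pi> by (intro mult_left_mono power_mono) auto
      also have "\<dots> = (real N ^ (r - 1) * \<pi>) * (4 * real q * real r) ^ (r - 1)" by (simp add: power_mult_distrib mult_ac)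
      also have "\<dots> \<le> \<Lambda> * (4 * real q * real r) ^ (r - 1)" using \<pi> by (intro mult_right_mono) auto
      finally show ?thesis .
    qed
    have c2: "c * 2 ^ (r + r\<^sup>2 * codegree_cap r) \<le> 1 / 4"
    proof -
      let ?d = "x ^ (r - 1) * p ^ (r choose 2)" and ?T = "(2::real) ^ (r + r\<^sup>2 * codegree_cap r)"
      have d: "0 < ?d" using x0 p by simp
      have "c * ?T * ?d = 2 * (\<pi> * x ^ (r - 1)) * ?T" using p by (simp add: c_def)
      also have "\<dots> \<le> 2 * (\<Lambda> * (4 * real q * real r) ^ (r - 1)) * ?T"
        using \<pi>x by (intro mult_right_mono mult_left_mono) auto
      also have "\<dots> = 1 / 4 * (richness_const r * L * real q ^ (r - 1))"
        by (simp add: richness_const_def \<Lambda>_def power_mult_distrib mult_ac)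
      also have "\<dots> \<le> 1 / 4 * ?d" using rich unfolding q_def by (intro mult_left_mono) auto
      finally show ?thesis by (rule mult_right_le_imp_le) (rule d)
    qed
    have c1: "c \<le> 1"
    proof -
      have "c * 1 \<le> c * 2 ^ (r + r\<^sup>2 * codegree_cap r)" using c0 by (intro mult_left_mono one_le_power) auto
      then show ?thesis using c2 by linarith
    qed
    have sparse2: "c * (p ^ (b * (r - b)) * (fact r * D ^ (r\<^sup>2) * (real (card V) ^ (r - b) * p ^ ((r - b) choose 2)))) \<le> \<xi>"
      if b: "2 \<le> b" "b < r" for b
    proof -
      define g where "g = b * (r - b) + ((r - b) choose 2)"
      have gC: "g + (b choose 2) = r choose 2" using choose_two_add[of b "r - b"] b by (simp add: g_def)
      have h: "1 \<le> sqrt p * (x ^ (b - 1) * p ^ (b choose 2))"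
      proof (rule power2_le_imp_le)
        have "x\<^sup>2 * p ^ r \<le> x\<^sup>2 * p ^ Suc b" using p b by (intro mult_left_mono power_decreasing) auto
        then have a: "1 \<le> (x\<^sup>2 * p ^ b) * p" using F4 by (simp add: mult_ac)
        have a1: "1 \<le> x\<^sup>2 * p ^ b"
        proof -
          have "(x\<^sup>2 * p ^ b) * p \<le> (x\<^sup>2 * p ^ b) * 1" using p by (intro mult_left_mono) auto
          then show ?thesis using a by linarith
        qed
        have "(x\<^sup>2 * p ^ b) ^ 1 \<le> (x\<^sup>2 * p ^ b) ^ (b - 1)" using a1 b by (intro power_increasing) auto
        then have "(x\<^sup>2 * p ^ b) * p \<le> (x\<^sup>2 * p ^ b) ^ (b - 1) * p" using p by (intro mult_right_mono) auto
        then have "1 \<le> p * (x\<^sup>2 * p ^ b) ^ (b - 1)" using a by (simp add: mult.commute)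
        also have "(x\<^sup>2 * p ^ b) ^ (b - 1) = x ^ (2 * (b - 1)) * p ^ (b * (b - 1))" by (simp add: power_mult_distrib power_mult)
        also have "p * (x ^ (2 * (b - 1)) * p ^ (b * (b - 1))) = (sqrt p * (x ^ (b - 1) * p ^ (b choose 2)))\<^sup>2"
          unfolding two_choose[symmetric] using p by (simp add: power_mult_distrib power_mult[symmetric] mult.commute)
        finally show "1\<^sup>2 \<le> (sqrt p * (x ^ (b - 1) * p ^ (b choose 2)))\<^sup>2" by simp
      qed (use sp x0 p in auto)
      have "c * (x ^ (r - b) * p ^ g) * 1 \<le> c * (x ^ (r - b) * p ^ g) * (sqrt p * (x ^ (b - 1) * p ^ (b choose 2)))"
        using h c0 x0 p by (intro mult_left_mono) auto
      also have "\<dots> = c * x ^ ((r - b) + (b - 1)) * p ^ (g + (b choose 2)) * sqrt p" by (simp add: power_add mult_ac)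
      also have "\<dots> = (2 * (\<pi> * x ^ (r - 1))) * sqrt p" unfolding gC using p b by (simp add: c_def)
      also have "\<dots> \<le> (2 * (\<Lambda> * (4 * real q * real r) ^ (r - 1))) * sqrt p"
        using \<pi>x sp by (intro mult_right_mono mult_left_mono) auto
      also have "\<dots> \<le> (1 + 2 * \<Lambda> * (4 * real q * real r) ^ (r - 1)) * sqrt p"
        using sp by (intro mult_right_mono) auto
      finally have "B * (c * (x ^ (r - b) * p ^ g)) \<le> B * ((1 + 2 * \<Lambda> * (4 * real q * real r) ^ (r - 1)) * sqrt p)"
        using B0 by (intro mult_left_mono) auto
      also have "\<dots> = \<xi>" by (simp add: \<xi>_def mult.assoc)
      finally show ?thesis by (simp add: B_def g_def finV x power_add mult_ac)
    qed
    have cp: "c * p ^ (r choose 2) / 2 = \<pi>" using p by (simp add: c_def)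
    have likely: "1 - 1 / x ^ 4 \<le> Pr (Idx q r N) (\<lambda>_. c * p ^ (r choose 2) / 2) (good_transversals q r N d1 (codegree_cap r))"
      unfolding cp using \<pi>(4) Pr_compl[of "Idx q r N" "\<lambda>_. \<pi>" "good_transversals q r N d1 (codegree_cap r)"] by simp
    show ?thesis using Npos yN c0 c1 c2 sparse2 likely by blast
  qed
  have r1pos: "0 \<le> 1 / x ^ 4" using x0 by simp
  have dq: "2 * d0 < q" by (simp add: d0_def q_def)
  let ?ok = "\<lambda>A. r * chromatic_number V (graph_complement V A) + packing_number (cliques (r + 1) V A) \<le> n + r * (q * r)"
  let ?many = "\<lambda>A. y \<le> card (cliques (r + 1) V A)"
  let ?nbr = "\<lambda>A. \<exists>v\<in>V. m * (r + 1) < card (clique_nbrs (cliques (r + 1) V A) v)"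
  have main: "Pr (nsets V 2) (\<lambda>_. p) (\<lambda>A. card (cliques (r + 1) V A) < y \<and> (\<forall>v\<in>V. card (clique_nbrs (cliques (r + 1) V A) v) \<le> d0) \<and> \<not> ?ok A) \<le> 1 / x ^ 4"
    using chromatic_upper_likely[OF finV(1) r p D1 D2 dq y2 r1pos dense sparse1 p\<xi> small1 size] by (simp add: finV)
  have pr: "is_prob (\<lambda>_::nat set. p)" using p by (auto simp: is_prob_def)
  have "Pr (nsets V 2) (\<lambda>_. p) (\<lambda>A. \<not> ?ok A) \<le> Pr (nsets V 2) (\<lambda>_. p) (\<lambda>A. ?many A \<or> (?nbr A \<or>
      (card (cliques (r + 1) V A) < y \<and> (\<forall>v\<in>V. card (clique_nbrs (cliques (r + 1) V A) v) \<le> d0) \<and> \<not> ?ok A)))"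
    using pr by (intro Pr_mono) (auto simp: d0_def not_less not_le)
  also have "\<dots> \<le> Pr (nsets V 2) (\<lambda>_. p) ?many + (Pr (nsets V 2) (\<lambda>_. p) ?nbr + Pr (nsets V 2) (\<lambda>_. p) (\<lambda>A.
      card (cliques (r + 1) V A) < y \<and> (\<forall>v\<in>V. card (clique_nbrs (cliques (r + 1) V A) v) \<le> d0) \<and> \<not> ?ok A))"
    using pr by (intro order_trans[OF Pr_disj_le] add_left_mono Pr_disj_le)
  also have "Pr (nsets V 2) (\<lambda>_. p) ?many \<le> 1 / x ^ 4"
    unfolding V_def y_def by (rule clique_count_tail_numeric[OF r x L s(1,2) \<Lambda>s(3) p F3 e0])
  also have "Pr (nsets V 2) (\<lambda>_. p) ?nbr \<le> 1 / x ^ 4"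
  proof -
    have "Pr (nsets V 2) (\<lambda>_. p) ?nbr \<le> real (card V) * (\<Sum>s\<in>{1..<r + 1}. real (m * (r + 1)) ^ (s - 1) * ext_weight (card V) (r + 1) p s) ^ m"
      using p r m by (intro clique_nbrs_tail finV) auto
    also have "\<dots> \<le> 1 / x ^ 4" using tail by (simp add: finV x)
    finally show ?thesis .
  qed
  finally have "Pr (nsets V 2) (\<lambda>_. p) (\<lambda>A. \<not> ?ok A) \<le> 3 / x ^ 4" using main by simp
  then show ?thesis unfolding V_def q_def .
qed

section \<open>The critical window\<close>

text \<open>
  The term for overlap \<open>1\<close> is singled out, since it alone can exceed \<open>\<surd>p\<close> in order.
\<close>

lemma forced_weights_sum_le:
  assumes r: "2 \<le> r" and p: "0 < p" "p \<le> 1" and F: "(real n)\<^sup>2 * p ^ (r + 1) \<le> 1" and a: "1 \<le> a"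
  shows "(\<Sum>s'\<in>{1..<r + 1}. a ^ (s' - 1) * ext_weight n (r + 1) p s')
    \<le> real n ^ r * p ^ ((r + 1) choose 2) + real r * a ^ r * sqrt p"
proof -
  have "{1..<r + 1} = insert 1 {2..r}" using r by auto
  then have "(\<Sum>s'\<in>{1..<r + 1}. a ^ (s' - 1) * ext_weight n (r + 1) p s')
    = ext_weight n (r + 1) p 1 + (\<Sum>s'\<in>{2..r}. a ^ (s' - 1) * ext_weight n (r + 1) p s')" by simp
  also have "ext_weight n (r + 1) p 1 = real n ^ r * p ^ ((r + 1) choose 2)" by (simp add: ext_weight_def binomial_eq_0)
  also have "(\<Sum>s'\<in>{2..r}. a ^ (s' - 1) * ext_weight n (r + 1) p s') \<le> (\<Sum>s'\<in>{2..r}. a ^ r * sqrt p)"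
  proof (rule sum_mono)
    fix s' assume s': "s' \<in> {2..r}"
    have "a ^ (s' - 1) \<le> a ^ r" using s' a by (intro power_increasing) auto
    moreover have "ext_weight n (r + 1) p s' \<le> sqrt p" using ext_weight_le_sqrt[OF p F] s' by simp
    ultimately show "a ^ (s' - 1) * ext_weight n (r + 1) p s' \<le> a ^ r * sqrt p"
      using a p by (intro mult_mono ext_weight_nonneg) auto
  qed
  also have "\<dots> \<le> real r * (a ^ r * sqrt p)"
  proof -
    have "0 \<le> a ^ r * sqrt p" using a p by simp
    then have "real (r - 1) * (a ^ r * sqrt p) \<le> real r * (a ^ r * sqrt p)" by (intro mult_right_mono) auto
    then show ?thesis using r by (simp add: Suc_diff_le)
  qed
  finally show ?thesis by simp
qed

text \<open>
  The parameters \<open>m\<close> and \<open>q\<close> near the lower end of the window.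
\<close>

definition nbr_steps :: "nat \<Rightarrow> nat" where "nbr_steps r = 20 * (r + 1)"
definition group_count :: "nat \<Rightarrow> nat" where "group_count r = 2 * (nbr_steps r * (r + 1)) + 1"

text \<open>
  Here \<open>d\<close> is the order of the number of \<open>r\<close>-cliques at a vertex.  If \<open>d \<le> x\<^bsup>1/6\<^esup>\<close>, the weights in the tail bound
  for clique neighbours are at most a negative power of \<open>x\<close>, so a constant \<open>m\<close> suffices.  Otherwise they
  need only be at most \<open>1/2\<close>; then \<open>m \<approx> s\<close> is used, which is affordable because \<open>d\<close> exceeds the required
  powers of \<open>s\<close>.
\<close>

theorem chromatic_excess_small:
  fixes n r :: nat and p s L x \<epsilon> d :: real
  assumes r: "2 \<le> r" and x: "x = real n" and L: "x = exp L" "1 \<le> L"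
    and s: "s ^ (8 * (r + 1) ^ 3) = x" "scale_const r \<le> s" "(2 * degree_const r + 20) * L \<le> s"
       "real r * real (nbr_steps r * (r + 1)) ^ r \<le> s" "richness_const r * (3 * (real r + 1)) ^ (r - 1) \<le> s"
       "9 * real r ^ 4 * (real r + 1)\<^sup>2 * (real r + 1) ^ (r + 1) \<le> \<epsilon> * s" "real r * (real r + 1) ^ r \<le> s"
    and \<epsilon>: "0 < \<epsilon>"
    and p: "0 < p" "p \<le> 1" and F3: "x\<^sup>2 * p ^ (r + 1) \<le> 1" and F4: "1 \<le> x\<^sup>2 * p ^ r"
    and d: "d = x ^ (r - 1) * p ^ (r choose 2)" "1 \<le> d" "richness_const r * L * real (group_count r) ^ (r - 1) \<le> d"
       "(real r * (real (group_count r) * real r))\<^sup>2 * (real r + 1) ^ (r + 1) \<le> \<epsilon> * d"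
    and e0: "x ^ (r + 1) * p ^ ((r + 1) choose 2) \<le> x / (96 * real r * (real r + 1))"
  shows "\<exists>l::nat. (real l)\<^sup>2 * (real r + 1) ^ (r + 1) \<le> \<epsilon> * d \<and>
     Pr (nsets {1..n} 2) (\<lambda>_. p) (\<lambda>A. \<not> r * chromatic_number {1..n} (graph_complement {1..n} A)
      + packing_number (cliques (r + 1) {1..n} A) \<le> n + l) \<le> 3 / x ^ 4"
proof -
  have x0: "0 < x" using L by simp
  have lam: "1 \<le> degree_const r" by (rule degree_const_ge)
  have "22 * 1 \<le> (2 * degree_const r + 20) * L" using lam L by (intro mult_mono) auto
  then have s22: "22 \<le> s" using s(3) by linarith
  have sL8: "(2 * degree_const r + 8) * L \<le> s"
  proof -
    have "(2 * degree_const r + 8) * L \<le> (2 * degree_const r + 20) * L" using L by (intro mult_right_mono) auto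
    then show ?thesis using s(3) by linarith
  qed
  have L22: "22 * L \<le> s"
  proof -
    have "22 * L \<le> (2 * degree_const r + 20) * L" using L lam by (intro mult_right_mono) auto
    then show ?thesis using s(3) by linarith
  qed
  \<comment> \<open>\<open>v = x\<^bsup>1/(r+1)\<^esup>\<close>\<close>
  define v where "v = s ^ (8 * (r + 1)\<^sup>2)"
  have v0: "0 < v" using s22 by (simp add: v_def)
  have vp: "sqrt p \<le> 1 / v"
    using sqrt_p_le[OF s(1) _ p(1) F3] s22 v0 by (simp add: v_def field_simps)
  have v_ge: "s ^ j \<le> v" if "j \<le> 8 * (r + 1)\<^sup>2" for j
    unfolding v_def using s22 that by (intro power_increasing) auto
  define e where "e = x ^ r * p ^ ((r + 1) choose 2)"
  have e_nonneg: "0 \<le> e" using x0 p by (simp add: e_def)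
  have ex: "x ^ (r + 1) * p ^ ((r + 1) choose 2) = e * x" by (simp add: e_def)
  have S: "(\<Sum>s'\<in>{1..<r + 1}. real (m * (r + 1)) ^ (s' - 1) * ext_weight n (r + 1) p s')
      \<le> e + real r * real (m * (r + 1)) ^ r * sqrt p" if "1 \<le> m" for m
  proof -
    have "1 * 1 \<le> m * (r + 1)" using that by (intro mult_le_mono) auto
    then have "1 \<le> real (m * (r + 1))" by linarith
    then show ?thesis using forced_weights_sum_le[OF r p, of n "real (m * (r + 1))"] F3 unfolding x e_def by blast
  qed
  have S0: "0 \<le> (\<Sum>s'\<in>{1..<r + 1}. real (m * (r + 1)) ^ (s' - 1) * ext_weight n (r + 1) p s')" for m
    using p by (intro sum_nonneg mult_nonneg_nonneg ext_weight_nonneg) auto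
  have step: "\<exists>l::nat. (real l)\<^sup>2 * (real r + 1) ^ (r + 1) \<le> \<epsilon> * d \<and>
     Pr (nsets {1..n} 2) (\<lambda>_. p) (\<lambda>A. \<not> r * chromatic_number {1..n} (graph_complement {1..n} A)
      + packing_number (cliques (r + 1) {1..n} A) \<le> n + l) \<le> 3 / x ^ 4"
    if m: "1 \<le> m" "real m \<le> s"
      and tail: "x * (\<Sum>s'\<in>{1..<r + 1}. real (m * (r + 1)) ^ (s' - 1) * ext_weight n (r + 1) p s') ^ m \<le> 1 / x ^ 4"
      and rich: "richness_const r * L * real (2 * (m * (r + 1)) + 1) ^ (r - 1) \<le> d"
      and l: "(real r * (real (2 * (m * (r + 1)) + 1) * real r))\<^sup>2 * (real r + 1) ^ (r + 1) \<le> \<epsilon> * d" for m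
  proof (intro exI conjI)
    show "Pr (nsets {1..n} 2) (\<lambda>_. p) (\<lambda>A. \<not> r * chromatic_number {1..n} (graph_complement {1..n} A)
      + packing_number (cliques (r + 1) {1..n} A) \<le> n + r * ((2 * (m * (r + 1)) + 1) * r)) \<le> 3 / x ^ 4"
      by (rule chromatic_excess_numeric[OF r x L s(1,2) sL8 p F3 F4 m tail rich[unfolded d(1)] e0])
    show "(real (r * ((2 * (m * (r + 1)) + 1) * r)))\<^sup>2 * (real r + 1) ^ (r + 1) \<le> \<epsilon> * d"
      using l by (simp only: of_nat_mult)
  qed
  show ?thesis
  \<comment> \<open>in the first case \<open>e x \<le> d\<^sup>3 \<le> x\<^bsup>1/2\<^esup>\<close>, in the second \<open>d > x\<^bsup>1/6\<^esup> \<ge> s\<^bsup>r+1\<^esup>\<close>\<close>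
  proof (cases "d ^ 6 \<le> x")
    case True
    have m0s: "1 \<le> nbr_steps r" "real (nbr_steps r) \<le> s"
    proof -
      show "1 \<le> nbr_steps r" by (simp add: nbr_steps_def)
      have "real (nbr_steps r) * 1 \<le> real r * real (nbr_steps r * (r + 1)) ^ r"
      proof -
        have "real (nbr_steps r) * 1 \<le> real (nbr_steps r * (r + 1)) ^ 1" by simp
        also have "\<dots> \<le> real (nbr_steps r * (r + 1)) ^ r" using r by (intro power_increasing) (auto simp: nbr_steps_def)
        also have "\<dots> \<le> real r * real (nbr_steps r * (r + 1)) ^ r" using r mult_right_mono[of 1 "real r" "real (nbr_steps r * (r + 1)) ^ r"] by simp
        finally show ?thesis .
      qed
      then show "real (nbr_steps r) \<le> s" using s(4) by simp
    qed
    have e_le: "e \<le> 1 / v"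
    proof -
      have "(e * x) ^ (r - 1) = d ^ (r + 1)"
        unfolding ex[symmetric] d(1) by (rule clique_mean_power)
      also have "\<dots> \<le> d ^ (3 * (r - 1))" using d(2) r by (intro power_increasing) auto
      finally have "(e * x) ^ (r - 1) \<le> (d ^ 3) ^ (r - 1)" by (simp only: power_mult)
      moreover have "r - 1 = Suc (r - 2)" using r by simp
      ultimately have "(e * x) ^ Suc (r - 2) \<le> (d ^ 3) ^ Suc (r - 2)" by (simp only:)
      then have "e * x \<le> d ^ 3" by (rule power_le_imp_le_base) (use d in auto)
      then have "(e * x)\<^sup>2 \<le> (d ^ 3)\<^sup>2" using e_nonneg x0 by (intro power_mono) auto
      also have "\<dots> \<le> x" using True by (simp add: power_mult[symmetric])
      finally have "e\<^sup>2 * x \<le> 1" using x0 by (simp add: power2_eq_square mult_ac)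
      moreover have "v\<^sup>2 \<le> x"
      proof -
        have "8 * (r + 1)\<^sup>2 * 2 \<le> 8 * (r + 1)\<^sup>2 * (r + 1)" using r by (intro mult_le_mono2) auto
        also have "\<dots> = 8 * (r + 1) ^ 3" by (simp only: power2_eq_square power3_eq_cube mult.assoc)
        finally show ?thesis unfolding v_def s(1)[symmetric] power_mult[symmetric] using s22 by (intro power_increasing) auto
      qed
      ultimately have "e\<^sup>2 * v\<^sup>2 \<le> 1" using mult_left_mono[of "v\<^sup>2" x "e\<^sup>2"] by simp
      then have "(e * v)\<^sup>2 \<le> 1\<^sup>2" by (simp add: power_mult_distrib)
      then have "e * v \<le> 1" by (rule power2_le_imp_le) simp
      then show ?thesis using v0 by (simp add: field_simps)
    qed
    let ?S = "\<Sum>s'\<in>{1..<r + 1}. real (nbr_steps r * (r + 1)) ^ (s' - 1) * ext_weight n (r + 1) p s'"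
    have "?S \<le> s\<^sup>2 / v"
    proof -
      have "real r * real (nbr_steps r * (r + 1)) ^ r * sqrt p \<le> s * (1 / v)"
        using s(4) vp s22 p by (intro mult_mono) auto
      then have "?S \<le> 1 / v + s / v" using S[OF m0s(1)] e_le by simp
      also have "\<dots> = (1 + s) / v" by (simp add: add_divide_distrib)
      also have "\<dots> \<le> s\<^sup>2 / v"
      proof (rule divide_right_mono)
        have "22 * s \<le> s * s" using s22 by (intro mult_right_mono) auto
        then show "1 + s \<le> s\<^sup>2" using s22 unfolding power2_eq_square by linarith
      qed (use v0 in simp)
      finally show ?thesis .
    qed
    then have "?S ^ nbr_steps r \<le> (s\<^sup>2 / v) ^ nbr_steps r" using S0 by (rule power_mono)
    also have "\<dots> = (s\<^sup>2) ^ nbr_steps r / x ^ 20"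
    proof -
      have "8 * (r + 1)\<^sup>2 * nbr_steps r = 8 * (r + 1) ^ 3 * 20" by (simp add: nbr_steps_def power2_eq_square power3_eq_cube algebra_simps)
      then have "v ^ nbr_steps r = x ^ 20" unfolding v_def s(1)[symmetric] power_mult[symmetric] by (simp only:)
      then show ?thesis by (simp add: power_divide)
    qed
    also have "\<dots> \<le> x ^ 5 / x ^ 20"
    proof (rule divide_right_mono)
      have "(r + 1) * 1 \<le> (r + 1) * ((r + 1) * (r + 1))" by (intro mult_le_mono2) auto
      then have "2 * nbr_steps r \<le> 8 * (r + 1) ^ 3 * 5" by (simp add: nbr_steps_def power3_eq_cube algebra_simps)
      then show "(s\<^sup>2) ^ nbr_steps r \<le> x ^ 5" unfolding s(1)[symmetric] power_mult[symmetric] using s22 by (intro power_increasing) auto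
    qed (use x0 in simp)
    finally have "x * ?S ^ nbr_steps r \<le> x * (x ^ 5 / x ^ 20)" using x0 by (intro mult_left_mono) auto
    also have "\<dots> = 1 / x ^ 14" using x0 by (simp add: field_simps eval_nat_numeral)
    also have "\<dots> \<le> 1 / x ^ 4"
    proof (rule divide_left_mono)
      have "1 \<le> x" using L by simp
      then show "x ^ 4 \<le> x ^ 14" by (intro power_increasing) auto
    qed (use x0 in auto)
    finally have tail: "x * ?S ^ nbr_steps r \<le> 1 / x ^ 4" .
    show ?thesis by (rule step[OF m0s tail d(3,4)[unfolded group_count_def]])
  next
    case False
    define m where "m = nat \<lfloor>s\<rfloor>"
    have m: "1 \<le> m" "real m \<le> s" "s - 1 \<le> real m" using s22 by (auto simp: m_def) linarith+
    have ds: "s ^ (r + 1) \<le> d"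
    proof -
      have "(s ^ (r + 1)) ^ Suc 5 \<le> s ^ (8 * (r + 1) ^ 3)" unfolding power_mult[symmetric] using s22
      proof (intro power_increasing)
        have "(r + 1) * 1 \<le> (r + 1) * ((r + 1) * (r + 1))" by (intro mult_le_mono2) auto
        then show "(r + 1) * Suc 5 \<le> 8 * (r + 1) ^ 3" by (simp add: power3_eq_cube algebra_simps)
      qed auto
      also have "\<dots> \<le> d ^ Suc 5" using False s(1) by simp
      finally show ?thesis by (rule power_le_imp_le_base) (use d in simp)
    qed
    have q: "real (2 * (m * (r + 1)) + 1) \<le> 3 * (real r + 1) * s"
    proof -
      have "real m * (real r + 1) \<le> s * (real r + 1)" using m by (intro mult_right_mono) auto
      moreover have "1 * 1 \<le> s * (real r + 1)" using s22 by (intro mult_mono) auto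
      moreover have "real (2 * (m * (r + 1)) + 1) = 2 * (real m * (real r + 1)) + 1" by (simp add: algebra_simps)
      moreover have "3 * (real r + 1) * s = 3 * (s * (real r + 1))" by simp
      ultimately show ?thesis by linarith
    qed
    let ?S = "\<Sum>s'\<in>{1..<r + 1}. real (m * (r + 1)) ^ (s' - 1) * ext_weight n (r + 1) p s'"
    have "?S \<le> 1 / 2"
    proof -
      have "real r * real (m * (r + 1)) ^ r * sqrt p \<le> real r * (s * (real r + 1)) ^ r * sqrt p"
      proof (intro mult_right_mono mult_left_mono power_mono)
        show "real (m * (r + 1)) \<le> s * (real r + 1)" using mult_right_mono[OF m(2), of "real r + 1"] by (simp add: algebra_simps)
      qed (use p in auto)
      also have "\<dots> = (real r * (real r + 1) ^ r) * s ^ r * sqrt p" by (simp add: power_mult_distrib)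
      also have "\<dots> \<le> s * s ^ r * (1 / v)" using s(7) vp s22 p by (intro mult_mono) auto
      also have "\<dots> \<le> 1 / s"
      proof -
        have "s ^ (r + 2) \<le> v" by (rule v_ge) (simp add: power2_eq_square)
        then show ?thesis using v0 s22 by (simp add: field_simps)
      qed
      also have "\<dots> \<le> 1 / 4" using s22 by (intro divide_left_mono) auto
      finally have a: "real r * real (m * (r + 1)) ^ r * sqrt p \<le> 1 / 4" .
      have "e * x \<le> x / 4"
      proof -
        have "1 * 1 \<le> real r * (real r + 1)" using r by (intro mult_mono) auto
        then have "x / (96 * real r * (real r + 1)) \<le> x / 4" using x0 r by (intro divide_left_mono) auto
        then show ?thesis using e0 ex by linarith
      qed
      then have "e \<le> 1 / 4" using x0 by simp
      then show ?thesis using S[OF m(1)] a by linarith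
    qed
    then have "?S ^ m \<le> (1 / 2) ^ m" using S0 by (rule power_mono)
    also have "\<dots> \<le> exp (- (1 / 2)) ^ m"
    proof (rule power_mono)
      have "exp (1 / 2) \<le> (2::real)"
      proof (rule power2_le_imp_le)
        have "(exp (1 / 2))\<^sup>2 = exp (1::real)" using exp_double[of "1 / 2 :: real"] by simp
        also have "\<dots> \<le> 2\<^sup>2" using exp_le by simp
        finally show "(exp (1 / 2))\<^sup>2 \<le> (2::real)\<^sup>2" .
      qed simp
      then show "1 / 2 \<le> exp (- (1 / 2) :: real)" by (simp add: exp_minus field_simps)
    qed simp
    also have "\<dots> \<le> exp (- (5 * L))" unfolding exp_of_nat_mult[symmetric] using m L22 s22 L by simp
    finally have "x * ?S ^ m \<le> x * exp (- (5 * L))" using x0 by (intro mult_left_mono) auto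
    also have "\<dots> = 1 / x ^ 4" unfolding L(1) by (simp add: exp_add[symmetric] exp_of_nat_mult[symmetric] exp_minus[symmetric] inverse_eq_divide[symmetric])
    finally have tail: "x * ?S ^ m \<le> 1 / x ^ 4" .
    have A0: "0 \<le> richness_const r" using lam by (simp add: richness_const_def)
    have rich: "richness_const r * L * real (2 * (m * (r + 1)) + 1) ^ (r - 1) \<le> d"
    proof -
      have "richness_const r * L * real (2 * (m * (r + 1)) + 1) ^ (r - 1) \<le> richness_const r * L * (3 * (real r + 1) * s) ^ (r - 1)"
        using A0 L q by (intro mult_left_mono power_mono) auto
      also have "\<dots> = (richness_const r * (3 * (real r + 1)) ^ (r - 1)) * L * s ^ (r - 1)" by (simp add: power_mult_distrib)
      also have "\<dots> \<le> s * s * s ^ (r - 1)" using s(5) L L22 s22 A0 by (intro mult_mono) auto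
      also have "\<dots> = s ^ (r + 1)" using r by (cases r) auto
      finally show ?thesis using ds by linarith
    qed
    have l: "(real r * (real (2 * (m * (r + 1)) + 1) * real r))\<^sup>2 * (real r + 1) ^ (r + 1) \<le> \<epsilon> * d"
    proof -
      have "(real r * (real (2 * (m * (r + 1)) + 1) * real r))\<^sup>2 * (real r + 1) ^ (r + 1)
        \<le> (real r * (3 * (real r + 1) * s * real r))\<^sup>2 * (real r + 1) ^ (r + 1)"
        using q by (intro mult_right_mono power_mono mult_left_mono) auto
      also have "\<dots> = (9 * real r ^ 4 * (real r + 1)\<^sup>2 * (real r + 1) ^ (r + 1)) * s\<^sup>2"
        unfolding power_mult_distrib power2_eq_square power4_eq_xxxx by (simp add: algebra_simps)
      also have "\<dots> \<le> (\<epsilon> * s) * s\<^sup>2" using s(6) by (rule mult_right_mono) simp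
      also have "\<dots> = \<epsilon> * s ^ 3" by (simp add: power2_eq_square power3_eq_cube)
      also have "\<dots> \<le> \<epsilon> * d"
      proof (rule mult_left_mono)
        have "s ^ 3 \<le> s ^ (r + 1)" using r s22 by (intro power_increasing) auto
        then show "s ^ 3 \<le> d" using ds by linarith
      qed (use \<epsilon> in simp)
      finally show ?thesis .
    qed
    show ?thesis by (rule step[OF m(1,2) tail rich l])
  qed
qed

lemma powr_power_mult: "0 < x \<Longrightarrow> (x powr a) ^ k = x powr (a * real k)" for x a :: real
  by (simp add: powr_power mult.commute)

text \<open>
  The lower end of the window, raised to the power \<open>r choose 2\<close>.
\<close>

lemma log_le_degree:
  fixes p :: "nat \<Rightarrow> real"
  assumes r: "2 \<le> r" and p: "\<And>n. 0 \<le> p n \<and> p n \<le> 1"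
    and lower: "(\<lambda>n. real n powr (- 2 / real r) * ln (real n) powr (1 / real (r choose 2))) \<in> o(p)"
  shows "eventually (\<lambda>n. A * ln (real n) \<le> real n ^ (r - 1) * p n ^ (r choose 2)) sequentially"
proof -
  define C where "C = r choose 2"
  define c where "c = 1 / max A 1"
  have C2: "2 * real C = real r * (real r - 1)"
    using two_choose[of r] r unfolding C_def by (metis Suc_leD of_nat_1 of_nat_diff of_nat_mult of_nat_numeral one_add_one plus_1_eq_Suc)
  have C1: "1 \<le> C" using r unfolding C_def by (metis One_nat_def Suc_leI zero_less_binomial)
  have c: "0 < c" "c \<le> 1" by (auto simp: c_def)
  have "eventually (\<lambda>n. norm (real n powr (- 2 / real r) * ln (real n) powr (1 / real C)) \<le> c * norm (p n)) sequentially"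
    using landau_o.smallD[OF lower c(1)] unfolding C_def .
  then show ?thesis using eventually_ge_at_top[of 3]
  proof eventually_elim
    case (elim n)
    define x where "x = real n"
    have x: "3 \<le> x" using elim by (simp add: x_def)
    have l: "0 < ln x" using x by simp
    let ?f = "x powr (- 2 / real r) * ln x powr (1 / real C)"
    have "?f \<le> c * p n" using elim(1) p[of n] unfolding x_def by simp
    then have "?f ^ C \<le> (c * p n) ^ C" using x l by (intro power_mono) auto
    also have "\<dots> = c ^ C * p n ^ C" by (rule power_mult_distrib)
    also have "?f ^ C = ln x / x ^ (r - 1)"
    proof -
      have "(x powr (- 2 / real r)) ^ C = x powr (- 2 / real r * real C)"
        using x by (intro powr_power_mult) simp
      also have "- 2 / real r * real C = - real (r - 1)"
      proof -
        have "- 2 / real r * real C = - (2 * real C) / real r" by simp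
        then show ?thesis unfolding C2 using r by (simp add: of_nat_diff)
      qed
      also have "x powr - real (r - 1) = 1 / x ^ (r - 1)" using x by (simp add: powr_minus powr_realpow divide_inverse)
      finally have a: "(x powr (- 2 / real r)) ^ C = 1 / x ^ (r - 1)" .
      have "(ln x powr (1 / real C)) ^ C = ln x powr (1 / real C * real C)" using l by (intro powr_power_mult) simp
      also have "\<dots> = ln x" using C1 l by simp
      finally show ?thesis using a by (simp add: power_mult_distrib)
    qed
    finally have h: "ln x / x ^ (r - 1) \<le> c ^ C * p n ^ C" .
    have "c ^ C \<le> c ^ 1" using c C1 by (intro power_decreasing) auto
    then have "c ^ C * p n ^ C \<le> c * p n ^ C" using p[of n] by (intro mult_right_mono) auto
    then have h2: "ln x \<le> c * p n ^ C * x ^ (r - 1)" using h x by (simp add: pos_divide_le_eq[symmetric])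
    have "A * ln x \<le> max A 1 * ln x" using l by (intro mult_right_mono) auto
    also have "\<dots> \<le> max A 1 * (c * p n ^ C * x ^ (r - 1))" using h2 by (intro mult_left_mono) auto
    also have "\<dots> = x ^ (r - 1) * p n ^ C" by (simp add: c_def)
    finally show "A * ln (real n) \<le> real n ^ (r - 1) * p n ^ (r choose 2)" by (simp add: x_def C_def)
  qed
qed

text \<open>
  The upper end of the window, raised to the powers \<open>r + 1\<close> and \<open>r + 1 choose 2\<close>.
\<close>

lemma clique_mean_small:
  fixes p :: "nat \<Rightarrow> real"
  assumes r: "2 \<le> r" and p: "\<And>n. 0 \<le> p n \<and> p n \<le> 1"
    and upper: "p \<in> o(\<lambda>n. real n powr (- 2 / real (r + 1)))" and \<epsilon>: "0 < \<epsilon>"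
  shows "eventually (\<lambda>n. (real n)\<^sup>2 * p n ^ (r + 1) \<le> 1 \<and>
    real n ^ (r + 1) * p n ^ ((r + 1) choose 2) \<le> \<epsilon> * real n) sequentially"
proof -
  define K where "K = (r + 1) choose 2"
  define c where "c = min \<epsilon> 1"
  have K2: "2 * real K = real (r + 1) * real r"
    using two_choose[of "r + 1"] unfolding K_def by (metis add_diff_cancel_right' of_nat_mult of_nat_numeral)
  have K1: "1 \<le> K" using r unfolding K_def by (metis One_nat_def Suc_eq_plus1 Suc_leI le_SucI zero_less_binomial)
  have c: "0 < c" "c \<le> 1" "c \<le> \<epsilon>" using \<epsilon> by (auto simp: c_def)
  have "eventually (\<lambda>n. norm (p n) \<le> c * norm (real n powr (- 2 / real (r + 1)))) sequentially"
    using landau_o.smallD[OF upper c(1)] .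
  then show ?thesis using eventually_ge_at_top[of 1]
  proof eventually_elim
    case (elim n)
    define x where "x = real n"
    have x: "1 \<le> x" using elim by (simp add: x_def)
    let ?g = "x powr (- 2 / real (r + 1))"
    have pg: "p n \<le> c * ?g" using elim(1) p[of n] unfolding x_def by simp
    have g0: "0 \<le> ?g" by simp
    have g1: "?g ^ (r + 1) = 1 / x\<^sup>2"
    proof -
      have "?g ^ (r + 1) = x powr (- 2 / real (r + 1) * real (r + 1))" using x by (intro powr_power_mult) simp
      also have "- 2 / real (r + 1) * real (r + 1) = - real 2" by (simp del: of_nat_add of_nat_Suc)
      also have "x powr - real 2 = 1 / x\<^sup>2" unfolding powr_minus using x by (subst powr_realpow) (auto simp: divide_inverse)
      finally show ?thesis .
    qed
    have g2: "?g ^ K = 1 / x ^ r"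
    proof -
      have "?g ^ K = x powr (- 2 / real (r + 1) * real K)" using x by (intro powr_power_mult) simp
      also have "- 2 / real (r + 1) * real K = - real r"
      proof -
        have "- 2 / real (r + 1) * real K = - (2 * real K) / real (r + 1)" by simp
        then show ?thesis unfolding K2 by simp
      qed
      also have "x powr - real r = 1 / x ^ r" using x by (simp add: powr_minus powr_realpow divide_inverse)
      finally show ?thesis .
    qed
    have "p n ^ (r + 1) \<le> (c * ?g) ^ (r + 1)" using pg p[of n] by (intro power_mono) auto
    also have "\<dots> = c ^ (r + 1) * (1 / x\<^sup>2)" unfolding power_mult_distrib g1 ..
    also have "\<dots> \<le> 1 * (1 / x\<^sup>2)" using c by (intro mult_right_mono power_le_one) auto
    finally have a: "x\<^sup>2 * p n ^ (r + 1) \<le> 1" using x by (simp add: field_simps)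
    have "p n ^ K \<le> (c * ?g) ^ K" using pg p[of n] by (intro power_mono) auto
    also have "\<dots> = c ^ K * (1 / x ^ r)" unfolding power_mult_distrib g2 ..
    also have "\<dots> \<le> \<epsilon> * (1 / x ^ r)"
    proof (rule mult_right_mono)
      have "c ^ K \<le> c ^ 1" using c K1 by (intro power_decreasing) auto
      then show "c ^ K \<le> \<epsilon>" using c by simp
    qed (use x in simp)
    finally have "x ^ r * p n ^ K \<le> \<epsilon>" using x by (simp add: field_simps)
    then have "x * (x ^ r * p n ^ K) \<le> x * \<epsilon>" using x by (intro mult_left_mono) auto
    then have "x ^ (r + 1) * p n ^ K \<le> \<epsilon> * x" by (simp add: mult_ac)
    then show ?case using a by (simp add: x_def K_def)
  qed
qed

lemma eventually_le_power:
  fixes a C :: real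
  assumes "0 < a"
  shows "eventually (\<lambda>n. C \<le> real n powr a) sequentially" "eventually (\<lambda>n. C * ln (real n) \<le> real n powr a) sequentially"
proof -
  have "filterlim (\<lambda>n. real n powr a) at_top sequentially" using assms by real_asymp
  then show "eventually (\<lambda>n. C \<le> real n powr a) sequentially" by (simp add: filterlim_at_top)
  have "(\<lambda>n. ln (real n)) \<in> o(\<lambda>n. real n powr a)" using assms by real_asymp
  from landau_o.smallD[OF this, of "1 / (\<bar>C\<bar> + 1)"]
  have "eventually (\<lambda>n. norm (ln (real n)) \<le> 1 / (\<bar>C\<bar> + 1) * norm (real n powr a)) sequentially" by simp
  then show "eventually (\<lambda>n. C * ln (real n) \<le> real n powr a) sequentially"
  proof eventually_elim
    case (elim n)
    have "C * ln (real n) \<le> \<bar>C * ln (real n)\<bar>" by simp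
    also have "\<dots> \<le> (\<bar>C\<bar> + 1) * \<bar>ln (real n)\<bar>" unfolding abs_mult by (intro mult_right_mono) auto
    also have "\<dots> \<le> (\<bar>C\<bar> + 1) * (1 / (\<bar>C\<bar> + 1) * norm (real n powr a))" using elim by (intro mult_left_mono) auto
    also have "\<dots> = real n powr a" by (simp add: add_pos_nonneg less_imp_neq[symmetric] add_nonneg_pos)
    finally show ?case .
  qed
qed

text \<open>
  Since \<open>d \<le> (r + 1)\<^bsup>r+1\<^esup> \<mu>\<close>, the bounds in terms of \<open>d\<close> become bounds in terms of \<open>\<mu>\<close>, and \<open>\<mu>\<close> tends to infinity.
\<close>

theorem eventually_chromatic_excess_small:
  fixes p :: "nat \<Rightarrow> real"
  assumes r: "2 \<le> r" and p: "\<And>n. 0 \<le> p n \<and> p n \<le> 1"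
    and lower: "(\<lambda>n. real n powr (- 2 / real r) * ln (real n) powr (1 / real (r choose 2))) \<in> o(p)"
    and upper: "p \<in> o(\<lambda>n. real n powr (- 2 / real (r + 1)))" and \<epsilon>: "0 < \<epsilon>"
  shows "eventually (\<lambda>n. 1 \<le> n \<and> 0 < p n \<and> p n \<le> 1 / 2 \<and> (real n)\<^sup>2 * p n ^ (r + 1) \<le> 1 \<and>
    1 \<le> \<epsilon> * expected_cliques (r + 1) n (p n) \<and>
    (\<Sum>s\<in>{1..<r + 1}. real (r + 1) ^ s * ext_weight n (r + 1) (p n) s) \<le> \<epsilon> \<and>
    (\<exists>l::nat. (real l)\<^sup>2 \<le> \<epsilon> * expected_cliques (r + 1) n (p n) \<and>
       Pr (nsets {1..n} 2) (\<lambda>_. p n) (\<lambda>A. \<not> r * chromatic_number {1..n} (graph_complement {1..n} A)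
        + packing_number (cliques (r + 1) {1..n} A) \<le> n + l) \<le> 3 / real n ^ 4)) sequentially"
proof -
  define a where "a = 1 / real (8 * (r + 1) ^ 3)"
  have a0: "0 < a" by (simp add: a_def)
  define cC where "cC = real (r + 1) * real r * real (r + 1) ^ r"
  define A where "A = 1 + richness_const r * real (group_count r) ^ (r - 1) + (real r * (real (group_count r) * real r))\<^sup>2 * (real r + 1) ^ (r + 1) / \<epsilon>
      + (real r + 1) ^ (r + 1) / \<epsilon>"
  define B where "B = scale_const r + real r * real (nbr_steps r * (r + 1)) ^ r + richness_const r * (3 * (real r + 1)) ^ (r - 1)
      + 9 * real r ^ 4 * (real r + 1)\<^sup>2 * (real r + 1) ^ (r + 1) / \<epsilon> + real r * (real r + 1) ^ r + 2 + 2 * cC / \<epsilon>"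
  define \<delta> where "\<delta> = min (1 / (96 * real r * (real r + 1))) (\<epsilon> / (2 * (real r + 1)))"
  have \<delta>: "0 < \<delta>" using r \<epsilon> by (simp add: \<delta>_def)
  have A0: "0 \<le> richness_const r" using degree_const_ge[of r] by (simp add: richness_const_def)
  have B0: "0 \<le> scale_const r" using sparsity_const_nonneg[of r] by (simp add: scale_const_def)
  have cC0: "0 \<le> cC" by (simp add: cC_def)
  show ?thesis
    using eventually_le_power(1)[OF a0, of B] eventually_le_power(2)[OF a0, of "2 * degree_const r + 20"]
      log_le_degree[OF r p lower, of A] clique_mean_small[OF r p upper \<delta>] eventually_ge_at_top[of 3] eventually_ge_at_top[of "r + 1"]
  proof eventually_elim
    case (elim n)
    define x where "x = real n"
    define s where "s = x powr a"
    define L where "L = ln x"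
    define d where "d = x ^ (r - 1) * p n ^ (r choose 2)"
    have x3: "3 \<le> x" using elim by (simp add: x_def)
    have L: "x = exp L" "1 \<le> L"
    proof -
      show "x = exp L" using x3 by (simp add: L_def)
      have "exp 1 \<le> x" using exp_le x3 by linarith
      then show "1 \<le> L" using x3 by (simp add: L_def ln_ge_iff)
    qed
    have s0: "0 \<le> s" by (simp add: s_def)
    have sw: "s ^ (8 * (r + 1) ^ 3) = x"
    proof -
      have "s ^ (8 * (r + 1) ^ 3) = x powr (a * real (8 * (r + 1) ^ 3))" unfolding s_def using x3 by (intro powr_power_mult) simp
      also have "a * real (8 * (r + 1) ^ 3) = 1" unfolding a_def by (simp del: of_nat_mult of_nat_power of_nat_add)
      finally show ?thesis using x3 by simp
    qed
    have Bs: "B \<le> s" using elim(1) by (simp add: s_def x_def)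
    have parts: "0 \<le> real r * real (nbr_steps r * (r + 1)) ^ r" "0 \<le> richness_const r * (3 * (real r + 1)) ^ (r - 1)"
      "0 \<le> 9 * real r ^ 4 * (real r + 1)\<^sup>2 * (real r + 1) ^ (r + 1) / \<epsilon>" "0 \<le> real r * (real r + 1) ^ r" "0 \<le> 2 * cC / \<epsilon>"
      using A0 cC0 \<epsilon> by auto
    have s2: "scale_const r \<le> s" and s4: "real r * real (nbr_steps r * (r + 1)) ^ r \<le> s" and s5: "richness_const r * (3 * (real r + 1)) ^ (r - 1) \<le> s"
      and s6': "9 * real r ^ 4 * (real r + 1)\<^sup>2 * (real r + 1) ^ (r + 1) / \<epsilon> \<le> s" and s7: "real r * (real r + 1) ^ r \<le> s"
      and s8: "2 \<le> s" and s9: "2 * cC / \<epsilon> \<le> s"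
      using Bs parts B0 unfolding B_def by linarith+
    have s6: "9 * real r ^ 4 * (real r + 1)\<^sup>2 * (real r + 1) ^ (r + 1) \<le> \<epsilon> * s"
      using s6' \<epsilon> by (simp only: pos_divide_le_eq mult.commute)
    have s3: "(2 * degree_const r + 20) * L \<le> s" using elim(2) by (simp add: s_def x_def L_def)
    have Ad: "A * L \<le> d" using elim(3) by (simp add: d_def x_def L_def)
    have Aparts: "0 \<le> richness_const r * real (group_count r) ^ (r - 1)" "0 \<le> (real r * (real (group_count r) * real r))\<^sup>2 * (real r + 1) ^ (r + 1) / \<epsilon>"
      "0 \<le> (real r + 1) ^ (r + 1) / \<epsilon>" using A0 \<epsilon> by auto
    have le_d: "t \<le> d" if "t \<le> A" for t
    proof -
      have "0 \<le> A" using Aparts unfolding A_def by linarith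
      then have "A * 1 \<le> A * L" using L by (intro mult_left_mono) auto
      then show ?thesis using that Ad by linarith
    qed
    have d1: "1 \<le> d" by (rule le_d) (use Aparts in \<open>unfold A_def, linarith\<close>)
    have d2: "richness_const r * L * real (group_count r) ^ (r - 1) \<le> d"
    proof -
      have "(richness_const r * real (group_count r) ^ (r - 1)) * L \<le> A * L" using Aparts L unfolding A_def by (intro mult_right_mono) linarith+
      then show ?thesis using Ad by (simp add: mult_ac)
    qed
    have d3: "(real r * (real (group_count r) * real r))\<^sup>2 * (real r + 1) ^ (r + 1) \<le> \<epsilon> * d"
    proof -
      have "(real r * (real (group_count r) * real r))\<^sup>2 * (real r + 1) ^ (r + 1) / \<epsilon> \<le> d"
        by (rule le_d) (use Aparts in \<open>unfold A_def, linarith\<close>)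
      then show ?thesis using \<epsilon> by (simp only: pos_divide_le_eq mult.commute)
    qed
    have d4: "(real r + 1) ^ (r + 1) \<le> \<epsilon> * d"
    proof -
      have "(real r + 1) ^ (r + 1) / \<epsilon> \<le> d" by (rule le_d) (use Aparts in \<open>unfold A_def, linarith\<close>)
      then show ?thesis using \<epsilon> by (simp only: pos_divide_le_eq mult.commute)
    qed
    have C1: "0 < r choose 2" using r by (simp add: zero_less_binomial)
    have p0: "0 < p n"
    proof (rule ccontr)
      assume "\<not> 0 < p n"
      then have "p n = 0" using p[of n] by linarith
      then have "d = 0" using C1 by (simp add: d_def)
      then show False using d1 by simp
    qed
    have F3: "x\<^sup>2 * p n ^ (r + 1) \<le> 1" and e0\<delta>: "x ^ (r + 1) * p n ^ ((r + 1) choose 2) \<le> \<delta> * x"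
      using elim(4) by (auto simp: x_def)
    have F4: "1 \<le> x\<^sup>2 * p n ^ r"
    proof (rule ccontr)
      assume "\<not> 1 \<le> x\<^sup>2 * p n ^ r"
      then have "(x\<^sup>2 * p n ^ r) ^ (r - 1) < 1 ^ (r - 1)" using r x3 p0 by (intro power_strict_mono) auto
      moreover have "(x\<^sup>2 * p n ^ r) ^ (r - 1) = d\<^sup>2"
      proof -
        have "(x\<^sup>2 * p n ^ r) ^ (r - 1) = x ^ (2 * (r - 1)) * p n ^ (2 * (r choose 2))"
          unfolding two_choose power_mult_distrib power_mult ..
        also have "\<dots> = d\<^sup>2" by (simp add: d_def power_mult_distrib power_mult[symmetric] mult.commute)
        finally show ?thesis .
      qed
      ultimately have "d\<^sup>2 < 1" by simp
      then show False using d1 one_le_power[of d 2] by linarith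
    qed
    have e0: "x ^ (r + 1) * p n ^ ((r + 1) choose 2) \<le> x / (96 * real r * (real r + 1))"
    proof -
      have "\<delta> * x \<le> 1 / (96 * real r * (real r + 1)) * x" using x3 by (intro mult_right_mono) (auto simp: \<delta>_def)
      then show ?thesis using e0\<delta> by simp
    qed
    define \<mu> where "\<mu> = expected_cliques (r + 1) n (p n)"
    have \<mu>d: "d \<le> (real r + 1) ^ (r + 1) * \<mu>"
    proof -
      let ?e = "x ^ (r + 1) * p n ^ ((r + 1) choose 2)"
      have "?e ^ (r - 1) = d ^ (r + 1)"
        unfolding d_def by (rule clique_mean_power)
      also have "\<dots> \<ge> d ^ (r - 1)" using d1 by (intro power_increasing) auto
      finally have "d ^ (r - 1) \<le> ?e ^ (r - 1)" .
      moreover have "r - 1 = Suc (r - 2)" using r by simp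
      ultimately have "d ^ Suc (r - 2) \<le> ?e ^ Suc (r - 2)" by (simp only:)
      then have "d \<le> ?e" by (rule power_le_imp_le_base) (use x3 p0 in auto)
      also have "x ^ (r + 1) \<le> (real r + 1) ^ (r + 1) * real (n choose (r + 1))"
      proof -
        have "(x / (real r + 1)) ^ (r + 1) \<le> real (n choose (r + 1))"
          using binomial_ge_n_over_k_pow_k[of "r + 1" n, where 'a = real] elim(6) by (simp add: x_def add.commute)
        moreover have "0 < (real r + 1) ^ (r + 1)" by simp
        ultimately show ?thesis unfolding power_divide by (simp only: pos_divide_le_eq mult.commute)
      qed
      then have "?e \<le> (real r + 1) ^ (r + 1) * real (n choose (r + 1)) * p n ^ ((r + 1) choose 2)"
        using p0 by (intro mult_right_mono) auto
      also have "\<dots> = (real r + 1) ^ (r + 1) * \<mu>" by (simp add: \<mu>_def expected_cliques_def)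
      finally show ?thesis .
    qed
    have r1: "0 < (real r + 1) ^ (r + 1)" by simp
    have d\<mu>: "t \<le> \<epsilon> * \<mu>" if "t * (real r + 1) ^ (r + 1) \<le> \<epsilon> * d" for t
    proof -
      have "\<epsilon> * d \<le> \<epsilon> * ((real r + 1) ^ (r + 1) * \<mu>)" using \<mu>d \<epsilon> by (intro mult_left_mono) auto
      also have "\<dots> = (\<epsilon> * \<mu>) * (real r + 1) ^ (r + 1)" by simp
      finally have "t * (real r + 1) ^ (r + 1) \<le> (\<epsilon> * \<mu>) * (real r + 1) ^ (r + 1)" using that by linarith
      then show ?thesis using r1 by (rule mult_right_le_imp_le)
    qed
    have sp: "sqrt (p n) \<le> 1 / s"
    proof -
      have "s ^ 1 * sqrt (p n) \<le> s ^ (8 * (r + 1)\<^sup>2) * sqrt (p n)" using s8 p0 by (intro mult_right_mono power_increasing) auto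
      then have "s * sqrt (p n) \<le> 1" using sqrt_p_le[OF sw s0 p0 F3] by simp
      then show ?thesis using s8 by (simp add: field_simps)
    qed
    have phalf: "p n \<le> 1 / 2"
    proof -
      have "1 / s \<le> 1 / 2" using s8 by (intro divide_left_mono) auto
      then have "sqrt (p n) \<le> 1 / 2" using sp by linarith
      then have "sqrt (p n) * sqrt (p n) \<le> 1 / 2 * 1" using p0 p[of n] by (intro mult_mono) auto
      then show ?thesis using p0 by simp
    qed
    have p1: "p n \<le> 1" using p by simp
    have weights: "(\<Sum>s\<in>{1..<r + 1}. real (r + 1) ^ s * ext_weight n (r + 1) (p n) s) \<le> \<epsilon>"
    proof -
      have "(\<Sum>s\<in>{1..<r + 1}. real (r + 1) ^ s * ext_weight n (r + 1) (p n) s)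
        = real (r + 1) * (\<Sum>s\<in>{1..<r + 1}. real (r + 1) ^ (s - 1) * ext_weight n (r + 1) (p n) s)"
        unfolding sum_distrib_left
      proof (rule sum.cong[OF refl])
        fix s assume "s \<in> {1..<r + 1}"
        then have "s = Suc (s - 1)" by simp
        then have "real (r + 1) ^ s = real (r + 1) * real (r + 1) ^ (s - 1)" by (metis power_Suc)
        then show "real (r + 1) ^ s * ext_weight n (r + 1) (p n) s = real (r + 1) * (real (r + 1) ^ (s - 1) * ext_weight n (r + 1) (p n) s)"
          by (simp only: mult.assoc)
      qed
      also have "\<dots> \<le> real (r + 1) * (real n ^ r * p n ^ ((r + 1) choose 2) + real r * real (r + 1) ^ r * sqrt (p n))"
        by (intro mult_left_mono forced_weights_sum_le[OF r p0 p1 F3[unfolded x_def]]) auto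
      also have "\<dots> = real (r + 1) * (x ^ r * p n ^ ((r + 1) choose 2)) + cC * sqrt (p n)"
        by (simp only: x_def cC_def distrib_left mult.assoc)
      also have "\<dots> \<le> \<epsilon> / 2 + \<epsilon> / 2"
      proof (rule add_mono)
        have "x * (x ^ r * p n ^ ((r + 1) choose 2)) \<le> x * \<delta>" using e0\<delta> by (simp add: mult_ac)
        then have "x ^ r * p n ^ ((r + 1) choose 2) \<le> \<delta>" by (rule mult_left_le_imp_le) (use x3 in simp)
        also have "\<delta> \<le> \<epsilon> / (2 * (real r + 1))" by (simp add: \<delta>_def)
        finally have "real (r + 1) * (x ^ r * p n ^ ((r + 1) choose 2)) \<le> real (r + 1) * (\<epsilon> / (2 * (real r + 1)))"
          by (rule mult_left_mono) simp
        also have "\<dots> = \<epsilon> / 2" by (simp add: field_simps)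
        finally show "real (r + 1) * (x ^ r * p n ^ ((r + 1) choose 2)) \<le> \<epsilon> / 2" .
        have "cC * sqrt (p n) \<le> cC * (1 / s)" using sp cC0 by (rule mult_left_mono)
        also have "\<dots> \<le> \<epsilon> / 2" using s9 s8 \<epsilon> by (simp add: field_simps)
        finally show "cC * sqrt (p n) \<le> \<epsilon> / 2" .
      qed
      finally show ?thesis by simp
    qed
    obtain l :: nat where l: "(real l)\<^sup>2 * (real r + 1) ^ (r + 1) \<le> \<epsilon> * d"
      "Pr (nsets {1..n} 2) (\<lambda>_. p n) (\<lambda>A. \<not> r * chromatic_number {1..n} (graph_complement {1..n} A)
        + packing_number (cliques (r + 1) {1..n} A) \<le> n + l) \<le> 3 / x ^ 4"
      using chromatic_excess_small[OF r x_def L sw s2 s3 s4 s5 s6 s7 \<epsilon> p0 p1 F3 F4 d_def d1 d2 d3 e0] by blast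
    have "1 \<le> n" using elim by simp
    moreover have "1 \<le> \<epsilon> * \<mu>" using d\<mu>[of 1] d4 by simp
    moreover have "(real l)\<^sup>2 \<le> \<epsilon> * \<mu>" by (rule d\<mu>[OF l(1)])
    ultimately show ?case using p0 phalf F3 weights l(2) unfolding \<mu>_def x_def by blast
  qed
qed

section \<open>Second moments and the correlation\<close>

lemma Var_add_le:
  assumes "is_prob pr"
  shows "Var E pr (\<lambda>A. f A + g A) \<le> 2 * Var E pr f + 2 * Var E pr g"
proof -
  have mean: "expect E pr (\<lambda>A. f A + g A) = expect E pr f + expect E pr g" by (rule expect_add)
  have "Var E pr (\<lambda>A. f A + g A) \<le> expect E pr (\<lambda>A. 2 * (f A - expect E pr f)\<^sup>2 + 2 * (g A - expect E pr g)\<^sup>2)"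
    unfolding Var_def mean
  proof (rule expect_mono[OF assms])
    fix A
    define u v where "u = f A - expect E pr f" and "v = g A - expect E pr g"
    have "(u + v)\<^sup>2 + (u - v)\<^sup>2 = 2 * u\<^sup>2 + 2 * v\<^sup>2" by (simp add: power2_eq_square algebra_simps)
    then have "(u + v)\<^sup>2 \<le> 2 * u\<^sup>2 + 2 * v\<^sup>2" using zero_le_power2[of "u - v"] by linarith
    moreover have "f A + g A - (expect E pr f + expect E pr g) = u + v" by (simp add: u_def v_def)
    ultimately show "(f A + g A - (expect E pr f + expect E pr g))\<^sup>2 \<le> 2 * (f A - expect E pr f)\<^sup>2 + 2 * (g A - expect E pr g)\<^sup>2"
      by (simp only: u_def v_def)
  qed
  then show ?thesis unfolding expect_add expect_cmult by (simp only: Var_def)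
qed

lemma Var_affine:
  assumes "finite E"
  shows "Var E pr (\<lambda>A. a * f A + b) = a\<^sup>2 * Var E pr f"
proof -
  have mean: "expect E pr (\<lambda>A. a * f A + b) = a * expect E pr f + b"
    by (simp only: expect_add expect_cmult expect_const[OF assms])
  have "Var E pr (\<lambda>A. a * f A + b) = expect E pr (\<lambda>A. a\<^sup>2 * (f A - expect E pr f)\<^sup>2)"
    unfolding Var_def mean
    by (intro expect_cong) (simp add: power2_eq_square algebra_simps)
  then show ?thesis by (simp only: expect_cmult Var_def)
qed

text \<open>
  Bounded by \<open>X\<^bsub>r+2\<^esub>\<close> when negative, by \<open>l\<close> when positive, and by the trivial bound \<open>r n\<close> on the
  exceptional event, whose probability compensates for \<open>n\<^sup>2\<close>.
\<close>

lemma excess_second_moment: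
  assumes r: "2 \<le> r" and n: "1 \<le> n" and p: "0 < p" "p \<le> 1" and F: "(real n)\<^sup>2 * p ^ (r + 1) \<le> 1"
    and bad: "Pr (nsets {1..n} 2) (\<lambda>_. p) (\<lambda>A. \<not> r * chromatic_number {1..n} (graph_complement {1..n} A)
        + packing_number (cliques (r + 1) {1..n} A) \<le> n + l) \<le> 3 / real n ^ 4"
  shows "expect (nsets {1..n} 2) (\<lambda>_. p) (\<lambda>A. (real r * real (chromatic_number {1..n} (graph_complement {1..n} A))
        + real (packing_number (cliques (r + 1) {1..n} A)) - real n)\<^sup>2)
      \<le> (\<Sum>s\<le>r + 2. real (r + 2) ^ s) + (real l)\<^sup>2 + 3 * (real r)\<^sup>2"
proof -
  define V where "V = {1..n}"
  define h where "h A = r * chromatic_number V (graph_complement V A) + packing_number (cliques (r + 1) V A)" for A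
  define X where "X A = card (cliques (r + 2) V A)" for A
  have V: "finite V" "card V = n" by (auto simp: V_def)
  have pr: "is_prob (\<lambda>_::nat set. p)" using p by (auto simp: is_prob_def)
  have lo: "n \<le> h A + X A" for A
    using card_le_packing_plus_cliques[OF V(1), of r A] r V(2) by (simp add: h_def X_def)
  have hi: "h A \<le> n + r * n" for A
  proof -
    obtain P where P: "P \<subseteq> cliques (r + 1) V A" "disjoint P" "card P = packing_number (cliques (r + 1) V A)"
      using packing_number_attained[OF finite_cliques[OF V(1)], of "r + 1" A] by metis
    have "card (V - \<Union>P - \<Union>{}) \<le> n" using card_mono[OF V(1), of "V - \<Union>P"] V(2) by auto
    then show ?thesis
      using chromatic_number_le_packings[OF V(1) P(1), of "{}" n] P r V(2) by (simp add: h_def)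
  qed
  have point: "(real (h A) - real n)\<^sup>2 \<le> ((real (X A))\<^sup>2 + (real l)\<^sup>2) + (real r * real n)\<^sup>2 * of_bool (\<not> h A \<le> n + l)" for A
  proof (cases "n \<le> h A")
    case False
    then have "\<bar>real (h A) - real n\<bar> \<le> \<bar>real (X A)\<bar>" using lo[of A] by linarith
    then have "(real (h A) - real n)\<^sup>2 \<le> (real (X A))\<^sup>2" by (simp only: abs_le_square_iff)
    moreover have "0 \<le> (real r * real n)\<^sup>2 * of_bool (\<not> h A \<le> n + l)" by simp
    ultimately show ?thesis using zero_le_power2[of "real l"] by linarith
  next
    case ge: True
    show ?thesis
    proof (cases "h A \<le> n + l")
      case True
      then have "\<bar>real (h A) - real n\<bar> \<le> \<bar>real l\<bar>" using ge by linarith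
      then have "(real (h A) - real n)\<^sup>2 \<le> (real l)\<^sup>2" by (simp only: abs_le_square_iff)
      moreover have "(real r * real n)\<^sup>2 * of_bool (\<not> h A \<le> n + l) = 0" using True by simp
      ultimately show ?thesis using zero_le_power2[of "real (X A)"] by linarith
    next
      case False
      have "real (h A) \<le> real (n + r * n)" using hi[of A] by (rule of_nat_mono)
      then have "\<bar>real (h A) - real n\<bar> \<le> \<bar>real r * real n\<bar>" using ge by simp
      then have "(real (h A) - real n)\<^sup>2 \<le> (real r * real n)\<^sup>2" by (simp only: abs_le_square_iff)
      moreover have "(real r * real n)\<^sup>2 * of_bool (\<not> h A \<le> n + l) = (real r * real n)\<^sup>2" using False by simp
      ultimately show ?thesis using zero_le_power2[of "real (X A)"] zero_le_power2[of "real l"] by linarith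
    qed
  qed
  have "expect (nsets V 2) (\<lambda>_. p) (\<lambda>A. (real (h A) - real n)\<^sup>2)
     \<le> expect (nsets V 2) (\<lambda>_. p) (\<lambda>A. ((real (X A))\<^sup>2 + (real l)\<^sup>2) + (real r * real n)\<^sup>2 * of_bool (\<not> h A \<le> n + l))"
    by (intro expect_mono[OF pr] point)
  also have "\<dots> = expect (nsets V 2) (\<lambda>_. p) (\<lambda>A. (real (X A))\<^sup>2) + (real l)\<^sup>2
      + (real r * real n)\<^sup>2 * Pr (nsets V 2) (\<lambda>_. p) (\<lambda>A. \<not> h A \<le> n + l)"
    unfolding expect_add expect_cmult Pr_def using V(1) by (simp add: expect_const finite_imp_finite_nsets)
  also have "(real r * real n)\<^sup>2 * Pr (nsets V 2) (\<lambda>_. p) (\<lambda>A. \<not> h A \<le> n + l) \<le> 3 * (real r)\<^sup>2"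
  proof -
    have "(real r * real n)\<^sup>2 * Pr (nsets V 2) (\<lambda>_. p) (\<lambda>A. \<not> h A \<le> n + l) \<le> (real r * real n)\<^sup>2 * (3 / real n ^ 4)"
      using bad unfolding h_def V_def by (rule mult_left_mono) simp
    also have "\<dots> = 3 * (real r)\<^sup>2 / (real n)\<^sup>2" using n by (simp add: power_mult_distrib field_simps eval_nat_numeral)
    also have "\<dots> \<le> 3 * (real r)\<^sup>2 / 1" using n by (intro divide_left_mono) (auto intro: one_le_power)
    finally show ?thesis by simp
  qed
  also have "expect (nsets V 2) (\<lambda>_. p) (\<lambda>A. (real (X A))\<^sup>2) \<le> (\<Sum>s\<le>r + 2. real (r + 2) ^ s)"
  proof -
    let ?C = "r + 2 choose 2"
    have "expect (nsets V 2) (\<lambda>_. p) (\<lambda>A. (real (X A))\<^sup>2)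
      \<le> real (n choose (r + 2)) * p ^ ?C * (\<Sum>s\<le>r + 2. real (r + 2) ^ s * ext_weight n (r + 2) p s)"
      using expect_cliques_square_le[OF V(1), of p "r + 2"] p V(2) by (simp add: X_def)
    also have "\<dots> \<le> 1 * (\<Sum>s\<le>r + 2. real (r + 2) ^ s * 1)"
    proof (rule mult_mono)
      have "real (n choose (r + 2)) * p ^ ?C \<le> real n ^ (r + 2) * p ^ ?C"
      proof (rule mult_right_mono)
        have "n choose (r + 2) \<le> n ^ (r + 2)" by (cases "r + 2 \<le> n", rule binomial_le_pow) (simp_all add: binomial_eq_0)
        then show "real (n choose (r + 2)) \<le> real n ^ (r + 2)" by (simp only: of_nat_power[symmetric] of_nat_le_iff)
      qed (use p in simp)
      also have "\<dots> = ext_weight n (r + 2) p 0" by (simp add: ext_weight_def binomial_eq_0)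
      also have "\<dots> \<le> 1" by (rule ext_weight_larger_le_one[OF p F]) simp
      finally show "real (n choose (r + 2)) * p ^ ?C \<le> 1" .
      show "(\<Sum>s\<le>r + 2. real (r + 2) ^ s * ext_weight n (r + 2) p s) \<le> (\<Sum>s\<le>r + 2. real (r + 2) ^ s * 1)"
        by (intro sum_mono mult_left_mono ext_weight_larger_le_one[OF p F]) auto
      show "0 \<le> (\<Sum>s\<le>r + 2. real (r + 2) ^ s * ext_weight n (r + 2) p s)"
        using p by (intro sum_nonneg mult_nonneg_nonneg ext_weight_nonneg) auto
    qed simp
    finally show ?thesis by simp
  qed
  finally show ?thesis by (simp add: h_def V_def)
qed

lemma Var_chromatic_plus_cliques:
  assumes r: "2 \<le> r" and n: "1 \<le> n" and p: "0 < p" "p \<le> 1" and F: "(real n)\<^sup>2 * p ^ (r + 1) \<le> 1"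
    and bad: "Pr (nsets {1..n} 2) (\<lambda>_. p) (\<lambda>A. \<not> r * chromatic_number {1..n} (graph_complement {1..n} A)
        + packing_number (cliques (r + 1) {1..n} A) \<le> n + l) \<le> 3 / real n ^ 4"
  shows "Var (nsets {1..n} 2) (\<lambda>_. p) (\<lambda>A. chi_compl n A + num_cliques (r + 1) n A / real r)
    \<le> 4 * real ((r + 1) choose 2) * (expected_cliques (r + 1) n p * (\<Sum>s\<in>{1..<r + 1}. real (r + 1) ^ s * ext_weight n (r + 1) p s))
      + 2 * ((\<Sum>s\<le>r + 2. real (r + 2) ^ s) + (real l)\<^sup>2 + 3 * (real r)\<^sup>2)"
proof -
  let ?E = "nsets {1..n::nat} 2" and ?pr = "\<lambda>_::nat set. p"
  have finE: "finite ?E" by (simp add: finite_imp_finite_nsets)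
  have pr: "is_prob ?pr" using p by (auto simp: is_prob_def)
  define W where "W = (\<lambda>A. real (card (cliques (r + 1) {1..n} A)) - real (packing_number (cliques (r + 1) {1..n} A)))"
  define D where "D = (\<lambda>A. real r * real (chromatic_number {1..n} (graph_complement {1..n} A))
        + real (packing_number (cliques (r + 1) {1..n} A)) - real n)"
  have VW: "Var ?E ?pr W \<le> 2 * real ((r + 1) choose 2) * (expected_cliques (r + 1) n p * (\<Sum>s\<in>{1..<r + 1}. real (r + 1) ^ s * ext_weight n (r + 1) p s))"
    using Var_packing_deficit[of "{1..n}" p "r + 1"] p r unfolding W_def expected_cliques_def by simp
  have VD: "Var ?E ?pr D \<le> (\<Sum>s\<le>r + 2. real (r + 2) ^ s) + (real l)\<^sup>2 + 3 * (real r)\<^sup>2"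
  proof -
    have "Var ?E ?pr D \<le> expect ?E ?pr (\<lambda>A. (D A)\<^sup>2)"
      unfolding Var_eq[OF finE] using zero_le_power2[of "expect ?E ?pr D"] by linarith
    then show ?thesis using excess_second_moment[OF assms] unfolding D_def by linarith
  qed
  have "(\<lambda>A. chi_compl n A + num_cliques (r + 1) n A / real r) = (\<lambda>A. (1 / real r) * (W A + D A) + real n / real r)"
    using r by (intro ext) (simp add: W_def D_def chi_compl_def num_cliques_def clique_count_eq field_simps)
  then have "Var ?E ?pr (\<lambda>A. chi_compl n A + num_cliques (r + 1) n A / real r) = (1 / real r)\<^sup>2 * Var ?E ?pr (\<lambda>A. W A + D A)"
    by (simp only: Var_affine[OF finE])
  also have "\<dots> \<le> 1 * Var ?E ?pr (\<lambda>A. W A + D A)"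
    using r Var_nonneg[OF pr] by (intro mult_right_mono power_le_one) auto
  also have "\<dots> \<le> 2 * Var ?E ?pr W + 2 * Var ?E ?pr D" using Var_add_le[OF pr] by simp
  finally show ?thesis using VW VD by simp
qed

text \<open>
  The constant \<open>k\<close> collects the coefficients in \<open>Var_chromatic_plus_cliques\<close>; the bounded terms are absorbed
  because \<open>1 \<le> \<delta> \<mu>\<close>.
\<close>

theorem eventually_Var_small:
  fixes p :: "nat \<Rightarrow> real"
  assumes r: "2 \<le> r" and p: "\<And>n. 0 \<le> p n \<and> p n \<le> 1"
    and lower: "(\<lambda>n. real n powr (- 2 / real r) * ln (real n) powr (1 / real (r choose 2))) \<in> o(p)"
    and upper: "p \<in> o(\<lambda>n. real n powr (- 2 / real (r + 1)))" and \<epsilon>: "0 < \<epsilon>"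
  shows "eventually (\<lambda>n. p n \<le> 1 / 2 \<and> 0 < expected_cliques (r + 1) n (p n) \<and>
     Var (nsets {1..n} 2) (\<lambda>_. p n) (\<lambda>A. chi_compl n A + num_cliques (r + 1) n A / real r)
       \<le> \<epsilon> * expected_cliques (r + 1) n (p n)) sequentially"
proof -
  define c where "c = (\<Sum>s\<le>r + 2. real (r + 2) ^ s) + 3 * (real r)\<^sup>2"
  define k where "k = 4 * real ((r + 1) choose 2) + 2 * c + 2"
  define \<delta> where "\<delta> = \<epsilon> / k"
  have c0: "0 \<le> c" by (auto simp: c_def intro!: add_nonneg_nonneg sum_nonneg)
  then have k0: "0 < k" by (simp add: k_def add_nonneg_pos)
  have \<delta>: "0 < \<delta>" using k0 \<epsilon> by (simp add: \<delta>_def)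
  show ?thesis
    using eventually_chromatic_excess_small[OF r p lower upper \<delta>]
  proof eventually_elim
    case (elim n)
    define \<mu> where "\<mu> = expected_cliques (r + 1) n (p n)"
    define S where "S = (\<Sum>s\<in>{1..<r + 1}. real (r + 1) ^ s * ext_weight n (r + 1) (p n) s)"
    from elim obtain l :: nat where l: "(real l)\<^sup>2 \<le> \<delta> * \<mu>" and bad: "Pr (nsets {1..n} 2) (\<lambda>_. p n) (\<lambda>A. \<not> r * chromatic_number {1..n} (graph_complement {1..n} A)
        + packing_number (cliques (r + 1) {1..n} A) \<le> n + l) \<le> 3 / real n ^ 4"
      unfolding \<mu>_def by blast
    have n: "1 \<le> n" "0 < p n" "p n \<le> 1 / 2" "p n \<le> 1" "(real n)\<^sup>2 * p n ^ (r + 1) \<le> 1" "1 \<le> \<delta> * \<mu>" "S \<le> \<delta>"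
      using elim p unfolding \<mu>_def S_def by blast+
    have \<mu>0: "0 < \<mu>" using n(6) \<delta> by (metis less_le_trans mult_pos_pos zero_less_mult_pos zero_less_one)
    have "Var (nsets {1..n} 2) (\<lambda>_. p n) (\<lambda>A. chi_compl n A + num_cliques (r + 1) n A / real r)
       \<le> 4 * real ((r + 1) choose 2) * (\<mu> * S) + 2 * (c + (real l)\<^sup>2)"
      using Var_chromatic_plus_cliques[OF r n(1,2,4,5) bad] unfolding \<mu>_def S_def c_def by simp
    also have "\<dots> \<le> 4 * real ((r + 1) choose 2) * (\<mu> * \<delta>) + 2 * (c * (\<delta> * \<mu>) + \<delta> * \<mu>)"
      using l n(6,7) \<mu>0 c0 mult_left_mono[OF n(6) c0] by (intro add_mono mult_left_mono) auto
    also have "\<dots> = (\<delta> * k) * \<mu>" by (simp add: k_def algebra_simps)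
    also have "\<dots> = \<epsilon> * \<mu>" using k0 by (simp add: \<delta>_def)
    finally show ?case using n(3) \<mu>0 by (simp add: \<mu>_def)
  qed
qed

text \<open>
  With \<open>z = a + c b\<close> the numerator \<open>E(ab) + \<nu>(a) \<nu>(b)\<close> equals \<open>E(zb) + (\<nu>(a) - c \<nu>(b)) \<nu>(b)\<close>, and both terms are at
  most \<open>\<nu>(z) \<nu>(b)\<close>, by the Cauchy--Schwarz and the triangle inequality.
\<close>

lemma correlation_plus_one_le:
  fixes a b :: "'a set \<Rightarrow> real"
  assumes fin: "finite E" and pr: "is_prob pr" and c: "0 < c"
  defines "\<nu> \<equiv> \<lambda>f. sqrt (expect E pr (\<lambda>A. (f A)\<^sup>2))"
  assumes small: "\<nu> (\<lambda>A. a A + c * b A) < c * \<nu> b"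
  shows "\<bar>expect E pr (\<lambda>A. a A * b A) / (\<nu> a * \<nu> b) + 1\<bar>
    \<le> 2 * \<nu> (\<lambda>A. a A + c * b A) / (c * \<nu> b - \<nu> (\<lambda>A. a A + c * b A))"
proof -
  let ?w = "\<lambda>A. sqrt (weight E pr A)"
  define z where "z = (\<lambda>A. a A + c * b A)"
  have w: "?w A * ?w A = weight E pr A" for A using weight_nonneg[OF pr] by simp
  have nu: "\<nu> f = L2_set (\<lambda>A. ?w A * f A) (Pow E)" for f
    unfolding \<nu>_def L2_set_def expect_def using weight_nonneg[OF pr] by (simp add: power_mult_distrib)
  have cs: "\<bar>expect E pr (\<lambda>A. f A * g A)\<bar> \<le> \<nu> f * \<nu> g" for f g
  proof -
    have "\<bar>expect E pr (\<lambda>A. f A * g A)\<bar> \<le> (\<Sum>A\<in>Pow E. \<bar>weight E pr A * (f A * g A)\<bar>)"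
      unfolding expect_def by (rule sum_abs)
    also have "\<dots> = (\<Sum>A\<in>Pow E. \<bar>?w A * f A\<bar> * \<bar>?w A * g A\<bar>)"
    proof (rule sum.cong[OF refl])
      fix A
      have "\<bar>?w A * f A\<bar> * \<bar>?w A * g A\<bar> = \<bar>(?w A * ?w A) * (f A * g A)\<bar>"
        unfolding abs_mult[symmetric] by (simp only: mult_ac)
      then show "\<bar>weight E pr A * (f A * g A)\<bar> = \<bar>?w A * f A\<bar> * \<bar>?w A * g A\<bar>" by (simp only: w)
    qed
    also have "\<dots> \<le> \<nu> f * \<nu> g" unfolding nu by (rule L2_set_mult_ineq)
    finally show ?thesis .
  qed
  have tri: "\<nu> (\<lambda>A. f A + g A) \<le> \<nu> f + \<nu> g" for f g
    unfolding nu distrib_left by (rule L2_set_triangle_ineq)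
  have scale: "\<nu> (\<lambda>A. t * f A) = \<bar>t\<bar> * \<nu> f" for t f
    unfolding \<nu>_def power_mult_distrib expect_cmult by (simp add: real_sqrt_mult)
  have nn: "0 \<le> \<nu> f" for f unfolding nu by simp
  have "\<nu> a \<le> \<nu> z + c * \<nu> b" using tri[of z "\<lambda>A. - c * b A"] scale[of "- c" b] c by (simp add: z_def)
  moreover have "c * \<nu> b \<le> \<nu> z + \<nu> a" using tri[of z "\<lambda>A. - 1 * a A"] scale[of "- 1" a] scale[of c b] c by (simp add: z_def)
  ultimately have diff: "\<bar>\<nu> a - c * \<nu> b\<bar> \<le> \<nu> z" "c * \<nu> b - \<nu> z \<le> \<nu> a" by linarith+
  have pos: "0 < c * \<nu> b - \<nu> z" using small by (simp add: z_def)
  then have "0 < c * \<nu> b" using nn[of z] by linarith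
  then have b0: "0 < \<nu> b" using c by (simp add: zero_less_mult_iff)
  have a0: "0 < \<nu> a" using diff pos by linarith
  have bb: "expect E pr (\<lambda>A. b A * b A) = \<nu> b * \<nu> b"
    unfolding \<nu>_def using expect_nonneg[OF pr, of E "\<lambda>A. (b A)\<^sup>2"] by (simp add: power2_eq_square)
  have "expect E pr (\<lambda>A. a A * b A) = expect E pr (\<lambda>A. z A * b A - c * (b A * b A))"
    by (intro expect_cong) (simp add: z_def algebra_simps)
  also have "\<dots> = expect E pr (\<lambda>A. z A * b A) - c * (\<nu> b * \<nu> b)" unfolding expect_diff expect_cmult bb ..
  finally have ab: "expect E pr (\<lambda>A. a A * b A) + \<nu> a * \<nu> b = expect E pr (\<lambda>A. z A * b A) + (\<nu> a - c * \<nu> b) * \<nu> b"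
    by (simp add: algebra_simps)
  have "\<bar>expect E pr (\<lambda>A. a A * b A) + \<nu> a * \<nu> b\<bar> \<le> \<nu> z * \<nu> b + \<nu> z * \<nu> b"
    unfolding ab
  proof (rule order_trans[OF abs_triangle_ineq] , rule add_mono[OF cs])
    show "\<bar>(\<nu> a - c * \<nu> b) * \<nu> b\<bar> \<le> \<nu> z * \<nu> b" unfolding abs_mult using diff b0 by (intro mult_mono) auto
  qed
  then have num: "\<bar>expect E pr (\<lambda>A. a A * b A) + \<nu> a * \<nu> b\<bar> \<le> 2 * \<nu> z * \<nu> b" by (simp only: mult_2 distrib_right)
  have "expect E pr (\<lambda>A. a A * b A) / (\<nu> a * \<nu> b) + 1 = (expect E pr (\<lambda>A. a A * b A) + \<nu> a * \<nu> b) / (\<nu> a * \<nu> b)"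
    using a0 b0 by (simp add: add_divide_distrib)
  then have "\<bar>expect E pr (\<lambda>A. a A * b A) / (\<nu> a * \<nu> b) + 1\<bar> = \<bar>expect E pr (\<lambda>A. a A * b A) + \<nu> a * \<nu> b\<bar> / (\<nu> a * \<nu> b)"
    using a0 b0 by (simp add: abs_mult)
  also have "\<dots> \<le> 2 * \<nu> z * \<nu> b / (\<nu> a * \<nu> b)" using num a0 b0 by (intro divide_right_mono) auto
  also have "\<dots> = 2 * \<nu> z / \<nu> a" using b0 by simp
  also have "\<dots> \<le> 2 * \<nu> z / (c * \<nu> b - \<nu> z)" using diff pos nn[of z] a0 by (intro divide_left_mono mult_pos_pos) auto
  finally show ?thesis by (simp add: z_def)
qed

theorem corollary1p6:
  fixes r :: nat and p :: "nat \<Rightarrow> real"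
  assumes "r \<ge> 2"
    and "\<And>n. 0 \<le> p n \<and> p n \<le> 1"
    and "(\<lambda>n. real n powr (- 2 / real r) * ln (real n) powr (1 / real (r choose 2))) \<in> o(p)"
    and "p \<in> o(\<lambda>n. real n powr (- 2 / real (r + 1)))"
  shows "(\<lambda>n. l2_norm_pmf (gnp n (p n))
            (\<lambda>H. (chi_compl n H - measure_pmf.expectation (gnp n (p n)) (chi_compl n))
                 + (num_cliques (r + 1) n H - expected_cliques (r + 1) n (p n)) / real r))
           \<in> o(\<lambda>n. sqrt (expected_cliques (r + 1) n (p n)))
         \<and> (\<lambda>n. correlation_pmf (gnp n (p n)) (chi_compl n) (num_cliques (r + 1) n))
             \<longlonglongrightarrow> -1"
proof -
  let ?E = "\<lambda>n. nsets {1..n::nat} 2" and ?pr = "\<lambda>n (_::nat set). p n"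
  define \<mu> where "\<mu> n = expected_cliques (r + 1) n (p n)" for n
  define X where "X n = num_cliques (r + 1) n" for n
  define a where "a n A = chi_compl n A - expect (?E n) (?pr n) (chi_compl n)" for n A
  define b where "b n A = X n A - \<mu> n" for n A
  define \<nu> where "\<nu> n f = sqrt (expect (?E n) (?pr n) (\<lambda>A. (f A)\<^sup>2))" for n f
  define \<zeta> where "\<zeta> n = \<nu> n (\<lambda>A. a n A + 1 / real r * b n A)" for n
  have finE: "finite (?E n)" for n by (simp add: finite_imp_finite_nsets)
  have pr: "is_prob (?pr n)" for n using assms(2)[of n] by (simp add: is_prob_def)
  have exp_gnp: "measure_pmf.expectation (gnp n (p n)) g = expect (?E n) (?pr n) g" for n g
    using expectation_gnp[of "p n"] assms(2)[of n] by simp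
  have EX: "expect (?E n) (?pr n) (X n) = \<mu> n" for n
    using expect_clique_count[of "{1..n}" "p n" "r + 1"]
    by (simp add: X_def num_cliques_def[abs_def] clique_count_eq \<mu>_def expected_cliques_def)
  have \<zeta>_Var: "\<zeta> n = sqrt (Var (?E n) (?pr n) (\<lambda>A. chi_compl n A + X n A / real r))" for n
  proof -
    have div: "X n A / real r = 1 / real r * X n A" for A by simp
    have mean: "expect (?E n) (?pr n) (\<lambda>A. chi_compl n A + X n A / real r) = expect (?E n) (?pr n) (chi_compl n) + \<mu> n / real r"
      unfolding div expect_add expect_cmult EX by simp
    have "a n A + 1 / real r * b n A = chi_compl n A + X n A / real r - (expect (?E n) (?pr n) (chi_compl n) + \<mu> n / real r)" for A
      by (simp add: a_def b_def diff_divide_distrib)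
    then show ?thesis unfolding \<zeta>_def \<nu>_def Var_def mean by simp
  qed
  have small: "eventually (\<lambda>n. p n \<le> 1 / 2 \<and> 0 < \<mu> n \<and> \<zeta> n \<le> e * sqrt (\<mu> n)) sequentially" if "0 < e" for e
  proof -
    have "0 < e\<^sup>2" using that by simp
    from eventually_Var_small[OF assms this] show ?thesis
    proof eventually_elim
      case (elim n)
      then have "\<zeta> n \<le> sqrt (e\<^sup>2 * \<mu> n)" unfolding \<zeta>_Var \<mu>_def X_def by simp
      then show ?case using elim that by (simp add: real_sqrt_mult \<mu>_def)
    qed
  qed
  have l2: "l2_norm_pmf (gnp n (p n)) (\<lambda>H. (chi_compl n H - measure_pmf.expectation (gnp n (p n)) (chi_compl n))
      + (num_cliques (r + 1) n H - expected_cliques (r + 1) n (p n)) / real r) = \<zeta> n" for n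
    unfolding l2_norm_pmf_def exp_gnp \<zeta>_def \<nu>_def a_def b_def X_def \<mu>_def by simp
  have corr: "correlation_pmf (gnp n (p n)) (chi_compl n) (num_cliques (r + 1) n)
      = expect (?E n) (?pr n) (\<lambda>A. a n A * b n A) / (\<nu> n (a n) * \<nu> n (b n))" for n
    unfolding correlation_pmf_def covariance_pmf_def exp_gnp \<nu>_def a_def b_def EX[unfolded X_def] X_def ..
  have b_ge: "sqrt (\<mu> n) / 2 \<le> \<nu> n (b n)" if "p n \<le> 1 / 2" "0 < \<mu> n" for n
  proof -
    have C: "1 \<le> (r + 1) choose 2" using assms(1) by (metis One_nat_def Suc_eq_plus1 Suc_leI le_SucI zero_less_binomial)
    have "p n ^ ((r + 1) choose 2) \<le> p n ^ 1" using assms(2)[of n] C by (intro power_decreasing) auto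
    then have "1 / 2 \<le> 1 - p n ^ ((r + 1) choose 2)" using that by simp
    then have "\<mu> n * (1 / 2) \<le> \<mu> n * (1 - p n ^ ((r + 1) choose 2))" using that by (intro mult_left_mono) auto
    also have "\<dots> \<le> Var (?E n) (?pr n) (X n)"
      using Var_cliques_ge[of "{1..n}" "p n" "r + 1"] assms(2)[of n]
      by (simp add: X_def num_cliques_def[abs_def] clique_count_eq \<mu>_def expected_cliques_def)
    also have "\<dots> = expect (?E n) (?pr n) (\<lambda>A. (b n A)\<^sup>2)" unfolding Var_def EX b_def ..
    finally have "\<mu> n / 4 \<le> expect (?E n) (?pr n) (\<lambda>A. (b n A)\<^sup>2)" using that by simp
    then have "sqrt (\<mu> n / 4) \<le> \<nu> n (b n)" unfolding \<nu>_def by simp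
    then show ?thesis by (simp add: real_sqrt_divide)
  qed
  have "(\<lambda>n. correlation_pmf (gnp n (p n)) (chi_compl n) (num_cliques (r + 1) n)) \<longlonglongrightarrow> -1"
  proof (rule tendstoI)
    fix e :: real assume e: "0 < e"
    define c where "c = 1 / real r"
    \<comment> \<open>with \<open>\<zeta> n \<le> \<delta> t\<close> and \<open>\<nu> n (b n) \<ge> t / 2\<close> the bound of \<open>correlation_plus_one_le\<close> is at most \<open>8 \<delta> / c\<close>\<close>
    define \<delta> where "\<delta> = min (c / 4) (e * c / 16)"
    have c: "0 < c" using assms(1) by (simp add: c_def)
    then have \<delta>: "0 < \<delta>" "\<delta> \<le> c / 4" "\<delta> \<le> e * c / 16" using e by (auto simp: \<delta>_def)
    show "eventually (\<lambda>n. dist (correlation_pmf (gnp n (p n)) (chi_compl n) (num_cliques (r + 1) n)) (- 1) < e) sequentially"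
      using small[OF \<delta>(1)]
    proof eventually_elim
      case (elim n)
      define t where "t = sqrt (\<mu> n)"
      have t: "0 < t" using elim by (simp add: t_def)
      have z: "\<zeta> n \<le> \<delta> * t" using elim by (simp add: t_def)
      have z0: "0 \<le> \<zeta> n" unfolding \<zeta>_Var using Var_nonneg[OF pr] by simp
      have "c * (t / 2) \<le> c * \<nu> n (b n)" using b_ge[of n] elim c by (intro mult_left_mono) (auto simp: t_def)
      moreover have "\<delta> * t \<le> c / 4 * t" using \<delta> t by (intro mult_right_mono) auto
      ultimately have gap: "c * t / 4 \<le> c * \<nu> n (b n) - \<zeta> n" using z by simp
      have ct: "0 < c * t / 4" using c t by simp
      have "\<bar>correlation_pmf (gnp n (p n)) (chi_compl n) (num_cliques (r + 1) n) + 1\<bar> \<le> 2 * \<zeta> n / (c * \<nu> n (b n) - \<zeta> n)"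
        unfolding corr using correlation_plus_one_le[OF finE[of n] pr c, of n "a n" "b n"] gap ct
        unfolding \<zeta>_def \<nu>_def c_def by simp
      also have "\<dots> \<le> 2 * (\<delta> * t) / (c * t / 4)" using z z0 gap ct by (intro frac_le) auto
      also have "\<dots> = 8 * \<delta> / c" using t c by (simp add: field_simps)
      also have "\<dots> \<le> e / 2" using \<delta>(3) c by (simp add: field_simps)
      also have "\<dots> < e" using e by simp
      finally show ?case by (simp add: dist_real_def)
    qed
  qed
  moreover have "\<zeta> \<in> o(\<lambda>n. sqrt (\<mu> n))"
  proof (rule landau_o.smallI)
    fix e :: real assume "0 < e"
    from small[OF this] show "eventually (\<lambda>n. norm (\<zeta> n) \<le> e * norm (sqrt (\<mu> n))) sequentially"
    proof eventually_elim
      case (elim n)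
      have "0 \<le> \<zeta> n" unfolding \<zeta>_Var using Var_nonneg[OF pr] by simp
      then show ?case using elim by simp
    qed
  qed
  ultimately show ?thesis unfolding l2 \<mu>_def by (rule conjI[rotated])
qed

end
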